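(* Let $\Bbbk$ be an algebraically closed field, and let $\tilde A$ be the algebra obtained from a finite-dimensional $\Bbbk$-algebra given by a quiver with relations by attaching to each vertex $k$ a new vertex $\tilde k$ and an arrow $k\to\tilde k$. Let $N$ be the nilpotency degree of $\mathrm{Rad}\,\tilde A$, and let $\mathfrak{D}=\mathfrak{D}(\tilde A)$ be the trivial extension of $\mathfrak{C}=\mathfrak{C}(\tilde A)$ by its restricted dual (see context). Assume that $\tilde A=\bigoplus_{i\ge0}\tilde A_i$ is positively graded and that the radical filtration coincides with the grading filtration, i.e. $\mathrm{Rad}^j\tilde A=\bigoplus_{i\ge j}\tilde A_i$ for all $j$. For $i\in\mathbb{Z}$ put $\overline{A}_i=\tilde A_i\oplus(\tilde A_{N-1-i})^*$, the degree $i$ component of the trivial extension $\overline A=\tilde A\oplus\tilde A^*$ with the grading in which $(\tilde A_i)^*$ has degree $N-1-i$ (so $\overline A_i=0$ for $i<0$). Let $\overline{\mathcal{B}}\subset\mathfrak{D}$ be the set of matrices whose entry in row $r$, column $c$ lies in $\overline{A}_{r-c}$ if $r\ge c$ and is zero if $r<c$. Then $\overline{\mathcal{B}}$ is a strong exact Borel subalgebra of $\mathfrak{D}$ with respect to the first order.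
   Context: Given an algebra with quiver on vertices $\mathbf{N}=\{1,\dots,n\}$ and relations $R$, $\tilde A$ is obtained by adding, for each $k$, a vertex $\tilde k$ and an arrow $\alpha_k:k\to\tilde k$ ($\alpha_k\in e_{\tilde k}\tilde Ae_k$) with no new relations; $\tilde{\mathbf{N}}=\{\tilde1,\dots,\tilde n\}$, $\overline{\mathbf N}=\mathbf N\cup\tilde{\mathbf N}$. Let $I_j=\mathrm{Rad}^j\tilde A$, $I_N=0$. $\mathfrak{C}=\mathfrak{C}(\tilde A)=\bigoplus_{r,c\in\mathbb{Z}}\mathfrak{C}_{r,c}$ is the algebra of $\mathbb{Z}\times\mathbb{Z}$-matrices with finitely many nonzero entries, where the entry in row $r$, column $c$ lies in $\mathfrak{C}_{r,c}=I_{r-c}$ if $r>c$, $\tilde A/I_{N-(c-r)}$ if $0\le c-r<N$, and $0$ if $c-r\ge N$, with multiplication induced from $\tilde A$. Let $e_{k,i}$ be $e_k$ in position $(i,i)$. $\mathfrak{D}=\mathfrak{C}\oplus\mathfrak{C}^*$, with $\mathfrak{C}^*=\bigoplus\mathrm{Hom}_\Bbbk(e_{y,j}\mathfrak{C}e_{x,i},\Bbbk)$ the restricted dual bimodule and product $(a,f)(b,g)=(ab,ag+fb)$. Thus $\mathfrak{D}$ has entry $\mathfrak{C}_{r,c}\oplus(\mathfrak{C}_{c,r})^*$ in row $r$, column $c$; for $0\le m=r-c<N$ this is $I_m\oplus(\tilde A/I_{N-m})^*$, which contains $\tilde A_m\oplus(\tilde A_{N-1-m})^*$ (functionals on $\tilde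 A/I_{N-m}=\bigoplus_{i<N-m}\tilde A_i$ supported in degree $N-1-m$). Simple $\mathfrak{D}$-modules are indexed by $(k,i)\in\overline{\mathbf N}\times\mathbb{Z}$. First order: $(k,i)>(l,j)$ iff $i>j$, or $i=j$, $k\in\mathbf{N}$, $l\in\tilde{\mathbf{N}}$. $\mathfrak{D}$ is quasi-hereditary for this order. The left standard module $\Delta(\lambda)$ is the quotient of the left projective $P(\lambda)$ by the sum of images of all homomorphisms $P(\mu)\to P(\lambda)$, $\mu>\lambda$. A subalgebra $B\subset\mathfrak{D}$ is an exact Borel subalgebra if $B$ and $\mathfrak{D}$ have the same (index set of) simple modules, $B$ is directed (quasi-hereditary for the given order with simple standard left modules), the functor $\mathfrak{D}\otimes_B{}_-$ on left modules is exact, and $\mathfrak{D}\otimes_BL_B(\lambda)\cong\Delta_{\mathfrak D}(\lambda)$ for all $\lambda$. It is strong if it contains a maximal semisimple subalgebra of $\mathfrak{D}$. *)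

theory Defs
  imports
    "HOL-Algebra.Module"
    "HOL-Algebra.QuotRing"
    "HOL-Library.Poly_Mapping"
    "HOL-Library.Set_Algebras"
    "HOL-Library.FuncSet"
    "HOL-Computational_Algebra.Group_Closure"
    "HOL-Computational_Algebra.Polynomial"
    "Graph_Theory.Arc_Walk"
begin

section \<open>Quivers with relations\<close>

text \<open>A path is a pair of its source and the list of its arrows in the order in which they are
  traversed; the pairs \<open>(v, [])\<close> are the trivial paths. Products are composed from right to left,
  so that \<open>q \<cdot> p\<close> is the path \<open>p\<close> followed by \<open>q\<close> and an arrow \<open>a : x \<rightarrow> y\<close> lies in
  \<open>e\<^sub>y (kQ) e\<^sub>x\<close>.\<close>

definition qpaths :: "('v, 'q) pre_digraph \<Rightarrow> ('v \<times> 'q list) set" where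
  "qpaths Q = {(u, p). \<exists>v. pre_digraph.awalk Q u p v}"

definition path_mult ::
    "('v, 'q) pre_digraph \<Rightarrow> 'v \<times> 'q list \<Rightarrow> 'v \<times> 'q list \<Rightarrow> ('v \<times> 'q list \<Rightarrow>\<^sub>0 'k::comm_ring_1)" where
  "path_mult Q q p =
     (if pre_digraph.awalk Q (fst p) (snd p) (fst q)
      then Poly_Mapping.single (fst p, snd p @ snd q) 1 else 0)"

definition path_algebra ::
    "('v, 'q) pre_digraph \<Rightarrow> ('k::comm_ring_1, 'v \<times> 'q list \<Rightarrow>\<^sub>0 'k) module" where
  "path_algebra Q =
    \<lparr>carrier = {f. Poly_Mapping.keys f \<subseteq> qpaths Q},
     monoid.mult = (\<lambda>f g. \<Sum>q\<in>Poly_Mapping.keys f. \<Sum>p\<in>Poly_Mapping.keys g.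
        Poly_Mapping.map ((*) (Poly_Mapping.lookup f q * Poly_Mapping.lookup g p)) (path_mult Q q p)),
     monoid.one = (\<Sum>v\<in>verts Q. Poly_Mapping.single (v, []) 1),
     ring.zero = 0,
     ring.add = (+),
     module.smult = (\<lambda>c. Poly_Mapping.map ((*) c))\<rparr>"

text \<open>The ideal generated by \<open>R\<close> is admissible: \<open>J\<^sup>m \<subseteq> \<langle>R\<rangle> \<subseteq> J\<^sup>2\<close> for the arrow
  ideal \<open>J\<close>. For a finite quiver this makes \<open>kQ/\<langle>R\<rangle>\<close> finite-dimensional.\<close>

definition admissible_relations ::
    "('v, 'q) pre_digraph \<Rightarrow> ('v \<times> 'q list \<Rightarrow>\<^sub>0 'k::comm_ring_1) set \<Rightarrow> bool" where
  "admissible_relations Q R \<longleftrightarrow>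
     R \<subseteq> carrier (path_algebra Q) \<and>
     (\<forall>r\<in>R. \<forall>p\<in>Poly_Mapping.keys r. 2 \<le> length (snd p)) \<and>
     (\<exists>m. \<forall>p\<in>qpaths Q. m \<le> length (snd p) \<longrightarrow>
        Poly_Mapping.single p 1 \<in> genideal (path_algebra Q) R)"

text \<open>The quiver with the additional vertices \<open>Inr k\<close> and the additional arrows
  \<open>Inr k : Inl k \<rightarrow> Inr k\<close>.\<close>

definition tilde_quiver :: "('v, 'q) pre_digraph \<Rightarrow> ('v + 'v, 'q + 'v) pre_digraph" where
  "tilde_quiver Q =
    \<lparr>verts = verts Q <+> verts Q,
     arcs = arcs Q <+> verts Q,
     tail = case_sum (\<lambda>a. Inl (tail Q a)) Inl,
     head = case_sum (\<lambda>a. Inl (head Q a)) Inr\<rparr>"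

definition tilde_relation ::
    "('v \<times> 'q list \<Rightarrow>\<^sub>0 'k::comm_ring_1) \<Rightarrow> (('v + 'v) \<times> ('q + 'v) list \<Rightarrow>\<^sub>0 'k)" where
  "tilde_relation r =
    (\<Sum>p\<in>Poly_Mapping.keys r.
       Poly_Mapping.single (Inl (fst p), map Inl (snd p)) (Poly_Mapping.lookup r p))"

locale k_algebra = vector_space scl
  for scl :: "'k::field \<Rightarrow> 'a::ring_1 \<Rightarrow> 'a" +
  assumes scl_mult_left: "scl c x * y = scl c (x * y)"
    and scl_mult_right: "x * scl c y = scl c (x * y)"

definition type_ring :: "'a::ring_1 ring" where
  "type_ring = \<lparr>carrier = UNIV, monoid.mult = (*), monoid.one = 1, ring.zero = 0, ring.add = (+)\<rparr>"

text \<open>\<open>\<phi>\<close> induces an isomorphism of algebras from \<open>kQ/\<langle>R\<rangle>\<close> onto the algebra given by the type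
  \<open>'a\<close> with scalar multiplication \<open>scl\<close>.\<close>

definition presentation ::
    "('v, 'q) pre_digraph \<Rightarrow> ('v \<times> 'q list \<Rightarrow>\<^sub>0 'k::field) set \<Rightarrow> ('k \<Rightarrow> 'a::ring_1 \<Rightarrow> 'a) \<Rightarrow>
      (('v \<times> 'q list \<Rightarrow>\<^sub>0 'k) \<Rightarrow> 'a) \<Rightarrow> bool" where
  "presentation Q R scl \<phi> \<longleftrightarrow>
     k_algebra scl \<and>
     \<phi> \<in> ring_hom (path_algebra Q) type_ring \<and>
     (\<forall>c. \<forall>f\<in>carrier (path_algebra Q). \<phi> (c \<odot>\<^bsub>path_algebra Q\<^esub> f) = scl c (\<phi> f)) \<and>
     \<phi> ` carrier (path_algebra Q) = UNIV \<and>
     a_kernel (path_algebra Q) type_ring \<phi> = genideal (path_algebra Q) R"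

definition vertex_idem :: "(('v \<times> 'q list \<Rightarrow>\<^sub>0 'k::field) \<Rightarrow> 'a) \<Rightarrow> 'v \<Rightarrow> 'a" where
  "vertex_idem \<phi> v = \<phi> (Poly_Mapping.single (v, []) 1)"


section \<open>The radical filtration and gradings\<close>

definition left_ideal :: "'a::ring_1 set \<Rightarrow> bool" where
  "left_ideal J \<longleftrightarrow> 0 \<in> J \<and> (\<forall>x\<in>J. \<forall>y\<in>J. x - y \<in> J) \<and> (\<forall>a. \<forall>x\<in>J. a * x \<in> J)"

definition maximal_left_ideal :: "'a::ring_1 set \<Rightarrow> bool" where
  "maximal_left_ideal J \<longleftrightarrow>
     left_ideal J \<and> J \<noteq> UNIV \<and> (\<forall>K. left_ideal K \<and> J \<subseteq> K \<longrightarrow> K = J \<or> K = UNIV)"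

definition jacobson_radical :: "'a::ring_1 set" where
  "jacobson_radical = \<Inter>{J. maximal_left_ideal J}"

fun rad_pow :: "nat \<Rightarrow> 'a::ring_1 set" where
  "rad_pow 0 = UNIV"
| "rad_pow (Suc j) = group_closure (jacobson_radical * rad_pow j)"

definition nilpotency_degree :: "'a::ring_1 itself \<Rightarrow> nat" where
  "nilpotency_degree _ = (LEAST m. rad_pow m = ({0} :: 'a set))"

definition positive_grading :: "('k::field \<Rightarrow> 'a::ring_1 \<Rightarrow> 'a) \<Rightarrow> (nat \<Rightarrow> 'a set) \<Rightarrow> bool" where
  "positive_grading scl G \<longleftrightarrow>
     (\<forall>i. Modules.module.subspace scl (G i)) \<and>
     (\<forall>i j. \<forall>x\<in>G i. \<forall>y\<in>G j. x * y \<in> G (i + j)) \<and>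
     (\<forall>x. \<exists>!g. (\<forall>i. g i \<in> G i) \<and> finite {i. g i \<noteq> 0} \<and> x = (\<Sum>i | g i \<noteq> 0. g i))"


section \<open>The algebras C and D\<close>

text \<open>The entry space in row \<open>r\<close> and column \<open>c\<close> is the quotient of \<open>ent_num r c\<close> by
  \<open>ent_den r c\<close>, so a matrix entry is a coset (for \<open>r > c\<close> a singleton). Cosets of the same
  subgroup are added by the elementwise sum of sets.\<close>

definition ent_num :: "int \<Rightarrow> int \<Rightarrow> 'a::ring_1 set" where
  "ent_num r c = (if r > c then rad_pow (nat (r - c)) else UNIV)"

definition ent_den :: "int \<Rightarrow> int \<Rightarrow> 'a::ring_1 set" where
  "ent_den r c =
     (if r > c then {0}
      else if c - r < int (nilpotency_degree TYPE('a))
        then rad_pow (nilpotency_degree TYPE('a) - nat (c - r))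
      else UNIV)"

definition ent :: "int \<Rightarrow> int \<Rightarrow> 'a::ring_1 set set" where
  "ent r c = {x +o ent_den r c | x. x \<in> ent_num r c}"

text \<open>If \<open>X\<close> and \<open>Y\<close> are cosets of \<open>x\<close> and \<open>y\<close> in \<open>ent r s\<close> and \<open>ent s c\<close>, then all products of
  their elements are congruent, and \<open>ent_mult r c X Y\<close> is the coset of \<open>x * y\<close> in \<open>ent r c\<close>.\<close>

definition ent_mult :: "int \<Rightarrow> int \<Rightarrow> 'a::ring_1 set \<Rightarrow> 'a set \<Rightarrow> 'a set" where
  "ent_mult r c X Y = X * Y + ent_den r c"

definition ent_scale :: "('k \<Rightarrow> 'a::ring_1 \<Rightarrow> 'a) \<Rightarrow> int \<Rightarrow> int \<Rightarrow> 'k \<Rightarrow> 'a set \<Rightarrow> 'a set" where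
  "ent_scale scl r c a X = scl a ` X + ent_den r c"

definition C_carrier :: "(int \<Rightarrow> int \<Rightarrow> 'a::ring_1 set) set" where
  "C_carrier = {M. (\<forall>r c. M r c \<in> ent r c) \<and> finite {(r, c). M r c \<noteq> ent_den r c}}"

text \<open>An element of the restricted dual has in row \<open>r\<close>, column \<open>c\<close> a functional on \<open>ent c r\<close>,
  extended by zero to a total function.\<close>

definition ent_dual :: "('k::field \<Rightarrow> 'a::ring_1 \<Rightarrow> 'a) \<Rightarrow> int \<Rightarrow> int \<Rightarrow> ('a set \<Rightarrow> 'k) set" where
  "ent_dual scl r c =
     {f. (\<forall>X\<in>ent r c. \<forall>Y\<in>ent r c. f (X + Y) = f X + f Y) \<and>
         (\<forall>a. \<forall>X\<in>ent r c. f (ent_scale scl r c a X) = a * f X) \<and>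
         (\<forall>X. X \<notin> ent r c \<longrightarrow> f X = 0)}"

definition C_dual_carrier ::
    "('k::field \<Rightarrow> 'a::ring_1 \<Rightarrow> 'a) \<Rightarrow> (int \<Rightarrow> int \<Rightarrow> 'a set \<Rightarrow> 'k) set" where
  "C_dual_carrier scl =
     {f. (\<forall>r c. f r c \<in> ent_dual scl c r) \<and> finite {(r, c). f r c \<noteq> (\<lambda>_. 0)}}"

definition C_mult ::
    "(int \<Rightarrow> int \<Rightarrow> 'a::ring_1 set) \<Rightarrow> (int \<Rightarrow> int \<Rightarrow> 'a set) \<Rightarrow> int \<Rightarrow> int \<Rightarrow> 'a set" where
  "C_mult M M' = (\<lambda>r c.
     ent_den r c + (\<Sum>s | M r s \<noteq> ent_den r s \<and> M' s c \<noteq> ent_den s c. ent_mult r c (M r s) (M' s c)))"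

text \<open>The bimodule structure of the dual: \<open>(M f)(X) = f(X M)\<close> and \<open>(f M)(X) = f(M X)\<close>.\<close>

definition C_dual_lact ::
    "(int \<Rightarrow> int \<Rightarrow> 'a::ring_1 set) \<Rightarrow> (int \<Rightarrow> int \<Rightarrow> 'a set \<Rightarrow> 'k::field) \<Rightarrow>
      int \<Rightarrow> int \<Rightarrow> 'a set \<Rightarrow> 'k" where
  "C_dual_lact M f = (\<lambda>r c X.
     if X \<in> ent c r then \<Sum>s | M r s \<noteq> ent_den r s. f s c (ent_mult c s X (M r s)) else 0)"

definition C_dual_ract ::
    "(int \<Rightarrow> int \<Rightarrow> 'a::ring_1 set \<Rightarrow> 'k::field) \<Rightarrow> (int \<Rightarrow> int \<Rightarrow> 'a set) \<Rightarrow>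
      int \<Rightarrow> int \<Rightarrow> 'a set \<Rightarrow> 'k" where
  "C_dual_ract f M = (\<lambda>r c X.
     if X \<in> ent c r then \<Sum>s | M s c \<noteq> ent_den s c. f r s (ent_mult s r (M s c) X) else 0)"

type_synonym ('k, 'a) D_elem = "(int \<Rightarrow> int \<Rightarrow> 'a set) \<times> (int \<Rightarrow> int \<Rightarrow> 'a set \<Rightarrow> 'k)"

text \<open>\<open>D\<close> has no unit element; the field \<open>one\<close> is irrelevant here and in all further records.\<close>

definition D_algebra ::
    "('k::field \<Rightarrow> 'a::ring_1 \<Rightarrow> 'a) \<Rightarrow> ('k, ('k, 'a) D_elem) module" where
  "D_algebra scl =
    \<lparr>carrier = C_carrier \<times> C_dual_carrier scl,
     monoid.mult = (\<lambda>(M, f) (M', g).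
       (C_mult M M', \<lambda>r c X. C_dual_lact M g r c X + C_dual_ract f M' r c X)),
     monoid.one = undefined,
     ring.zero = (ent_den, \<lambda>_ _ _. 0),
     ring.add = (\<lambda>(M, f) (M', g). (\<lambda>r c. M r c + M' r c, \<lambda>r c X. f r c X + g r c X)),
     module.smult = (\<lambda>a (M, f). (\<lambda>r c. ent_scale scl r c a (M r c), \<lambda>r c X. a * f r c X))\<rparr>"

definition D_idem ::
    "(('v \<times> 'q list \<Rightarrow>\<^sub>0 'k::field) \<Rightarrow> 'a::ring_1) \<Rightarrow> 'v \<times> int \<Rightarrow> ('k, 'a) D_elem" where
  "D_idem \<phi> = (\<lambda>(k, i).
     (\<lambda>r c. if r = i \<and> c = i then vertex_idem \<phi> k +o ent_den r c else ent_den r c, \<lambda>_ _ _. 0))"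

definition first_order :: "('v + 'v) \<times> int \<Rightarrow> ('v + 'v) \<times> int \<Rightarrow> bool" where
  "first_order = (\<lambda>(k, i) (l, j). i > j \<or> (i = j \<and> isl k \<and> \<not> isl l))"

definition B_bar ::
    "('k::field \<Rightarrow> 'a::ring_1 \<Rightarrow> 'a) \<Rightarrow> (nat \<Rightarrow> 'a set) \<Rightarrow> ('k, 'a) D_elem set" where
  "B_bar scl G =
     {(M, f). (M, f) \<in> carrier (D_algebra scl) \<and>
       (\<forall>r c. r \<ge> c \<longrightarrow>
          (\<exists>x\<in>G (nat (r - c)). M r c = x +o ent_den r c) \<and>
          (\<forall>i. \<forall>x\<in>G i. int i \<noteq> int (nilpotency_degree TYPE('a)) - 1 - (r - c) \<longrightarrow>
             f r c (x +o ent_den c r) = 0)) \<and>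
       (\<forall>r c. r < c \<longrightarrow> M r c = ent_den r c \<and> f r c = (\<lambda>_. 0))}"


section \<open>Left modules over algebras with local units\<close>

text \<open>As in the library, algebras and modules are records of type \<^typ>\<open>('a, 'b) module\<close>; only the
  fields that are meaningful for a left module are used. The last axiom says that the module is
  unital: over an algebra \<open>E\<close> with local units it is equivalent to \<open>E M = M\<close>. Such a module carries
  a unique compatible vector space structure, so scalars need not be mentioned.\<close>

locale left_module = abelian_group M
  for E :: "('a, 'x) ring_scheme" and M :: "('a, 'm, 'y) module_scheme" (structure) +
  assumes act_closed: "a \<in> carrier E \<Longrightarrow> x \<in> carrier M \<Longrightarrow> a \<odot>\<^bsub>M\<^esub> x \<in> carrier M"
    and act_add_left: "a \<in> carrier E \<Longrightarrow> b \<in> carrier E \<Longrightarrow> x \<in> carrier M \<Longrightarrow>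
      (a \<oplus>\<^bsub>E\<^esub> b) \<odot>\<^bsub>M\<^esub> x = a \<odot>\<^bsub>M\<^esub> x \<oplus>\<^bsub>M\<^esub> b \<odot>\<^bsub>M\<^esub> x"
    and act_add_right: "a \<in> carrier E \<Longrightarrow> x \<in> carrier M \<Longrightarrow> y \<in> carrier M \<Longrightarrow>
      a \<odot>\<^bsub>M\<^esub> (x \<oplus>\<^bsub>M\<^esub> y) = a \<odot>\<^bsub>M\<^esub> x \<oplus>\<^bsub>M\<^esub> a \<odot>\<^bsub>M\<^esub> y"
    and act_mult: "a \<in> carrier E \<Longrightarrow> b \<in> carrier E \<Longrightarrow> x \<in> carrier M \<Longrightarrow>
      (a \<otimes>\<^bsub>E\<^esub> b) \<odot>\<^bsub>M\<^esub> x = a \<odot>\<^bsub>M\<^esub> (b \<odot>\<^bsub>M\<^esub> x)"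
    and unital: "x \<in> carrier M \<Longrightarrow> \<exists>a\<in>carrier E. a \<odot>\<^bsub>M\<^esub> x = x"

definition module_homs ::
    "('a, 'x) ring_scheme \<Rightarrow> ('a, 'm, 'y) module_scheme \<Rightarrow> ('a, 'n, 'z) module_scheme \<Rightarrow>
      ('m \<Rightarrow> 'n) set" where
  "module_homs E M M' =
     {f. f \<in> carrier M \<rightarrow> carrier M' \<and>
         (\<forall>x\<in>carrier M. \<forall>y\<in>carrier M. f (x \<oplus>\<^bsub>M\<^esub> y) = f x \<oplus>\<^bsub>M'\<^esub> f y) \<and>
         (\<forall>a\<in>carrier E. \<forall>x\<in>carrier M. f (a \<odot>\<^bsub>M\<^esub> x) = a \<odot>\<^bsub>M'\<^esub> f x)}"

definition module_iso ::
    "('a, 'x) ring_scheme \<Rightarrow> ('a, 'm, 'y) module_scheme \<Rightarrow> ('a, 'n, 'z) module_scheme \<Rightarrow> bool" where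
  "module_iso E M M' \<longleftrightarrow> (\<exists>f\<in>module_homs E M M'. bij_betw f (carrier M) (carrier M'))"

definition quotient_module ::
    "('a, 'm, 'y) module_scheme \<Rightarrow> 'm set \<Rightarrow> ('a, 'm set) module" where
  "quotient_module M U =
    \<lparr>carrier = a_rcosets\<^bsub>M\<^esub> U, monoid.mult = undefined, monoid.one = undefined,
     ring.zero = U, ring.add = set_add M,
     module.smult = (\<lambda>a X. \<Union>x\<in>X. U +>\<^bsub>M\<^esub> (a \<odot>\<^bsub>M\<^esub> x))\<rparr>"

definition generated_submodule ::
    "('a, 'x) ring_scheme \<Rightarrow> ('a, 'm, 'y) module_scheme \<Rightarrow> 'm set \<Rightarrow> 'm set" where
  "generated_submodule E M S = \<Inter>{U. submodule U E M \<and> S \<subseteq> U}"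

definition maximal_submodule ::
    "('a, 'x) ring_scheme \<Rightarrow> ('a, 'm, 'y) module_scheme \<Rightarrow> 'm set \<Rightarrow> bool" where
  "maximal_submodule E M U \<longleftrightarrow>
     submodule U E M \<and> U \<noteq> carrier M \<and>
     (\<forall>V. submodule V E M \<and> U \<subseteq> V \<longrightarrow> V = U \<or> V = carrier M)"

definition module_radical ::
    "('a, 'x) ring_scheme \<Rightarrow> ('a, 'm, 'y) module_scheme \<Rightarrow> 'm set" where
  "module_radical E M = carrier M \<inter> \<Inter>{U. maximal_submodule E M U}"

definition simple_module ::
    "('a, 'x) ring_scheme \<Rightarrow> ('a, 'm, 'y) module_scheme \<Rightarrow> bool" where
  "simple_module E M \<longleftrightarrow>
     left_module E M \<and> carrier M \<noteq> {\<zero>\<^bsub>M\<^esub>} \<and>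
     (\<forall>U. submodule U E M \<longrightarrow> U = {\<zero>\<^bsub>M\<^esub>} \<or> U = carrier M)"

text \<open>\<open>M\<close> has a finite filtration whose subquotients are isomorphic to members of the family.\<close>

definition filtered_by ::
    "('a, 'x) ring_scheme \<Rightarrow> ('a, 'm) module \<Rightarrow> ('l \<Rightarrow> ('a, 'n) module) \<Rightarrow> 'l set \<Rightarrow> bool" where
  "filtered_by E M X \<Gamma> \<longleftrightarrow>
     (\<exists>t U. U 0 = {\<zero>\<^bsub>M\<^esub>} \<and> U t = carrier M \<and> (\<forall>i\<le>t. submodule (U i) E M) \<and>
       (\<forall>i<t. U i \<subseteq> U (Suc i) \<and>
          (\<exists>\<mu>\<in>\<Gamma>. module_iso E (quotient_module (M\<lparr>carrier := U (Suc i)\<rparr>) (U i)) (X \<mu>))))"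


section \<open>Simple, projective and standard modules\<close>

definition regular_module :: "('a, 'x) ring_scheme \<Rightarrow> ('a, 'a) module" where
  "regular_module E =
    \<lparr>carrier = carrier E, monoid.mult = undefined, monoid.one = undefined,
     ring.zero = \<zero>\<^bsub>E\<^esub>, ring.add = ring.add E, module.smult = monoid.mult E\<rparr>"

text \<open>In the following, \<open>\<epsilon>\<close> is a family of idempotents of \<open>E\<close> and \<open>gt \<mu> \<nu>\<close> stands for \<open>\<mu> > \<nu>\<close>.\<close>

definition proj_module :: "('a, 'x) ring_scheme \<Rightarrow> ('l \<Rightarrow> 'a) \<Rightarrow> 'l \<Rightarrow> ('a, 'a) module" where
  "proj_module E \<epsilon> \<nu> = (regular_module E)\<lparr>carrier := {a \<otimes>\<^bsub>E\<^esub> \<epsilon> \<nu> | a. a \<in> carrier E}\<rparr>"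

definition top_module :: "('a, 'x) ring_scheme \<Rightarrow> ('l \<Rightarrow> 'a) \<Rightarrow> 'l \<Rightarrow> ('a, 'a set) module" where
  "top_module E \<epsilon> \<nu> = quotient_module (proj_module E \<epsilon> \<nu>) (module_radical E (proj_module E \<epsilon> \<nu>))"

text \<open>The simple left \<open>E\<close>-modules are indexed by \<open>\<Lambda>\<close>, where \<open>\<nu>\<close> corresponds to the simple top of
  \<open>E \<epsilon>\<^sub>\<nu>\<close>; so \<open>E \<epsilon>\<^sub>\<nu>\<close> is the projective cover \<open>P(\<nu>)\<close> of the simple module with index \<open>\<nu>\<close>.\<close>

definition simples_indexed ::
    "'m itself \<Rightarrow> ('a, 'x) ring_scheme \<Rightarrow> 'l set \<Rightarrow> ('l \<Rightarrow> 'a) \<Rightarrow> bool" where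
  "simples_indexed _ E \<Lambda> \<epsilon> \<longleftrightarrow>
     (\<forall>\<nu>\<in>\<Lambda>. \<epsilon> \<nu> \<in> carrier E \<and> \<epsilon> \<nu> \<otimes>\<^bsub>E\<^esub> \<epsilon> \<nu> = \<epsilon> \<nu> \<and> simple_module E (top_module E \<epsilon> \<nu>)) \<and>
     (\<forall>\<nu>\<in>\<Lambda>. \<forall>\<mu>\<in>\<Lambda>. module_iso E (top_module E \<epsilon> \<nu>) (top_module E \<epsilon> \<mu>) \<longrightarrow> \<nu> = \<mu>) \<and>
     (\<forall>M :: ('a, 'm) module. simple_module E M \<longrightarrow> (\<exists>\<nu>\<in>\<Lambda>. module_iso E M (top_module E \<epsilon> \<nu>)))"

definition std_trace ::
    "('a, 'x) ring_scheme \<Rightarrow> 'l set \<Rightarrow> ('l \<Rightarrow> 'a) \<Rightarrow> ('l \<Rightarrow> 'l \<Rightarrow> bool) \<Rightarrow> 'l \<Rightarrow> 'a set" where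
  "std_trace E \<Lambda> \<epsilon> gt \<nu> =
     generated_submodule E (proj_module E \<epsilon> \<nu>)
       (\<Union>\<mu>\<in>{\<mu>\<in>\<Lambda>. gt \<mu> \<nu>}. \<Union>f\<in>module_homs E (proj_module E \<epsilon> \<mu>) (proj_module E \<epsilon> \<nu>).
          f ` carrier (proj_module E \<epsilon> \<mu>))"

definition std_module ::
    "('a, 'x) ring_scheme \<Rightarrow> 'l set \<Rightarrow> ('l \<Rightarrow> 'a) \<Rightarrow> ('l \<Rightarrow> 'l \<Rightarrow> bool) \<Rightarrow> 'l \<Rightarrow> ('a, 'a set) module" where
  "std_module E \<Lambda> \<epsilon> gt \<nu> = quotient_module (proj_module E \<epsilon> \<nu>) (std_trace E \<Lambda> \<epsilon> gt \<nu>)"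

text \<open>The kernel of \<open>P(\<nu>) \<rightarrow> \<Delta>(\<nu>)\<close> is filtered by \<open>\<Delta>(\<mu>)\<close> with \<open>\<mu> > \<nu>\<close>, and the kernel of
  \<open>\<Delta>(\<nu>) \<rightarrow> L(\<nu>)\<close> is filtered by \<open>L(\<mu>)\<close> with \<open>\<mu> < \<nu>\<close>.\<close>

definition quasi_hereditary ::
    "('a, 'x) ring_scheme \<Rightarrow> 'l set \<Rightarrow> ('l \<Rightarrow> 'a) \<Rightarrow> ('l \<Rightarrow> 'l \<Rightarrow> bool) \<Rightarrow> bool" where
  "quasi_hereditary E \<Lambda> \<epsilon> gt \<longleftrightarrow>
     (\<forall>\<nu>\<in>\<Lambda>.
        filtered_by E ((proj_module E \<epsilon> \<nu>)\<lparr>carrier := std_trace E \<Lambda> \<epsilon> gt \<nu>\<rparr>)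
          (std_module E \<Lambda> \<epsilon> gt) {\<mu>\<in>\<Lambda>. gt \<mu> \<nu>} \<and>
        std_trace E \<Lambda> \<epsilon> gt \<nu> \<subseteq> module_radical E (proj_module E \<epsilon> \<nu>) \<and>
        filtered_by E
          (quotient_module ((proj_module E \<epsilon> \<nu>)\<lparr>carrier := module_radical E (proj_module E \<epsilon> \<nu>)\<rparr>)
             (std_trace E \<Lambda> \<epsilon> gt \<nu>))
          (top_module E \<epsilon>) {\<mu>\<in>\<Lambda>. gt \<nu> \<mu>})"

definition directed_algebra ::
    "('a, 'x) ring_scheme \<Rightarrow> 'l set \<Rightarrow> ('l \<Rightarrow> 'a) \<Rightarrow> ('l \<Rightarrow> 'l \<Rightarrow> bool) \<Rightarrow> bool" where
  "directed_algebra E \<Lambda> \<epsilon> gt \<longleftrightarrow>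
     quasi_hereditary E \<Lambda> \<epsilon> gt \<and> (\<forall>\<nu>\<in>\<Lambda>. simple_module E (std_module E \<Lambda> \<epsilon> gt \<nu>))"


section \<open>Induction along a subalgebra\<close>

definition subalgebra :: "'a set \<Rightarrow> ('k, 'a) module \<Rightarrow> bool" where
  "subalgebra B D \<longleftrightarrow>
     subgroup B (add_monoid D) \<and>
     (\<forall>x\<in>B. \<forall>y\<in>B. x \<otimes>\<^bsub>D\<^esub> y \<in> B) \<and> (\<forall>c. \<forall>x\<in>B. c \<odot>\<^bsub>D\<^esub> x \<in> B)"

text \<open>\<open>D \<otimes>\<^sub>B M\<close> is the quotient of the free abelian group on \<open>D \<times> M\<close> by the subgroup
  \<open>tensor_rels D B M\<close>; its elements are cosets in \<^typ>\<open>('d \<times> 'm) \<Rightarrow>\<^sub>0 int\<close>.\<close>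

definition tensor_rels ::
    "('k, 'd) module \<Rightarrow> 'd set \<Rightarrow> ('d, 'm) module \<Rightarrow> ('d \<times> 'm \<Rightarrow>\<^sub>0 int) set" where
  "tensor_rels D B M = group_closure
     ({frag_of (d \<oplus>\<^bsub>D\<^esub> d', x) - frag_of (d, x) - frag_of (d', x) | d d' x.
         d \<in> carrier D \<and> d' \<in> carrier D \<and> x \<in> carrier M} \<union>
      {frag_of (d, x \<oplus>\<^bsub>M\<^esub> x') - frag_of (d, x) - frag_of (d, x') | d x x'.
         d \<in> carrier D \<and> x \<in> carrier M \<and> x' \<in> carrier M} \<union>
      {frag_of (d \<otimes>\<^bsub>D\<^esub> b, x) - frag_of (d, b \<odot>\<^bsub>M\<^esub> x) | d b x.
         d \<in> carrier D \<and> b \<in> B \<and> x \<in> carrier M})"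

definition induced_module ::
    "('k, 'd) module \<Rightarrow> 'd set \<Rightarrow> ('d, 'm) module \<Rightarrow> ('d, ('d \<times> 'm \<Rightarrow>\<^sub>0 int) set) module" where
  "induced_module D B M =
    \<lparr>carrier = {u +o tensor_rels D B M | u. Poly_Mapping.keys u \<subseteq> carrier D \<times> carrier M},
     monoid.mult = undefined, monoid.one = undefined, ring.zero = tensor_rels D B M, ring.add = (+),
     module.smult = (\<lambda>d X. frag_extend (\<lambda>(d', x). frag_of (d \<otimes>\<^bsub>D\<^esub> d', x)) ` X + tensor_rels D B M)\<rparr>"

definition induced_hom ::
    "('k, 'd) module \<Rightarrow> 'd set \<Rightarrow> ('d, 'n) module \<Rightarrow> ('m \<Rightarrow> 'n) \<Rightarrow>
      ('d \<times> 'm \<Rightarrow>\<^sub>0 int) set \<Rightarrow> ('d \<times> 'n \<Rightarrow>\<^sub>0 int) set" where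
  "induced_hom D B M' f X =
     frag_extend (\<lambda>(d, x). frag_of (d, f x)) ` X + tensor_rels D B M'"

definition short_exact ::
    "('a, 'x) ring_scheme \<Rightarrow> ('a, 'm) module \<Rightarrow> ('m \<Rightarrow> 'n) \<Rightarrow> ('a, 'n) module \<Rightarrow> ('n \<Rightarrow> 'p) \<Rightarrow>
      ('a, 'p) module \<Rightarrow> bool" where
  "short_exact E M f M' g M'' \<longleftrightarrow>
     left_module E M \<and> left_module E M' \<and> left_module E M'' \<and>
     f \<in> module_homs E M M' \<and> g \<in> module_homs E M' M'' \<and>
     inj_on f (carrier M) \<and>
     f ` carrier M = {x \<in> carrier M'. g x = \<zero>\<^bsub>M''\<^esub>} \<and>
     g ` carrier M' = carrier M''"

definition induction_exact :: "'m itself \<Rightarrow> ('k, 'd) module \<Rightarrow> 'd set \<Rightarrow> bool" where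
  "induction_exact _ D B \<longleftrightarrow>
     (\<forall>(M :: ('d, 'm) module) f (M' :: ('d, 'm) module) g (M'' :: ('d, 'm) module).
        short_exact (D\<lparr>carrier := B\<rparr>) M f M' g M'' \<longrightarrow>
        short_exact D (induced_module D B M) (induced_hom D B M' f)
          (induced_module D B M') (induced_hom D B M'' g) (induced_module D B M''))"


section \<open>Exact Borel subalgebras\<close>

text \<open>The idempotents \<open>e\<close> fix the indexing of the simple \<open>D\<close>-modules, the idempotents \<open>\<epsilon>\<close> of \<open>B\<close> an
  indexing of the simple \<open>B\<close>-modules by the same set. The type \<open>'m\<close> is the universe of modules over
  which the classification of simple modules and the exactness of induction are stated.\<close>

definition exact_borel ::
    "'m itself \<Rightarrow> ('k, 'd) module \<Rightarrow> 'l set \<Rightarrow> ('l \<Rightarrow> 'd) \<Rightarrow> ('l \<Rightarrow> 'l \<Rightarrow> bool) \<Rightarrow> 'd set \<Rightarrow> bool" where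
  "exact_borel T D \<Lambda> e gt B \<longleftrightarrow>
     subalgebra B D \<and>
     simples_indexed T D \<Lambda> e \<and>
     (\<exists>\<epsilon>. simples_indexed T (D\<lparr>carrier := B\<rparr>) \<Lambda> \<epsilon> \<and>
        directed_algebra (D\<lparr>carrier := B\<rparr>) \<Lambda> \<epsilon> gt \<and>
        induction_exact T D B \<and>
        (\<forall>\<nu>\<in>\<Lambda>. module_iso D (induced_module D B (top_module (D\<lparr>carrier := B\<rparr>) \<epsilon> \<nu>))
           (std_module D \<Lambda> e gt \<nu>)))"

definition local_units :: "('a, 'x) ring_scheme \<Rightarrow> bool" where
  "local_units E \<longleftrightarrow>
     (\<forall>F. finite F \<and> F \<subseteq> carrier E \<longrightarrow>
        (\<exists>u\<in>carrier E. u \<otimes>\<^bsub>E\<^esub> u = u \<and> (\<forall>x\<in>F. u \<otimes>\<^bsub>E\<^esub> x = x \<and> x \<otimes>\<^bsub>E\<^esub> u = x)))"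

definition semisimple_algebra :: "('a, 'x) ring_scheme \<Rightarrow> bool" where
  "semisimple_algebra E \<longleftrightarrow>
     local_units E \<and>
     generated_submodule E (regular_module E)
       (\<Union>{U. submodule U E (regular_module E) \<and> simple_module E ((regular_module E)\<lparr>carrier := U\<rparr>)})
     = carrier E"

definition maximal_semisimple_subalgebra :: "'a set \<Rightarrow> ('k, 'a) module \<Rightarrow> bool" where
  "maximal_semisimple_subalgebra S D \<longleftrightarrow>
     subalgebra S D \<and> semisimple_algebra (D\<lparr>carrier := S\<rparr>) \<and>
     (\<forall>T. subalgebra T D \<and> semisimple_algebra (D\<lparr>carrier := T\<rparr>) \<and> S \<subseteq> T \<longrightarrow> T = S)"

definition strong_exact_borel ::
    "'m itself \<Rightarrow> ('k, 'd) module \<Rightarrow> 'l set \<Rightarrow> ('l \<Rightarrow> 'd) \<Rightarrow> ('l \<Rightarrow> 'l \<Rightarrow> bool) \<Rightarrow> 'd set \<Rightarrow> bool" where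
  "strong_exact_borel T D \<Lambda> e gt B \<longleftrightarrow>
     exact_borel T D \<Lambda> e gt B \<and> (\<exists>S\<subseteq>B. maximal_semisimple_subalgebra S D)"

end

theory Submission
  imports Defs "HOL-Algebra.Free_Abelian_Groups"
begin

text \<open>Let \<open>A\<close> be the extended algebra. Write \<open>J\<^sub>m\<close> for \<open>Rad\<^sup>m A\<close> (the whole algebra if \<open>m \<le> 0\<close>) and let \<open>A \<oplus> A\<^sup>*\<close> be the trivial extension,
graded so that \<open>(A\<^sub>i)\<^sup>*\<close> has degree \<open>N - 1 - i\<close>. An element of \<open>D\<close> is represented by a finitely supported
matrix over \<open>A \<oplus> A\<^sup>*\<close> whose entry in position \<open>(r, c)\<close> has its first component in \<open>J\<^bsub>r-c\<^esub>\<close> and a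
second component that vanishes on \<open>J\<^bsub>N+c-r\<^esub>\<close>. Two such matrices represent the same element iff the
differences of their entries have first component in \<open>J\<^bsub>N+r-c\<^esub>\<close> and second component vanishing on
\<open>J\<^bsub>c-r\<^esub>\<close> (\<open>\<Phi>_surj\<close>, \<open>\<Phi>_eq_iff\<close>). Hence the entry of \<open>D\<close> in position \<open>(r, c)\<close> is made of the homogeneous
components of \<open>A \<oplus> A\<^sup>*\<close> of the degrees \<open>r - c, \<dots>, r - c + N - 1\<close>, and \<open>B\<close> consists of the matrices whose
entries are homogeneous of the lowest of these degrees.

This makes \<open>D\<close> a projective right \<open>B\<close>-module: let \<open>u\<^bsub>r,j\<^esub>\<close> with \<open>0 \<le> j < N\<close> be the matrix with
entry \<open>1\<close> in position \<open>(r, r + j)\<close>, and let \<open>b\<^bsub>r,j\<^esub>(d)\<close> have in row \<open>r + j\<close> the components of degree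
\<open>r + j - c\<close> of the entries in row \<open>r\<close> of \<open>d\<close>. Splitting every entry into its \<open>N\<close> components gives
\<open>d = \<Sum> u\<^bsub>r,j\<^esub> b\<^bsub>r,j\<^esub>(d)\<close>, and the \<open>b\<^bsub>r,j\<^esub>\<close> are \<open>B\<close>-linear on the right because \<open>B\<close> is homogeneous
(\<open>D_dual_basis\<close>). So the functor \<open>D \<otimes>\<^sub>B _\<close> is exact (\<open>induction_exact\<close>).

The order enters as follows. If \<open>\<epsilon>\<^bsub>(v,i)\<^esub> B \<epsilon>\<^bsub>(w,j)\<^esub> \<noteq> 0\<close>, then \<open>i \<ge> j\<close>. For \<open>i = j\<close> the entry has degree zero,
so it lies in \<open>A\<^sub>0 \<oplus> (A\<^bsub>N-1\<^esub>)\<^sup>*\<close>, where \<open>A\<^sub>0\<close> is spanned by the idempotents. The last layer \<open>A\<^bsub>N-1\<^esub>\<close> is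
annihilated by the radical from the left. An element \<open>x\<close> with \<open>\<alpha>\<^sub>k x = 0\<close> satisfies \<open>e\<^sub>k x = 0\<close>, because
\<open>\<alpha>\<^sub>k\<close> occurs in no relation; and the radical annihilates \<open>e\<^sub>v\<close> from the left for each added vertex \<open>v\<close>,
which is a sink. So the paths in the last layer run from old vertices to added ones, and the
functionals on it go the other way: they contribute only to pairs \<open>(v, i) > (w, i)\<close> with \<open>v\<close> old and
\<open>w\<close> added (\<open>hcorner_directed\<close>). Therefore \<open>B\<close> is directed: the radical of \<open>B \<epsilon>\<^sub>\<nu>\<close> is generated by the
images of the \<open>B \<epsilon>\<^sub>\<mu>\<close> with \<open>\<mu> > \<nu>\<close>, and the standard modules of \<open>B\<close> are simple.

Finally, \<open>D \<otimes>\<^sub>B L(\<nu>)\<close> is the quotient of \<open>D \<epsilon>\<^sub>\<nu>\<close> by \<open>D rad(B \<epsilon>\<^sub>\<nu>)\<close>. This submodule is contained in the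
trace of the larger projectives because the radical of \<open>B \<epsilon>\<^sub>\<nu>\<close> has components only at larger indices;
conversely, an element of \<open>\<epsilon>\<^sub>\<mu> D \<epsilon>\<^sub>\<nu>\<close> with \<open>\<mu> > \<nu>\<close> has all its coefficients \<open>b\<^bsub>r,j\<^esub>\<close> in the radical of \<open>B\<close>
(\<open>coeff_weights\<close>). So the quotient is the standard module \<open>\<Delta>(\<nu>)\<close> (\<open>induced_simple\<close>).

The vertex idempotents of the presentation need not be homogeneous. Their components \<open>\<epsilon>\<^sub>v\<close> of degree
zero are again orthogonal idempotents; they lie in \<open>B\<close>, span a maximal semisimple subalgebra of \<open>D\<close>,
and generate projective modules isomorphic to the original ones (\<open>conjugators\<close>). The parts of the
argument that do not depend on matrices are carried out for algebras with local units whose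
idempotents \<open>\<epsilon>\<^sub>\<nu>\<close> have local corners \<open>\<epsilon>\<^sub>\<nu> D \<epsilon>\<^sub>\<nu>\<close> with residue field \<open>k\<close> (\<open>split_algebra\<close>).\<close>

section \<open>Modules, quotients and isomorphisms\<close>

text \<open>A left module carries no information about the additive group of the acting algebra, which is needed
  for \<open>(- a) x = - (a x)\<close>.\<close>

locale unital_module = left_module E M + R: abelian_group E
  for E :: "('a, 'x) ring_scheme" and M :: "('a, 'm, 'y) module_scheme" (structure) +
  assumes mult_closed: "a \<in> carrier E \<Longrightarrow> b \<in> carrier E \<Longrightarrow> a \<otimes>\<^bsub>E\<^esub> b \<in> carrier E"
begin

lemma act_zero: assumes "a \<in> carrier E" shows "a \<odot> \<zero> = \<zero>"
proof -
  have "a \<odot> \<zero> \<oplus> a \<odot> \<zero> = a \<odot> \<zero>"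
    using act_add_right[of a \<zero> \<zero>] assms by simp
  then show ?thesis
    using act_closed[OF assms zero_closed] by (simp add: add.r_cancel_one)
qed

lemma zero_act: assumes "x \<in> carrier M" shows "\<zero>\<^bsub>E\<^esub> \<odot> x = \<zero>"
proof -
  have "\<zero>\<^bsub>E\<^esub> \<odot> x \<oplus> \<zero>\<^bsub>E\<^esub> \<odot> x = \<zero>\<^bsub>E\<^esub> \<odot> x"
    using act_add_left[of "\<zero>\<^bsub>E\<^esub>" "\<zero>\<^bsub>E\<^esub>" x] assms by simp
  then show ?thesis using act_closed[of "\<zero>\<^bsub>E\<^esub>" x] assms by (simp add: add.r_cancel_one)
qed

lemma minus_act:
  assumes "a \<in> carrier E" "x \<in> carrier M" shows "(\<ominus>\<^bsub>E\<^esub> a) \<odot> x = \<ominus> (a \<odot> x)"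
proof -
  have "(\<ominus>\<^bsub>E\<^esub> a) \<odot> x \<oplus> a \<odot> x = (\<ominus>\<^bsub>E\<^esub> a \<oplus>\<^bsub>E\<^esub> a) \<odot> x"
    using assms by (simp add: act_add_left)
  also have "\<dots> = \<zero>" using assms by (simp add: R.l_neg zero_act)
  finally show ?thesis using assms by (simp add: minus_equality act_closed)
qed

text \<open>Because the action is unital, the negative of a vector is \<open>(- a) x\<close> with \<open>a x = x\<close>, so a
  submodule need not be assumed to be closed under negation. The criterion mentions only operations
  that do not depend on the carrier, which makes it invariant under shrinking the module.\<close>

lemma submodule_iff:
  "submodule U E M \<longleftrightarrow> U \<subseteq> carrier M \<and> \<zero> \<in> U \<and> (\<forall>x\<in>U. \<forall>y\<in>U. x \<oplus> y \<in> U) \<and>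
     (\<forall>a\<in>carrier E. \<forall>x\<in>U. a \<odot> x \<in> U)" (is "?L \<longleftrightarrow> ?R")
proof
  assume ?L
  then interpret submodule U E M .
  show ?R using subset one_closed m_closed smult_closed by auto
next
  assume r: ?R
  have "inv\<^bsub>add_monoid M\<^esub> x \<in> U" if x: "x \<in> U" for x
  proof -
    have xM: "x \<in> carrier M" using r x by blast
    obtain a where a: "a \<in> carrier E" "a \<odot> x = x" using unital[OF xM] by blast
    have "(\<ominus>\<^bsub>E\<^esub> a) \<odot> x \<in> U" using r x R.a_inv_closed[OF a(1)] by blast
    then show ?thesis using minus_act[OF a(1) xM] a(2) by (simp add: a_inv_def)
  qed
  then have "subgroup U (add_monoid M)" using r by (intro subgroup.intro) auto
  then show ?L using r by (intro submodule.intro submodule_axioms.intro) auto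
qed

lemma submoduleI:
  assumes "U \<subseteq> carrier M" "\<zero> \<in> U" "\<And>x y. x \<in> U \<Longrightarrow> y \<in> U \<Longrightarrow> x \<oplus> y \<in> U"
    "\<And>a x. a \<in> carrier E \<Longrightarrow> x \<in> U \<Longrightarrow> a \<odot> x \<in> U"
  shows "submodule U E M"
  using assms unfolding submodule_iff by blast

lemma submoduleD:
  assumes "submodule U E M"
  shows "U \<subseteq> carrier M" "\<zero> \<in> U" "\<And>x y. x \<in> U \<Longrightarrow> y \<in> U \<Longrightarrow> x \<oplus> y \<in> U"
    "\<And>a x. a \<in> carrier E \<Longrightarrow> x \<in> U \<Longrightarrow> a \<odot> x \<in> U"
    "\<And>x. x \<in> U \<Longrightarrow> \<ominus> x \<in> U" "\<And>x y. x \<in> U \<Longrightarrow> y \<in> U \<Longrightarrow> x \<ominus> y \<in> U"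
proof -
  show 1: "U \<subseteq> carrier M" "\<zero> \<in> U" "\<And>x y. x \<in> U \<Longrightarrow> y \<in> U \<Longrightarrow> x \<oplus> y \<in> U"
    "\<And>a x. a \<in> carrier E \<Longrightarrow> x \<in> U \<Longrightarrow> a \<odot> x \<in> U"
    using assms unfolding submodule_iff by auto
  show 2: "\<ominus> x \<in> U" if x: "x \<in> U" for x
  proof -
    interpret submodule U E M by fact
    show ?thesis using m_inv_closed[OF x] by (simp add: a_inv_def)
  qed
  show "\<And>x y. x \<in> U \<Longrightarrow> y \<in> U \<Longrightarrow> x \<ominus> y \<in> U" unfolding a_minus_def using 1 2 by blast
qed

lemma submodule_carrier: "submodule (carrier M) E M"
  by (rule submoduleI) (auto simp: act_closed)

lemma submodule_zero: "submodule {\<zero>} E M"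
  by (rule submoduleI) (auto simp: act_zero)

lemma submodule_abelian_subgroup: "submodule U E M \<Longrightarrow> abelian_subgroup U M"
  by (intro abelian_subgroupI3 additive_subgroupI abelian_group_axioms) (rule submodule.axioms)

lemma restrict_abelian_group:
  assumes "submodule U E M" shows "abelian_group (M\<lparr>carrier := U\<rparr>)"
proof (rule abelian_groupI)
  note U = submoduleD[OF assms]
  show "\<And>x. x \<in> carrier (M\<lparr>carrier := U\<rparr>) \<Longrightarrow>
      \<exists>y\<in>carrier (M\<lparr>carrier := U\<rparr>). y \<oplus>\<^bsub>M\<lparr>carrier := U\<rparr>\<^esub> x = \<zero>\<^bsub>M\<lparr>carrier := U\<rparr>\<^esub>"
  proof -
    fix x assume "x \<in> carrier (M\<lparr>carrier := U\<rparr>)"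
    then have x: "x \<in> U" by simp
    then have "\<ominus> x \<oplus> x = \<zero>" using U(1) l_neg by blast
    with U(5)[OF x] show "\<exists>y\<in>carrier (M\<lparr>carrier := U\<rparr>). y \<oplus>\<^bsub>M\<lparr>carrier := U\<rparr>\<^esub> x = \<zero>\<^bsub>M\<lparr>carrier := U\<rparr>\<^esub>"
      by auto
  qed
qed (use submoduleD[OF assms] in \<open>auto simp: a_ac subset_iff\<close>)

lemma restrict_unital_module:
  assumes "submodule U E M" shows "unital_module E (M\<lparr>carrier := U\<rparr>)"
proof -
  note U = submoduleD[OF assms]
  interpret A: abelian_group "M\<lparr>carrier := U\<rparr>" by (rule restrict_abelian_group[OF assms])
  show ?thesis
    by unfold_locales
      (use U unital in \<open>auto simp: act_add_left act_add_right act_mult mult_closed subset_iff\<close>)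
qed

lemma submodule_restrict:
  assumes "submodule U E M" "V \<subseteq> U"
  shows "submodule V E (M\<lparr>carrier := U\<rparr>) \<longleftrightarrow> submodule V E M"
proof -
  interpret A: unital_module E "M\<lparr>carrier := U\<rparr>" by (rule restrict_unital_module[OF assms(1)])
  show ?thesis unfolding A.submodule_iff submodule_iff using assms submoduleD(1)[OF assms(1)] by auto
qed

lemma submodule_Inter:
  assumes "\<And>U. U \<in> \<U> \<Longrightarrow> submodule U E M" "\<U> \<noteq> {}"
  shows "submodule (\<Inter>\<U>) E M"
  using assms unfolding submodule_iff by blast

lemma generated_submodule:
  assumes "X \<subseteq> carrier M"
  shows "submodule (generated_submodule E M X) E M" "X \<subseteq> generated_submodule E M X"
    "\<And>U. submodule U E M \<Longrightarrow> X \<subseteq> U \<Longrightarrow> generated_submodule E M X \<subseteq> U"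
proof -
  show "submodule (generated_submodule E M X) E M"
    unfolding generated_submodule_def
    using assms submodule_carrier by (intro submodule_Inter) auto
qed (auto simp: generated_submodule_def)

lemma quotient_simps [simp]:
  "carrier (quotient_module M U) = a_rcosets U" "ring.zero (quotient_module M U) = U"
  "ring.add (quotient_module M U) = set_add M"
  by (simp_all add: quotient_module_def)

lemma mem_quotient: "X \<in> a_rcosets U \<longleftrightarrow> (\<exists>x\<in>carrier M. X = U +> x)"
  by (auto simp: A_RCOSETS_def')

lemma cosetI: "x \<in> carrier M \<Longrightarrow> U +> x \<in> a_rcosets U"
  by (auto simp: mem_quotient)

lemma coset_add:
  assumes "submodule U E M" "x \<in> carrier M" "y \<in> carrier M"
  shows "(U +> x) <+> (U +> y) = U +> (x \<oplus> y)"
  using abelian_subgroup.a_rcos_sum[OF submodule_abelian_subgroup] assms by blast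

lemma coset_eq_iff:
  assumes "submodule U E M" "x \<in> carrier M" "y \<in> carrier M"
  shows "U +> x = U +> y \<longleftrightarrow> x \<ominus> y \<in> U"
proof -
  interpret A: abelian_subgroup U M by (rule submodule_abelian_subgroup) fact
  have "x \<ominus> y \<in> U \<longleftrightarrow> x \<in> U +> y"
    using A.a_rcos_module[OF assms(3,2)] by (simp add: minus_eq)
  then show ?thesis
    using assms(2,3) A.a_rcos_self A.a_repr_independence'
    by (metis (no_types, lifting) A.a_repr_independenceD)
qed

lemma coset_eq_zero_iff:
  assumes "submodule U E M" "x \<in> carrier M"
  shows "U +> x = U \<longleftrightarrow> x \<in> U"
proof -
  have "\<ominus> \<zero> = \<zero>" by (rule minus_equality) auto
  then have "x \<ominus> \<zero> = x" using assms(2) by (metis minus_eq r_zero)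
  then show ?thesis
    using coset_eq_iff[OF assms zero_closed] a_coset_add_zero submoduleD(1)[OF assms(1)] by metis
qed

lemma coset_act:
  assumes U: "submodule U E M" and a: "a \<in> carrier E" and x: "x \<in> carrier M"
  shows "a \<odot>\<^bsub>quotient_module M U\<^esub> (U +> x) = U +> (a \<odot> x)"
proof -
  interpret A: abelian_subgroup U M by (rule submodule_abelian_subgroup) fact
  have "U +> (a \<odot> y) = U +> (a \<odot> x)" if y: "y \<in> U +> x" for y
  proof -
    obtain u where u: "u \<in> U" "y = u \<oplus> x" using y by (auto simp: a_r_coset_def')
    then have uM: "u \<in> carrier M" using submoduleD(1)[OF U] by auto
    have "a \<odot> y = a \<odot> u \<oplus> a \<odot> x" using u uM a x by (simp add: act_add_right)
    then have "a \<odot> y \<ominus> a \<odot> x = a \<odot> u"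
      using uM a x by (simp add: act_closed minus_eq a_assoc r_neg)
    then show ?thesis
      using coset_eq_iff[OF U, of "a \<odot> y" "a \<odot> x"] u uM a x submoduleD(4)[OF U a] by (simp add: act_closed)
  qed
  moreover have "x \<in> U +> x" using x by (rule A.a_rcos_self)
  ultimately have "(\<Union>y\<in>U +> x. U +> (a \<odot> y)) = U +> (a \<odot> x)"
    by (intro SUP_eq_const) blast+
  then show ?thesis by (simp add: quotient_module_def)
qed

lemma quotient_unital_module:
  assumes U: "submodule U E M" shows "unital_module E (quotient_module M U)"
proof -
  let ?Q = "quotient_module M U"
  note ca = coset_add[OF U]
  have z: "\<zero>\<^bsub>?Q\<^esub> = U +> \<zero>" using submoduleD(1)[OF U] by simp
  interpret A: abelian_group ?Q
  proof (rule abelian_groupI)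
    show "\<exists>y\<in>carrier ?Q. y \<oplus>\<^bsub>?Q\<^esub> X = \<zero>\<^bsub>?Q\<^esub>" if X: "X \<in> carrier ?Q" for X
    proof -
      obtain x where x: "x \<in> carrier M" "X = U +> x" using X by (auto simp: mem_quotient)
      then have "(U +> (\<ominus> x)) \<oplus>\<^bsub>?Q\<^esub> X = \<zero>\<^bsub>?Q\<^esub>"
        using coset_add[OF U, of "\<ominus> x" x] z by (simp add: l_neg)
      then show ?thesis using x by (intro bexI[of _ "U +> (\<ominus> x)"]) (auto intro: cosetI)
    qed
    fix X assume "X \<in> carrier ?Q"
    then obtain x where "x \<in> carrier M" "X = U +> x" by (auto simp: mem_quotient)
    then show "\<zero>\<^bsub>?Q\<^esub> \<oplus>\<^bsub>?Q\<^esub> X = X" unfolding z using ca[of \<zero> x] by simp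
  next
    show "\<zero>\<^bsub>?Q\<^esub> \<in> carrier ?Q" unfolding z by (auto intro: cosetI)
  qed (auto simp: mem_quotient ca a_ac)
  show ?thesis
  proof unfold_locales
    fix X assume "X \<in> carrier ?Q"
    then obtain x where x: "x \<in> carrier M" "X = U +> x" by (auto simp: mem_quotient)
    then show "\<exists>a\<in>carrier E. a \<odot>\<^bsub>?Q\<^esub> X = X"
      using unital[OF x(1)] coset_act[OF U _ x(1)] by metis
  qed (auto simp: mem_quotient coset_add[OF U] coset_act[OF U] act_closed act_add_left
        act_add_right act_mult mult_closed)
qed

end

lemma module_homsD:
  assumes "h \<in> module_homs E M M'"
  shows "\<And>x. x \<in> carrier M \<Longrightarrow> h x \<in> carrier M'"
    "\<And>x y. x \<in> carrier M \<Longrightarrow> y \<in> carrier M \<Longrightarrow> h (x \<oplus>\<^bsub>M\<^esub> y) = h x \<oplus>\<^bsub>M'\<^esub> h y"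
    "\<And>a x. a \<in> carrier E \<Longrightarrow> x \<in> carrier M \<Longrightarrow> h (a \<odot>\<^bsub>M\<^esub> x) = a \<odot>\<^bsub>M'\<^esub> h x"
  using assms by (auto simp: module_homs_def)

lemma module_hom_zero:
  assumes "h \<in> module_homs E M M'" "unital_module E M" "unital_module E M'"
  shows "h \<zero>\<^bsub>M\<^esub> = \<zero>\<^bsub>M'\<^esub>"
proof -
  interpret M: unital_module E M by fact
  interpret M': unital_module E M' by fact
  have "h \<zero>\<^bsub>M\<^esub> \<oplus>\<^bsub>M'\<^esub> h \<zero>\<^bsub>M\<^esub> = h \<zero>\<^bsub>M\<^esub>"
    using module_homsD(2)[OF assms(1), of "\<zero>\<^bsub>M\<^esub>" "\<zero>\<^bsub>M\<^esub>"] by simp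
  then show ?thesis using module_homsD(1)[OF assms(1) M.zero_closed] by (simp add: M'.add.r_cancel_one)
qed

lemma module_hom_minus:
  assumes h: "h \<in> module_homs E M M'" and "unital_module E M" "unital_module E M'"
    and x: "x \<in> carrier M" "y \<in> carrier M"
  shows "h (x \<ominus>\<^bsub>M\<^esub> y) = h x \<ominus>\<^bsub>M'\<^esub> h y"
proof -
  interpret M: unital_module E M by fact
  interpret M': unital_module E M' by fact
  have "h (\<ominus>\<^bsub>M\<^esub> y) \<oplus>\<^bsub>M'\<^esub> h y = \<zero>\<^bsub>M'\<^esub>"
    using module_homsD(2)[OF h, of "\<ominus>\<^bsub>M\<^esub> y" y] x module_hom_zero[OF assms(1-3)] by (simp add: M.l_neg)
  then have "h (\<ominus>\<^bsub>M\<^esub> y) = \<ominus>\<^bsub>M'\<^esub> h y"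
    using M'.minus_equality[of "h (\<ominus>\<^bsub>M\<^esub> y)" "h y"] module_homsD(1)[OF h] x by simp
  then show ?thesis using module_homsD(2)[OF h, of x "\<ominus>\<^bsub>M\<^esub> y"] x by (simp add: a_minus_def)
qed

lemma module_hom_kernel:
  assumes h: "h \<in> module_homs E M M'" and "unital_module E M" "unital_module E M'"
  shows "submodule {x \<in> carrier M. h x = \<zero>\<^bsub>M'\<^esub>} E M"
proof -
  interpret M: unital_module E M by fact
  interpret M': unital_module E M' by fact
  show ?thesis
    by (rule M.submoduleI)
      (use module_homsD[OF h] module_hom_zero[OF assms] in \<open>auto simp: M.act_closed M'.act_zero\<close>)
qed

lemma module_hom_image:
  assumes h: "h \<in> module_homs E M M'" and "unital_module E M" "unital_module E M'"
    and U: "submodule U E M"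
  shows "submodule (h ` U) E M'"
proof -
  interpret M: unital_module E M by fact
  interpret M': unital_module E M' by fact
  note U' = M.submoduleD[OF U]
  show ?thesis
  proof (rule M'.submoduleI)
    show "h ` U \<subseteq> carrier M'" using module_homsD(1)[OF h] U'(1) by auto
    show "\<zero>\<^bsub>M'\<^esub> \<in> h ` U" using module_hom_zero[OF assms(1-3)] U'(2) by (metis imageI)
    show "x \<oplus>\<^bsub>M'\<^esub> y \<in> h ` U" if xy: "x \<in> h ` U" "y \<in> h ` U" for x y
    proof -
      obtain u v where "u \<in> U" "v \<in> U" "x = h u" "y = h v" using xy by auto
      then have "x \<oplus>\<^bsub>M'\<^esub> y = h (u \<oplus>\<^bsub>M\<^esub> v)" "u \<oplus>\<^bsub>M\<^esub> v \<in> U"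
        using module_homsD(2)[OF h, of u v] U'(1,3) by (metis subsetD, blast)
      then show ?thesis by blast
    qed
    show "a \<odot>\<^bsub>M'\<^esub> x \<in> h ` U" if a: "a \<in> carrier E" and x: "x \<in> h ` U" for a x
    proof -
      obtain u where "u \<in> U" "x = h u" using x by auto
      then have "a \<odot>\<^bsub>M'\<^esub> x = h (a \<odot>\<^bsub>M\<^esub> u)" "a \<odot>\<^bsub>M\<^esub> u \<in> U"
        using module_homsD(3)[OF h a, of u] U'(1,4) a by (metis subsetD, blast)
      then show ?thesis by blast
    qed
  qed
qed

lemma module_iso_sym:
  assumes "module_iso E M M'" and "unital_module E M"
  shows "module_iso E M' M"
proof -
  interpret M: unital_module E M by fact
  obtain h where h: "h \<in> module_homs E M M'" and bij: "bij_betw h (carrier M) (carrier M')"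
    using assms(1) by (auto simp: module_iso_def)
  define g where "g = the_inv_into (carrier M) h"
  have inj: "inj_on h (carrier M)" using bij by (simp add: bij_betw_def)
  have gM: "g y \<in> carrier M" and hg: "h (g y) = y" if "y \<in> carrier M'" for y
    using that bij unfolding g_def by (auto simp: bij_betw_def the_inv_into_into f_the_inv_into_f)
  have gh: "g (h x) = x" if "x \<in> carrier M" for x
    unfolding g_def using inj that by (rule the_inv_into_f_f)
  have "g \<in> module_homs E M' M"
    unfolding module_homs_def
  proof (intro CollectI conjI ballI)
    show "g \<in> carrier M' \<rightarrow> carrier M" using gM by auto
    fix x y assume xy: "x \<in> carrier M'" "y \<in> carrier M'"
    have "h (g x \<oplus>\<^bsub>M\<^esub> g y) = x \<oplus>\<^bsub>M'\<^esub> y" using module_homsD(2)[OF h] xy gM hg by simp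
    then show "g (x \<oplus>\<^bsub>M'\<^esub> y) = g x \<oplus>\<^bsub>M\<^esub> g y" using gh[of "g x \<oplus>\<^bsub>M\<^esub> g y"] xy gM by simp
  next
    fix a x assume ax: "a \<in> carrier E" "x \<in> carrier M'"
    have "h (a \<odot>\<^bsub>M\<^esub> g x) = a \<odot>\<^bsub>M'\<^esub> x" using module_homsD(3)[OF h] ax gM hg by simp
    then show "g (a \<odot>\<^bsub>M'\<^esub> x) = a \<odot>\<^bsub>M\<^esub> g x" using gh[of "a \<odot>\<^bsub>M\<^esub> g x"] ax gM by (simp add: M.act_closed)
  qed
  moreover have "bij_betw g (carrier M') (carrier M)"
    unfolding g_def using bij by (rule bij_betw_the_inv_into)
  ultimately show ?thesis unfolding module_iso_def by blast
qed

lemma first_isomorphism: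
  assumes h: "h \<in> module_homs E M M'" and um: "unital_module E M" "unital_module E M'"
    and surj: "h ` carrier M = carrier M'"
    and K: "K = {x \<in> carrier M. h x = \<zero>\<^bsub>M'\<^esub>}"
  shows "module_iso E (quotient_module M K) M'"
proof -
  interpret M: unital_module E M by fact
  interpret M': unital_module E M' by fact
  have sub: "submodule K E M" unfolding K by (rule module_hom_kernel[OF h um])
  interpret A: abelian_subgroup K M by (rule M.submodule_abelian_subgroup) fact
  define g where "g X = h (SOME x. x \<in> X)" for X
  have gx: "g (K +>\<^bsub>M\<^esub> x) = h x" if x: "x \<in> carrier M" for x
  proof -
    have "(SOME y. y \<in> K +>\<^bsub>M\<^esub> x) \<in> K +>\<^bsub>M\<^esub> x"
      using A.a_rcos_self[OF x] by (rule someI)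
    then obtain u where u: "u \<in> K" "(SOME y. y \<in> K +>\<^bsub>M\<^esub> x) = u \<oplus>\<^bsub>M\<^esub> x"
      by (auto simp: a_r_coset_def')
    have "u \<in> carrier M" "h u = \<zero>\<^bsub>M'\<^esub>" using u(1) unfolding K by blast+
    then show ?thesis
      unfolding g_def u(2) using module_homsD(1)[OF h x] module_homsD(2)[OF h, of u x] x by simp
  qed
  have "g \<in> module_homs E (quotient_module M K) M'"
    unfolding module_homs_def
  proof (intro CollectI conjI ballI Pi_I)
    fix X Y assume "X \<in> carrier (quotient_module M K)" "Y \<in> carrier (quotient_module M K)"
    then obtain x y where "x \<in> carrier M" "X = K +>\<^bsub>M\<^esub> x" "y \<in> carrier M" "Y = K +>\<^bsub>M\<^esub> y"
      by (auto simp: M.mem_quotient)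
    then show "g (X \<oplus>\<^bsub>quotient_module M K\<^esub> Y) = g X \<oplus>\<^bsub>M'\<^esub> g Y"
      using module_homsD(2)[OF h] gx by (simp add: M.coset_add[OF sub])
  next
    fix a X assume a: "a \<in> carrier E" and "X \<in> carrier (quotient_module M K)"
    then obtain x where "x \<in> carrier M" "X = K +>\<^bsub>M\<^esub> x" by (auto simp: M.mem_quotient)
    then show "g (a \<odot>\<^bsub>quotient_module M K\<^esub> X) = a \<odot>\<^bsub>M'\<^esub> g X"
      using module_homsD(3)[OF h a] gx a by (simp add: M.coset_act[OF sub] M.act_closed)
  next
    fix X assume "X \<in> carrier (quotient_module M K)"
    then show "g X \<in> carrier M'" using gx module_homsD(1)[OF h] by (auto simp: M.mem_quotient)
  qed
  moreover have "inj_on g (carrier (quotient_module M K))"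
  proof (rule inj_onI)
    fix X Y assume "X \<in> carrier (quotient_module M K)" "Y \<in> carrier (quotient_module M K)"
      and eq: "g X = g Y"
    then obtain x y where x: "x \<in> carrier M" "X = K +>\<^bsub>M\<^esub> x" and y: "y \<in> carrier M" "Y = K +>\<^bsub>M\<^esub> y"
      by (auto simp: M.mem_quotient)
    have "h (x \<ominus>\<^bsub>M\<^esub> y) = \<zero>\<^bsub>M'\<^esub>"
      using eq gx[OF x(1)] gx[OF y(1)] x(2) y(2) module_hom_minus[OF h um x(1) y(1)]
        module_homsD(1)[OF h y(1)] by (metis M'.minus_eq M'.r_neg)
    then have "x \<ominus>\<^bsub>M\<^esub> y \<in> K" using M.minus_closed[OF x(1) y(1)] unfolding K by blast
    then show "X = Y" using M.coset_eq_iff[OF sub x(1) y(1)] x(2) y(2) by blast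
  qed
  moreover have "g ` carrier (quotient_module M K) = carrier M'"
  proof (intro equalityI subsetI)
    fix y assume "y \<in> carrier M'"
    then obtain x where "x \<in> carrier M" "y = h x" using surj by blast
    then have "y = g (K +>\<^bsub>M\<^esub> x)" "K +>\<^bsub>M\<^esub> x \<in> carrier (quotient_module M K)"
      using gx by (auto simp: M.mem_quotient)
    then show "y \<in> g ` carrier (quotient_module M K)" by (rule image_eqI)
  qed (use gx module_homsD(1)[OF h] in \<open>auto simp: M.mem_quotient\<close>)
  ultimately show ?thesis unfolding module_iso_def bij_betw_def by blast
qed

section \<open>Algebras split by characters\<close>

text \<open>Sums over lists mention only addition and zero, so they do not change when the carrier is
  shrunk to a subalgebra.\<close>

definition lsum :: "('a, 'x) ring_scheme \<Rightarrow> 'a list \<Rightarrow> 'a" where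
  "lsum E xs = foldr (ring.add E) xs (ring.zero E)"

lemma lsum_simps [simp]:
  "lsum E [] = \<zero>\<^bsub>E\<^esub>" "lsum E (x # xs) = x \<oplus>\<^bsub>E\<^esub> lsum E xs"
  by (simp_all add: lsum_def)

lemma lsum_carrier_update [simp]: "lsum (E\<lparr>carrier := T\<rparr>) xs = lsum E xs"
  by (simp add: lsum_def)

locale nonunital_algebra = abelian_group D for D :: "('k::field, 'd) module" (structure) +
  assumes m_closed [simp, intro]: "x \<in> carrier D \<Longrightarrow> y \<in> carrier D \<Longrightarrow> x \<otimes> y \<in> carrier D"
    and m_assoc: "x \<in> carrier D \<Longrightarrow> y \<in> carrier D \<Longrightarrow> z \<in> carrier D \<Longrightarrow> (x \<otimes> y) \<otimes> z = x \<otimes> (y \<otimes> z)"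
    and l_distr: "x \<in> carrier D \<Longrightarrow> y \<in> carrier D \<Longrightarrow> z \<in> carrier D \<Longrightarrow> (x \<oplus> y) \<otimes> z = x \<otimes> z \<oplus> y \<otimes> z"
    and r_distr: "x \<in> carrier D \<Longrightarrow> y \<in> carrier D \<Longrightarrow> z \<in> carrier D \<Longrightarrow> z \<otimes> (x \<oplus> y) = z \<otimes> x \<oplus> z \<otimes> y"
    and s_closed [simp, intro]: "x \<in> carrier D \<Longrightarrow> c \<odot> x \<in> carrier D"
    and s_add: "x \<in> carrier D \<Longrightarrow> y \<in> carrier D \<Longrightarrow> c \<odot> (x \<oplus> y) = c \<odot> x \<oplus> c \<odot> y"
    and add_s: "x \<in> carrier D \<Longrightarrow> (c + d) \<odot> x = c \<odot> x \<oplus> d \<odot> x"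
    and s_s: "x \<in> carrier D \<Longrightarrow> c \<odot> (d \<odot> x) = (c * d) \<odot> x"
    and one_s [simp]: "x \<in> carrier D \<Longrightarrow> 1 \<odot> x = x"
    and s_mult_left: "x \<in> carrier D \<Longrightarrow> y \<in> carrier D \<Longrightarrow> (c \<odot> x) \<otimes> y = c \<odot> (x \<otimes> y)"
    and s_mult_right: "x \<in> carrier D \<Longrightarrow> y \<in> carrier D \<Longrightarrow> x \<otimes> (c \<odot> y) = c \<odot> (x \<otimes> y)"
begin

lemma l_null [simp]: assumes "x \<in> carrier D" shows "\<zero> \<otimes> x = \<zero>"
proof -
  have "\<zero> \<otimes> x \<oplus> \<zero> \<otimes> x = \<zero> \<otimes> x" using l_distr[of \<zero> \<zero> x] assms by simp
  then show ?thesis using assms m_closed[of \<zero> x] by (simp add: add.r_cancel_one)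
qed

lemma r_null [simp]: assumes "x \<in> carrier D" shows "x \<otimes> \<zero> = \<zero>"
proof -
  have "x \<otimes> \<zero> \<oplus> x \<otimes> \<zero> = x \<otimes> \<zero>" using r_distr[of \<zero> \<zero> x] assms by simp
  then show ?thesis using assms m_closed[of x \<zero>] by (simp add: add.r_cancel_one)
qed

lemma zero_s [simp]: assumes "x \<in> carrier D" shows "0 \<odot> x = \<zero>"
proof -
  have "0 \<odot> x \<oplus> 0 \<odot> x = 0 \<odot> x" using add_s[of x 0 0] assms by simp
  then show ?thesis using s_closed[OF assms, of 0] by (simp add: add.r_cancel_one)
qed

lemma s_zero [simp]: "c \<odot> \<zero> = \<zero>"
proof -
  have "c \<odot> \<zero> \<oplus> c \<odot> \<zero> = c \<odot> \<zero>" using s_add[of \<zero> \<zero> c] by simp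
  then show ?thesis using s_closed[OF zero_closed, of c] by (simp add: add.r_cancel_one)
qed

lemma a_inv_s: assumes "x \<in> carrier D" shows "\<ominus> x = (-1) \<odot> x"
proof -
  have "(-1) \<odot> x \<oplus> x = (-1 + 1) \<odot> x" using assms add_s[of x "-1" 1] by simp
  also have "\<dots> = \<zero>" using assms by simp
  finally show ?thesis using assms by (simp add: minus_equality)
qed

lemma l_minus: "x \<in> carrier D \<Longrightarrow> y \<in> carrier D \<Longrightarrow> (\<ominus> x) \<otimes> y = \<ominus> (x \<otimes> y)"
  by (simp add: a_inv_s s_mult_left)

lemma r_minus: "x \<in> carrier D \<Longrightarrow> y \<in> carrier D \<Longrightarrow> x \<otimes> (\<ominus> y) = \<ominus> (x \<otimes> y)"
  by (simp add: a_inv_s s_mult_right)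

lemma lsum_closed: "set xs \<subseteq> carrier D \<Longrightarrow> lsum D xs \<in> carrier D"
  by (induction xs) auto

lemma lsum_mult_left:
  "x \<in> carrier D \<Longrightarrow> (\<And>i. i \<in> set is \<Longrightarrow> f i \<in> carrier D) \<Longrightarrow>
    x \<otimes> lsum D (map f is) = lsum D (map (\<lambda>i. x \<otimes> f i) is)"
proof (induction "is")
  case (Cons i "is")
  have "lsum D (map f is) \<in> carrier D" using Cons.prems by (intro lsum_closed) auto
  then show ?case using Cons by (simp add: r_distr)
qed simp

lemma lsum_mult_right:
  "x \<in> carrier D \<Longrightarrow> (\<And>i. i \<in> set is \<Longrightarrow> f i \<in> carrier D) \<Longrightarrow>
    lsum D (map f is) \<otimes> x = lsum D (map (\<lambda>i. f i \<otimes> x) is)"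
proof (induction "is")
  case (Cons i "is")
  have "lsum D (map f is) \<in> carrier D" using Cons.prems by (intro lsum_closed) auto
  then show ?case using Cons by (simp add: l_distr)
qed simp

lemma unital_moduleI: "left_module D M \<Longrightarrow> unital_module D M"
  by (simp add: unital_module_def unital_module_axioms_def abelian_group_axioms)

lemma subalgebraD:
  assumes "subalgebra T D"
  shows "\<And>x. x \<in> T \<Longrightarrow> x \<in> carrier D" "\<zero> \<in> T" "\<And>x y. x \<in> T \<Longrightarrow> y \<in> T \<Longrightarrow> x \<oplus> y \<in> T"
    "\<And>x y. x \<in> T \<Longrightarrow> y \<in> T \<Longrightarrow> x \<otimes> y \<in> T" "\<And>c x. x \<in> T \<Longrightarrow> c \<odot> x \<in> T"
proof -
  have sub: "subgroup T (add_monoid D)" using assms by (simp add: subalgebra_def)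
  show "\<And>x. x \<in> T \<Longrightarrow> x \<in> carrier D" "\<zero> \<in> T" "\<And>x y. x \<in> T \<Longrightarrow> y \<in> T \<Longrightarrow> x \<oplus> y \<in> T"
    using subgroup.subset[OF sub] subgroup.one_closed[OF sub] subgroup.m_closed[OF sub] by auto
qed (use assms in \<open>auto simp: subalgebra_def\<close>)

lemma subalgebra_nonunital_algebra:
  assumes "subalgebra T D" shows "nonunital_algebra (D\<lparr>carrier := T\<rparr>)"
proof -
  note T' = subalgebraD(1)[OF assms] and T = subalgebraD(2-3)[OF assms]
    and m = subalgebraD(4)[OF assms] and s = subalgebraD(5)[OF assms]
  interpret A: abelian_group "D\<lparr>carrier := T\<rparr>"
  proof (rule abelian_groupI)
    show "\<exists>y\<in>carrier (D\<lparr>carrier := T\<rparr>). y \<oplus>\<^bsub>D\<lparr>carrier := T\<rparr>\<^esub> x = \<zero>\<^bsub>D\<lparr>carrier := T\<rparr>\<^esub>"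
      if "x \<in> carrier (D\<lparr>carrier := T\<rparr>)" for x
    proof -
      have x: "x \<in> T" using that by simp
      then have "(-1) \<odot> x \<oplus> x = \<zero>" using a_inv_s[of x] l_neg[of x] T' by auto
      then show ?thesis using s[OF x] by auto
    qed
  qed (use T in \<open>auto simp: a_ac T'\<close>)
  show ?thesis
    by unfold_locales (use m s in \<open>auto simp: T' m_assoc l_distr r_distr s_add add_s s_s s_mult_left s_mult_right\<close>)
qed

lemma subalgebraI:
  assumes "T \<subseteq> carrier D" "\<zero> \<in> T" "\<And>x y. x \<in> T \<Longrightarrow> y \<in> T \<Longrightarrow> x \<oplus> y \<in> T"
    "\<And>x y. x \<in> T \<Longrightarrow> y \<in> T \<Longrightarrow> x \<otimes> y \<in> T" "\<And>c x. x \<in> T \<Longrightarrow> c \<odot> x \<in> T"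
  shows "subalgebra T D"
  unfolding subalgebra_def
proof (intro conjI subgroup.intro ballI allI)
  show "inv\<^bsub>add_monoid D\<^esub> x \<in> T" if "x \<in> T" for x
    using a_inv_s[of x] assms(1) assms(5)[OF that, of "-1"] that unfolding a_inv_def by auto
qed (use assms in auto)

end

text \<open>The corner \<open>\<epsilon>\<^sub>\<nu> D \<epsilon>\<^sub>\<nu>\<close> is \<open>k \<epsilon>\<^sub>\<nu>\<close> plus nilpotent elements, and \<open>\<chi>\<^sub>\<nu>\<close> is the projection to \<open>k\<close>; it is defined and
  multiplicative on all of \<open>D\<close>. Nilpotency is expressed by iterated multiplication because there is no
  unit element to start powers from.\<close>

locale split_algebra = nonunital_algebra D for D :: "('k::field, 'd) module" (structure) +
  fixes \<Lambda> :: "'l set" and \<epsilon> :: "'l \<Rightarrow> 'd" and \<chi> :: "'l \<Rightarrow> 'd \<Rightarrow> 'k"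
  assumes idem_closed [simp, intro]: "\<nu> \<in> \<Lambda> \<Longrightarrow> \<epsilon> \<nu> \<in> carrier D"
    and idem_orth: "\<nu> \<in> \<Lambda> \<Longrightarrow> \<mu> \<in> \<Lambda> \<Longrightarrow> \<epsilon> \<nu> \<otimes> \<epsilon> \<mu> = (if \<nu> = \<mu> then \<epsilon> \<nu> else \<zero>)"
    and local_unit: "a \<in> carrier D \<Longrightarrow> \<exists>ns. set ns \<subseteq> \<Lambda> \<and> distinct ns \<and>
      lsum D (map (\<lambda>\<nu>. \<epsilon> \<nu> \<otimes> a) ns) = a \<and> lsum D (map (\<lambda>\<nu>. a \<otimes> \<epsilon> \<nu>) ns) = a"
    and char_add: "\<nu> \<in> \<Lambda> \<Longrightarrow> a \<in> carrier D \<Longrightarrow> b \<in> carrier D \<Longrightarrow> \<chi> \<nu> (a \<oplus> b) = \<chi> \<nu> a + \<chi> \<nu> b"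
    and char_mult: "\<nu> \<in> \<Lambda> \<Longrightarrow> a \<in> carrier D \<Longrightarrow> b \<in> carrier D \<Longrightarrow> \<chi> \<nu> (a \<otimes> b) = \<chi> \<nu> a * \<chi> \<nu> b"
    and char_smult: "\<nu> \<in> \<Lambda> \<Longrightarrow> a \<in> carrier D \<Longrightarrow> \<chi> \<nu> (c \<odot> a) = c * \<chi> \<nu> a"
    and char_idem: "\<nu> \<in> \<Lambda> \<Longrightarrow> \<mu> \<in> \<Lambda> \<Longrightarrow> \<chi> \<nu> (\<epsilon> \<mu>) = (if \<nu> = \<mu> then 1 else 0)"
    and local_nilpotent: "\<nu> \<in> \<Lambda> \<Longrightarrow> a \<in> carrier D \<Longrightarrow> \<epsilon> \<nu> \<otimes> a = a \<Longrightarrow> a \<otimes> \<epsilon> \<nu> = a \<Longrightarrow> \<chi> \<nu> a = 0 \<Longrightarrow>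
      \<exists>m. ((\<lambda>x. a \<otimes> x) ^^ m) (\<epsilon> \<nu>) = \<zero>"
begin

lemma char_zero [simp]: "\<nu> \<in> \<Lambda> \<Longrightarrow> \<chi> \<nu> \<zero> = 0"
  using char_smult[of \<nu> \<zero> 0] by simp

lemma char_minus: "\<nu> \<in> \<Lambda> \<Longrightarrow> a \<in> carrier D \<Longrightarrow> \<chi> \<nu> (\<ominus> a) = - \<chi> \<nu> a"
  by (simp add: a_inv_s char_smult)

lemma idem_neq_zero: "\<nu> \<in> \<Lambda> \<Longrightarrow> \<epsilon> \<nu> \<noteq> \<zero>"
  using char_idem[of \<nu> \<nu>] char_zero[of \<nu>] by auto

definition unit_of :: "'l list \<Rightarrow> 'd" where "unit_of ns = lsum D (map \<epsilon> ns)"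

lemma unit_closed [simp]: "set ns \<subseteq> \<Lambda> \<Longrightarrow> unit_of ns \<in> carrier D"
  unfolding unit_of_def by (intro lsum_closed) auto

lemma unit_idem:
  assumes "set ns \<subseteq> \<Lambda>" "distinct ns" "\<nu> \<in> \<Lambda>"
  shows "unit_of ns \<otimes> \<epsilon> \<nu> = (if \<nu> \<in> set ns then \<epsilon> \<nu> else \<zero>)"
    and "\<epsilon> \<nu> \<otimes> unit_of ns = (if \<nu> \<in> set ns then \<epsilon> \<nu> else \<zero>)"
proof -
  have "unit_of ns \<otimes> \<epsilon> \<nu> = (if \<nu> \<in> set ns then \<epsilon> \<nu> else \<zero>) \<and>
    \<epsilon> \<nu> \<otimes> unit_of ns = (if \<nu> \<in> set ns then \<epsilon> \<nu> else \<zero>)"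
    using assms(1,2)
  proof (induction ns)
    case Nil then show ?case using assms(3) by (simp add: unit_of_def)
  next
    case (Cons \<mu> ns)
    have eq: "unit_of (\<mu> # ns) = \<epsilon> \<mu> \<oplus> unit_of ns" by (simp add: unit_of_def)
    have cl: "unit_of ns \<in> carrier D" using Cons.prems by simp
    show ?case
      using Cons cl assms(3) unfolding eq by (auto simp: l_distr r_distr idem_orth)
  qed
  then show "unit_of ns \<otimes> \<epsilon> \<nu> = (if \<nu> \<in> set ns then \<epsilon> \<nu> else \<zero>)"
    and "\<epsilon> \<nu> \<otimes> unit_of ns = (if \<nu> \<in> set ns then \<epsilon> \<nu> else \<zero>)" by auto
qed

lemma unit_of_unit: 
  assumes "set ns \<subseteq> \<Lambda>" "distinct ns" shows "unit_of ns \<otimes> unit_of ns = unit_of ns"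
proof -
  have "unit_of ns \<otimes> unit_of ns = lsum D (map (\<lambda>\<nu>. unit_of ns \<otimes> \<epsilon> \<nu>) ns)"
    using lsum_mult_left[of "unit_of ns" ns \<epsilon>] assms unfolding unit_of_def[of ns, symmetric]
    by (auto simp: subset_iff)
  also have "map (\<lambda>\<nu>. unit_of ns \<otimes> \<epsilon> \<nu>) ns = map \<epsilon> ns"
    using assms unit_idem(1)[OF assms] by (intro map_cong) (auto simp: subset_iff)
  finally show ?thesis by (simp add: unit_of_def)
qed

lemma unit_of_superset:
  assumes ms: "set ms \<subseteq> \<Lambda>" "distinct ms" and ns: "set ns \<subseteq> set ms" and a: "a \<in> carrier D"
    and l: "lsum D (map (\<lambda>\<nu>. \<epsilon> \<nu> \<otimes> a) ns) = a" and r: "lsum D (map (\<lambda>\<nu>. a \<otimes> \<epsilon> \<nu>) ns) = a"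
  shows "unit_of ms \<otimes> a = a" "a \<otimes> unit_of ms = a"
proof -
  have in\<Lambda>: "\<nu> \<in> \<Lambda>" if "\<nu> \<in> set ns" for \<nu> using that ms ns by auto
  have u: "unit_of ms \<in> carrier D" using ms by simp
  have "unit_of ms \<otimes> lsum D (map (\<lambda>\<nu>. \<epsilon> \<nu> \<otimes> a) ns) = lsum D (map (\<lambda>\<nu>. unit_of ms \<otimes> (\<epsilon> \<nu> \<otimes> a)) ns)"
    using u a in\<Lambda> by (subst lsum_mult_left) auto
  also have "map (\<lambda>\<nu>. unit_of ms \<otimes> (\<epsilon> \<nu> \<otimes> a)) ns = map (\<lambda>\<nu>. \<epsilon> \<nu> \<otimes> a) ns"
    using u a in\<Lambda> ms ns unit_idem(1)[OF ms] by (intro map_cong) (auto simp: m_assoc[symmetric])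
  finally show "unit_of ms \<otimes> a = a" using l by simp
  have "lsum D (map (\<lambda>\<nu>. a \<otimes> \<epsilon> \<nu>) ns) \<otimes> unit_of ms = lsum D (map (\<lambda>\<nu>. (a \<otimes> \<epsilon> \<nu>) \<otimes> unit_of ms) ns)"
    using u a in\<Lambda> by (subst lsum_mult_right) auto
  also have "map (\<lambda>\<nu>. (a \<otimes> \<epsilon> \<nu>) \<otimes> unit_of ms) ns = map (\<lambda>\<nu>. a \<otimes> \<epsilon> \<nu>) ns"
    using u a in\<Lambda> ms ns unit_idem(2)[OF ms] by (intro map_cong) (auto simp: m_assoc)
  finally show "a \<otimes> unit_of ms = a" using r by simp
qed

lemma common_unit:
  assumes "finite X" "X \<subseteq> carrier D"
  shows "\<exists>ns. set ns \<subseteq> \<Lambda> \<and> distinct ns \<and> (\<forall>x\<in>X. unit_of ns \<otimes> x = x \<and> x \<otimes> unit_of ns = x)"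
proof -
  have "\<forall>x\<in>X. \<exists>ns. set ns \<subseteq> \<Lambda> \<and> distinct ns \<and>
      lsum D (map (\<lambda>\<nu>. \<epsilon> \<nu> \<otimes> x) ns) = x \<and> lsum D (map (\<lambda>\<nu>. x \<otimes> \<epsilon> \<nu>) ns) = x"
    using local_unit assms(2) by blast
  then obtain f where f: "\<And>x. x \<in> X \<Longrightarrow> set (f x) \<subseteq> \<Lambda> \<and> distinct (f x) \<and>
      lsum D (map (\<lambda>\<nu>. \<epsilon> \<nu> \<otimes> x) (f x)) = x \<and> lsum D (map (\<lambda>\<nu>. x \<otimes> \<epsilon> \<nu>) (f x)) = x"
    by metis
  obtain ms where ms: "set ms = (\<Union>x\<in>X. set (f x))" "distinct ms"
    using finite_distinct_list[of "\<Union>x\<in>X. set (f x)"] assms(1) by auto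
  have "set ms \<subseteq> \<Lambda>" using f ms by blast
  moreover have "unit_of ms \<otimes> x = x \<and> x \<otimes> unit_of ms = x" if x: "x \<in> X" for x
  proof -
    have "set (f x) \<subseteq> set ms" "x \<in> carrier D" using x ms assms(2) by auto
    with f[OF x] ms(2) \<open>set ms \<subseteq> \<Lambda>\<close> show ?thesis using unit_of_superset[of ms "f x" x] by auto
  qed
  ultimately show ?thesis using ms(2) by blast
qed

lemma exists_unit:
  assumes "a \<in> carrier D" shows "\<exists>u\<in>carrier D. u \<otimes> a = a \<and> a \<otimes> u = a"
  using common_unit[of "{a}"] assms by auto

lemma local_units: "local_units D"
  unfolding local_units_def
proof (intro allI impI, elim conjE)
  fix F assume "finite F" "F \<subseteq> carrier D"
  then obtain ns where "set ns \<subseteq> \<Lambda>" "distinct ns" "\<forall>x\<in>F. unit_of ns \<otimes> x = x \<and> x \<otimes> unit_of ns = x"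
    using common_unit by metis
  then show "\<exists>u\<in>carrier D. u \<otimes> u = u \<and> (\<forall>x\<in>F. u \<otimes> x = x \<and> x \<otimes> u = x)"
    by (intro bexI[of _ "unit_of ns"]) (auto simp: unit_of_unit)
qed

subsection \<open>Projective and simple modules\<close>

lemma regular_simps [simp]:
  "carrier (regular_module D) = carrier D" "\<zero>\<^bsub>regular_module D\<^esub> = \<zero>"
  "ring.add (regular_module D) = ring.add D" "module.smult (regular_module D) = monoid.mult D"
  by (simp_all add: regular_module_def)

lemma regular_unital: "unital_module D (regular_module D)"
proof -
  interpret A: abelian_group "regular_module D"
    by (rule abelian_groupI) (auto simp: a_ac intro: l_neg)
  show ?thesis
    by unfold_locales (auto simp: l_distr r_distr m_assoc dest: exists_unit)
qed

lemma proj_carrier: "\<nu> \<in> \<Lambda> \<Longrightarrow> carrier (proj_module D \<epsilon> \<nu>) = {y \<in> carrier D. y \<otimes> \<epsilon> \<nu> = y}"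
  unfolding proj_module_def
proof (intro equalityI subsetI)
  fix y assume \<nu>: "\<nu> \<in> \<Lambda>" and "y \<in> carrier (regular_module D\<lparr>carrier := {a \<otimes> \<epsilon> \<nu> |a. a \<in> carrier D}\<rparr>)"
  then obtain a where "a \<in> carrier D" "y = a \<otimes> \<epsilon> \<nu>" by auto
  then show "y \<in> {y \<in> carrier D. y \<otimes> \<epsilon> \<nu> = y}" using \<nu> by (simp add: m_assoc idem_orth)
qed force

lemma proj_simps [simp]:
  "\<zero>\<^bsub>proj_module D \<epsilon> \<nu>\<^esub> = \<zero>" "ring.add (proj_module D \<epsilon> \<nu>) = ring.add D"
  "module.smult (proj_module D \<epsilon> \<nu>) = monoid.mult D"
  by (simp_all add: proj_module_def)

lemma proj_submodule: "\<nu> \<in> \<Lambda> \<Longrightarrow> submodule (carrier (proj_module D \<epsilon> \<nu>)) D (regular_module D)"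
proof -
  interpret R: unital_module D "regular_module D" by (rule regular_unital)
  show "\<nu> \<in> \<Lambda> \<Longrightarrow> submodule (carrier (proj_module D \<epsilon> \<nu>)) D (regular_module D)"
    by (rule R.submoduleI) (auto simp: proj_carrier l_distr m_assoc)
qed

lemma proj_unital: assumes "\<nu> \<in> \<Lambda>" shows "unital_module D (proj_module D \<epsilon> \<nu>)"
proof -
  interpret R: unital_module D "regular_module D" by (rule regular_unital)
  show ?thesis using R.restrict_unital_module[OF proj_submodule[OF assms]] by (simp add: proj_module_def)
qed

lemma idem_in_proj: "\<nu> \<in> \<Lambda> \<Longrightarrow> \<epsilon> \<nu> \<in> carrier (proj_module D \<epsilon> \<nu>)"
  by (simp add: proj_carrier idem_orth)

text \<open>This turns out to be the radical of \<open>D \<epsilon>\<^sub>\<nu>\<close> and its only maximal submodule.\<close>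

definition rad_proj :: "'l \<Rightarrow> 'd set" where
  "rad_proj \<nu> = {y \<in> carrier D. y \<otimes> \<epsilon> \<nu> = y \<and> \<chi> \<nu> y = 0}"

lemma rad_proj_submodule: assumes "\<nu> \<in> \<Lambda>" shows "submodule (rad_proj \<nu>) D (proj_module D \<epsilon> \<nu>)"
proof -
  interpret P: unital_module D "proj_module D \<epsilon> \<nu>" by (rule proj_unital) fact
  show ?thesis
    by (rule P.submoduleI) (use assms in \<open>auto simp: rad_proj_def proj_carrier l_distr m_assoc char_add char_mult\<close>)
qed

text \<open>Locality of \<open>\<epsilon>\<^sub>\<nu> D \<epsilon>\<^sub>\<nu>\<close>: after rescaling, an element \<open>y\<close> of \<open>U\<close> with \<open>\<chi>\<^sub>\<nu> y \<noteq> 0\<close> yields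
  \<open>\<epsilon>\<^sub>\<nu> - n \<in> U\<close> with \<open>n\<close> nilpotent, and \<open>\<epsilon>\<^sub>\<nu> - n\<^sup>j \<in> U\<close> follows for all \<open>j\<close>. The argument stays
  inside the left ideal, so that it applies to every subalgebra containing the idempotents.\<close>

lemma submodule_eq_proj:
  assumes \<nu>: "\<nu> \<in> \<Lambda>" and U: "submodule U D (proj_module D \<epsilon> \<nu>)" and y: "y \<in> U" "\<chi> \<nu> y \<noteq> 0"
  shows "U = carrier (proj_module D \<epsilon> \<nu>)"
proof -
  interpret P: unital_module D "proj_module D \<epsilon> \<nu>" by (rule proj_unital) fact
  note U' = P.submoduleD[OF U, simplified]
  have UD: "x \<in> carrier D" "x \<otimes> \<epsilon> \<nu> = x" if "x \<in> U" for x using U'(1) that \<nu> by (auto simp: proj_carrier)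
  note [simp] = \<nu> idem_closed[OF \<nu>]
  define z where "z = (inverse (\<chi> \<nu> y) \<odot> \<epsilon> \<nu>) \<otimes> y"
  have zU: "z \<in> U" unfolding z_def using U'(4) y(1) by simp
  note z = UD[OF zU]
  have \<epsilon>z: "\<epsilon> \<nu> \<otimes> z = z"
    unfolding z_def using UD[OF y(1)] by (simp add: m_assoc[symmetric] s_mult_left s_mult_right idem_orth)
  have \<chi>z: "\<chi> \<nu> z = 1" unfolding z_def using UD[OF y(1)] y(2) by (simp add: char_mult char_smult char_idem)
  \<comment> \<open>The nilpotent element: it lies in the corner and is killed by the character.\<close>
  define n where "n = \<epsilon> \<nu> \<oplus> \<ominus> z"
  have n: "n \<in> carrier D" "\<epsilon> \<nu> \<otimes> n = n" "n \<otimes> \<epsilon> \<nu> = n" "\<chi> \<nu> n = 0"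
    unfolding n_def using z \<epsilon>z \<chi>z
    by (auto simp: r_distr l_distr r_minus l_minus idem_orth char_add char_minus char_idem)
  have \<epsilon>n: "\<epsilon> \<nu> \<oplus> \<ominus> n = z"
    unfolding n_def using z by (simp add: minus_add a_assoc[symmetric] r_neg)
  define p where "p j = ((\<lambda>x. n \<otimes> x) ^^ j) (\<epsilon> \<nu>)" for j
  have p: "p j \<in> carrier D \<and> \<epsilon> \<nu> \<oplus> \<ominus> p j \<in> U" for j
  proof (induction j)
    case 0 then show ?case using U'(2) by (simp add: p_def r_neg)
  next
    case (Suc j)
    have pS: "p (Suc j) = n \<otimes> p j" by (simp add: p_def)
    have "n \<otimes> (\<epsilon> \<nu> \<oplus> \<ominus> p j) \<in> U" using Suc U'(4) n(1) by simp
    also have "n \<otimes> (\<epsilon> \<nu> \<oplus> \<ominus> p j) = n \<oplus> \<ominus> p (Suc j)"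
      using Suc n by (simp add: r_distr r_minus pS)
    finally have "z \<oplus> (n \<oplus> \<ominus> p (Suc j)) \<in> U" using U'(3) zU by blast
    moreover have "z \<oplus> (n \<oplus> \<ominus> p (Suc j)) = \<epsilon> \<nu> \<oplus> \<ominus> p (Suc j)"
      unfolding \<epsilon>n[symmetric] using Suc n pS by (simp add: a_assoc) (simp add: a_assoc[symmetric] l_neg)
    ultimately show ?case using Suc n pS by simp
  qed
  obtain m where "p m = \<zero>" using local_nilpotent[OF \<nu> n] unfolding p_def by blast
  then have "\<epsilon> \<nu> \<in> U" using p[of m] by (simp add: a_inv_s)
  then have "x \<in> U" if "x \<in> carrier (proj_module D \<epsilon> \<nu>)" for x
    using U'(4)[of x "\<epsilon> \<nu>"] that by (simp add: proj_carrier)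
  then show ?thesis using U'(1) by auto
qed

lemma rad_proj_proper: "\<nu> \<in> \<Lambda> \<Longrightarrow> \<epsilon> \<nu> \<notin> rad_proj \<nu>"
  by (simp add: rad_proj_def char_idem)

lemma proper_submodule:
  assumes "\<nu> \<in> \<Lambda>" "submodule U D (proj_module D \<epsilon> \<nu>)" "U \<noteq> carrier (proj_module D \<epsilon> \<nu>)"
  shows "U \<subseteq> rad_proj \<nu>"
proof
  fix y assume y: "y \<in> U"
  interpret P: unital_module D "proj_module D \<epsilon> \<nu>" by (rule proj_unital) fact
  have "y \<in> carrier (proj_module D \<epsilon> \<nu>)" using P.submoduleD(1)[OF assms(2)] y by auto
  moreover have "\<chi> \<nu> y = 0" using submodule_eq_proj[OF assms(1,2) y] assms(3) by blast
  ultimately show "y \<in> rad_proj \<nu>" using assms(1) by (simp add: rad_proj_def proj_carrier)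
qed

lemma module_radical_proj: assumes "\<nu> \<in> \<Lambda>" shows "module_radical D (proj_module D \<epsilon> \<nu>) = rad_proj \<nu>"
proof -
  let ?P = "proj_module D \<epsilon> \<nu>"
  have ne: "rad_proj \<nu> \<noteq> carrier ?P" using rad_proj_proper[OF assms] idem_in_proj[OF assms] by auto
  have sub: "rad_proj \<nu> \<subseteq> carrier ?P" using assms by (auto simp: rad_proj_def proj_carrier)
  have "maximal_submodule D ?P U \<longleftrightarrow> U = rad_proj \<nu>" for U
  proof
    assume m: "maximal_submodule D ?P U"
    then have "U \<subseteq> rad_proj \<nu>" using proper_submodule[OF assms] by (auto simp: maximal_submodule_def)
    then show "U = rad_proj \<nu>"
      using m rad_proj_submodule[OF assms] ne unfolding maximal_submodule_def by blast
  next
    assume U: "U = rad_proj \<nu>"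
    show "maximal_submodule D ?P U"
      unfolding maximal_submodule_def U using rad_proj_submodule[OF assms] ne proper_submodule[OF assms] by blast
  qed
  then have "{U. maximal_submodule D ?P U} = {rad_proj \<nu>}" by auto
  then show ?thesis unfolding module_radical_def using sub by auto
qed

lemma top_eq: "\<nu> \<in> \<Lambda> \<Longrightarrow> top_module D \<epsilon> \<nu> = quotient_module (proj_module D \<epsilon> \<nu>) (rad_proj \<nu>)"
  by (simp add: top_module_def module_radical_proj)

lemma top_unital: "\<nu> \<in> \<Lambda> \<Longrightarrow> unital_module D (top_module D \<epsilon> \<nu>)"
  using unital_module.quotient_unital_module[OF proj_unital rad_proj_submodule] top_eq by simp

lemma top_elem:
  assumes \<nu>: "\<nu> \<in> \<Lambda>" and X: "X \<in> carrier (top_module D \<epsilon> \<nu>)"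
  obtains y where "y \<in> carrier D" "y \<otimes> \<epsilon> \<nu> = y" "X = rad_proj \<nu> +>\<^bsub>proj_module D \<epsilon> \<nu>\<^esub> y"
proof -
  interpret P: unital_module D "proj_module D \<epsilon> \<nu>" by (rule proj_unital) fact
  show ?thesis using X that \<nu> unfolding top_eq[OF \<nu>] by (auto simp: P.mem_quotient proj_carrier)
qed

lemma top_coset:
  assumes \<nu>: "\<nu> \<in> \<Lambda>" and y: "y \<in> carrier D" "y \<otimes> \<epsilon> \<nu> = y"
  shows "rad_proj \<nu> +>\<^bsub>proj_module D \<epsilon> \<nu>\<^esub> y \<in> carrier (top_module D \<epsilon> \<nu>)"
    and "rad_proj \<nu> +>\<^bsub>proj_module D \<epsilon> \<nu>\<^esub> y = \<zero>\<^bsub>top_module D \<epsilon> \<nu>\<^esub> \<longleftrightarrow> \<chi> \<nu> y = 0"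
    and "a \<in> carrier D \<Longrightarrow> a \<odot>\<^bsub>top_module D \<epsilon> \<nu>\<^esub> (rad_proj \<nu> +>\<^bsub>proj_module D \<epsilon> \<nu>\<^esub> y) =
      rad_proj \<nu> +>\<^bsub>proj_module D \<epsilon> \<nu>\<^esub> (a \<otimes> y)"
proof -
  interpret P: unital_module D "proj_module D \<epsilon> \<nu>" by (rule proj_unital) fact
  have yP: "y \<in> carrier (proj_module D \<epsilon> \<nu>)" using \<nu> y by (simp add: proj_carrier)
  note K = rad_proj_submodule[OF \<nu>]
  show "rad_proj \<nu> +>\<^bsub>proj_module D \<epsilon> \<nu>\<^esub> y \<in> carrier (top_module D \<epsilon> \<nu>)"
    unfolding top_eq[OF \<nu>] using yP by (auto intro: P.cosetI)
  show "rad_proj \<nu> +>\<^bsub>proj_module D \<epsilon> \<nu>\<^esub> y = \<zero>\<^bsub>top_module D \<epsilon> \<nu>\<^esub> \<longleftrightarrow> \<chi> \<nu> y = 0"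
    unfolding top_eq[OF \<nu>] using P.coset_eq_zero_iff[OF K yP] y by (simp add: rad_proj_def)
  show "a \<in> carrier D \<Longrightarrow> a \<odot>\<^bsub>top_module D \<epsilon> \<nu>\<^esub> (rad_proj \<nu> +>\<^bsub>proj_module D \<epsilon> \<nu>\<^esub> y) =
      rad_proj \<nu> +>\<^bsub>proj_module D \<epsilon> \<nu>\<^esub> (a \<otimes> y)"
    unfolding top_eq[OF \<nu>] using P.coset_act[OF K _ yP] by simp
qed

lemma top_simple: assumes \<nu>: "\<nu> \<in> \<Lambda>" shows "simple_module D (top_module D \<epsilon> \<nu>)"
proof -
  let ?P = "proj_module D \<epsilon> \<nu>" and ?L = "top_module D \<epsilon> \<nu>"
  interpret P: unital_module D ?P by (rule proj_unital) fact
  interpret L: unital_module D ?L by (rule top_unital) fact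
  note K = rad_proj_submodule[OF \<nu>]
  have \<epsilon>: "\<epsilon> \<nu> \<in> carrier D" "\<epsilon> \<nu> \<otimes> \<epsilon> \<nu> = \<epsilon> \<nu>" using \<nu> by (auto simp: idem_orth)
  have "W = {\<zero>\<^bsub>?L\<^esub>} \<or> W = carrier ?L" if W: "submodule W D ?L" for W
  proof (cases "\<exists>y\<in>carrier ?P. rad_proj \<nu> +>\<^bsub>?P\<^esub> y \<in> W \<and> \<chi> \<nu> y \<noteq> 0")
    case True
    note W' = L.submoduleD[OF W]
    have "submodule {y \<in> carrier ?P. rad_proj \<nu> +>\<^bsub>?P\<^esub> y \<in> W} D ?P"
    proof (rule P.submoduleI)
      show "\<zero>\<^bsub>?P\<^esub> \<in> {y \<in> carrier ?P. rad_proj \<nu> +>\<^bsub>?P\<^esub> y \<in> W}"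
        using top_coset(2)[OF \<nu>, of \<zero>] W'(2) \<nu> by (simp add: proj_carrier)
    next
      fix x y assume xy: "x \<in> {y \<in> carrier ?P. rad_proj \<nu> +>\<^bsub>?P\<^esub> y \<in> W}" "y \<in> {y \<in> carrier ?P. rad_proj \<nu> +>\<^bsub>?P\<^esub> y \<in> W}"
      then have "rad_proj \<nu> +>\<^bsub>?P\<^esub> (x \<oplus>\<^bsub>?P\<^esub> y) = (rad_proj \<nu> +>\<^bsub>?P\<^esub> x) \<oplus>\<^bsub>?L\<^esub> (rad_proj \<nu> +>\<^bsub>?P\<^esub> y)"
        unfolding top_eq[OF \<nu>] using P.coset_add[OF K] by simp
      then show "x \<oplus>\<^bsub>?P\<^esub> y \<in> {y \<in> carrier ?P. rad_proj \<nu> +>\<^bsub>?P\<^esub> y \<in> W}" using xy W'(3) P.a_closed by auto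
    next
      fix a x assume a: "a \<in> carrier D" and x: "x \<in> {y \<in> carrier ?P. rad_proj \<nu> +>\<^bsub>?P\<^esub> y \<in> W}"
      then have "rad_proj \<nu> +>\<^bsub>?P\<^esub> (a \<odot>\<^bsub>?P\<^esub> x) = a \<odot>\<^bsub>?L\<^esub> (rad_proj \<nu> +>\<^bsub>?P\<^esub> x)"
        unfolding top_eq[OF \<nu>] using P.coset_act[OF K] by simp
      then show "a \<odot>\<^bsub>?P\<^esub> x \<in> {y \<in> carrier ?P. rad_proj \<nu> +>\<^bsub>?P\<^esub> y \<in> W}"
        using a x W'(4) P.act_closed[of a x] by auto
    qed auto
    then have eq: "{y \<in> carrier ?P. rad_proj \<nu> +>\<^bsub>?P\<^esub> y \<in> W} = carrier ?P"
      using submodule_eq_proj[OF \<nu>] True by blast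
    have "carrier ?L \<subseteq> W"
    proof
      fix X assume "X \<in> carrier ?L"
      then obtain y where "y \<in> carrier ?P" "X = rad_proj \<nu> +>\<^bsub>?P\<^esub> y"
        using \<nu> by (auto elim!: top_elem simp: proj_carrier)
      then show "X \<in> W" using eq by blast
    qed
    then show ?thesis using W'(1) by auto
  next
    case False
    note W' = L.submoduleD[OF W]
    have "X = \<zero>\<^bsub>?L\<^esub>" if X: "X \<in> W" for X
    proof -
      obtain y where y: "y \<in> carrier D" "y \<otimes> \<epsilon> \<nu> = y" "X = rad_proj \<nu> +>\<^bsub>?P\<^esub> y"
        using top_elem[OF \<nu>] W'(1) X by blast
      then have "\<chi> \<nu> y = 0" using False X \<nu> by (auto simp: proj_carrier)
      then show ?thesis using top_coset(2)[OF \<nu> y(1,2)] y(3) by simp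
    qed
    then have "W \<subseteq> {\<zero>\<^bsub>?L\<^esub>}" by blast
    then show ?thesis using W'(2) by blast
  qed
  moreover have "carrier ?L \<noteq> {\<zero>\<^bsub>?L\<^esub>}"
    using top_coset(1,2)[OF \<nu> \<epsilon>] char_idem[OF \<nu> \<nu>] by auto
  ultimately show ?thesis unfolding simple_module_def using L.left_module_axioms by blast
qed

lemma act_hom:
  assumes \<nu>: "\<nu> \<in> \<Lambda>" and "unital_module D M" and x: "x \<in> carrier M"
  shows "(\<lambda>y. y \<odot>\<^bsub>M\<^esub> x) \<in> module_homs D (proj_module D \<epsilon> \<nu>) M"
proof -
  interpret M: unital_module D M by fact
  show ?thesis
    using x \<nu> by (auto simp: module_homs_def proj_carrier M.act_closed M.act_add_left M.act_mult)
qed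

text \<open>The kernel of \<open>y \<mapsto> y x\<close> on \<open>D \<epsilon>\<^sub>\<nu>\<close> contains the radical and is proper, so it is the radical.\<close>

lemma cyclic_top_iso:
  assumes \<nu>: "\<nu> \<in> \<Lambda>" and M: "unital_module D M" and x: "x \<in> carrier M" "\<epsilon> \<nu> \<odot>\<^bsub>M\<^esub> x = x" "x \<noteq> \<zero>\<^bsub>M\<^esub>"
    and gen: "carrier M \<subseteq> {a \<odot>\<^bsub>M\<^esub> x | a. a \<in> carrier D}"
    and rad: "\<And>y. y \<in> rad_proj \<nu> \<Longrightarrow> y \<odot>\<^bsub>M\<^esub> x = \<zero>\<^bsub>M\<^esub>"
  shows "module_iso D (top_module D \<epsilon> \<nu>) M"
proof -
  let ?P = "proj_module D \<epsilon> \<nu>"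
  interpret M: unital_module D M by fact
  let ?h = "\<lambda>y. y \<odot>\<^bsub>M\<^esub> x"
  have h: "?h \<in> module_homs D ?P M" by (rule act_hom[OF \<nu> M x(1)])
  have "?h ` carrier ?P = carrier M"
  proof (intro equalityI subsetI)
    fix z assume "z \<in> carrier M"
    then obtain a where a: "a \<in> carrier D" "z = a \<odot>\<^bsub>M\<^esub> x" using gen by auto
    then have "z = (a \<otimes> \<epsilon> \<nu>) \<odot>\<^bsub>M\<^esub> x" using M.act_mult[OF a(1) _ x(1)] \<nu> x(2) by simp
    then show "z \<in> ?h ` carrier ?P" using a \<nu> by (auto simp: proj_carrier m_assoc idem_orth)
  qed (use module_homsD(1)[OF h] in auto)
  moreover have "rad_proj \<nu> = {y \<in> carrier ?P. ?h y = \<zero>\<^bsub>M\<^esub>}"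
  proof
    show "rad_proj \<nu> \<subseteq> {y \<in> carrier ?P. ?h y = \<zero>\<^bsub>M\<^esub>}"
      using rad \<nu> by (auto simp: rad_proj_def proj_carrier)
    have "\<epsilon> \<nu> \<notin> {y \<in> carrier ?P. ?h y = \<zero>\<^bsub>M\<^esub>}" using x by simp
    then have "{y \<in> carrier ?P. ?h y = \<zero>\<^bsub>M\<^esub>} \<noteq> carrier ?P" using idem_in_proj[OF \<nu>] by blast
    then show "{y \<in> carrier ?P. ?h y = \<zero>\<^bsub>M\<^esub>} \<subseteq> rad_proj \<nu>"
      using proper_submodule[OF \<nu> module_hom_kernel[OF h proj_unital[OF \<nu>] M]] by blast
  qed
  ultimately show ?thesis
    unfolding top_eq[OF \<nu>] using first_isomorphism[OF h proj_unital[OF \<nu>] M] by blast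
qed

text \<open>A nonzero vector \<open>x = a x\<close> is not annihilated by all idempotents, since \<open>a\<close> is a sum of elements
  \<open>a \<epsilon>\<^sub>\<nu>\<close>. If \<open>\<epsilon>\<^sub>\<nu> x \<noteq> 0\<close>, then \<open>M\<close> is a simple quotient of \<open>D \<epsilon>\<^sub>\<nu>\<close>.\<close>

lemma simple_iso_top:
  assumes S: "simple_module D M" shows "\<exists>\<nu>\<in>\<Lambda>. module_iso D M (top_module D \<epsilon> \<nu>)"
proof -
  interpret M: unital_module D M using S unital_moduleI by (auto simp: simple_module_def)
  have M: "unital_module D M" by unfold_locales
  have simple: "\<And>U. submodule U D M \<Longrightarrow> U = {\<zero>\<^bsub>M\<^esub>} \<or> U = carrier M" and ne: "carrier M \<noteq> {\<zero>\<^bsub>M\<^esub>}"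
    using S by (auto simp: simple_module_def)
  obtain x where x: "x \<in> carrier M" "x \<noteq> \<zero>\<^bsub>M\<^esub>" using ne M.zero_closed by blast
  obtain a where a: "a \<in> carrier D" "a \<odot>\<^bsub>M\<^esub> x = x" using M.unital[OF x(1)] by blast
  obtain ns where ns: "set ns \<subseteq> \<Lambda>" "lsum D (map (\<lambda>\<nu>. a \<otimes> \<epsilon> \<nu>) ns) = a" using local_unit[OF a(1)] by blast
  have "\<exists>\<nu>\<in>\<Lambda>. \<epsilon> \<nu> \<odot>\<^bsub>M\<^esub> x \<noteq> \<zero>\<^bsub>M\<^esub>"
  proof (rule ccontr)
    assume neg: "\<not> ?thesis"
    have "lsum D (map (\<lambda>\<nu>. a \<otimes> \<epsilon> \<nu>) ns) \<odot>\<^bsub>M\<^esub> x = \<zero>\<^bsub>M\<^esub>"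
      using ns(1)
    proof (induction ns)
      case (Cons \<nu> ns)
      have "lsum D (map (\<lambda>\<nu>. a \<otimes> \<epsilon> \<nu>) ns) \<in> carrier D" using Cons.prems a(1) by (intro lsum_closed) auto
      then show ?case using Cons neg a(1) x(1) by (simp add: M.act_add_left M.act_mult M.act_zero)
    qed (use x M.zero_act in simp)
    then show False using ns(2) a(2) x(2) by simp
  qed
  then obtain \<nu> where \<nu>: "\<nu> \<in> \<Lambda>" and nz: "\<epsilon> \<nu> \<odot>\<^bsub>M\<^esub> x \<noteq> \<zero>\<^bsub>M\<^esub>" by blast
  let ?P = "proj_module D \<epsilon> \<nu>"
  define x' where "x' = \<epsilon> \<nu> \<odot>\<^bsub>M\<^esub> x"
  have x': "x' \<in> carrier M" "x' \<noteq> \<zero>\<^bsub>M\<^esub>" "\<epsilon> \<nu> \<odot>\<^bsub>M\<^esub> x' = x'"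
    using nz x(1) \<nu> M.act_mult[of "\<epsilon> \<nu>" "\<epsilon> \<nu>" x] by (auto simp: x'_def M.act_closed idem_orth)
  let ?h = "\<lambda>y. y \<odot>\<^bsub>M\<^esub> x'"
  have h: "?h \<in> module_homs D ?P M" by (rule act_hom[OF \<nu> M x'(1)])
  interpret P: unital_module D ?P by (rule proj_unital) fact
  note P = proj_unital[OF \<nu>]
  have "x' \<in> ?h ` carrier ?P" using x'(3) idem_in_proj[OF \<nu>] by (metis imageI)
  then have im: "?h ` carrier ?P = carrier M"
    using simple[OF module_hom_image[OF h P M P.submodule_carrier]] x'(2) by auto
  have "?h ` rad_proj \<nu> = {\<zero>\<^bsub>M\<^esub>}"
  proof (rule ccontr)
    assume "?h ` rad_proj \<nu> \<noteq> {\<zero>\<^bsub>M\<^esub>}"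
    then have "x' \<in> ?h ` rad_proj \<nu>"
      using simple[OF module_hom_image[OF h P M rad_proj_submodule[OF \<nu>]]] x'(1) by auto
    then obtain y where y: "y \<in> rad_proj \<nu>" "y \<odot>\<^bsub>M\<^esub> x' = x'" by auto
    then have yD: "y \<in> carrier D" "y \<otimes> \<epsilon> \<nu> = y" "\<chi> \<nu> y = 0" by (auto simp: rad_proj_def)
    have "(\<epsilon> \<nu> \<oplus> \<ominus> y) \<odot>\<^bsub>M\<^esub> x' = x' \<oplus>\<^bsub>M\<^esub> \<ominus>\<^bsub>M\<^esub> x'"
      using yD \<nu> x' y by (simp add: M.act_add_left M.minus_act)
    then have "\<epsilon> \<nu> \<oplus> \<ominus> y \<in> {y \<in> carrier ?P. ?h y = \<zero>\<^bsub>M\<^esub>}"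
      using yD \<nu> x' by (simp add: M.r_neg proj_carrier l_distr l_minus idem_orth)
    moreover have "\<chi> \<nu> (\<epsilon> \<nu> \<oplus> \<ominus> y) \<noteq> 0" using yD \<nu> by (simp add: char_add char_minus char_idem)
    ultimately have "{y \<in> carrier ?P. ?h y = \<zero>\<^bsub>M\<^esub>} = carrier ?P"
      using submodule_eq_proj[OF \<nu> module_hom_kernel[OF h P M]] by blast
    then have "\<epsilon> \<nu> \<odot>\<^bsub>M\<^esub> x' = \<zero>\<^bsub>M\<^esub>" using idem_in_proj[OF \<nu>] by blast
    then show False using x'(2,3) by simp
  qed
  then have "module_iso D (top_module D \<epsilon> \<nu>) M"
    using im x' \<nu> by (intro cyclic_top_iso[OF \<nu> M x'(1,3,2)]) (auto simp: proj_carrier)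
  then show ?thesis using module_iso_sym top_unital \<nu> by blast
qed

text \<open>The idempotent \<open>\<epsilon>\<^sub>\<nu>\<close> acts nontrivially on the top of \<open>D \<epsilon>\<^sub>\<nu>\<close>, but it maps \<open>D \<epsilon>\<^sub>\<mu>\<close> into the kernel of \<open>\<chi>\<^sub>\<mu>\<close>
  for \<open>\<mu> \<noteq> \<nu>\<close>.\<close>

lemma tops_distinct:
  assumes \<nu>: "\<nu> \<in> \<Lambda>" and \<mu>: "\<mu> \<in> \<Lambda>" and "module_iso D (top_module D \<epsilon> \<nu>) (top_module D \<epsilon> \<mu>)"
  shows "\<nu> = \<mu>"
proof (rule ccontr)
  assume ne: "\<nu> \<noteq> \<mu>"
  let ?L = "top_module D \<epsilon> \<nu>" and ?L' = "top_module D \<epsilon> \<mu>"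
  obtain h where h: "h \<in> module_homs D ?L ?L'" and inj: "inj_on h (carrier ?L)"
    using assms(3) by (auto simp: module_iso_def bij_betw_def)
  interpret L: unital_module D ?L by (rule top_unital) fact
  interpret L': unital_module D ?L' by (rule top_unital) fact
  define X where "X = rad_proj \<nu> +>\<^bsub>proj_module D \<epsilon> \<nu>\<^esub> \<epsilon> \<nu>"
  have \<epsilon>: "\<epsilon> \<nu> \<in> carrier D" "\<epsilon> \<nu> \<otimes> \<epsilon> \<nu> = \<epsilon> \<nu>" using \<nu> by (auto simp: idem_orth)
  have X: "X \<in> carrier ?L" "X \<noteq> \<zero>\<^bsub>?L\<^esub>" "\<epsilon> \<nu> \<odot>\<^bsub>?L\<^esub> X = X"
    unfolding X_def using top_coset[OF \<nu> \<epsilon>] \<epsilon> char_idem[OF \<nu> \<nu>] by auto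
  obtain y where y: "y \<in> carrier D" "y \<otimes> \<epsilon> \<mu> = y" "h X = rad_proj \<mu> +>\<^bsub>proj_module D \<epsilon> \<mu>\<^esub> y"
    using top_elem[OF \<mu>] module_homsD(1)[OF h X(1)] by blast
  have "h X = \<epsilon> \<nu> \<odot>\<^bsub>?L'\<^esub> h X" using module_homsD(3)[OF h \<epsilon>(1) X(1)] X(3) by simp
  also have "\<dots> = rad_proj \<mu> +>\<^bsub>proj_module D \<epsilon> \<mu>\<^esub> (\<epsilon> \<nu> \<otimes> y)"
    unfolding y(3) by (rule top_coset(3)[OF \<mu> y(1,2) \<epsilon>(1)])
  also have "\<dots> = \<zero>\<^bsub>?L'\<^esub>"
    using top_coset(2)[OF \<mu>, of "\<epsilon> \<nu> \<otimes> y"] y \<epsilon> \<mu> \<nu> ne by (simp add: m_assoc char_mult char_idem)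
  finally have "h X = h \<zero>\<^bsub>?L\<^esub>"
    using module_hom_zero[OF h top_unital[OF \<nu>] top_unital[OF \<mu>]] by simp
  then show False using inj X(1,2) L.zero_closed by (auto dest: inj_onD)
qed

lemma simples_indexed: "simples_indexed T D \<Lambda> \<epsilon>"
  unfolding simples_indexed_def
  using idem_orth top_simple tops_distinct simple_iso_top by auto

lemma common_kernel_acts_zero:
  assumes S: "simple_module D M" and n: "n \<in> carrier D" "\<And>\<nu>. \<nu> \<in> \<Lambda> \<Longrightarrow> \<chi> \<nu> n = 0" and x: "x \<in> carrier M"
  shows "n \<odot>\<^bsub>M\<^esub> x = \<zero>\<^bsub>M\<^esub>"
proof -
  obtain \<nu> where \<nu>: "\<nu> \<in> \<Lambda>" and "module_iso D M (top_module D \<epsilon> \<nu>)" using simple_iso_top[OF S] by blast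
  let ?L = "top_module D \<epsilon> \<nu>"
  obtain h where h: "h \<in> module_homs D M ?L" and inj: "inj_on h (carrier M)"
    using \<open>module_iso D M ?L\<close> by (auto simp: module_iso_def bij_betw_def)
  interpret M: unital_module D M using S unital_moduleI by (auto simp: simple_module_def)
  have M: "unital_module D M" by unfold_locales
  obtain y where y: "y \<in> carrier D" "y \<otimes> \<epsilon> \<nu> = y" "h x = rad_proj \<nu> +>\<^bsub>proj_module D \<epsilon> \<nu>\<^esub> y"
    using top_elem[OF \<nu>] module_homsD(1)[OF h x] by blast
  have "h (n \<odot>\<^bsub>M\<^esub> x) = rad_proj \<nu> +>\<^bsub>proj_module D \<epsilon> \<nu>\<^esub> (n \<otimes> y)"
    using module_homsD(3)[OF h n(1) x] y(3) top_coset(3)[OF \<nu> y(1,2) n(1)] by simp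
  also have "\<dots> = \<zero>\<^bsub>?L\<^esub>"
    using top_coset(2)[OF \<nu>, of "n \<otimes> y"] y n \<nu> by (simp add: m_assoc char_mult)
  finally have "h (n \<odot>\<^bsub>M\<^esub> x) = h \<zero>\<^bsub>M\<^esub>" using module_hom_zero[OF h M top_unital[OF \<nu>]] by simp
  then show ?thesis using inj M.act_closed[OF n(1) x] M.zero_closed by (auto dest: inj_onD)
qed

lemma subalgebra_split:
  assumes "subalgebra T D" "\<epsilon> ` \<Lambda> \<subseteq> T"
  shows "split_algebra (D\<lparr>carrier := T\<rparr>) \<Lambda> \<epsilon> \<chi>"
proof -
  interpret A: nonunital_algebra "D\<lparr>carrier := T\<rparr>" by (rule subalgebra_nonunital_algebra) fact
  have T: "x \<in> carrier D" if "x \<in> T" for x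
    using subalgebraD(1)[OF assms(1)] that by blast
  show ?thesis
    by unfold_locales
      (use assms(2) T in \<open>auto simp: idem_orth char_add char_mult char_smult char_idem
        intro: local_unit local_nilpotent\<close>)
qed

subsection \<open>The maximal semisimple subalgebra\<close>

text \<open>The span of the idempotents: by local units \<open>a\<close> is a sum of elements \<open>a \<epsilon>\<^sub>\<nu>\<close>, so the condition says
  that \<open>a\<close> is a combination of the \<open>\<epsilon>\<^sub>\<nu>\<close> with the coefficients \<open>\<chi>\<^sub>\<nu> a\<close>.\<close>

definition idem_span :: "'d set" where
  "idem_span = {a \<in> carrier D. \<forall>\<nu>\<in>\<Lambda>. a \<otimes> \<epsilon> \<nu> = \<chi> \<nu> a \<odot> \<epsilon> \<nu>}"

lemma idem_span_subalgebra: "subalgebra idem_span D"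
proof (rule subalgebraI)
  fix x y assume "x \<in> idem_span" "y \<in> idem_span"
  then show "x \<otimes> y \<in> idem_span"
    by (auto simp: idem_span_def m_assoc s_mult_right char_mult s_s mult.commute)
qed (auto simp: idem_span_def l_distr char_add add_s s_mult_left char_smult s_s)

lemma idem_in_span: "\<epsilon> ` \<Lambda> \<subseteq> idem_span"
  by (auto simp: idem_span_def idem_orth char_idem)

lemma idem_span_least:
  assumes "subalgebra T D" "\<epsilon> ` \<Lambda> \<subseteq> T" shows "idem_span \<subseteq> T"
proof
  fix a assume a: "a \<in> idem_span"
  have T: "\<zero> \<in> T" "\<And>x y. x \<in> T \<Longrightarrow> y \<in> T \<Longrightarrow> x \<oplus> y \<in> T" "\<And>c x. x \<in> T \<Longrightarrow> c \<odot> x \<in> T"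
    using subalgebraD[OF assms(1)] by auto
  obtain ns where ns: "set ns \<subseteq> \<Lambda>" "lsum D (map (\<lambda>\<nu>. a \<otimes> \<epsilon> \<nu>) ns) = a"
    using local_unit[of a] a unfolding idem_span_def by blast
  have "lsum D (map (\<lambda>\<nu>. a \<otimes> \<epsilon> \<nu>) ns) \<in> T"
    using ns(1) by (induction ns) (use a T assms(2) in \<open>auto simp: idem_span_def\<close>)
  then show "a \<in> T" using ns(2) by simp
qed

text \<open>Every line \<open>k \<epsilon>\<^sub>\<nu>\<close> is a simple submodule, and these lines generate.\<close>

lemma idem_span_semisimple: "semisimple_algebra (D\<lparr>carrier := idem_span\<rparr>)"
proof -
  let ?S = "D\<lparr>carrier := idem_span\<rparr>"
  interpret S: split_algebra ?S \<Lambda> \<epsilon> \<chi> by (rule subalgebra_split[OF idem_span_subalgebra idem_in_span])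
  interpret R: unital_module ?S "regular_module ?S" by (rule S.regular_unital)
  let ?U = "\<lambda>\<nu>. {c \<odot> \<epsilon> \<nu> | c. True}"
  let ?X = "\<Union>{U. submodule U ?S (regular_module ?S) \<and> simple_module ?S (regular_module ?S\<lparr>carrier := U\<rparr>)}"
  have SD: "a \<in> carrier D" if "a \<in> idem_span" for a using that by (simp add: idem_span_def)
  have \<epsilon>S: "\<epsilon> \<nu> \<in> idem_span" if "\<nu> \<in> \<Lambda>" for \<nu> using idem_in_span that by auto
  have U: "submodule (?U \<nu>) ?S (regular_module ?S)" if \<nu>: "\<nu> \<in> \<Lambda>" for \<nu>
  proof (rule R.submoduleI)
    show "?U \<nu> \<subseteq> carrier (regular_module ?S)" using S.s_closed[of "\<epsilon> \<nu>"] \<epsilon>S[OF \<nu>] by auto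
    show "\<zero>\<^bsub>regular_module ?S\<^esub> \<in> ?U \<nu>" using zero_s[OF idem_closed[OF \<nu>]] by (auto intro!: exI[of _ 0])
    show "x \<oplus>\<^bsub>regular_module ?S\<^esub> y \<in> ?U \<nu>" if "x \<in> ?U \<nu>" "y \<in> ?U \<nu>" for x y
      using that \<nu> by (auto simp: add_s[symmetric])
    show "a \<odot>\<^bsub>regular_module ?S\<^esub> x \<in> ?U \<nu>" if ax: "a \<in> carrier ?S" "x \<in> ?U \<nu>" for a x
    proof -
      obtain c where c: "x = c \<odot> \<epsilon> \<nu>" using ax(2) by blast
      have "a \<in> carrier D" "a \<otimes> \<epsilon> \<nu> = \<chi> \<nu> a \<odot> \<epsilon> \<nu>" using ax(1) \<nu> by (auto simp: idem_span_def)
      then have "a \<otimes> x = (c * \<chi> \<nu> a) \<odot> \<epsilon> \<nu>" using c \<nu> by (simp add: s_mult_right s_s)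
      then show ?thesis by auto
    qed
  qed
  have simple: "simple_module ?S (regular_module ?S\<lparr>carrier := ?U \<nu>\<rparr>)" if \<nu>: "\<nu> \<in> \<Lambda>" for \<nu>
  proof -
    let ?M = "regular_module ?S\<lparr>carrier := ?U \<nu>\<rparr>"
    interpret M: unital_module ?S ?M by (rule R.restrict_unital_module[OF U[OF \<nu>]])
    have "W = {\<zero>\<^bsub>?M\<^esub>} \<or> W = carrier ?M" if W: "submodule W ?S ?M" for W
    proof (cases "W \<subseteq> {\<zero>}")
      case True
      then show ?thesis using M.submoduleD(2)[OF W] by auto
    next
      case False
      note W' = M.submoduleD[OF W]
      obtain w where w: "w \<in> W" "w \<noteq> \<zero>" using False by auto
      then obtain c where c: "w = c \<odot> \<epsilon> \<nu>" using W'(1) by auto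
      then have c0: "c \<noteq> 0" using w \<nu> by auto
      have "d \<odot> \<epsilon> \<nu> \<in> W" for d
      proof -
        have "((d / c) \<odot> \<epsilon> \<nu>) \<odot>\<^bsub>?M\<^esub> w \<in> W"
          using W'(4)[OF _ w(1)] S.s_closed[of "\<epsilon> \<nu>"] \<epsilon>S[OF \<nu>] by auto
        then show ?thesis using c c0 \<nu> by (simp add: s_mult_left s_mult_right s_s idem_orth)
      qed
      then have "carrier ?M \<subseteq> W" by auto
      then show ?thesis using W'(1) by auto
    qed
    moreover have "\<epsilon> \<nu> \<in> carrier ?M" using one_s[OF idem_closed[OF \<nu>]] by (auto intro!: exI[of _ 1])
    then have "carrier ?M \<noteq> {\<zero>\<^bsub>?M\<^esub>}" using idem_neq_zero[OF \<nu>] by auto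
    ultimately show ?thesis unfolding simple_module_def using M.left_module_axioms by blast
  qed
  have XS: "?X \<subseteq> carrier (regular_module ?S)" using R.submoduleD(1) by blast
  note gen = R.generated_submodule[OF XS]
  have "a \<in> generated_submodule ?S (regular_module ?S) ?X" if a: "a \<in> idem_span" for a
  proof -
    obtain ns where ns: "set ns \<subseteq> \<Lambda>" "lsum D (map (\<lambda>\<nu>. a \<otimes> \<epsilon> \<nu>) ns) = a"
      using local_unit[OF SD[OF a]] by blast
    have "a \<otimes> \<epsilon> \<nu> \<in> ?X" if \<nu>: "\<nu> \<in> \<Lambda>" for \<nu>
      using U[OF \<nu>] simple[OF \<nu>] a \<nu> by (intro UnionI[of "?U \<nu>"]) (auto simp: idem_span_def)
    then have in_gen: "a \<otimes> \<epsilon> \<nu> \<in> generated_submodule ?S (regular_module ?S) ?X" if "\<nu> \<in> \<Lambda>" for \<nu>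
      using gen(2) that by blast
    have "lsum D (map (\<lambda>\<nu>. a \<otimes> \<epsilon> \<nu>) ns) \<in> generated_submodule ?S (regular_module ?S) ?X"
      using ns(1)
    proof (induction ns)
      case Nil
      then show ?case using R.submoduleD(2)[OF gen(1)] by simp
    next
      case (Cons \<nu> ns)
      then show ?case using R.submoduleD(3)[OF gen(1) in_gen[of \<nu>]] by simp
    qed
    then show ?thesis using ns(2) by simp
  qed
  then have "generated_submodule ?S (regular_module ?S) ?X = carrier ?S"
    using R.submoduleD(1)[OF gen(1)] by auto
  then show ?thesis unfolding semisimple_algebra_def using S.local_units by blast
qed

text \<open>A semisimple subalgebra \<open>T\<close> containing the idempotents is again split by the same characters, so
  the elements of \<open>T\<close> in the common kernel of the characters annihilate all simple \<open>T\<close>-modules and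
  hence \<open>T\<close> itself.\<close>

lemma idem_span_maximal: "maximal_semisimple_subalgebra idem_span D"
  unfolding maximal_semisimple_subalgebra_def
proof (intro conjI allI impI idem_span_subalgebra idem_span_semisimple; elim conjE)
  fix T assume T: "subalgebra T D" and ss: "semisimple_algebra (D\<lparr>carrier := T\<rparr>)" and ST: "idem_span \<subseteq> T"
  let ?T = "D\<lparr>carrier := T\<rparr>"
  have \<epsilon>T: "\<epsilon> ` \<Lambda> \<subseteq> T" using ST idem_in_span by auto
  interpret T: split_algebra ?T \<Lambda> \<epsilon> \<chi> by (rule subalgebra_split[OF T \<epsilon>T])
  interpret R: unital_module ?T "regular_module ?T" by (rule T.regular_unital)
  have TD: "a \<in> carrier D" if "a \<in> T" for a
    using subalgebraD(1)[OF T] that by blast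
  let ?X = "\<Union>{U. submodule U ?T (regular_module ?T) \<and> simple_module ?T (regular_module ?T\<lparr>carrier := U\<rparr>)}"
  have XT: "?X \<subseteq> carrier (regular_module ?T)" using R.submoduleD(1) by blast
  \<comment> \<open>The elements annihilated from the left by the common kernel form a submodule with all simple submodules.\<close>
  have zero: "n = \<zero>" if n: "n \<in> T" "\<And>\<nu>. \<nu> \<in> \<Lambda> \<Longrightarrow> \<chi> \<nu> n = 0" for n
  proof -
    let ?A = "{x \<in> T. \<forall>n\<in>T. (\<forall>\<nu>\<in>\<Lambda>. \<chi> \<nu> n = 0) \<longrightarrow> n \<otimes> x = \<zero>}"
    have "submodule ?A ?T (regular_module ?T)"
    proof (rule R.submoduleI)
      show "x \<oplus>\<^bsub>regular_module ?T\<^esub> y \<in> ?A" if "x \<in> ?A" "y \<in> ?A" for x y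
        using that T.a_closed[of x y] by (auto simp: r_distr TD)
      show "a \<odot>\<^bsub>regular_module ?T\<^esub> x \<in> ?A" if a: "a \<in> carrier ?T" and x: "x \<in> ?A" for a x
      proof -
        have "n \<otimes> (a \<otimes> x) = \<zero>" if "n \<in> T" "\<forall>\<nu>\<in>\<Lambda>. \<chi> \<nu> n = 0" for n
        proof -
          have "n \<otimes> a \<in> T" "\<forall>\<nu>\<in>\<Lambda>. \<chi> \<nu> (n \<otimes> a) = 0"
            using that a T.m_closed[of n a] by (auto simp: char_mult TD)
          then have "(n \<otimes> a) \<otimes> x = \<zero>" using x by blast
          then show ?thesis using that a x by (simp add: m_assoc TD)
        qed
        then show ?thesis using a x T.m_closed[of a x] by auto
      qed
    qed (use T.zero_closed in \<open>auto simp: TD\<close>)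
    moreover have "?X \<subseteq> ?A"
    proof
      fix x assume "x \<in> ?X"
      then obtain U where U: "submodule U ?T (regular_module ?T)" "x \<in> U"
        and simple: "simple_module ?T (regular_module ?T\<lparr>carrier := U\<rparr>)" by blast
      have "x \<in> T" using R.submoduleD(1)[OF U(1)] U(2) by auto
      moreover have "n \<otimes> x = \<zero>" if "n \<in> T" "\<forall>\<nu>\<in>\<Lambda>. \<chi> \<nu> n = 0" for n
        using T.common_kernel_acts_zero[OF simple, of n x] that U(2) by simp
      ultimately show "x \<in> ?A" by blast
    qed
    ultimately have "carrier ?T \<subseteq> ?A"
      using R.generated_submodule(3)[OF XT] ss unfolding semisimple_algebra_def by blast
    moreover obtain u where "u \<in> T" "n \<otimes> u = n" using T.exists_unit[of n] n(1) by auto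
    ultimately show ?thesis using n by auto
  qed
  have "t \<in> idem_span" if t: "t \<in> T" for t
  proof -
    have "t \<otimes> \<epsilon> \<nu> = \<chi> \<nu> t \<odot> \<epsilon> \<nu>" if \<nu>: "\<nu> \<in> \<Lambda>" for \<nu>
    proof -
      have \<epsilon>\<nu>: "\<epsilon> \<nu> \<in> T" using \<epsilon>T \<nu> by auto
      let ?n = "t \<otimes> \<epsilon> \<nu> \<oplus> (- \<chi> \<nu> t) \<odot> \<epsilon> \<nu>"
      have "?n = \<zero>"
      proof (rule zero)
        show "?n \<in> T" using T.a_closed T.m_closed T.s_closed t \<epsilon>\<nu> by simp
        show "\<chi> \<mu> ?n = 0" if "\<mu> \<in> \<Lambda>" for \<mu>
          using that \<nu> TD[OF t] by (simp add: char_add char_mult char_smult char_idem)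
      qed
      then have "t \<otimes> \<epsilon> \<nu> = \<ominus> ((- \<chi> \<nu> t) \<odot> \<epsilon> \<nu>)"
        using minus_equality[of "t \<otimes> \<epsilon> \<nu>" "(- \<chi> \<nu> t) \<odot> \<epsilon> \<nu>"] \<nu> TD[OF t] by simp
      then show ?thesis using \<nu> by (simp add: a_inv_s s_s)
    qed
    then show ?thesis using TD[OF t] by (simp add: idem_span_def)
  qed
  then show "T = idem_span" using ST by auto
qed

end

section \<open>Induction along a subalgebra with a dual basis\<close>

text \<open>Actions and induced maps on tensor products are defined by enlarging the image of a coset to a
  coset of the target relations; this evaluates them.\<close>

lemma additive_image_coset:
  fixes F :: "'u::ab_group_add \<Rightarrow> 'v::ab_group_add"
  assumes add: "\<And>x y. F (x + y) = F x + F y" and R: "F ` R \<subseteq> R'" "0 \<in> R"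
    and R': "\<And>x y. x \<in> R' \<Longrightarrow> y \<in> R' \<Longrightarrow> x + y \<in> R'"
  shows "F ` (u +o R) + R' = F u +o R'"
proof (intro equalityI subsetI)
  fix z assume "z \<in> F ` (u +o R) + R'"
  then obtain r s where "r \<in> R" "s \<in> R'" "z = F (u + r) + s" by (auto simp: elt_set_plus_def set_plus_def)
  moreover then have "z = F u + (F r + s)" by (simp only: add add.assoc)
  moreover have "F r + s \<in> R'" using R R' \<open>r \<in> R\<close> \<open>s \<in> R'\<close> by (metis image_subset_iff)
  ultimately show "z \<in> F u +o R'" by (metis set_plus_intro2)
next
  fix z assume "z \<in> F u +o R'"
  then obtain s where s: "s \<in> R'" "z = F u + s" by (auto simp: elt_set_plus_def)
  have "F (u + 0) \<in> F ` (u +o R)" using R by blast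
  with s show "z \<in> F ` (u +o R) + R'" by auto
qed

lemma diff_diff_eq_swap: "(v - w) - (v' - w') = (v - v') - (w - (w' :: 'u :: ab_group_add))"
  by (simp add: algebra_simps)

text \<open>A dual basis \<open>(u\<^sub>i, b\<^sub>i)\<close> exhibits \<open>D\<close> as a projective right \<open>B\<close>-module. There may be infinitely many
  \<open>u\<^sub>i\<close>. One list of indices has to serve finitely many elements at once, because an element of a
  tensor product involves several elements of \<open>D\<close>.\<close>

locale dual_basis = split_algebra D \<Lambda> \<epsilon> \<chi>
  for D :: "('k::field, 'd) module" (structure) and \<Lambda> :: "'l set" and \<epsilon> :: "'l \<Rightarrow> 'd" and \<chi> :: "'l \<Rightarrow> 'd \<Rightarrow> 'k" +
  fixes B :: "'d set" and u :: "'i \<Rightarrow> 'd" and b :: "'i \<Rightarrow> 'd \<Rightarrow> 'd"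
  assumes B_sub: "subalgebra B D" and \<epsilon>_B: "\<epsilon> ` \<Lambda> \<subseteq> B"
    and u_closed [simp]: "u i \<in> carrier D"
    and b_closed [simp]: "d \<in> carrier D \<Longrightarrow> b i d \<in> B"
    and b_add: "d \<in> carrier D \<Longrightarrow> d' \<in> carrier D \<Longrightarrow> b i (d \<oplus> d') = b i d \<oplus> b i d'"
    and b_mult: "d \<in> carrier D \<Longrightarrow> y \<in> B \<Longrightarrow> b i (d \<otimes> y) = b i d \<otimes> y"
    and dual_expansion: "finite X \<Longrightarrow> X \<subseteq> carrier D \<Longrightarrow>
      \<exists>is. \<forall>d\<in>X. d = lsum D (map (\<lambda>i. u i \<otimes> b i d) is)"
begin

abbreviation "BA \<equiv> D\<lparr>carrier := B\<rparr>"

lemma B_in_D [simp]: "x \<in> B \<Longrightarrow> x \<in> carrier D"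
  using subalgebraD(1)[OF B_sub] by blast

lemma split_B: "split_algebra BA \<Lambda> \<epsilon> \<chi>"
  by (rule subalgebra_split[OF B_sub \<epsilon>_B])

end

locale tensor = dual_basis D \<Lambda> \<epsilon> \<chi> B u b + M: unital_module "D\<lparr>carrier := B\<rparr>" M
  for D :: "('k::field, 'd) module" (structure) and \<Lambda> :: "'l set" and \<epsilon> :: "'l \<Rightarrow> 'd" and \<chi> :: "'l \<Rightarrow> 'd \<Rightarrow> 'k"
    and B :: "'d set" and u :: "'i \<Rightarrow> 'd" and b :: "'i \<Rightarrow> 'd \<Rightarrow> 'd" and M :: "('d, 'm) module"
begin

definition rels where "rels = tensor_rels D B M"
definition eqv (infix \<open>\<doteq>\<close> 50) where "v \<doteq> w \<longleftrightarrow> v - w \<in> rels"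
definition frags where "frags = {w :: ('d \<times> 'm) \<Rightarrow>\<^sub>0 int. Poly_Mapping.keys w \<subseteq> carrier D \<times> carrier M}"
definition cls where "cls w = w +o rels"

lemma act_B [simp]: "y \<in> B \<Longrightarrow> x \<in> carrier M \<Longrightarrow> y \<odot>\<^bsub>M\<^esub> x \<in> carrier M"
  using M.act_closed by simp

lemma rels_zero [simp]: "0 \<in> rels" by (simp add: rels_def tensor_rels_def)
lemma rels_diff: "v \<in> rels \<Longrightarrow> w \<in> rels \<Longrightarrow> v - w \<in> rels"
  unfolding rels_def tensor_rels_def by (rule group_closure.diff)
lemma rels_add: "v \<in> rels \<Longrightarrow> w \<in> rels \<Longrightarrow> v + w \<in> rels"
  unfolding rels_def tensor_rels_def by (rule group_closure_add)
lemma rels_minus: "v \<in> rels \<Longrightarrow> - v \<in> rels"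
  unfolding rels_def tensor_rels_def by simp

lemma eqv_refl [simp]: "v \<doteq> v" by (simp add: eqv_def)
lemma eqv_sym: "v \<doteq> w \<Longrightarrow> w \<doteq> v" unfolding eqv_def using rels_minus by fastforce
lemma eqv_trans [trans]: "v \<doteq> w \<Longrightarrow> w \<doteq> z \<Longrightarrow> v \<doteq> z" unfolding eqv_def using rels_add by fastforce
lemma eqv_add: "v \<doteq> w \<Longrightarrow> v' \<doteq> w' \<Longrightarrow> v + v' \<doteq> w + w'"
  unfolding eqv_def using rels_add[of "v - w" "v' - w'"] by (simp only: add_diff_add)
lemma eqv_diff: "v \<doteq> w \<Longrightarrow> v' \<doteq> w' \<Longrightarrow> v - v' \<doteq> w - w'"
  unfolding eqv_def using rels_diff[of "v - w" "v' - w'"] diff_diff_eq_swap[of v w v' w'] by simp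
lemma eqv_sum_list: "(\<And>i. i \<in> set is \<Longrightarrow> f i \<doteq> g i) \<Longrightarrow> sum_list (map f is) \<doteq> sum_list (map g is)"
  by (induction "is") (auto intro: eqv_add)
lemma eqv_zero: "v \<doteq> 0 \<longleftrightarrow> v \<in> rels" by (simp add: eqv_def)

lemma tens_add_left:
  "d \<in> carrier D \<Longrightarrow> d' \<in> carrier D \<Longrightarrow> x \<in> carrier M \<Longrightarrow> frag_of (d \<oplus> d', x) \<doteq> frag_of (d, x) + frag_of (d', x)"
  unfolding eqv_def rels_def tensor_rels_def diff_diff_eq[symmetric]
  by (rule group_closure.base) blast
lemma tens_add_right:
  "d \<in> carrier D \<Longrightarrow> x \<in> carrier M \<Longrightarrow> x' \<in> carrier M \<Longrightarrow> frag_of (d, x \<oplus>\<^bsub>M\<^esub> x') \<doteq> frag_of (d, x) + frag_of (d, x')"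
  unfolding eqv_def rels_def tensor_rels_def diff_diff_eq[symmetric]
  by (rule group_closure.base) blast
lemma tens_balanced:
  "d \<in> carrier D \<Longrightarrow> y \<in> B \<Longrightarrow> x \<in> carrier M \<Longrightarrow> frag_of (d \<otimes> y, x) \<doteq> frag_of (d, y \<odot>\<^bsub>M\<^esub> x)"
  unfolding eqv_def rels_def tensor_rels_def
  by (rule group_closure.base) blast

lemma tens_zero_left: assumes "x \<in> carrier M" shows "frag_of (\<zero>, x) \<doteq> 0"
  using eqv_sym[OF tens_add_left[of \<zero> \<zero> x]] assms by (simp add: eqv_def)
lemma tens_zero_right: assumes "d \<in> carrier D" shows "frag_of (d, \<zero>\<^bsub>M\<^esub>) \<doteq> 0"
  using eqv_sym[OF tens_add_right[of d "\<zero>\<^bsub>M\<^esub>" "\<zero>\<^bsub>M\<^esub>"]] assms by (simp add: eqv_def)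
lemma tens_diff_right:
  assumes "d \<in> carrier D" "x \<in> carrier M" "y \<in> carrier M"
  shows "frag_of (d, x \<ominus>\<^bsub>M\<^esub> y) \<doteq> frag_of (d, x) - frag_of (d, y)"
proof -
  have "x \<ominus>\<^bsub>M\<^esub> y \<oplus>\<^bsub>M\<^esub> y = x" using assms(2,3) by (simp add: M.minus_eq M.a_assoc M.l_neg)
  then have "frag_of (d, x) \<doteq> frag_of (d, x \<ominus>\<^bsub>M\<^esub> y) + frag_of (d, y)"
    using tens_add_right[of d "x \<ominus>\<^bsub>M\<^esub> y" y] assms by simp
  from eqv_diff[OF eqv_sym[OF this] eqv_refl[of "frag_of (d, y)"]] show ?thesis by simp
qed

lemma tens_lsum:
  assumes "x \<in> carrier M" "\<And>i. i \<in> set is \<Longrightarrow> f i \<in> carrier D"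
  shows "frag_of (lsum D (map f is), x) \<doteq> sum_list (map (\<lambda>i. frag_of (f i, x)) is)"
  using assms(2)
proof (induction "is")
  case Nil then show ?case using tens_zero_left[OF assms(1)] by simp
next
  case (Cons i "is")
  have "lsum D (map f is) \<in> carrier D" using Cons.prems by (intro lsum_closed) auto
  then have "frag_of (lsum D (map f (i # is)), x) \<doteq> frag_of (f i, x) + frag_of (lsum D (map f is), x)"
    using tens_add_left[of "f i"] assms(1) Cons.prems by simp
  also have "\<dots> \<doteq> frag_of (f i, x) + sum_list (map (\<lambda>i. frag_of (f i, x)) is)"
    using Cons by (intro eqv_add) auto
  finally show ?case by simp
qed

lemma frags_zero [simp]: "0 \<in> frags" by (simp add: frags_def)
lemma frags_of [simp]: "frag_of (d, x) \<in> frags \<longleftrightarrow> d \<in> carrier D \<and> x \<in> carrier M"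
  by (auto simp: frags_def keys_frag_of)
lemma frags_diff: "v \<in> frags \<Longrightarrow> w \<in> frags \<Longrightarrow> v - w \<in> frags"
  unfolding frags_def using keys_diff[of v w] by blast
lemma frags_add: "v \<in> frags \<Longrightarrow> w \<in> frags \<Longrightarrow> v + w \<in> frags"
  unfolding frags_def using Poly_Mapping.keys_add[of v w] by blast
lemma frags_minus: "v \<in> frags \<Longrightarrow> - v \<in> frags"
  using frags_diff[of 0 v] by simp
lemma frags_sum_list: "(\<And>i. i \<in> set is \<Longrightarrow> f i \<in> frags) \<Longrightarrow> sum_list (map f is) \<in> frags"
  by (induction "is") (auto intro: frags_add)

lemma rels_frags: "w \<in> rels \<Longrightarrow> w \<in> frags"
  unfolding rels_def tensor_rels_def
proof (induction rule: group_closure.induct)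
  case (base s)
  then show ?case by (auto intro!: frags_diff)
qed (rule frags_diff)

lemma frags_induct [consumes 1, case_names zero tens diff]:
  assumes "w \<in> frags" "P 0" "\<And>d x. d \<in> carrier D \<Longrightarrow> x \<in> carrier M \<Longrightarrow> P (frag_of (d, x))"
    "\<And>v w. v \<in> frags \<Longrightarrow> w \<in> frags \<Longrightarrow> P v \<Longrightarrow> P w \<Longrightarrow> P (v - w)"
  shows "P w"
proof -
  have "Poly_Mapping.keys w \<subseteq> carrier D \<times> carrier M" using assms(1) by (simp add: frags_def)
  then have "w \<in> frags \<and> P w"
    by (induction w rule: frag_induction) (use assms(2-4) frags_diff in auto)
  then show ?thesis by simp
qed

text \<open>An additive map sends relations to relations as soon as it does so for the three kinds of defining
  relations.\<close>

lemma rels_image: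
  assumes add: "\<And>v w. F (v - w) = F v - F w" and R: "0 \<in> R" "\<And>v w. v \<in> R \<Longrightarrow> w \<in> R \<Longrightarrow> v - w \<in> R"
    and "\<And>d d' x. d \<in> carrier D \<Longrightarrow> d' \<in> carrier D \<Longrightarrow> x \<in> carrier M \<Longrightarrow>
      F (frag_of (d \<oplus> d', x)) - F (frag_of (d, x)) - F (frag_of (d', x)) \<in> R"
    and "\<And>d x x'. d \<in> carrier D \<Longrightarrow> x \<in> carrier M \<Longrightarrow> x' \<in> carrier M \<Longrightarrow>
      F (frag_of (d, x \<oplus>\<^bsub>M\<^esub> x')) - F (frag_of (d, x)) - F (frag_of (d, x')) \<in> R"
    and "\<And>d y x. d \<in> carrier D \<Longrightarrow> y \<in> B \<Longrightarrow> x \<in> carrier M \<Longrightarrow>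
      F (frag_of (d \<otimes> y, x)) - F (frag_of (d, y \<odot>\<^bsub>M\<^esub> x)) \<in> R"
  shows "w \<in> rels \<Longrightarrow> F w \<in> (R :: 'z::ab_group_add set)"
  unfolding rels_def tensor_rels_def
proof (induction rule: group_closure.induct)
  case (base s)
  have "F 0 = 0" using add[of 0 0] by simp
  then show ?case using base assms by auto
next
  case (diff s t)
  then show ?case using add R by simp
qed

subsection \<open>The universal property\<close>

text \<open>The universal property of the tensor product. It is stated for the free group, since the target
  is a group with an explicit carrier, so that additivity can only be claimed on \<open>frags\<close>.\<close>

lemma lift:
  assumes P: "abelian_group P" and closed: "\<And>d x. d \<in> carrier D \<Longrightarrow> x \<in> carrier M \<Longrightarrow> g d x \<in> carrier P"
    and add_left: "\<And>d d' x. d \<in> carrier D \<Longrightarrow> d' \<in> carrier D \<Longrightarrow> x \<in> carrier M \<Longrightarrow> g (d \<oplus> d') x = g d x \<oplus>\<^bsub>P\<^esub> g d' x"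
    and add_right: "\<And>d x x'. d \<in> carrier D \<Longrightarrow> x \<in> carrier M \<Longrightarrow> x' \<in> carrier M \<Longrightarrow> g d (x \<oplus>\<^bsub>M\<^esub> x') = g d x \<oplus>\<^bsub>P\<^esub> g d x'"
    and balanced: "\<And>d y x. d \<in> carrier D \<Longrightarrow> y \<in> B \<Longrightarrow> x \<in> carrier M \<Longrightarrow> g (d \<otimes> y) x = g d (y \<odot>\<^bsub>M\<^esub> x)"
  shows "\<exists>H. (\<forall>w\<in>frags. H w \<in> carrier P) \<and> (\<forall>v\<in>frags. \<forall>w\<in>frags. H (v - w) = H v \<ominus>\<^bsub>P\<^esub> H w) \<and>
    (\<forall>d\<in>carrier D. \<forall>x\<in>carrier M. H (frag_of (d, x)) = g d x) \<and> (\<forall>w\<in>rels. H w = \<zero>\<^bsub>P\<^esub>)"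
proof -
  interpret P: abelian_group P by fact
  let ?S = "carrier D \<times> carrier M"
  have G: "carrier (free_Abelian_group ?S) = frags" by (simp add: free_Abelian_group_def frags_def)
  have "(\<lambda>(d, x). g d x) ` ?S \<subseteq> carrier (add_monoid P)" using closed by auto
  then obtain H where H: "H \<in> hom (free_Abelian_group ?S) (add_monoid P)"
    and Hof: "\<And>z. z \<in> ?S \<Longrightarrow> H (frag_of z) = (\<lambda>(d, x). g d x) z"
    using comm_group.free_Abelian_group_universal[OF P.a_comm_group, of "\<lambda>(d, x). g d x" ?S] by metis
  have Hc: "H w \<in> carrier P" if "w \<in> frags" for w
    using H that unfolding hom_def G by auto
  have Ha: "H (v + w) = H v \<oplus>\<^bsub>P\<^esub> H w" if "v \<in> frags" "w \<in> frags" for v w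
    using H that unfolding hom_def G by (simp add: free_Abelian_group_def)
  have Hd: "H (v - w) = H v \<ominus>\<^bsub>P\<^esub> H w" if "v \<in> frags" "w \<in> frags" for v w
  proof -
    have "H v = H (v - w) \<oplus>\<^bsub>P\<^esub> H w" using Ha[of "v - w" w] that frags_diff by simp
    then show ?thesis using Hc that frags_diff[OF that] by (simp add: P.minus_eq P.a_assoc P.r_neg)
  qed
  have H0: "H 0 = \<zero>\<^bsub>P\<^esub>" using Hd[of 0 0] Hc[of 0] by (simp add: P.minus_eq P.r_neg)
  have z: "(a \<oplus>\<^bsub>P\<^esub> c) \<ominus>\<^bsub>P\<^esub> a \<ominus>\<^bsub>P\<^esub> c = \<zero>\<^bsub>P\<^esub>" if "a \<in> carrier P" "c \<in> carrier P" for a c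
  proof -
    have "(a \<oplus>\<^bsub>P\<^esub> c) \<ominus>\<^bsub>P\<^esub> a = c"
      using that by (simp add: P.minus_eq P.a_comm[of a c] P.a_assoc P.r_neg)
    then show ?thesis using that by (simp add: P.minus_eq P.r_neg)
  qed
  have HR: "H w = \<zero>\<^bsub>P\<^esub>" if "w \<in> rels" for w
    using that unfolding rels_def tensor_rels_def
  proof (induction rule: group_closure.induct)
    case (base s)
    then show ?case
    proof (elim insertE UnE CollectE exE conjE)
      assume "s = 0" then show ?thesis by (simp add: H0)
    next
      fix d d' x assume "s = frag_of (d \<oplus> d', x) - frag_of (d, x) - frag_of (d', x)"
        "d \<in> carrier D" "d' \<in> carrier D" "x \<in> carrier M"
      then show ?thesis using add_left z closed by (simp add: Hd frags_diff Hof)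
    next
      fix d x x' assume "s = frag_of (d, x \<oplus>\<^bsub>M\<^esub> x') - frag_of (d, x) - frag_of (d, x')"
        "d \<in> carrier D" "x \<in> carrier M" "x' \<in> carrier M"
      then show ?thesis using add_right z closed by (simp add: Hd frags_diff Hof)
    next
      fix d y x assume "s = frag_of (d \<otimes> y, x) - frag_of (d, y \<odot>\<^bsub>M\<^esub> x)"
        "d \<in> carrier D" "y \<in> B" "x \<in> carrier M"
      then show ?thesis using balanced closed by (simp add: Hd frags_diff Hof P.minus_eq P.r_neg)
    qed
  next
    case (diff s t)
    then have "s \<in> frags" "t \<in> frags"
      using rels_frags unfolding rels_def tensor_rels_def by blast+
    then show ?case using diff Hd by (simp add: P.minus_eq P.r_neg)
  qed
  show ?thesis by (rule exI[of _ H]) (use Hc Hd Hof HR in auto)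
qed

text \<open>The \<open>i\<close>-th coordinate \<open>d \<otimes> x \<mapsto> b\<^sub>i(d) x\<close> with values in \<open>M\<close>, as a function on the free group.\<close>

definition is_coord where
  "is_coord i H \<longleftrightarrow> (\<forall>w\<in>frags. H w \<in> carrier M) \<and> (\<forall>v\<in>frags. \<forall>w\<in>frags. H (v - w) = H v \<ominus>\<^bsub>M\<^esub> H w) \<and>
    (\<forall>d\<in>carrier D. \<forall>x\<in>carrier M. H (frag_of (d, x)) = b i d \<odot>\<^bsub>M\<^esub> x) \<and> (\<forall>w\<in>rels. H w = \<zero>\<^bsub>M\<^esub>)"

definition coord where "coord i = (SOME H. is_coord i H)"

lemma is_coord: "is_coord i (coord i)"
proof -
  have "\<exists>H. is_coord i H"
    unfolding is_coord_def
  proof (rule lift[of M "\<lambda>d x. b i d \<odot>\<^bsub>M\<^esub> x"])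
    show "b i (d \<oplus> d') \<odot>\<^bsub>M\<^esub> x = b i d \<odot>\<^bsub>M\<^esub> x \<oplus>\<^bsub>M\<^esub> b i d' \<odot>\<^bsub>M\<^esub> x"
      if "d \<in> carrier D" "d' \<in> carrier D" "x \<in> carrier M" for d d' x
      using that M.act_add_left[of "b i d" "b i d'" x] by (simp add: b_add)
    show "b i (d \<otimes> y) \<odot>\<^bsub>M\<^esub> x = b i d \<odot>\<^bsub>M\<^esub> (y \<odot>\<^bsub>M\<^esub> x)"
      if "d \<in> carrier D" "y \<in> B" "x \<in> carrier M" for d y x
      using that M.act_mult[of "b i d" y x] by (simp add: b_mult)
  qed (auto simp: M.act_add_right M.abelian_group_axioms)
  then show ?thesis unfolding coord_def by (rule someI_ex)
qed

lemma coord_closed [simp]: "w \<in> frags \<Longrightarrow> coord i w \<in> carrier M"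
  and coord_diff: "v \<in> frags \<Longrightarrow> w \<in> frags \<Longrightarrow> coord i (v - w) = coord i v \<ominus>\<^bsub>M\<^esub> coord i w"
  and coord_of: "d \<in> carrier D \<Longrightarrow> x \<in> carrier M \<Longrightarrow> coord i (frag_of (d, x)) = b i d \<odot>\<^bsub>M\<^esub> x"
  and coord_rels: "w \<in> rels \<Longrightarrow> coord i w = \<zero>\<^bsub>M\<^esub>"
  using is_coord[of i] unfolding is_coord_def by auto

lemma coord_zero [simp]: "coord i 0 = \<zero>\<^bsub>M\<^esub>" by (simp add: coord_rels)

text \<open>The dual basis turns the coordinates into an isomorphism of \<open>D \<otimes>\<^sub>B M\<close> onto a direct summand of a
  direct sum of copies of \<open>M\<close>; this is its injectivity together with a formula for the inverse.\<close>

lemma coord_expansion: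
  assumes w: "w \<in> frags"
  shows "\<exists>is. w \<doteq> sum_list (map (\<lambda>i. frag_of (u i, coord i w)) is)"
proof -
  have K: "Poly_Mapping.keys w \<subseteq> carrier D \<times> carrier M" using w by (simp add: frags_def)
  then have "finite (fst ` Poly_Mapping.keys w)" "fst ` Poly_Mapping.keys w \<subseteq> carrier D" by auto
  then obtain "is" where "is": "\<And>d. d \<in> fst ` Poly_Mapping.keys w \<Longrightarrow> d = lsum D (map (\<lambda>i. u i \<otimes> b i d) is)"
    using dual_expansion by metis
  let ?E = "\<lambda>v. sum_list (map (\<lambda>i. frag_of (u i, coord i v)) is)"
  have "v \<in> frags \<and> v \<doteq> ?E v" if "Poly_Mapping.keys v \<subseteq> Poly_Mapping.keys w" for v
    using that
  proof (induction v rule: frag_induction)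
    case zero
    have "sum_list (map (\<lambda>i. frag_of (u i, \<zero>\<^bsub>M\<^esub>)) is) \<doteq> sum_list (map (\<lambda>i. 0) is)"
      by (intro eqv_sum_list tens_zero_right) simp
    then show ?case by (simp add: eqv_sym)
  next
    case (one z)
    obtain d x where z: "z = (d, x)" by force
    have dx: "d \<in> carrier D" "x \<in> carrier M" using K one z by auto
    have "d \<in> fst ` Poly_Mapping.keys w" using one z by force
    then have "frag_of (d, x) = frag_of (lsum D (map (\<lambda>i. u i \<otimes> b i d) is), x)" using "is" by metis
    also have "\<dots> \<doteq> sum_list (map (\<lambda>i. frag_of (u i \<otimes> b i d, x)) is)"
      using dx by (intro tens_lsum) auto
    also have "\<dots> \<doteq> ?E (frag_of (d, x))"
      using dx by (intro eqv_sum_list) (auto simp: coord_of intro: tens_balanced)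
    finally show ?case using z dx by simp
  next
    case (diff v v')
    have "v - v' \<doteq> ?E v - ?E v'" using diff by (intro eqv_diff) auto
    also have "?E v - ?E v' = sum_list (map (\<lambda>i. frag_of (u i, coord i v) - frag_of (u i, coord i v')) is)"
      by (simp add: sum_list_subtractf)
    also have "\<dots> \<doteq> ?E (v - v')"
      using diff by (intro eqv_sum_list) (auto simp: coord_diff intro: eqv_sym[OF tens_diff_right])
    finally show ?case using diff frags_diff by blast
  qed
  then show ?thesis by blast
qed

text \<open>In the expansion all coefficients vanish.\<close>

lemma coord_injective:
  assumes w: "w \<in> frags" "\<And>i. coord i w = \<zero>\<^bsub>M\<^esub>" shows "w \<in> rels"
proof -
  obtain "is" where "w \<doteq> sum_list (map (\<lambda>i. frag_of (u i, coord i w)) is)"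
    using coord_expansion[OF w(1)] by blast
  also have "\<dots> \<doteq> sum_list (map (\<lambda>i. 0) is)"
    unfolding w(2) by (intro eqv_sum_list tens_zero_right) simp
  finally show ?thesis by (simp add: eqv_zero)
qed

subsection \<open>The induced module\<close>

abbreviation "Ind \<equiv> induced_module D B M"

lemma cls_eq_iff: "cls v = cls w \<longleftrightarrow> v \<doteq> w"
proof
  assume "cls v = cls w"
  moreover have "v + 0 \<in> cls v" unfolding cls_def by (rule set_plus_intro2) simp
  ultimately have "v \<in> w +o rels" by (simp add: cls_def)
  then show "v \<doteq> w" unfolding eqv_def by (rule set_plus_imp_minus)
next
  have *: "cls v \<subseteq> cls w" if "v \<doteq> w" for v w
  proof
    fix z assume "z \<in> cls v"
    then have "z - v \<in> rels" unfolding cls_def by (rule set_plus_imp_minus)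
    then have "(z - v) + (v - w) \<in> rels" using rels_add that unfolding eqv_def by blast
    moreover have "(z - v) + (v - w) = z - w" by simp
    ultimately show "z \<in> cls w" unfolding cls_def by (metis set_minus_imp_plus)
  qed
  assume "v \<doteq> w"
  then show "cls v = cls w" using * eqv_sym by blast
qed

lemma cls_add: "cls v + cls w = cls (v + w)"
proof -
  have "rels + rels = rels"
  proof
    show "rels + rels \<subseteq> rels" using rels_add by (auto elim: set_plus_elim)
    show "rels \<subseteq> rels + rels" by (rule set_zero_plus2) simp
  qed
  then show ?thesis by (simp add: cls_def set_plus_rearrange)
qed

lemma cls_zero: "cls 0 = rels" by (simp add: cls_def)

lemma cls_eq_zero_iff: "cls w = rels \<longleftrightarrow> w \<in> rels"
  using cls_eq_iff[of w 0] by (simp add: cls_zero eqv_zero)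

lemma Ind_simps [simp]: "\<zero>\<^bsub>Ind\<^esub> = rels" "X \<oplus>\<^bsub>Ind\<^esub> Y = X + Y"
  by (simp_all add: induced_module_def rels_def)

lemma Ind_carrier: "carrier Ind = cls ` frags"
  by (auto simp: induced_module_def rels_def cls_def frags_def)

definition lact where "lact d = frag_extend (\<lambda>(d', x :: 'm). frag_of (d \<otimes> d', x))"

lemma lact_simps [simp]: "lact d 0 = 0" "lact d (frag_of (d', x)) = frag_of (d \<otimes> d', x)"
  "lact d (v - w) = lact d v - lact d w" "lact d (v + w) = lact d v + lact d w"
  by (simp_all add: lact_def frag_extend_diff frag_extend_add)

lemma lact_frags: "w \<in> frags \<Longrightarrow> d \<in> carrier D \<Longrightarrow> lact d w \<in> frags"
  by (induction w rule: frags_induct) (auto intro: frags_diff)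

lemma lact_rels: assumes d: "d \<in> carrier D" shows "w \<in> rels \<Longrightarrow> lact d w \<in> rels"
proof (rule rels_image[of "lact d" rels])
  show "lact d (frag_of (d' \<oplus> d'', x)) - lact d (frag_of (d', x)) - lact d (frag_of (d'', x)) \<in> rels"
    if "d' \<in> carrier D" "d'' \<in> carrier D" "x \<in> carrier M" for d' d'' x
    using tens_add_left[of "d \<otimes> d'" "d \<otimes> d''" x] that d by (simp add: eqv_def r_distr algebra_simps)
  show "lact d (frag_of (d', x \<oplus>\<^bsub>M\<^esub> x')) - lact d (frag_of (d', x)) - lact d (frag_of (d', x')) \<in> rels"
    if "d' \<in> carrier D" "x \<in> carrier M" "x' \<in> carrier M" for d' x x'
    using tens_add_right[of "d \<otimes> d'" x x'] that d by (simp add: eqv_def algebra_simps)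
  show "lact d (frag_of (d' \<otimes> y, x)) - lact d (frag_of (d', y \<odot>\<^bsub>M\<^esub> x)) \<in> rels"
    if "d' \<in> carrier D" "y \<in> B" "x \<in> carrier M" for d' y x
    using tens_balanced[of "d \<otimes> d'" y x] that d by (simp add: eqv_def m_assoc)
qed (auto intro: rels_diff)

lemma Ind_act: assumes "d \<in> carrier D" shows "d \<odot>\<^bsub>Ind\<^esub> cls w = cls (lact d w)"
proof -
  have "d \<odot>\<^bsub>Ind\<^esub> cls w = lact d ` (w +o rels) + rels"
    by (simp add: induced_module_def cls_def lact_def rels_def)
  also have "\<dots> = cls (lact d w)"
    unfolding cls_def
    by (rule additive_image_coset) (use lact_rels[OF assms] rels_add in auto)
  finally show ?thesis .
qed

lemma Ind_unital: "unital_module D Ind"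
proof -
  interpret A: abelian_group Ind
  proof (rule abelian_groupI)
    show "\<exists>Y\<in>carrier Ind. Y \<oplus>\<^bsub>Ind\<^esub> X = \<zero>\<^bsub>Ind\<^esub>" if X: "X \<in> carrier Ind" for X
    proof -
      obtain w where w: "w \<in> frags" "X = cls w" using X by (auto simp: Ind_carrier)
      then have "cls (- w) \<oplus>\<^bsub>Ind\<^esub> X = \<zero>\<^bsub>Ind\<^esub>" by (simp add: cls_add cls_zero)
      moreover have "cls (- w) \<in> carrier Ind" using w frags_minus by (simp add: Ind_carrier)
      ultimately show ?thesis by blast
    qed
    show "\<zero>\<^bsub>Ind\<^esub> \<in> carrier Ind" by (auto simp: Ind_carrier cls_zero[symmetric])
    show "\<And>X. X \<in> carrier Ind \<Longrightarrow> \<zero>\<^bsub>Ind\<^esub> \<oplus>\<^bsub>Ind\<^esub> X = X"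
      by (auto simp: Ind_carrier cls_zero[symmetric] cls_add)
    show "\<And>X Y. X \<in> carrier Ind \<Longrightarrow> Y \<in> carrier Ind \<Longrightarrow> X \<oplus>\<^bsub>Ind\<^esub> Y \<in> carrier Ind"
      by (auto simp: Ind_carrier cls_add intro: frags_add)
  qed (simp_all add: ac_simps)
  have add_left: "lact (c \<oplus> d) w \<doteq> lact c w + lact d w" if "w \<in> frags" "c \<in> carrier D" "d \<in> carrier D" for c d w
    using that
  proof (induction w rule: frags_induct)
    case (tens d' x)
    then show ?case using tens_add_left[of "c \<otimes> d'" "d \<otimes> d'" x] by (simp add: l_distr)
  next
    case (diff v w)
    then have "lact (c \<oplus> d) (v - w) \<doteq> (lact c v + lact d v) - (lact c w + lact d w)"
      by (auto intro: eqv_diff)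
    then show ?case by (simp add: algebra_simps)
  qed simp
  have mult: "lact (c \<otimes> d) w = lact c (lact d w)" if "w \<in> frags" "c \<in> carrier D" "d \<in> carrier D" for c d w
    using that by (induction w rule: frags_induct) (auto simp: m_assoc)
  show ?thesis
  proof unfold_locales
    fix X assume "X \<in> carrier Ind"
    then obtain w where w: "w \<in> frags" "X = cls w" by (auto simp: Ind_carrier)
    then have K: "Poly_Mapping.keys w \<subseteq> carrier D \<times> carrier M" by (simp add: frags_def)
    then have "finite (fst ` Poly_Mapping.keys w)" "fst ` Poly_Mapping.keys w \<subseteq> carrier D" by auto
    then obtain ns where ns: "set ns \<subseteq> \<Lambda>" "\<forall>x\<in>fst ` Poly_Mapping.keys w. unit_of ns \<otimes> x = x"
      using common_unit by metis
    have "lact (unit_of ns) v = v" if "Poly_Mapping.keys v \<subseteq> Poly_Mapping.keys w" for v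
      using that
      by (induction v rule: frag_induction) (use ns(2) in force)+
    then show "\<exists>a\<in>carrier D. a \<odot>\<^bsub>Ind\<^esub> X = X"
      using ns(1) w by (intro bexI[of _ "unit_of ns"]) (auto simp: Ind_act)
  next
    fix c d X assume cd: "c \<in> carrier D" "d \<in> carrier D" and "X \<in> carrier Ind"
    then obtain w where w: "w \<in> frags" "X = cls w" by (auto simp: Ind_carrier)
    show "(c \<oplus> d) \<odot>\<^bsub>Ind\<^esub> X = c \<odot>\<^bsub>Ind\<^esub> X \<oplus>\<^bsub>Ind\<^esub> d \<odot>\<^bsub>Ind\<^esub> X"
      using w cd add_left by (simp add: Ind_act cls_add cls_eq_iff)
    show "(c \<otimes> d) \<odot>\<^bsub>Ind\<^esub> X = c \<odot>\<^bsub>Ind\<^esub> (d \<odot>\<^bsub>Ind\<^esub> X)"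
      using w cd mult by (simp add: Ind_act)
  qed (auto simp: Ind_carrier Ind_act lact_frags cls_add)
qed

end

locale tensor_hom = M: tensor D \<Lambda> \<epsilon> \<chi> B u b M + M': tensor D \<Lambda> \<epsilon> \<chi> B u b M'
  for D :: "('k::field, 'd) module" (structure) and \<Lambda> :: "'l set" and \<epsilon> :: "'l \<Rightarrow> 'd" and \<chi> :: "'l \<Rightarrow> 'd \<Rightarrow> 'k"
    and B :: "'d set" and u :: "'i \<Rightarrow> 'd" and b :: "'i \<Rightarrow> 'd \<Rightarrow> 'd"
    and M :: "('d, 'm) module" and M' :: "('d, 'n) module" +
  fixes f :: "'m \<Rightarrow> 'n"
  assumes f: "f \<in> module_homs (D\<lparr>carrier := B\<rparr>) M M'"
begin

definition ext where "ext = frag_extend (\<lambda>(d :: 'd, x). frag_of (d, f x))"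

lemma ext_simps [simp]: "ext 0 = 0" "ext (frag_of (d, x)) = frag_of (d, f x)"
  "ext (v - w) = ext v - ext w" "ext (v + w) = ext v + ext w"
  by (simp_all add: ext_def frag_extend_diff frag_extend_add)

lemma ext_sum_list: "ext (sum_list (map h is)) = sum_list (map (\<lambda>i. ext (h i)) is)"
  by (induction "is") auto

lemma f_simps: "x \<in> carrier M \<Longrightarrow> f x \<in> carrier M'"
  "x \<in> carrier M \<Longrightarrow> y \<in> carrier M \<Longrightarrow> f (x \<oplus>\<^bsub>M\<^esub> y) = f x \<oplus>\<^bsub>M'\<^esub> f y"
  "a \<in> B \<Longrightarrow> x \<in> carrier M \<Longrightarrow> f (a \<odot>\<^bsub>M\<^esub> x) = a \<odot>\<^bsub>M'\<^esub> f x"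
  using module_homsD[OF f] by auto

lemma ext_frags: "w \<in> M.frags \<Longrightarrow> ext w \<in> M'.frags"
  by (induction w rule: M.frags_induct) (auto intro: M'.frags_diff f_simps)

lemma ext_rels: "w \<in> M.rels \<Longrightarrow> ext w \<in> M'.rels"
proof (rule M.rels_image[of ext M'.rels])
  show "ext (frag_of (d \<oplus> d', x)) - ext (frag_of (d, x)) - ext (frag_of (d', x)) \<in> M'.rels"
    if "d \<in> carrier D" "d' \<in> carrier D" "x \<in> carrier M" for d d' x
    using M'.tens_add_left[of d d' "f x"] that f_simps by (simp add: M'.eqv_def algebra_simps)
  show "ext (frag_of (d, x \<oplus>\<^bsub>M\<^esub> x')) - ext (frag_of (d, x)) - ext (frag_of (d, x')) \<in> M'.rels"
    if "d \<in> carrier D" "x \<in> carrier M" "x' \<in> carrier M" for d x x'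
    using M'.tens_add_right[of d "f x" "f x'"] that f_simps by (simp add: M'.eqv_def algebra_simps)
  show "ext (frag_of (d \<otimes> y, x)) - ext (frag_of (d, y \<odot>\<^bsub>M\<^esub> x)) \<in> M'.rels"
    if "d \<in> carrier D" "y \<in> B" "x \<in> carrier M" for d y x
    using M'.tens_balanced[of d y "f x"] that f_simps by (simp add: M'.eqv_def)
qed (auto intro: M'.rels_diff)

lemma ext_lact: "w \<in> M.frags \<Longrightarrow> ext (M.lact d w) = M'.lact d (ext w)"
  by (induction w rule: M.frags_induct) auto

lemma induced_hom_cls: "induced_hom D B M' f (M.cls w) = M'.cls (ext w)"
proof -
  have "induced_hom D B M' f (M.cls w) = ext ` (w +o M.rels) + M'.rels"
    by (simp add: induced_hom_def M.cls_def ext_def M'.rels_def)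
  also have "\<dots> = M'.cls (ext w)"
    unfolding M'.cls_def by (rule additive_image_coset) (use ext_rels M'.rels_add in auto)
  finally show ?thesis .
qed

lemma induced_hom: "induced_hom D B M' f \<in> module_homs D M.Ind M'.Ind"
  unfolding module_homs_def
  by (auto simp: M.Ind_carrier M'.Ind_carrier induced_hom_cls ext_frags M.cls_add M'.cls_add M.Ind_act M'.Ind_act
      M.lact_frags ext_lact)

lemma coord_ext: assumes "w \<in> M.frags" shows "M'.coord i (ext w) = f (M.coord i w)"
  using assms
proof (induction w rule: M.frags_induct)
  case zero
  then show ?case using module_hom_zero[OF f M.M.unital_module_axioms M'.M.unital_module_axioms] by simp
next
  case (tens d x)
  then show ?case using f_simps by (simp add: M.coord_of M'.coord_of)
next
  case (diff v w)
  then show ?case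
    using module_hom_minus[OF f M.M.unital_module_axioms M'.M.unital_module_axioms]
    by (simp add: M.coord_diff M'.coord_diff ext_frags)
qed

end

context dual_basis
begin

text \<open>Coordinates commute with induced maps. So injectivity is checked on coordinates, and a class in the
  kernel of the second map has coordinates in the image of \<open>M\<close>, from which the expansion builds a
  preimage. Surjectivity is lifted tensor by tensor.\<close>

theorem induction_exact: "induction_exact T D B"
  unfolding induction_exact_def
proof (intro allI impI)
  fix M :: "('d, 'm) module" and f and M' :: "('d, 'm) module" and g and M'' :: "('d, 'm) module"
  interpret BA: split_algebra BA \<Lambda> \<epsilon> \<chi> by (rule split_B)
  assume ex: "short_exact BA M f M' g M''"
  then have um: "unital_module BA M" "unital_module BA M'" "unital_module BA M''"
    and f: "f \<in> module_homs BA M M'" and g: "g \<in> module_homs BA M' M''" and inj: "inj_on f (carrier M)"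
    and mid: "f ` carrier M = {x \<in> carrier M'. g x = \<zero>\<^bsub>M''\<^esub>}" and surj: "g ` carrier M' = carrier M''"
    by (auto simp: short_exact_def BA.unital_moduleI)
  interpret M: unital_module BA M by fact
  interpret M': unital_module BA M' by fact
  interpret M'': unital_module BA M'' by fact
  interpret F: tensor_hom D \<Lambda> \<epsilon> \<chi> B u b M M' f by unfold_locales fact
  interpret G: tensor_hom D \<Lambda> \<epsilon> \<chi> B u b M' M'' g by unfold_locales fact
  let ?F = "induced_hom D B M' f" and ?G = "induced_hom D B M'' g"
  have inj': "inj_on ?F (carrier F.M.Ind)"
  proof (rule inj_onI)
    fix X Y assume "X \<in> carrier F.M.Ind" "Y \<in> carrier F.M.Ind" and eq: "?F X = ?F Y"
    then obtain v w where v: "v \<in> F.M.frags" "X = F.M.cls v" and w: "w \<in> F.M.frags" "Y = F.M.cls w"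
      by (auto simp: F.M.Ind_carrier)
    have vw: "v - w \<in> F.M.frags" using v w F.M.frags_diff by blast
    have "F.ext (v - w) \<in> F.M'.rels"
      using eq v w by (simp add: F.induced_hom_cls F.M'.cls_eq_iff F.M'.eqv_def)
    then have "f (F.M.coord i (v - w)) = f \<zero>\<^bsub>M\<^esub>" for i
      using F.coord_ext[OF vw, of i] F.M'.coord_rels module_hom_zero[OF f um(1,2)] by simp
    then have "F.M.coord i (v - w) = \<zero>\<^bsub>M\<^esub>" for i
      using inj F.M.coord_closed[OF vw] M.zero_closed by (meson inj_onD)
    then have "v - w \<in> F.M.rels" by (rule F.M.coord_injective[OF vw])
    then show "X = Y" using v w by (simp add: F.M.cls_eq_iff F.M.eqv_def)
  qed
  have sub: "?G (?F X) = \<zero>\<^bsub>G.M'.Ind\<^esub>" if "X \<in> carrier F.M.Ind" for X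
  proof -
    obtain w where w: "w \<in> F.M.frags" "X = F.M.cls w" using \<open>X \<in> _\<close> by (auto simp: F.M.Ind_carrier)
    have "G.ext (F.ext w) \<in> G.M'.rels"
      using w(1)
    proof (induction w rule: F.M.frags_induct)
      case (tens d x)
      then have "g (f x) = \<zero>\<^bsub>M''\<^esub>" using mid by blast
      then show ?case using G.M'.tens_zero_right[OF tens(1)] by (simp add: G.M'.eqv_zero)
    qed (auto intro: G.M'.rels_diff)
    then show ?thesis using w(2) by (simp add: F.induced_hom_cls G.induced_hom_cls G.M'.cls_eq_zero_iff)
  qed
  have ker: "X \<in> ?F ` carrier F.M.Ind" if X: "X \<in> carrier F.M'.Ind" "?G X = \<zero>\<^bsub>G.M'.Ind\<^esub>" for X
  proof -
    obtain w where w: "w \<in> F.M'.frags" "X = F.M'.cls w" using X(1) by (auto simp: F.M'.Ind_carrier)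
    have "G.ext w \<in> G.M'.rels" using X(2) w(2) by (simp add: G.induced_hom_cls G.M'.cls_eq_zero_iff)
    then have "g (F.M'.coord i w) = \<zero>\<^bsub>M''\<^esub>" for i
      using G.coord_ext[OF w(1), of i] G.M'.coord_rels by simp
    then have "F.M'.coord i w \<in> f ` carrier M" for i
      unfolding mid using F.M'.coord_closed[OF w(1)] by blast
    then have "\<forall>i. \<exists>m\<in>carrier M. F.M'.coord i w = f m" by blast
    then obtain m where m: "\<And>i. m i \<in> carrier M" "\<And>i. F.M'.coord i w = f (m i)" by metis
    obtain "is" where "is": "F.M'.eqv w (sum_list (map (\<lambda>i. frag_of (u i, F.M'.coord i w)) is))"
      using F.M'.coord_expansion[OF w(1)] by blast
    let ?v = "sum_list (map (\<lambda>i. frag_of (u i, m i)) is)"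
    have "?v \<in> F.M.frags" using m(1) by (intro F.M.frags_sum_list) auto
    moreover have "X = ?F (F.M.cls ?v)"
      using "is" w(2) m(2) by (simp add: F.induced_hom_cls F.M'.cls_eq_iff F.ext_sum_list)
    ultimately show ?thesis by (auto simp: F.M.Ind_carrier)
  qed
  have surj': "X \<in> ?G ` carrier F.M'.Ind" if X: "X \<in> carrier G.M'.Ind" for X
  proof -
    obtain w where w: "w \<in> G.M'.frags" "X = G.M'.cls w" using X by (auto simp: G.M'.Ind_carrier)
    have "\<exists>v\<in>F.M'.frags. G.ext v = w"
      using w(1)
    proof (induction w rule: G.M'.frags_induct)
      case zero then show ?case by (intro bexI[of _ 0]) auto
    next
      case (tens d x)
      then obtain y where "y \<in> carrier M'" "x = g y" using surj by blast
      then show ?case using tens by (intro bexI[of _ "frag_of (d, y)"]) auto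
    next
      case (diff v w)
      then obtain v' w' where "v' \<in> F.M'.frags" "G.ext v' = v" "w' \<in> F.M'.frags" "G.ext w' = w" by blast
      then show ?case by (intro bexI[of _ "v' - w'"]) (auto intro: F.M'.frags_diff)
    qed
    then show ?thesis using w(2) by (auto simp: F.M'.Ind_carrier G.induced_hom_cls image_iff)
  qed
  have im: "?F ` carrier F.M.Ind = {X \<in> carrier F.M'.Ind. ?G X = \<zero>\<^bsub>G.M'.Ind\<^esub>}"
    using sub ker module_homsD(1)[OF F.induced_hom] by blast
  have im': "?G ` carrier F.M'.Ind = carrier G.M'.Ind"
    using surj' module_homsD(1)[OF G.induced_hom] by blast
  show "short_exact D (induced_module D B M) ?F (induced_module D B M') ?G (induced_module D B M'')"
    unfolding short_exact_def
    using inj' im im' F.induced_hom G.induced_hom F.M.Ind_unital F.M'.Ind_unital G.M'.Ind_unital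
    by (simp add: unital_module_def)
qed

end

section \<open>Directed subalgebras and standard modules\<close>

lemma filtered_by_extend:
  assumes M: "unital_module E M" and W: "submodule W E M" and W': "submodule W' E M" "W \<subseteq> W'"
    and filt: "filtered_by E (M\<lparr>carrier := W\<rparr>) X \<Gamma>"
    and "\<mu> \<in> \<Gamma>" "module_iso E (quotient_module (M\<lparr>carrier := W'\<rparr>) W) (X \<mu>)"
  shows "filtered_by E (M\<lparr>carrier := W'\<rparr>) X \<Gamma>"
proof -
  interpret M: unital_module E M by fact
  interpret MW: unital_module E "M\<lparr>carrier := W\<rparr>" by (rule M.restrict_unital_module[OF W])
  obtain t U where U: "U 0 = {\<zero>\<^bsub>M\<^esub>}" "U t = W" "\<And>i. i \<le> t \<Longrightarrow> submodule (U i) E (M\<lparr>carrier := W\<rparr>)"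
    "\<And>i. i < t \<Longrightarrow> U i \<subseteq> U (Suc i) \<and> (\<exists>\<mu>\<in>\<Gamma>. module_iso E (quotient_module (M\<lparr>carrier := U (Suc i)\<rparr>) (U i)) (X \<mu>))"
    using filt unfolding filtered_by_def by auto
  let ?U = "U(Suc t := W')"
  have sub: "submodule (?U i) E (M\<lparr>carrier := W'\<rparr>)" if "i \<le> Suc t" for i
  proof (cases "i = Suc t")
    case True
    then show ?thesis using M.submodule_restrict[OF W'(1) order_refl] W' by simp
  next
    case False
    then have i: "submodule (U i) E (M\<lparr>carrier := W\<rparr>)" using U(3) that by simp
    then have "U i \<subseteq> W" using MW.submoduleD(1) by simp
    then show ?thesis
      using i False M.submodule_restrict[OF W, of "U i"] M.submodule_restrict[OF W'(1), of "U i"] W'(2) by auto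
  qed
  have step: "?U i \<subseteq> ?U (Suc i) \<and>
      (\<exists>\<mu>\<in>\<Gamma>. module_iso E (quotient_module (M\<lparr>carrier := W'\<rparr>\<lparr>carrier := ?U (Suc i)\<rparr>) (?U i)) (X \<mu>))"
    if "i < Suc t" for i
  proof (cases "i = t")
    case True
    then show ?thesis using U(2) W' assms(6,7) by auto
  next
    case False
    then show ?thesis using U(4)[of i] that by simp
  qed
  show ?thesis
    unfolding filtered_by_def
    by (intro exI[of _ "Suc t"] exI[of _ ?U]) (use sub step U(1) in auto)
qed

lemma filtered_by_zero:
  assumes M: "unital_module E M" shows "filtered_by E (M\<lparr>carrier := {\<zero>\<^bsub>M\<^esub>}\<rparr>) X \<Gamma>"
proof -
  interpret M: unital_module E M by fact
  show ?thesis
    unfolding filtered_by_def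
    by (intro exI[of _ 0] exI[of _ "\<lambda>_. {\<zero>\<^bsub>M\<^esub>}"])
      (use M.submodule_zero M.submodule_restrict[OF M.submodule_zero order_refl] in auto)
qed

context split_algebra
begin

text \<open>Homomorphisms \<open>P(\<mu>) \<rightarrow> P(\<nu>)\<close> are right multiplications by elements of \<open>\<epsilon>\<^sub>\<mu> D \<epsilon>\<^sub>\<nu>\<close>.\<close>

lemma trace_generators:
  assumes \<nu>: "\<nu> \<in> \<Lambda>"
  shows "(\<Union>\<mu>\<in>{\<mu>\<in>\<Lambda>. gt \<mu> \<nu>}. \<Union>f\<in>module_homs D (proj_module D \<epsilon> \<mu>) (proj_module D \<epsilon> \<nu>).
      f ` carrier (proj_module D \<epsilon> \<mu>)) =
    {y \<otimes> w | y w. \<exists>\<mu>\<in>\<Lambda>. gt \<mu> \<nu> \<and> y \<in> carrier D \<and> y \<otimes> \<epsilon> \<mu> = y \<and> w \<in> carrier D \<and> \<epsilon> \<mu> \<otimes> w = w \<and> w \<otimes> \<epsilon> \<nu> = w}"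
    (is "?L = ?R")
proof
  show "?L \<subseteq> ?R"
  proof
    fix z assume "z \<in> ?L"
    then obtain \<mu> f y where \<mu>: "\<mu> \<in> \<Lambda>" "gt \<mu> \<nu>"
      and f: "f \<in> module_homs D (proj_module D \<epsilon> \<mu>) (proj_module D \<epsilon> \<nu>)"
      and y: "y \<in> carrier (proj_module D \<epsilon> \<mu>)" "z = f y" by blast
    note fD = module_homsD[OF f, simplified]
    have \<epsilon>: "\<epsilon> \<mu> \<in> carrier (proj_module D \<epsilon> \<mu>)" by (rule idem_in_proj) fact
    have y': "y \<in> carrier D" "y \<otimes> \<epsilon> \<mu> = y" using y \<mu> by (auto simp: proj_carrier)
    have "f (\<epsilon> \<mu>) \<in> carrier (proj_module D \<epsilon> \<nu>)" using fD(1)[OF \<epsilon>] .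
    then have w: "f (\<epsilon> \<mu>) \<in> carrier D" "f (\<epsilon> \<mu>) \<otimes> \<epsilon> \<nu> = f (\<epsilon> \<mu>)" using \<nu> by (auto simp: proj_carrier)
    have "\<epsilon> \<mu> \<otimes> f (\<epsilon> \<mu>) = f (\<epsilon> \<mu>)" using fD(3)[OF idem_closed[OF \<mu>(1)] \<epsilon>] \<mu> by (simp add: idem_orth)
    moreover have "z = y \<otimes> f (\<epsilon> \<mu>)" using fD(3)[OF y'(1) \<epsilon>] y' y(2) by simp
    ultimately show "z \<in> ?R" using \<mu> w y' by blast
  qed
  show "?R \<subseteq> ?L"
  proof
    fix z assume "z \<in> ?R"
    then obtain y w \<mu> where \<mu>: "\<mu> \<in> \<Lambda>" "gt \<mu> \<nu>" and y: "y \<in> carrier D" "y \<otimes> \<epsilon> \<mu> = y"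
      and w: "w \<in> carrier D" "\<epsilon> \<mu> \<otimes> w = w" "w \<otimes> \<epsilon> \<nu> = w" and z: "z = y \<otimes> w" by blast
    have "(\<lambda>y. y \<otimes> w) \<in> module_homs D (proj_module D \<epsilon> \<mu>) (proj_module D \<epsilon> \<nu>)"
      unfolding module_homs_def using \<mu> \<nu> w by (auto simp: proj_carrier m_assoc l_distr)
    moreover have "y \<in> carrier (proj_module D \<epsilon> \<mu>)" using y \<mu> by (simp add: proj_carrier)
    ultimately show "z \<in> ?L" using \<mu> z by blast
  qed
qed

lemma std_trace:
  assumes \<nu>: "\<nu> \<in> \<Lambda>"
  shows "submodule (std_trace D \<Lambda> \<epsilon> gt \<nu>) D (proj_module D \<epsilon> \<nu>)"
    and "\<And>y w \<mu>. \<mu> \<in> \<Lambda> \<Longrightarrow> gt \<mu> \<nu> \<Longrightarrow> y \<in> carrier D \<Longrightarrow> y \<otimes> \<epsilon> \<mu> = y \<Longrightarrow> w \<in> carrier D \<Longrightarrow>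
      \<epsilon> \<mu> \<otimes> w = w \<Longrightarrow> w \<otimes> \<epsilon> \<nu> = w \<Longrightarrow> y \<otimes> w \<in> std_trace D \<Lambda> \<epsilon> gt \<nu>"
    and "\<And>U. submodule U D (proj_module D \<epsilon> \<nu>) \<Longrightarrow>
      (\<And>y w \<mu>. \<mu> \<in> \<Lambda> \<Longrightarrow> gt \<mu> \<nu> \<Longrightarrow> y \<in> carrier D \<Longrightarrow> y \<otimes> \<epsilon> \<mu> = y \<Longrightarrow> w \<in> carrier D \<Longrightarrow>
      \<epsilon> \<mu> \<otimes> w = w \<Longrightarrow> w \<otimes> \<epsilon> \<nu> = w \<Longrightarrow> y \<otimes> w \<in> U) \<Longrightarrow> std_trace D \<Lambda> \<epsilon> gt \<nu> \<subseteq> U"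
proof -
  interpret P: unital_module D "proj_module D \<epsilon> \<nu>" by (rule proj_unital) fact
  let ?R = "{y \<otimes> w | y w. \<exists>\<mu>\<in>\<Lambda>. gt \<mu> \<nu> \<and> y \<in> carrier D \<and> y \<otimes> \<epsilon> \<mu> = y \<and> w \<in> carrier D \<and>
    \<epsilon> \<mu> \<otimes> w = w \<and> w \<otimes> \<epsilon> \<nu> = w}"
  have eq: "std_trace D \<Lambda> \<epsilon> gt \<nu> = generated_submodule D (proj_module D \<epsilon> \<nu>) ?R"
    unfolding std_trace_def trace_generators[OF \<nu>] ..
  have R: "?R \<subseteq> carrier (proj_module D \<epsilon> \<nu>)" using \<nu> by (auto simp: proj_carrier m_assoc)
  show "submodule (std_trace D \<Lambda> \<epsilon> gt \<nu>) D (proj_module D \<epsilon> \<nu>)"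
    unfolding eq by (rule P.generated_submodule(1)[OF R])
  show "\<And>y w \<mu>. \<mu> \<in> \<Lambda> \<Longrightarrow> gt \<mu> \<nu> \<Longrightarrow> y \<in> carrier D \<Longrightarrow> y \<otimes> \<epsilon> \<mu> = y \<Longrightarrow> w \<in> carrier D \<Longrightarrow>
      \<epsilon> \<mu> \<otimes> w = w \<Longrightarrow> w \<otimes> \<epsilon> \<nu> = w \<Longrightarrow> y \<otimes> w \<in> std_trace D \<Lambda> \<epsilon> gt \<nu>"
    unfolding eq using P.generated_submodule(2)[OF R] by blast
  show "std_trace D \<Lambda> \<epsilon> gt \<nu> \<subseteq> U" if U: "submodule U D (proj_module D \<epsilon> \<nu>)"
    and in_U: "\<And>y w \<mu>. \<mu> \<in> \<Lambda> \<Longrightarrow> gt \<mu> \<nu> \<Longrightarrow> y \<in> carrier D \<Longrightarrow> y \<otimes> \<epsilon> \<mu> = y \<Longrightarrow> w \<in> carrier D \<Longrightarrow>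
      \<epsilon> \<mu> \<otimes> w = w \<Longrightarrow> w \<otimes> \<epsilon> \<nu> = w \<Longrightarrow> y \<otimes> w \<in> U" for U
    unfolding eq by (rule P.generated_submodule(3)[OF R U]) (use in_U in blast)
qed

lemma submodule_lsum:
  assumes "\<nu> \<in> \<Lambda>" "submodule U D (proj_module D \<epsilon> \<nu>)" "\<And>i. i \<in> set is \<Longrightarrow> f i \<in> U"
  shows "lsum D (map f is) \<in> U"
proof -
  interpret P: unital_module D "proj_module D \<epsilon> \<nu>" by (rule proj_unital) fact
  note U = P.submoduleD[OF assms(2), simplified]
  show ?thesis using assms(3) by (induction "is") (auto intro: U)
qed

text \<open>By local units an element is the sum of its components \<open>\<epsilon>\<^sub>\<mu> a\<close>.\<close>

lemma eq_zero_if_components: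
  assumes a: "a \<in> carrier D" "\<And>\<mu>. \<mu> \<in> \<Lambda> \<Longrightarrow> \<epsilon> \<mu> \<otimes> a = \<zero>" shows "a = \<zero>"
proof -
  obtain ns where ns: "set ns \<subseteq> \<Lambda>" "lsum D (map (\<lambda>\<nu>. \<epsilon> \<nu> \<otimes> a) ns) = a" using local_unit[OF a(1)] by blast
  have "lsum D (map (\<lambda>\<nu>. \<epsilon> \<nu> \<otimes> a) ns) = \<zero>" using ns(1) by (induction ns) (auto simp: a(2))
  then show ?thesis using ns(2) by simp
qed

text \<open>The span of \<open>W\<close> and a list of vectors, built by one vector at a time so that each step of a
  filtration is at most one-dimensional.\<close>

fun adjoin :: "'d set \<Rightarrow> 'd list \<Rightarrow> 'd set" where
  "adjoin W [] = W"
| "adjoin W (x # xs) = {w \<oplus> c \<odot> x | w c. w \<in> adjoin W xs}"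

lemma adjoin_closed: "W \<subseteq> carrier D \<Longrightarrow> set xs \<subseteq> carrier D \<Longrightarrow> adjoin W xs \<subseteq> carrier D"
  by (induction xs) auto

lemma adjoin_add:
  assumes "v \<in> W" "W \<subseteq> carrier D" "set xs \<subseteq> carrier D" "z \<in> adjoin {\<zero>} xs"
  shows "v \<oplus> z \<in> adjoin W xs"
  using assms(3,4)
proof (induction xs arbitrary: z)
  case Nil then show ?case using assms(1,2) by auto
next
  case (Cons x xs)
  then obtain w c where w: "w \<in> adjoin {\<zero>} xs" "z = w \<oplus> c \<odot> x" by auto
  have "w \<in> carrier D" using w adjoin_closed[of "{\<zero>}" xs] Cons.prems by auto
  then have "v \<oplus> z = (v \<oplus> w) \<oplus> c \<odot> x" using w assms(1,2) Cons.prems by (auto simp: a_assoc)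
  then show ?case using Cons.IH[OF _ w(1)] Cons.prems by auto
qed

end

text \<open>The idempotents \<open>\<epsilon>\<close> lie in \<open>B\<close>, the idempotents \<open>e\<close> index the simple modules of \<open>D\<close>; they are linked only by
  having the same characters. The last assumption says that the coefficients of an element of \<open>\<epsilon>\<^sub>\<mu> D \<epsilon>\<^sub>\<nu>\<close>
  with \<open>\<mu> > \<nu>\<close> lie in the radical of \<open>B \<epsilon>\<^sub>\<nu>\<close>, so that such elements vanish in \<open>D \<otimes>\<^sub>B L(\<nu>)\<close>.\<close>

locale directed_dual_basis = dual_basis D \<Lambda> \<epsilon> \<chi> B u b + Es: split_algebra D \<Lambda> e \<chi>
  for D :: "('k::field, 'd) module" (structure) and \<Lambda> :: "'l set" and \<epsilon> :: "'l \<Rightarrow> 'd" and \<chi> :: "'l \<Rightarrow> 'd \<Rightarrow> 'k"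
    and B :: "'d set" and u :: "'i \<Rightarrow> 'd" and b :: "'i \<Rightarrow> 'd \<Rightarrow> 'd" and e :: "'l \<Rightarrow> 'd" +
  fixes gt :: "'l \<Rightarrow> 'l \<Rightarrow> bool"
  assumes gt_irrefl: "\<not> gt \<mu> \<mu>" and gt_trans: "gt \<kappa> \<mu> \<Longrightarrow> gt \<mu> \<nu> \<Longrightarrow> gt \<kappa> \<nu>"
    and B_local: "\<nu> \<in> \<Lambda> \<Longrightarrow> y \<in> B \<Longrightarrow> \<epsilon> \<nu> \<otimes> y = y \<Longrightarrow> y \<otimes> \<epsilon> \<nu> = y \<Longrightarrow> y = \<chi> \<nu> y \<odot> \<epsilon> \<nu>"
    and B_directed: "\<mu> \<in> \<Lambda> \<Longrightarrow> \<nu> \<in> \<Lambda> \<Longrightarrow> \<mu> \<noteq> \<nu> \<Longrightarrow> y \<in> B \<Longrightarrow> \<epsilon> \<mu> \<otimes> y = y \<Longrightarrow> y \<otimes> \<epsilon> \<nu> = y \<Longrightarrow>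
      y \<noteq> \<zero> \<Longrightarrow> gt \<mu> \<nu>"
    and B_finite: "\<nu> \<in> \<Lambda> \<Longrightarrow> \<exists>F. finite F \<and> (\<forall>\<mu>\<in>\<Lambda> - F. \<forall>y\<in>B. \<epsilon> \<mu> \<otimes> y = y \<longrightarrow> y \<otimes> \<epsilon> \<nu> = y \<longrightarrow> y = \<zero>)"
    and B_span: "\<mu> \<in> \<Lambda> \<Longrightarrow> \<nu> \<in> \<Lambda> \<Longrightarrow> \<exists>xs. set xs \<subseteq> {y \<in> B. \<epsilon> \<mu> \<otimes> y = y \<and> y \<otimes> \<epsilon> \<nu> = y} \<and>
      {y \<in> B. \<epsilon> \<mu> \<otimes> y = y \<and> y \<otimes> \<epsilon> \<nu> = y} \<subseteq> adjoin {\<zero>} xs"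
    and coeff_radical: "\<mu> \<in> \<Lambda> \<Longrightarrow> \<nu> \<in> \<Lambda> \<Longrightarrow> gt \<mu> \<nu> \<Longrightarrow> y \<in> carrier D \<Longrightarrow> \<epsilon> \<mu> \<otimes> y = y \<Longrightarrow> y \<otimes> \<epsilon> \<nu> = y \<Longrightarrow>
      \<chi> \<nu> (b i y) = 0"
begin

sublocale BA: split_algebra BA \<Lambda> \<epsilon> \<chi> by (rule split_B)

lemma \<epsilon>_in_B [simp]: "\<nu> \<in> \<Lambda> \<Longrightarrow> \<epsilon> \<nu> \<in> B" using \<epsilon>_B by auto

lemmas B_closed [simp] = BA.m_closed[simplified] BA.a_closed[simplified] BA.s_closed[simplified] BA.zero_closed[simplified]

lemma rad_B: "BA.rad_proj \<nu> = {y \<in> B. y \<otimes> \<epsilon> \<nu> = y \<and> \<chi> \<nu> y = 0}"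
  by (simp add: BA.rad_proj_def)

text \<open>The indices \<open>\<mu>\<close> with \<open>\<epsilon>\<^sub>\<mu> y \<noteq> 0\<close> are called the weights of \<open>y\<close>. The weight \<open>\<nu>\<close> does not occur in the radical of
  \<open>B \<epsilon>\<^sub>\<nu>\<close>, as \<open>\<epsilon>\<^sub>\<nu> B \<epsilon>\<^sub>\<nu>\<close> consists of multiples of \<open>\<epsilon>\<^sub>\<nu>\<close>, which \<open>\<chi>\<^sub>\<nu>\<close> detects; the others are larger by
  directedness.\<close>

lemma rad_B_weights:
  assumes \<nu>: "\<nu> \<in> \<Lambda>" and y: "y \<in> BA.rad_proj \<nu>" and \<mu>: "\<mu> \<in> \<Lambda>" "\<epsilon> \<mu> \<otimes> y \<noteq> \<zero>" shows "gt \<mu> \<nu>"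
proof -
  have y': "y \<in> B" "y \<otimes> \<epsilon> \<nu> = y" "\<chi> \<nu> y = 0" using y by (auto simp: rad_B)
  have \<epsilon>y: "\<epsilon> \<mu> \<otimes> y \<in> B" "\<epsilon> \<mu> \<otimes> (\<epsilon> \<mu> \<otimes> y) = \<epsilon> \<mu> \<otimes> y" "(\<epsilon> \<mu> \<otimes> y) \<otimes> \<epsilon> \<nu> = \<epsilon> \<mu> \<otimes> y"
    using y' \<mu> \<nu> by (auto simp: m_assoc[symmetric] idem_orth) (simp add: m_assoc)
  show ?thesis
  proof (cases "\<mu> = \<nu>")
    case True
    have "\<epsilon> \<nu> \<otimes> y = \<chi> \<nu> (\<epsilon> \<nu> \<otimes> y) \<odot> \<epsilon> \<nu>" using B_local[OF \<nu>, of "\<epsilon> \<nu> \<otimes> y"] \<epsilon>y True by simp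
    also have "\<chi> \<nu> (\<epsilon> \<nu> \<otimes> y) = 0" using y' \<nu> by (simp add: char_mult)
    finally show ?thesis using True \<mu>(2) \<nu> by simp
  next
    case False
    then show ?thesis using B_directed[OF \<mu>(1) \<nu> _ \<epsilon>y] \<mu>(2) by simp
  qed
qed

text \<open>For \<open>\<mu> > \<nu>\<close> the character \<open>\<chi>\<^sub>\<nu>\<close> kills \<open>\<epsilon>\<^sub>\<mu> w\<close>, so the trace lies in the radical; conversely, an element of
  the radical is the sum of its components \<open>\<epsilon>\<^sub>\<mu> y\<close>, which lie in the trace.\<close>

lemma std_trace_B: assumes \<nu>: "\<nu> \<in> \<Lambda>" shows "std_trace BA \<Lambda> \<epsilon> gt \<nu> = BA.rad_proj \<nu>"
proof
  show "std_trace BA \<Lambda> \<epsilon> gt \<nu> \<subseteq> BA.rad_proj \<nu>"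
  proof (rule BA.std_trace(3)[OF \<nu> BA.rad_proj_submodule[OF \<nu>]])
    fix y w \<mu> assume \<mu>: "\<mu> \<in> \<Lambda>" "gt \<mu> \<nu>" and y: "y \<in> carrier BA" "y \<otimes>\<^bsub>BA\<^esub> \<epsilon> \<mu> = y"
      and w: "w \<in> carrier BA" "\<epsilon> \<mu> \<otimes>\<^bsub>BA\<^esub> w = w" "w \<otimes>\<^bsub>BA\<^esub> \<epsilon> \<nu> = w"
    have ne: "\<mu> \<noteq> \<nu>" using \<mu> gt_irrefl by auto
    have "\<chi> \<nu> (\<epsilon> \<mu> \<otimes> w) = \<chi> \<nu> (\<epsilon> \<mu>) * \<chi> \<nu> w" using \<mu> \<nu> w(1) by (intro char_mult) auto
    then have "\<chi> \<nu> (\<epsilon> \<mu> \<otimes> w) = 0" using ne \<mu> \<nu> by (simp add: char_idem)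
    then have "\<chi> \<nu> w = 0" using w by simp
    then show "y \<otimes>\<^bsub>BA\<^esub> w \<in> BA.rad_proj \<nu>" using y w \<nu> by (simp add: rad_B m_assoc char_mult)
  qed
  show "BA.rad_proj \<nu> \<subseteq> std_trace BA \<Lambda> \<epsilon> gt \<nu>"
  proof
    fix y assume y: "y \<in> BA.rad_proj \<nu>"
    then have y': "y \<in> B" "y \<otimes> \<epsilon> \<nu> = y" by (auto simp: rad_B)
    obtain ns where ns: "set ns \<subseteq> \<Lambda>" "lsum D (map (\<lambda>\<mu>. \<epsilon> \<mu> \<otimes> y) ns) = y" using local_unit[of y] y' by auto
    interpret P: unital_module BA "proj_module BA \<epsilon> \<nu>" by (rule BA.proj_unital) fact
    have "\<epsilon> \<mu> \<otimes> y \<in> std_trace BA \<Lambda> \<epsilon> gt \<nu>" if \<mu>: "\<mu> \<in> \<Lambda>" for \<mu>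
    proof (cases "\<epsilon> \<mu> \<otimes> y = \<zero>")
      case True
      then show ?thesis using P.submoduleD(2)[OF BA.std_trace(1)[OF \<nu>]] by simp
    next
      case False
      then have "gt \<mu> \<nu>" using rad_B_weights[OF \<nu> y \<mu>] by simp
      then have "\<epsilon> \<mu> \<otimes>\<^bsub>BA\<^esub> (\<epsilon> \<mu> \<otimes> y) \<in> std_trace BA \<Lambda> \<epsilon> gt \<nu>"
        using \<mu> \<nu> y' by (intro BA.std_trace(2)[OF \<nu> \<mu>]) (simp_all add: m_assoc[symmetric] idem_orth, simp add: m_assoc)
      then show ?thesis using \<mu> y' by (simp add: m_assoc[symmetric] idem_orth)
    qed
    then have "lsum BA (map (\<lambda>\<mu>. \<epsilon> \<mu> \<otimes> y) ns) \<in> std_trace BA \<Lambda> \<epsilon> gt \<nu>"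
      using ns(1) by (intro BA.submodule_lsum[OF \<nu> BA.std_trace(1)[OF \<nu>]]) auto
    then show "y \<in> std_trace BA \<Lambda> \<epsilon> gt \<nu>" using ns(2) by simp
  qed
qed

lemma std_module_B: "\<nu> \<in> \<Lambda> \<Longrightarrow> std_module BA \<Lambda> \<epsilon> gt \<nu> = top_module BA \<epsilon> \<nu>"
  by (simp add: std_module_def std_trace_B BA.top_eq)

subsection \<open>The filtration of the radical\<close>

definition weight_space :: "'l \<Rightarrow> 'l set \<Rightarrow> 'd set" where
  "weight_space \<nu> H = {y \<in> B. y \<otimes> \<epsilon> \<nu> = y \<and> (\<forall>\<mu>\<in>\<Lambda> - H. \<epsilon> \<mu> \<otimes> y = \<zero>)}"

text \<open>Multiplication by \<open>B\<close> moves weights upwards, because \<open>\<epsilon>\<^sub>\<kappa> a \<epsilon>\<^sub>\<mu>\<close> is then a nonzero element of \<open>B\<close>.\<close>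

lemma weight_space_act:
  assumes \<nu>: "\<nu> \<in> \<Lambda>" and \<mu>: "\<mu> \<in> \<Lambda>" and \<kappa>: "\<kappa> \<in> \<Lambda>" and a: "a \<in> B" and x: "x \<in> B" "\<epsilon> \<mu> \<otimes> x = x" "x \<otimes> \<epsilon> \<nu> = x"
    and nz: "\<epsilon> \<kappa> \<otimes> (a \<otimes> x) \<noteq> \<zero>"
  shows "\<kappa> = \<mu> \<or> gt \<kappa> \<mu>"
proof (rule disjCI)
  assume "\<not> gt \<kappa> \<mu>"
  have eq: "(\<epsilon> \<kappa> \<otimes> a \<otimes> \<epsilon> \<mu>) \<otimes> x = \<epsilon> \<kappa> \<otimes> (a \<otimes> x)" using \<mu> \<kappa> a x by (simp add: m_assoc)
  have "\<epsilon> \<kappa> \<otimes> a \<otimes> \<epsilon> \<mu> \<noteq> \<zero>"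
  proof
    assume "\<epsilon> \<kappa> \<otimes> a \<otimes> \<epsilon> \<mu> = \<zero>"
    then show False using eq nz x by simp
  qed
  moreover have "\<epsilon> \<kappa> \<otimes> (\<epsilon> \<kappa> \<otimes> a \<otimes> \<epsilon> \<mu>) = \<epsilon> \<kappa> \<otimes> a \<otimes> \<epsilon> \<mu>" "(\<epsilon> \<kappa> \<otimes> a \<otimes> \<epsilon> \<mu>) \<otimes> \<epsilon> \<mu> = \<epsilon> \<kappa> \<otimes> a \<otimes> \<epsilon> \<mu>"
    using \<kappa> \<mu> a by (simp_all add: m_assoc[symmetric] idem_orth) (simp add: m_assoc idem_orth)
  ultimately show "\<kappa> = \<mu>" using B_directed[OF \<kappa> \<mu>, of "\<epsilon> \<kappa> \<otimes> a \<otimes> \<epsilon> \<mu>"] \<kappa> \<mu> a \<open>\<not> gt \<kappa> \<mu>\<close> by auto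
qed

text \<open>The radical has finitely many weights. If \<open>H\<close> is an upward closed set of them, then the elements with
  weights in \<open>H\<close> form a submodule. Removing from \<open>H\<close> a minimal weight \<open>\<mu>\<close> leaves an upward closed set \<open>H'\<close>, and
  \<open>B\<close> acts on the quotient of the two submodules through \<open>\<chi>\<^sub>\<mu>\<close>. So adjoining a finite spanning set of the
  component of weight \<open>\<mu>\<close> vector by vector gives steps that are trivial or isomorphic to \<open>L(\<mu>)\<close>, which
  is the standard module.\<close>

lemma rad_B_filtered:
  assumes \<nu>: "\<nu> \<in> \<Lambda>"
  shows "filtered_by BA ((proj_module BA \<epsilon> \<nu>)\<lparr>carrier := BA.rad_proj \<nu>\<rparr>) (std_module BA \<Lambda> \<epsilon> gt) {\<mu>\<in>\<Lambda>. gt \<mu> \<nu>}"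
proof -
  let ?P = "proj_module BA \<epsilon> \<nu>"
  let ?filt = "\<lambda>W. filtered_by BA (?P\<lparr>carrier := W\<rparr>) (std_module BA \<Lambda> \<epsilon> gt) {\<mu>\<in>\<Lambda>. gt \<mu> \<nu>}"
  have P: "unital_module BA ?P" by (rule BA.proj_unital) fact
  interpret P: unital_module BA ?P by fact
  have Pc: "carrier ?P = {y \<in> B. y \<otimes> \<epsilon> \<nu> = y}" using BA.proj_carrier[OF \<nu>] by simp
  obtain F where F: "finite F"
    "\<And>\<mu> y. \<mu> \<in> \<Lambda> - F \<Longrightarrow> y \<in> B \<Longrightarrow> \<epsilon> \<mu> \<otimes> y = y \<Longrightarrow> y \<otimes> \<epsilon> \<nu> = y \<Longrightarrow> y = \<zero>"
    using B_finite[OF \<nu>] by blast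
  \<comment> \<open>All weights of the radical lie in this finite set.\<close>
  define G where "G = {\<mu> \<in> \<Lambda>. \<mu> \<in> F \<and> gt \<mu> \<nu>}"
  have finG: "finite G" using F(1) by (simp add: G_def)
  have inG: "\<kappa> \<in> G" if \<kappa>: "\<kappa> \<in> \<Lambda>" and \<mu>: "\<mu> \<in> \<Lambda>" "gt \<mu> \<nu>" and a: "a \<in> B" and x: "x \<in> B" "\<epsilon> \<mu> \<otimes> x = x" "x \<otimes> \<epsilon> \<nu> = x"
    and nz: "\<epsilon> \<kappa> \<otimes> (a \<otimes> x) \<noteq> \<zero>" for \<kappa> \<mu> a x
  proof -
    have "gt \<kappa> \<nu>" using weight_space_act[OF \<nu> \<mu>(1) \<kappa> a x nz] \<mu>(2) gt_trans by blast
    moreover have "\<kappa> \<in> F"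
    proof (rule ccontr)
      assume "\<kappa> \<notin> F"
      then have "\<epsilon> \<kappa> \<otimes> (a \<otimes> x) = \<zero>"
        using \<kappa> \<nu> a x by (intro F(2)[of \<kappa>]) (simp_all add: m_assoc[symmetric] idem_orth, simp add: m_assoc)
      then show False using nz by simp
    qed
    ultimately show ?thesis using \<kappa> by (simp add: G_def)
  qed
  have wsub: "submodule (weight_space \<nu> H) BA ?P"
    if H: "H \<subseteq> G" "\<And>\<mu> \<kappa>. \<mu> \<in> H \<Longrightarrow> \<kappa> \<in> G \<Longrightarrow> gt \<kappa> \<mu> \<Longrightarrow> \<kappa> \<in> H" for H
  proof (rule P.submoduleI)
    show "weight_space \<nu> H \<subseteq> carrier ?P" by (auto simp: weight_space_def Pc)
    show "\<zero>\<^bsub>?P\<^esub> \<in> weight_space \<nu> H" using \<nu> by (auto simp: weight_space_def)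
    show "x \<oplus>\<^bsub>?P\<^esub> y \<in> weight_space \<nu> H" if "x \<in> weight_space \<nu> H" "y \<in> weight_space \<nu> H" for x y
      using that \<nu> by (auto simp: weight_space_def l_distr r_distr)
    show "a \<odot>\<^bsub>?P\<^esub> y \<in> weight_space \<nu> H" if a': "a \<in> carrier BA" and y: "y \<in> weight_space \<nu> H" for a y
    proof -
      have a: "a \<in> B" using a' by simp
      have y': "y \<in> B" "y \<otimes> \<epsilon> \<nu> = y" "\<And>\<mu>. \<mu> \<in> \<Lambda> - H \<Longrightarrow> \<epsilon> \<mu> \<otimes> y = \<zero>" using y by (auto simp: weight_space_def)
      obtain ns where ns: "set ns \<subseteq> \<Lambda>" "lsum D (map (\<lambda>\<mu>. \<epsilon> \<mu> \<otimes> y) ns) = y" using local_unit[of y] y'(1) by auto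
      have "\<epsilon> \<kappa> \<otimes> (a \<otimes> y) = \<zero>" if \<kappa>: "\<kappa> \<in> \<Lambda> - H" for \<kappa>
      proof -
        have zero: "\<epsilon> \<kappa> \<otimes> (a \<otimes> (\<epsilon> \<mu> \<otimes> y)) = \<zero>" if \<mu>: "\<mu> \<in> \<Lambda>" for \<mu>
        proof (rule ccontr)
          assume nz: "\<epsilon> \<kappa> \<otimes> (a \<otimes> (\<epsilon> \<mu> \<otimes> y)) \<noteq> \<zero>"
          have "\<epsilon> \<mu> \<otimes> y \<noteq> \<zero>" using nz a \<kappa> by auto
          then have \<mu>H: "\<mu> \<in> H" using y'(3) \<mu> by blast
          then have \<mu>G: "gt \<mu> \<nu>" using H(1) by (auto simp: G_def)
          have x: "\<epsilon> \<mu> \<otimes> y \<in> B" "\<epsilon> \<mu> \<otimes> (\<epsilon> \<mu> \<otimes> y) = \<epsilon> \<mu> \<otimes> y" "(\<epsilon> \<mu> \<otimes> y) \<otimes> \<epsilon> \<nu> = \<epsilon> \<mu> \<otimes> y"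
            using y' \<mu> \<nu> by (simp_all add: m_assoc[symmetric] idem_orth) (simp add: m_assoc)
          have "\<kappa> \<in> \<Lambda>" using \<kappa> by simp
          then have "\<kappa> = \<mu> \<or> gt \<kappa> \<mu>" "\<kappa> \<in> G"
            using weight_space_act[OF \<nu> \<mu> _ a x nz] inG[OF _ \<mu> \<mu>G a x nz] by auto
          then show False using H(2)[OF \<mu>H] \<mu>H \<kappa> by auto
        qed
        have "\<epsilon> \<kappa> \<otimes> (a \<otimes> lsum D (map (\<lambda>\<mu>. \<epsilon> \<mu> \<otimes> y) ns)) = \<zero>"
          using ns(1)
        proof (induction ns)
          case (Cons \<mu> ns)
          have "lsum D (map (\<lambda>\<mu>. \<epsilon> \<mu> \<otimes> y) ns) \<in> carrier D" using Cons.prems y'(1) by (intro lsum_closed) auto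
          then show ?case using Cons a y'(1) \<kappa> zero[of \<mu>] by (simp add: r_distr)
        qed (use a \<kappa> in auto)
        then show ?thesis using ns(2) by simp
      qed
      then show ?thesis using a y' \<nu> by (auto simp: weight_space_def m_assoc)
    qed
  qed
  have main: "?filt (weight_space \<nu> H)"
    if "H \<subseteq> G" "\<And>\<mu> \<kappa>. \<mu> \<in> H \<Longrightarrow> \<kappa> \<in> G \<Longrightarrow> gt \<kappa> \<mu> \<Longrightarrow> \<kappa> \<in> H" for H
    using finite_subset[OF that(1) finG] that
  proof (induction H rule: finite_psubset_induct)
    case (psubset H)
    show ?case
    proof (cases "H = {}")
      case True
      have "weight_space \<nu> {} = {\<zero>}"
      proof
        show "weight_space \<nu> {} \<subseteq> {\<zero>}"
          unfolding weight_space_def by (intro subsetI CollectI, elim CollectE conjE) (simp add: eq_zero_if_components)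
        show "{\<zero>} \<subseteq> weight_space \<nu> {}" using \<nu> by (simp add: weight_space_def)
      qed
      then show ?thesis using True filtered_by_zero[OF P] by simp
    next
      case False
      have "asymp_on H gt" "transp_on H gt" using gt_irrefl gt_trans by (auto intro!: asymp_onI transp_onI)
      then have "\<exists>\<mu>\<in>H. \<forall>\<kappa>\<in>H. \<kappa> \<noteq> \<mu> \<longrightarrow> \<not> gt \<mu> \<kappa>"
        by (rule Finite_Set.bex_max_element[OF psubset.hyps _ _ False])
      then obtain \<mu> where \<mu>H: "\<mu> \<in> H" and max: "\<forall>\<kappa>\<in>H. \<kappa> \<noteq> \<mu> \<longrightarrow> \<not> gt \<mu> \<kappa>" by blast
      have "\<not> gt \<mu> \<kappa>" if "\<kappa> \<in> H" for \<kappa> using max that gt_irrefl[of \<mu>] by metis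
      note \<mu> = \<mu>H this
      have \<mu>\<Lambda>: "\<mu> \<in> \<Lambda>" and \<mu>\<nu>: "gt \<mu> \<nu>" using \<mu>(1) psubset.prems(1) by (auto simp: G_def)
      define H' where "H' = H - {\<mu>}"
      have up: "\<kappa> \<in> H'" if "\<mu>' \<in> H'" "\<kappa> \<in> G" "gt \<kappa> \<mu>'" for \<mu>' \<kappa>
        using psubset.prems(2)[of \<mu>' \<kappa>] \<mu>(2)[of \<mu>'] that by (auto simp: H'_def)
      have H'G: "H' \<subseteq> G" using psubset.prems(1) by (auto simp: H'_def)
      have sub': "submodule (weight_space \<nu> H') BA ?P" using H'G up by (rule wsub)
      have "H' \<subset> H" using \<mu>(1) by (auto simp: H'_def)
      then have filt': "?filt (weight_space \<nu> H')" using H'G up by (rule psubset.IH)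
      obtain xs where xs: "set xs \<subseteq> {y \<in> B. \<epsilon> \<mu> \<otimes> y = y \<and> y \<otimes> \<epsilon> \<nu> = y}"
        and span: "{y \<in> B. \<epsilon> \<mu> \<otimes> y = y \<and> y \<otimes> \<epsilon> \<nu> = y} \<subseteq> adjoin {\<zero>} xs"
        using B_span[OF \<mu>\<Lambda> \<nu>] by blast
      \<comment> \<open>The algebra acts on vectors of weight \<open>\<mu>\<close> through \<open>\<chi>\<^sub>\<mu>\<close>, up to larger weights.\<close>
      have act: "a \<otimes> x \<oplus> (- \<chi> \<mu> a) \<odot> x \<in> weight_space \<nu> H'"
        if a: "a \<in> B" and x: "x \<in> B" "\<epsilon> \<mu> \<otimes> x = x" "x \<otimes> \<epsilon> \<nu> = x" for a x
      proof -
        have "\<epsilon> \<kappa> \<otimes> (a \<otimes> x \<oplus> (- \<chi> \<mu> a) \<odot> x) = \<zero>" if \<kappa>: "\<kappa> \<in> \<Lambda> - H'" for \<kappa>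
        proof (cases "\<kappa> = \<mu>")
          case True
          let ?y = "\<epsilon> \<mu> \<otimes> a \<otimes> \<epsilon> \<mu>"
          have "?y = \<chi> \<mu> ?y \<odot> \<epsilon> \<mu>"
            using \<mu>\<Lambda> a by (intro B_local) (simp_all add: m_assoc[symmetric] idem_orth, simp add: m_assoc idem_orth)
          also have "\<chi> \<mu> ?y = \<chi> \<mu> a" using \<mu>\<Lambda> a by (simp add: char_mult char_idem)
          finally have "?y \<otimes> x = (\<chi> \<mu> a \<odot> \<epsilon> \<mu>) \<otimes> x" by simp
          then have "\<epsilon> \<mu> \<otimes> (a \<otimes> x) = \<chi> \<mu> a \<odot> x" using \<mu>\<Lambda> a x by (simp add: m_assoc s_mult_left)
          then have "\<epsilon> \<mu> \<otimes> (a \<otimes> x \<oplus> (- \<chi> \<mu> a) \<odot> x) = \<chi> \<mu> a \<odot> x \<oplus> (- \<chi> \<mu> a) \<odot> x"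
            using \<mu>\<Lambda> a x by (simp add: r_distr s_mult_right)
          also have "\<dots> = \<zero>" using x(1) by (simp add: add_s[symmetric])
          finally show ?thesis using True by simp
        next
          case False
          have "\<epsilon> \<kappa> \<otimes> x = \<epsilon> \<kappa> \<otimes> \<epsilon> \<mu> \<otimes> x" using x \<kappa> \<mu>\<Lambda> by (simp add: m_assoc)
          also have "\<dots> = \<zero>" using False \<kappa> \<mu>\<Lambda> x(1) by (simp add: idem_orth)
          finally have "\<epsilon> \<kappa> \<otimes> x = \<zero>" .
          moreover have "\<epsilon> \<kappa> \<otimes> (a \<otimes> x) = \<zero>"
          proof (rule ccontr)
            assume nz: "\<epsilon> \<kappa> \<otimes> (a \<otimes> x) \<noteq> \<zero>"
            have \<kappa>\<Lambda>: "\<kappa> \<in> \<Lambda>" using \<kappa> by simp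
            have "gt \<kappa> \<mu>" using weight_space_act[OF \<nu> \<mu>\<Lambda> \<kappa>\<Lambda> a x nz] False by simp
            moreover have "\<kappa> \<in> G" by (rule inG[OF \<kappa>\<Lambda> \<mu>\<Lambda> \<mu>\<nu> a x nz])
            ultimately show False using psubset.prems(2)[OF \<mu>(1)] False \<kappa> by (auto simp: H'_def)
          qed
          ultimately show ?thesis using \<kappa> a x(1) by (simp add: r_distr s_mult_right)
        qed
        then show ?thesis using a x \<nu> by (auto simp: weight_space_def l_distr m_assoc s_mult_left)
      qed
      have adj: "submodule (adjoin (weight_space \<nu> H') ys) BA ?P \<and> weight_space \<nu> H' \<subseteq> adjoin (weight_space \<nu> H') ys \<and>
          ?filt (adjoin (weight_space \<nu> H') ys)" if "set ys \<subseteq> set xs" for ys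
        using that
      proof (induction ys)
        case Nil
        then show ?case using sub' filt' by simp
      next
        case (Cons x ys)
        define W where "W = adjoin (weight_space \<nu> H') ys"
        define W' where "W' = {w \<oplus> c \<odot> x | w c. w \<in> W}"
        have W: "submodule W BA ?P" "weight_space \<nu> H' \<subseteq> W" "?filt W" using Cons by (auto simp: W_def)
        note WD = P.submoduleD[OF W(1), simplified]
        have x: "x \<in> B" "\<epsilon> \<mu> \<otimes> x = x" "x \<otimes> \<epsilon> \<nu> = x" using Cons.prems xs by auto
        have WB: "w \<in> B" "w \<otimes> \<epsilon> \<nu> = w" if "w \<in> W" for w using WD(1) that Pc by auto
        have WW': "W \<subseteq> W'"
        proof
          fix w assume "w \<in> W"
          then have "w = w \<oplus> 0 \<odot> x" using WB x by simp
          then show "w \<in> W'" using \<open>w \<in> W\<close> unfolding W'_def by blast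
        qed
        have ax: "\<exists>w\<in>W. a \<otimes> x = w \<oplus> \<chi> \<mu> a \<odot> x" if a: "a \<in> B" for a
        proof (rule bexI)
          show "a \<otimes> x \<oplus> (- \<chi> \<mu> a) \<odot> x \<in> W" using act[OF a x] W(2) by blast
          show "a \<otimes> x = a \<otimes> x \<oplus> (- \<chi> \<mu> a) \<odot> x \<oplus> \<chi> \<mu> a \<odot> x"
            using a x(1) by (simp add: a_assoc add_s[symmetric])
        qed
        have W': "submodule W' BA ?P"
        proof (rule P.submoduleI)
          show "W' \<subseteq> carrier ?P" unfolding W'_def Pc using WB x \<nu> by (auto simp: l_distr s_mult_left)
          show "\<zero>\<^bsub>?P\<^esub> \<in> W'" using WD(2) WW' by auto
          show "y \<oplus>\<^bsub>?P\<^esub> z \<in> W'" if "y \<in> W'" "z \<in> W'" for y z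
          proof -
            obtain v c w d where v: "v \<in> W" "y = v \<oplus> c \<odot> x" and w: "w \<in> W" "z = w \<oplus> d \<odot> x"
              using \<open>y \<in> W'\<close> \<open>z \<in> W'\<close> unfolding W'_def by blast
            have "y \<oplus> z = (v \<oplus> w) \<oplus> (c + d) \<odot> x" using v w WB x(1) by (simp add: add_s a_ac)
            then show ?thesis using WD(3)[OF v(1) w(1)] unfolding W'_def by auto
          qed
          show "a \<odot>\<^bsub>?P\<^esub> z \<in> W'" if a': "a \<in> carrier BA" and "z \<in> W'" for a z
          proof -
            have a: "a \<in> B" using a' by simp
            obtain w c where w: "w \<in> W" "z = w \<oplus> c \<odot> x" using \<open>z \<in> W'\<close> unfolding W'_def by blast
            obtain v where v: "v \<in> W" "(c \<odot> a) \<otimes> x = v \<oplus> \<chi> \<mu> (c \<odot> a) \<odot> x" using ax[of "c \<odot> a"] a by auto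
            have "a \<otimes> z = a \<otimes> w \<oplus> (c \<odot> a) \<otimes> x" using w a x WB by (simp add: r_distr s_mult_left s_mult_right)
            also have "\<dots> = (a \<otimes> w \<oplus> v) \<oplus> \<chi> \<mu> (c \<odot> a) \<odot> x" using v w a x WB by (simp add: a_assoc)
            finally show ?thesis using WD(3)[OF WD(4)[OF a w(1)] v(1)] unfolding W'_def by auto
          qed
        qed
        have "?filt W'"
        proof (cases "x \<in> W")
          case True
          have "W' \<subseteq> W"
          proof
            fix z assume "z \<in> W'"
            then obtain w c where w: "w \<in> W" "z = w \<oplus> c \<odot> x" unfolding W'_def by blast
            have "c \<odot> x = (c \<odot> \<epsilon> \<mu>) \<otimes> x" using x \<mu>\<Lambda> by (simp add: s_mult_left)
            then have "c \<odot> x \<in> W" using WD(4)[of "c \<odot> \<epsilon> \<mu>" x] True \<mu>\<Lambda> by simp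
            then show "z \<in> W" using w WD(3) by simp
          qed
          then have "W' = W" using WW' by blast
          then show ?thesis using W(3) by (simp only:)
        next
          case False
          let ?M = "?P\<lparr>carrier := W'\<rparr>"
          interpret M: unital_module BA ?M by (rule P.restrict_unital_module[OF W'])
          have WM: "submodule W BA ?M" using P.submodule_restrict[OF W' WW'] W(1) by simp
          let ?Q = "quotient_module ?M W"
          interpret Q: unital_module BA ?Q by (rule M.quotient_unital_module[OF WM])
          have xW': "x \<in> carrier ?M" using x(1) WD(2) by (auto simp: W'_def intro!: exI[of _ \<zero>] exI[of _ 1])
          define X where "X = W +>\<^bsub>?M\<^esub> x"
          have XQ: "X \<in> carrier ?Q" unfolding X_def using xW' by (simp add: M.cosetI)
          have act_X: "a \<odot>\<^bsub>?Q\<^esub> X = W +>\<^bsub>?M\<^esub> (a \<otimes> x)" if "a \<in> B" for a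
            unfolding X_def using M.coset_act[OF WM _ xW', of a] that by simp
          have "module_iso BA (top_module BA \<epsilon> \<mu>) ?Q"
          proof (rule BA.cyclic_top_iso[OF \<mu>\<Lambda> _ XQ])
            show "unital_module BA ?Q" by unfold_locales
            show "\<epsilon> \<mu> \<odot>\<^bsub>?Q\<^esub> X = X" using act_X[of "\<epsilon> \<mu>"] \<mu>\<Lambda> x(2) by (simp add: X_def)
            show "X \<noteq> \<zero>\<^bsub>?Q\<^esub>" using M.coset_eq_zero_iff[OF WM xW'] False by (simp add: X_def)
            show "carrier ?Q \<subseteq> {a \<odot>\<^bsub>?Q\<^esub> X |a. a \<in> carrier BA}"
            proof
              fix Y assume "Y \<in> carrier ?Q"
              then obtain z where z: "z \<in> W'" "Y = W +>\<^bsub>?M\<^esub> z" by (auto simp: M.mem_quotient)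
              obtain w c where w: "w \<in> W" "z = w \<oplus> c \<odot> x" using z(1) unfolding W'_def by blast
              have cx: "(c \<odot> \<epsilon> \<mu>) \<otimes> x = c \<odot> x" using x \<mu>\<Lambda> by (simp add: s_mult_left)
              have cxM: "c \<odot> x \<in> carrier ?M" using M.act_closed[of "c \<odot> \<epsilon> \<mu>" x] xW' \<mu>\<Lambda> cx by simp
              have "Y = (W +>\<^bsub>?M\<^esub> w) <+>\<^bsub>?M\<^esub> (W +>\<^bsub>?M\<^esub> (c \<odot> x))"
                using M.coset_add[OF WM, of w "c \<odot> x"] w cxM WW' z(2) by auto
              also have "W +>\<^bsub>?M\<^esub> w = W +>\<^bsub>?M\<^esub> \<zero>\<^bsub>?M\<^esub>"
                using M.coset_eq_zero_iff[OF WM, of w] M.coset_eq_zero_iff[OF WM, of "\<zero>\<^bsub>?M\<^esub>"] w(1) WW' WD(2) M.zero_closed by auto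
              also have "\<dots> <+>\<^bsub>?M\<^esub> (W +>\<^bsub>?M\<^esub> (c \<odot> x)) = W +>\<^bsub>?M\<^esub> (c \<odot> x)"
                using M.coset_add[OF WM M.zero_closed cxM] M.l_zero[OF cxM] by simp
              finally have "Y = (c \<odot> \<epsilon> \<mu>) \<odot>\<^bsub>?Q\<^esub> X" using act_X[of "c \<odot> \<epsilon> \<mu>"] \<mu>\<Lambda> cx by simp
              then show "Y \<in> {a \<odot>\<^bsub>?Q\<^esub> X |a. a \<in> carrier BA}" using \<mu>\<Lambda> by (intro CollectI exI[of _ "c \<odot> \<epsilon> \<mu>"]) simp
            qed
            show "y \<odot>\<^bsub>?Q\<^esub> X = \<zero>\<^bsub>?Q\<^esub>" if y: "y \<in> BA.rad_proj \<mu>" for y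
            proof -
              have yB: "y \<in> B" "\<chi> \<mu> y = 0" using y by (auto simp: rad_B)
              then obtain w where "w \<in> W" "y \<otimes> x = w \<oplus> \<chi> \<mu> y \<odot> x" using ax by blast
              then have "y \<otimes> x \<in> W" using yB x(1) WB by simp
              then show ?thesis using act_X[OF yB(1)] M.coset_eq_zero_iff[OF WM, of "y \<otimes> x"] WW' by auto
            qed
          qed
          then have "module_iso BA ?Q (std_module BA \<Lambda> \<epsilon> gt \<mu>)"
            using module_iso_sym BA.top_unital[OF \<mu>\<Lambda>] std_module_B[OF \<mu>\<Lambda>] by simp
          then show ?thesis using \<mu>\<Lambda> \<mu>\<nu> by (intro filtered_by_extend[OF P W(1) W' WW' W(3)]) auto
        qed
        then show ?case using W' WW' W(2) by (auto simp: W_def[symmetric] W'_def)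
      qed
      have "weight_space \<nu> H = adjoin (weight_space \<nu> H') xs"
      proof
        show "weight_space \<nu> H \<subseteq> adjoin (weight_space \<nu> H') xs"
        proof
          fix y assume y: "y \<in> weight_space \<nu> H"
          then have y': "y \<in> B" "y \<otimes> \<epsilon> \<nu> = y" by (auto simp: weight_space_def)
          have z: "\<epsilon> \<mu> \<otimes> y \<in> adjoin {\<zero>} xs"
            using y' \<mu>\<Lambda> \<nu> by (intro subsetD[OF span]) (simp add: m_assoc[symmetric] idem_orth, simp add: m_assoc)
          have v: "y \<oplus> (-1) \<odot> (\<epsilon> \<mu> \<otimes> y) \<in> weight_space \<nu> H'"
            unfolding weight_space_def
          proof (intro CollectI conjI ballI)
            show "y \<oplus> (-1) \<odot> (\<epsilon> \<mu> \<otimes> y) \<in> B" using y' \<mu>\<Lambda> by simp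
            show "(y \<oplus> (-1) \<odot> (\<epsilon> \<mu> \<otimes> y)) \<otimes> \<epsilon> \<nu> = y \<oplus> (-1) \<odot> (\<epsilon> \<mu> \<otimes> y)"
              using y' \<mu>\<Lambda> \<nu> by (simp add: l_distr s_mult_left m_assoc)
            fix \<kappa> assume \<kappa>: "\<kappa> \<in> \<Lambda> - H'"
            have "\<epsilon> \<kappa> \<otimes> (y \<oplus> (-1) \<odot> (\<epsilon> \<mu> \<otimes> y)) = \<epsilon> \<kappa> \<otimes> y \<oplus> (-1) \<odot> ((\<epsilon> \<kappa> \<otimes> \<epsilon> \<mu>) \<otimes> y)"
              using y' \<mu>\<Lambda> \<kappa> by (simp add: r_distr s_mult_right m_assoc)
            also have "\<dots> = \<zero>"
            proof (cases "\<kappa> = \<mu>")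
              case True
              then show ?thesis using y' \<mu>\<Lambda> by (simp add: idem_orth a_inv_s[symmetric] r_neg)
            next
              case False
              then have "\<epsilon> \<kappa> \<otimes> y = \<zero>" using y \<kappa> by (auto simp: weight_space_def H'_def)
              then show ?thesis using False y' \<mu>\<Lambda> \<kappa> by (simp add: idem_orth)
            qed
            finally show "\<epsilon> \<kappa> \<otimes> (y \<oplus> (-1) \<odot> (\<epsilon> \<mu> \<otimes> y)) = \<zero>" .
          qed
          have "y = (y \<oplus> (-1) \<odot> (\<epsilon> \<mu> \<otimes> y)) \<oplus> \<epsilon> \<mu> \<otimes> y"
            using y' \<mu>\<Lambda> by (simp add: a_assoc a_inv_s[symmetric] l_neg)
          moreover have "weight_space \<nu> H' \<subseteq> carrier D" "set xs \<subseteq> carrier D" using xs by (auto simp: weight_space_def)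
          ultimately show "y \<in> adjoin (weight_space \<nu> H') xs" using adjoin_add[OF v _ _ z] by metis
        qed
        have mono: "weight_space \<nu> H' \<subseteq> weight_space \<nu> H" by (auto simp: weight_space_def H'_def)
        have xsH: "x \<in> weight_space \<nu> H" if "x \<in> set xs" for x
        proof -
          have x: "x \<in> B" "\<epsilon> \<mu> \<otimes> x = x" "x \<otimes> \<epsilon> \<nu> = x" using xs that by auto
          have "\<epsilon> \<kappa> \<otimes> x = \<zero>" if \<kappa>: "\<kappa> \<in> \<Lambda> - H" for \<kappa>
          proof -
            have "\<epsilon> \<kappa> \<otimes> x = \<epsilon> \<kappa> \<otimes> \<epsilon> \<mu> \<otimes> x" using x \<kappa> \<mu>\<Lambda> by (simp add: m_assoc)
            then show ?thesis using \<kappa> \<mu>(1) \<mu>\<Lambda> x(1) by (auto simp: idem_orth)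
          qed
          then show ?thesis using x by (auto simp: weight_space_def)
        qed
        have "adjoin (weight_space \<nu> H') ys \<subseteq> weight_space \<nu> H" if "set ys \<subseteq> set xs" for ys
          using that
        proof (induction ys)
          case (Cons x ys)
          have "x \<in> weight_space \<nu> H" using Cons.prems xsH by auto
          moreover have "c \<odot> x \<in> weight_space \<nu> H" if "x \<in> weight_space \<nu> H" for c x
            using that \<nu> by (auto simp: weight_space_def s_mult_left s_mult_right)
          moreover have "x \<oplus> y \<in> weight_space \<nu> H" if "x \<in> weight_space \<nu> H" "y \<in> weight_space \<nu> H" for x y
            using that \<nu> by (auto simp: weight_space_def l_distr r_distr)
          ultimately show ?case using Cons by auto
        qed (use mono in simp)
        then show "adjoin (weight_space \<nu> H') xs \<subseteq> weight_space \<nu> H" by blast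
      qed
      then show ?thesis using adj[of xs] by simp
    qed
  qed
  have "BA.rad_proj \<nu> = weight_space \<nu> G"
  proof
    show "BA.rad_proj \<nu> \<subseteq> weight_space \<nu> G"
    proof
      fix y assume y: "y \<in> BA.rad_proj \<nu>"
      then have y': "y \<in> B" "y \<otimes> \<epsilon> \<nu> = y" by (auto simp: rad_B)
      have "\<epsilon> \<kappa> \<otimes> y = \<zero>" if \<kappa>: "\<kappa> \<in> \<Lambda> - G" for \<kappa>
      proof (rule ccontr)
        assume nz: "\<epsilon> \<kappa> \<otimes> y \<noteq> \<zero>"
        then have "gt \<kappa> \<nu>" using rad_B_weights[OF \<nu> y] \<kappa> by simp
        then have "\<kappa> \<notin> F" using \<kappa> by (auto simp: G_def)
        then have "\<epsilon> \<kappa> \<otimes> y = \<zero>"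
          using \<kappa> \<nu> y' by (intro F(2)[of \<kappa>]) (simp_all add: m_assoc[symmetric] idem_orth, simp add: m_assoc)
        then show False using nz by simp
      qed
      then show "y \<in> weight_space \<nu> G" using y' by (auto simp: weight_space_def)
    qed
    show "weight_space \<nu> G \<subseteq> BA.rad_proj \<nu>"
    proof
      fix y assume y: "y \<in> weight_space \<nu> G"
      have "\<nu> \<notin> G" using gt_irrefl by (simp add: G_def)
      then have "\<epsilon> \<nu> \<otimes> y = \<zero>" using y \<nu> by (auto simp: weight_space_def)
      then have "\<chi> \<nu> (\<epsilon> \<nu> \<otimes> y) = 0" using \<nu> by simp
      then have "\<chi> \<nu> y = 0" using y \<nu> by (simp add: weight_space_def char_mult char_idem)
      then show "y \<in> BA.rad_proj \<nu>" using y by (auto simp: weight_space_def rad_B)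
    qed
  qed
  then show ?thesis using main[of G] by auto
qed

text \<open>Since the trace is the whole radical, the filtration between the trace and the radical is empty.\<close>

lemma directed: "directed_algebra BA \<Lambda> \<epsilon> gt"
  unfolding directed_algebra_def quasi_hereditary_def
proof (intro conjI ballI)
  fix \<nu> assume \<nu>: "\<nu> \<in> \<Lambda>"
  let ?P = "proj_module BA \<epsilon> \<nu>"
  let ?M = "?P\<lparr>carrier := BA.rad_proj \<nu>\<rparr>"
  have P: "unital_module BA ?P" by (rule BA.proj_unital) fact
  interpret P: unital_module BA ?P by fact
  note K = BA.rad_proj_submodule[OF \<nu>]
  interpret M: unital_module BA ?M by (rule P.restrict_unital_module[OF K])
  show "filtered_by BA (?P\<lparr>carrier := std_trace BA \<Lambda> \<epsilon> gt \<nu>\<rparr>) (std_module BA \<Lambda> \<epsilon> gt) {\<mu>\<in>\<Lambda>. gt \<mu> \<nu>}"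
    using rad_B_filtered[OF \<nu>] std_trace_B[OF \<nu>] by simp
  show "std_trace BA \<Lambda> \<epsilon> gt \<nu> \<subseteq> module_radical BA ?P"
    using std_trace_B[OF \<nu>] BA.module_radical_proj[OF \<nu>] by simp
  show "simple_module BA (std_module BA \<Lambda> \<epsilon> gt \<nu>)"
    using BA.top_simple[OF \<nu>] std_module_B[OF \<nu>] by simp
  have KM: "submodule (BA.rad_proj \<nu>) BA ?M" using P.submodule_restrict[OF K order_refl] K by simp
  let ?Q = "quotient_module ?M (BA.rad_proj \<nu>)"
  interpret Q: unital_module BA ?Q by (rule M.quotient_unital_module[OF KM])
  have "carrier ?Q = {\<zero>\<^bsub>?Q\<^esub>}"
  proof
    show "carrier ?Q \<subseteq> {\<zero>\<^bsub>?Q\<^esub>}"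
    proof
      fix X assume "X \<in> carrier ?Q"
      then obtain x where "x \<in> carrier ?M" "X = BA.rad_proj \<nu> +>\<^bsub>?M\<^esub> x" by (auto simp: M.mem_quotient)
      then show "X \<in> {\<zero>\<^bsub>?Q\<^esub>}" using M.coset_eq_zero_iff[OF KM, of x] by simp
    qed
    show "{\<zero>\<^bsub>?Q\<^esub>} \<subseteq> carrier ?Q" using Q.zero_closed by blast
  qed
  then have "?Q = ?Q\<lparr>carrier := {\<zero>\<^bsub>?Q\<^esub>}\<rparr>" by simp
  then have "filtered_by BA ?Q (top_module BA \<epsilon>) {\<mu> \<in> \<Lambda>. gt \<nu> \<mu>}"
    using filtered_by_zero[OF Q.unital_module_axioms] by metis
  then show "filtered_by BA (quotient_module (?P\<lparr>carrier := module_radical BA ?P\<rparr>) (std_trace BA \<Lambda> \<epsilon> gt \<nu>))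
      (top_module BA \<epsilon>) {\<mu> \<in> \<Lambda>. gt \<nu> \<mu>}"
    using std_trace_B[OF \<nu>] BA.module_radical_proj[OF \<nu>] by simp
qed

subsection \<open>Induced simple modules\<close>

text \<open>Since \<open>\<chi>\<^sub>\<nu>(\<epsilon>\<^sub>\<nu> e\<^sub>\<nu>) = 1\<close>, locality shows that \<open>D \<epsilon>\<^sub>\<nu> e\<^sub>\<nu>\<close> is all of \<open>D e\<^sub>\<nu>\<close>, which gives \<open>p q = e\<^sub>\<nu>\<close>. Then \<open>q p\<close>
  is an idempotent in the local corner of \<open>\<epsilon>\<^sub>\<nu>\<close> with nonzero character, hence equal to \<open>\<epsilon>\<^sub>\<nu>\<close>. So right
  multiplications by \<open>p\<close> and \<open>q\<close> are inverse isomorphisms between \<open>D e\<^sub>\<nu>\<close> and \<open>D \<epsilon>\<^sub>\<nu>\<close>.\<close>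

lemma conjugators:
  assumes \<nu>: "\<nu> \<in> \<Lambda>"
  shows "\<exists>p q. p \<in> carrier D \<and> q \<in> carrier D \<and> e \<nu> \<otimes> p = p \<and> p \<otimes> \<epsilon> \<nu> = p \<and> \<epsilon> \<nu> \<otimes> q = q \<and> q \<otimes> e \<nu> = q \<and>
    p \<otimes> q = e \<nu> \<and> q \<otimes> p = \<epsilon> \<nu>"
proof -
  note [simp] = \<nu> idem_closed[OF \<nu>] Es.idem_closed[OF \<nu>]
  have ee: "e \<nu> \<otimes> e \<nu> = e \<nu>" "\<epsilon> \<nu> \<otimes> \<epsilon> \<nu> = \<epsilon> \<nu>" using Es.idem_orth[of \<nu> \<nu>] idem_orth[of \<nu> \<nu>] by auto
  interpret Pe: unital_module D "proj_module D e \<nu>" by (rule Es.proj_unital) fact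
  interpret P: unital_module D "proj_module D \<epsilon> \<nu>" by (rule proj_unital) fact
  have "submodule ((\<lambda>y. y \<otimes> (\<epsilon> \<nu> \<otimes> e \<nu>)) ` carrier D) D (proj_module D e \<nu>)"
  proof (rule Pe.submoduleI)
    show "(\<lambda>y. y \<otimes> (\<epsilon> \<nu> \<otimes> e \<nu>)) ` carrier D \<subseteq> carrier (proj_module D e \<nu>)"
      by (auto simp: Es.proj_carrier m_assoc ee)
    show "\<zero>\<^bsub>proj_module D e \<nu>\<^esub> \<in> (\<lambda>y. y \<otimes> (\<epsilon> \<nu> \<otimes> e \<nu>)) ` carrier D"
      by (auto intro!: image_eqI[of _ _ \<zero>])
    show "x \<oplus>\<^bsub>proj_module D e \<nu>\<^esub> y \<in> (\<lambda>y. y \<otimes> (\<epsilon> \<nu> \<otimes> e \<nu>)) ` carrier D"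
      if "x \<in> (\<lambda>y. y \<otimes> (\<epsilon> \<nu> \<otimes> e \<nu>)) ` carrier D" "y \<in> (\<lambda>y. y \<otimes> (\<epsilon> \<nu> \<otimes> e \<nu>)) ` carrier D" for x y
      using that by (auto simp: l_distr[symmetric])
    show "a \<odot>\<^bsub>proj_module D e \<nu>\<^esub> x \<in> (\<lambda>y. y \<otimes> (\<epsilon> \<nu> \<otimes> e \<nu>)) ` carrier D"
      if "a \<in> carrier D" "x \<in> (\<lambda>y. y \<otimes> (\<epsilon> \<nu> \<otimes> e \<nu>)) ` carrier D" for a x
      using that by (auto simp: m_assoc[symmetric])
  qed
  moreover have "\<epsilon> \<nu> \<otimes> e \<nu> \<in> (\<lambda>y. y \<otimes> (\<epsilon> \<nu> \<otimes> e \<nu>)) ` carrier D"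
    by (rule image_eqI[of _ _ "\<epsilon> \<nu>"]) (simp_all add: m_assoc[symmetric] ee)
  moreover have "\<chi> \<nu> (\<epsilon> \<nu> \<otimes> e \<nu>) \<noteq> 0" by (simp add: char_mult char_idem Es.char_idem)
  ultimately have "e \<nu> \<in> (\<lambda>y. y \<otimes> (\<epsilon> \<nu> \<otimes> e \<nu>)) ` carrier D"
    using Es.submodule_eq_proj[OF \<nu>] Es.idem_in_proj[OF \<nu>] by blast
  then obtain z where z: "z \<in> carrier D" "e \<nu> = z \<otimes> (\<epsilon> \<nu> \<otimes> e \<nu>)" by blast
  define p where "p = e \<nu> \<otimes> (z \<otimes> \<epsilon> \<nu>)"
  define q where "q = \<epsilon> \<nu> \<otimes> e \<nu>"
  have pq_in: "p \<in> carrier D" "q \<in> carrier D" using z by (auto simp: p_def q_def)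
  have pq1: "e \<nu> \<otimes> p = p" "p \<otimes> \<epsilon> \<nu> = p" "\<epsilon> \<nu> \<otimes> q = q" "q \<otimes> e \<nu> = q"
    using z(1) by (simp_all add: p_def q_def m_assoc ee) (simp_all add: m_assoc[symmetric] ee)
  have "p \<otimes> q = e \<nu> \<otimes> (z \<otimes> (\<epsilon> \<nu> \<otimes> \<epsilon> \<nu> \<otimes> e \<nu>))" using z(1) by (simp add: p_def q_def m_assoc)
  also have "\<dots> = e \<nu>" using z(2) by (simp add: ee)
  finally have pq: "p \<otimes> q = e \<nu>" .
  define g where "g = q \<otimes> p"
  have g: "g \<in> carrier D" "g \<otimes> \<epsilon> \<nu> = g" "\<epsilon> \<nu> \<otimes> g = g"
    using pq_in pq1 by (simp_all add: g_def m_assoc) (simp add: m_assoc[symmetric] pq1)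
  have gg: "g \<otimes> g = g"
  proof -
    have "g \<otimes> g = q \<otimes> ((p \<otimes> q) \<otimes> p)" using pq_in by (simp add: g_def m_assoc)
    then show ?thesis by (simp add: pq pq1 g_def)
  qed
  have "\<chi> \<nu> p * \<chi> \<nu> q = 1" using pq char_mult[OF \<nu> pq_in] Es.char_idem[of \<nu> \<nu>] by simp
  then have \<chi>g: "\<chi> \<nu> g \<noteq> 0" using char_mult[OF \<nu> pq_in(2,1)] by (auto simp: g_def)
  have "submodule ((\<lambda>y. y \<otimes> g) ` carrier D) D (proj_module D \<epsilon> \<nu>)"
  proof (rule P.submoduleI)
    show "(\<lambda>y. y \<otimes> g) ` carrier D \<subseteq> carrier (proj_module D \<epsilon> \<nu>)" using g by (auto simp: proj_carrier m_assoc)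
    show "\<zero>\<^bsub>proj_module D \<epsilon> \<nu>\<^esub> \<in> (\<lambda>y. y \<otimes> g) ` carrier D" using g by (auto intro!: image_eqI[of _ _ \<zero>])
    show "x \<oplus>\<^bsub>proj_module D \<epsilon> \<nu>\<^esub> y \<in> (\<lambda>y. y \<otimes> g) ` carrier D"
      if "x \<in> (\<lambda>y. y \<otimes> g) ` carrier D" "y \<in> (\<lambda>y. y \<otimes> g) ` carrier D" for x y
      using that g by (auto simp: l_distr[symmetric])
    show "a \<odot>\<^bsub>proj_module D \<epsilon> \<nu>\<^esub> x \<in> (\<lambda>y. y \<otimes> g) ` carrier D"
      if "a \<in> carrier D" "x \<in> (\<lambda>y. y \<otimes> g) ` carrier D" for a x
      using that g by (auto simp: m_assoc[symmetric])
  qed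
  moreover have "g \<in> (\<lambda>y. y \<otimes> g) ` carrier D" using g gg by (intro image_eqI[of _ _ g]) simp_all
  ultimately have "\<epsilon> \<nu> \<in> (\<lambda>y. y \<otimes> g) ` carrier D"
    using submodule_eq_proj[OF \<nu> _ _ \<chi>g] idem_in_proj[OF \<nu>] by blast
  then obtain w where w: "w \<in> carrier D" "\<epsilon> \<nu> = w \<otimes> g" by blast
  have "g = \<epsilon> \<nu> \<otimes> g" using g by simp
  also have "\<dots> = w \<otimes> (g \<otimes> g)" using w g by (simp add: m_assoc)
  also have "\<dots> = \<epsilon> \<nu>" using gg w by simp
  finally have "q \<otimes> p = \<epsilon> \<nu>" by (simp add: g_def)
  then show ?thesis using pq_in pq1 pq by blast
qed

text \<open>With a generator \<open>E\<close> of \<open>L(\<nu>)\<close>, the map \<open>x \<mapsto> x p \<otimes> E\<close> is surjective from \<open>D e\<^sub>\<nu>\<close> onto \<open>D \<otimes>\<^sub>B L(\<nu>)\<close>. Its kernel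
  contains the trace because the coordinates \<open>b\<^sub>i(v) E\<close> vanish for \<open>v \<in> \<epsilon>\<^sub>\<mu> D \<epsilon>\<^sub>\<nu>\<close> with \<open>\<mu> > \<nu>\<close>. If \<open>x\<close> lies in
  the kernel, then all coefficients of \<open>x p = \<Sum> u\<^sub>i b\<^sub>i(x p)\<close> lie in the radical of \<open>B \<epsilon>\<^sub>\<nu>\<close>, which has weights
  larger than \<open>\<nu>\<close>, and so \<open>x\<close> lies in the trace.\<close>

lemma induced_simple:
  assumes \<nu>: "\<nu> \<in> \<Lambda>"
  shows "module_iso D (induced_module D B (top_module BA \<epsilon> \<nu>)) (std_module D \<Lambda> e gt \<nu>)"
proof -
  let ?L = "top_module BA \<epsilon> \<nu>" and ?P = "proj_module D e \<nu>"
  interpret L: unital_module BA ?L by (rule BA.top_unital) fact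
  interpret T: tensor D \<Lambda> \<epsilon> \<chi> B u b ?L by unfold_locales
  interpret P: unital_module D ?P by (rule Es.proj_unital) fact
  have Pu: "unital_module D ?P" by unfold_locales
  have Pc: "carrier ?P = {y \<in> carrier D. y \<otimes> e \<nu> = y}" by (rule Es.proj_carrier) fact
  have "\<forall>\<nu>\<in>\<Lambda>. \<exists>pq. fst pq \<in> carrier D \<and> snd pq \<in> carrier D \<and> e \<nu> \<otimes> fst pq = fst pq \<and>
      fst pq \<otimes> \<epsilon> \<nu> = fst pq \<and> \<epsilon> \<nu> \<otimes> snd pq = snd pq \<and> snd pq \<otimes> e \<nu> = snd pq \<and>
      fst pq \<otimes> snd pq = e \<nu> \<and> snd pq \<otimes> fst pq = \<epsilon> \<nu>"
    using conjugators by simp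
  then obtain pq0 where pq0: "\<forall>\<nu>\<in>\<Lambda>. fst (pq0 \<nu>) \<in> carrier D \<and> snd (pq0 \<nu>) \<in> carrier D \<and>
      e \<nu> \<otimes> fst (pq0 \<nu>) = fst (pq0 \<nu>) \<and> fst (pq0 \<nu>) \<otimes> \<epsilon> \<nu> = fst (pq0 \<nu>) \<and>
      \<epsilon> \<nu> \<otimes> snd (pq0 \<nu>) = snd (pq0 \<nu>) \<and> snd (pq0 \<nu>) \<otimes> e \<nu> = snd (pq0 \<nu>) \<and>
      fst (pq0 \<nu>) \<otimes> snd (pq0 \<nu>) = e \<nu> \<and> snd (pq0 \<nu>) \<otimes> fst (pq0 \<nu>) = \<epsilon> \<nu>"
    by (rule bchoice[THEN exE]) blast
  define p where "p \<mu> = fst (pq0 \<mu>)" for \<mu>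
  define q where "q \<mu> = snd (pq0 \<mu>)" for \<mu>
  have p: "p \<mu> \<in> carrier D" "e \<mu> \<otimes> p \<mu> = p \<mu>" "p \<mu> \<otimes> \<epsilon> \<mu> = p \<mu>"
    and q: "q \<mu> \<in> carrier D" "\<epsilon> \<mu> \<otimes> q \<mu> = q \<mu>" "q \<mu> \<otimes> e \<mu> = q \<mu>"
    and pq: "p \<mu> \<otimes> q \<mu> = e \<mu>" and qp: "q \<mu> \<otimes> p \<mu> = \<epsilon> \<mu>" if "\<mu> \<in> \<Lambda>" for \<mu>
    using pq0 that by (simp_all add: p_def q_def)
  note pn = p[OF \<nu>] and qn = q[OF \<nu>]
  define E where "E = BA.rad_proj \<nu> +>\<^bsub>proj_module BA \<epsilon> \<nu>\<^esub> \<epsilon> \<nu>"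
  have \<epsilon>\<epsilon>: "\<epsilon> \<nu> \<otimes> \<epsilon> \<nu> = \<epsilon> \<nu>" using \<nu> by (simp add: idem_orth)
  have EL: "E \<in> carrier ?L" unfolding E_def using BA.top_coset(1)[OF \<nu>, of "\<epsilon> \<nu>"] \<nu> \<epsilon>\<epsilon> by simp
  have actE: "y \<odot>\<^bsub>?L\<^esub> E = BA.rad_proj \<nu> +>\<^bsub>proj_module BA \<epsilon> \<nu>\<^esub> (y \<otimes> \<epsilon> \<nu>)" if "y \<in> B" for y
    unfolding E_def using BA.top_coset(3)[OF \<nu>, of "\<epsilon> \<nu>" y] that \<nu> \<epsilon>\<epsilon> by simp
  have actE0: "y \<odot>\<^bsub>?L\<^esub> E = \<zero>\<^bsub>?L\<^esub> \<longleftrightarrow> \<chi> \<nu> y = 0" if "y \<in> B" "y \<otimes> \<epsilon> \<nu> = y" for y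
    using actE[OF that(1)] BA.top_coset(2)[OF \<nu>, of y] that by simp
  define \<theta> where "\<theta> x = T.cls (frag_of (x \<otimes> p \<nu>, E))" for x
  have \<theta>: "\<theta> \<in> module_homs D ?P T.Ind"
    unfolding module_homs_def
  proof (intro CollectI conjI ballI Pi_I)
    fix x assume "x \<in> carrier ?P"
    then have x: "x \<in> carrier D" by (simp add: Pc)
    then show "\<theta> x \<in> carrier T.Ind" using EL pn by (simp add: \<theta>_def T.Ind_carrier)
    show "\<theta> (a \<odot>\<^bsub>?P\<^esub> x) = a \<odot>\<^bsub>T.Ind\<^esub> \<theta> x" if "a \<in> carrier D" for a
      using that x pn by (simp add: \<theta>_def T.Ind_act m_assoc)
    fix y assume "y \<in> carrier ?P"
    then have y: "y \<in> carrier D" by (simp add: Pc)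
    show "\<theta> (x \<oplus>\<^bsub>?P\<^esub> y) = \<theta> x \<oplus>\<^bsub>T.Ind\<^esub> \<theta> y"
      using x y pn EL T.tens_add_left[of "x \<otimes> p \<nu>" "y \<otimes> p \<nu>" E]
      by (simp add: \<theta>_def T.cls_add T.cls_eq_iff l_distr)
  qed
  have surj: "\<theta> ` carrier ?P = carrier T.Ind"
  proof
    show "\<theta> ` carrier ?P \<subseteq> carrier T.Ind" using module_homsD(1)[OF \<theta>] by blast
    show "carrier T.Ind \<subseteq> \<theta> ` carrier ?P"
    proof
      fix X assume "X \<in> carrier T.Ind"
      then obtain w where w: "w \<in> T.frags" "X = T.cls w" by (auto simp: T.Ind_carrier)
      have "\<exists>x\<in>carrier ?P. T.eqv w (frag_of (x \<otimes> p \<nu>, E))"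
        using w(1)
      proof (induction w rule: T.frags_induct)
        case zero
        have "T.eqv 0 (frag_of (\<zero> \<otimes> p \<nu>, E))" using T.eqv_sym[OF T.tens_zero_left[OF EL]] pn by simp
        then show ?case using P.zero_closed by auto
      next
        case (tens d Y)
        obtain y where y: "y \<in> B" "y \<otimes> \<epsilon> \<nu> = y" "Y = BA.rad_proj \<nu> +>\<^bsub>proj_module BA \<epsilon> \<nu>\<^esub> y"
          using BA.top_elem[OF \<nu> tens(2)] by auto
        have "Y = y \<odot>\<^bsub>?L\<^esub> E" using actE[OF y(1)] y by simp
        moreover have "((d \<otimes> y) \<otimes> q \<nu>) \<otimes> p \<nu> = d \<otimes> y" using tens(1) y pn qn qp[OF \<nu>] by (simp add: m_assoc)
        ultimately have "T.eqv (frag_of (d, Y)) (frag_of (((d \<otimes> y) \<otimes> q \<nu>) \<otimes> p \<nu>, E))"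
          using T.eqv_sym[OF T.tens_balanced[OF tens(1) y(1) EL]] by simp
        moreover have "(d \<otimes> y) \<otimes> q \<nu> \<in> carrier ?P" using tens(1) y qn \<nu> by (simp add: Pc m_assoc)
        ultimately show ?case by blast
      next
        case (diff v w)
        then obtain x y where x: "x \<in> carrier ?P" "T.eqv v (frag_of (x \<otimes> p \<nu>, E))"
          and y: "y \<in> carrier ?P" "T.eqv w (frag_of (y \<otimes> p \<nu>, E))" by blast
        have xy: "x \<in> carrier D" "y \<in> carrier D" using x y by (auto simp: Pc)
        have xmy: "x \<oplus> \<ominus> y \<in> carrier ?P" using x y \<nu> by (auto simp: Pc l_distr l_minus)
        have "(x \<oplus> \<ominus> y) \<otimes> p \<nu> \<oplus> y \<otimes> p \<nu> = x \<otimes> p \<nu>"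
          using xy pn by (simp add: l_distr[symmetric] a_assoc l_neg)
        then have "T.eqv (frag_of (x \<otimes> p \<nu>, E)) (frag_of ((x \<oplus> \<ominus> y) \<otimes> p \<nu>, E) + frag_of (y \<otimes> p \<nu>, E))"
          using T.tens_add_left[of "(x \<oplus> \<ominus> y) \<otimes> p \<nu>" "y \<otimes> p \<nu>" E] xy pn EL by simp
        then have "T.eqv v (frag_of ((x \<oplus> \<ominus> y) \<otimes> p \<nu>, E) + frag_of (y \<otimes> p \<nu>, E))" using x(2) T.eqv_trans by blast
        from T.eqv_diff[OF this y(2)] show ?case using xmy by (intro bexI[of _ "x \<oplus> \<ominus> y"]) simp_all
      qed
      then show "X \<in> \<theta> ` carrier ?P" using w(2) by (auto simp: \<theta>_def T.cls_eq_iff)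
    qed
  qed
  let ?K = "{x \<in> carrier ?P. \<theta> x = \<zero>\<^bsub>T.Ind\<^esub>}"
  have K: "std_trace D \<Lambda> e gt \<nu> = ?K"
  proof
    show "std_trace D \<Lambda> e gt \<nu> \<subseteq> ?K"
    proof (rule Es.std_trace(3)[OF \<nu> module_hom_kernel[OF \<theta> Pu T.Ind_unital]])
      fix y w \<mu> assume \<mu>: "\<mu> \<in> \<Lambda>" "gt \<mu> \<nu>" and y: "y \<in> carrier D" "y \<otimes> e \<mu> = y"
        and w: "w \<in> carrier D" "e \<mu> \<otimes> w = w" "w \<otimes> e \<nu> = w"
      define v where "v = q \<mu> \<otimes> (w \<otimes> p \<nu>)"
      have v: "v \<in> carrier D" "\<epsilon> \<mu> \<otimes> v = v" "v \<otimes> \<epsilon> \<nu> = v"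
        unfolding v_def using \<mu> \<nu> w pn q[OF \<mu>(1)] by (simp_all add: m_assoc) (simp add: m_assoc[symmetric])
      have "frag_of (v, E) \<in> T.rels"
      proof (rule T.coord_injective)
        show "frag_of (v, E) \<in> T.frags" using v EL by simp
        fix i
        have "b i v \<otimes> \<epsilon> \<nu> = b i v" using b_mult[of v "\<epsilon> \<nu>" i] v \<nu> by simp
        then show "T.coord i (frag_of (v, E)) = \<zero>\<^bsub>?L\<^esub>"
          using coeff_radical[OF \<mu>(1) \<nu> \<mu>(2) v] actE0[of "b i v"] v EL by (simp add: T.coord_of)
      qed
      moreover have "y \<otimes> p \<mu> \<otimes> v = (y \<otimes> w) \<otimes> p \<nu>"
      proof -
        have "y \<otimes> p \<mu> \<otimes> v = y \<otimes> ((p \<mu> \<otimes> q \<mu>) \<otimes> (w \<otimes> p \<nu>))"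
          unfolding v_def using y w pn p[OF \<mu>(1)] q[OF \<mu>(1)] by (simp add: m_assoc)
        also have "\<dots> = y \<otimes> ((e \<mu> \<otimes> w) \<otimes> p \<nu>)"
          using pq[OF \<mu>(1)] m_assoc[OF Es.idem_closed[OF \<mu>(1)] w(1) pn(1)] by simp
        finally show ?thesis using w y pn by (simp add: m_assoc)
      qed
      ultimately have "frag_of ((y \<otimes> w) \<otimes> p \<nu>, E) \<in> T.rels"
        using T.lact_rels[of "y \<otimes> p \<mu>" "frag_of (v, E)"] y p[OF \<mu>(1)] by simp
      then show "y \<otimes> w \<in> ?K" using y w \<nu> by (simp add: \<theta>_def T.cls_eq_zero_iff Pc m_assoc)
    qed
    show "?K \<subseteq> std_trace D \<Lambda> e gt \<nu>"
    proof
      fix x assume "x \<in> ?K"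
      then have x: "x \<in> carrier D" "x \<otimes> e \<nu> = x" and rel: "frag_of (x \<otimes> p \<nu>, E) \<in> T.rels"
        by (auto simp: Pc \<theta>_def T.cls_eq_zero_iff)
      have xp: "x \<otimes> p \<nu> \<in> carrier D" using x pn by simp
      have rad: "b i (x \<otimes> p \<nu>) \<in> BA.rad_proj \<nu>" for i
      proof -
        have "b i (x \<otimes> p \<nu>) \<otimes> \<epsilon> \<nu> = b i (x \<otimes> p \<nu>)"
          using b_mult[of "x \<otimes> p \<nu>" "\<epsilon> \<nu>" i] x pn \<nu> by (simp add: m_assoc)
        moreover have "b i (x \<otimes> p \<nu>) \<odot>\<^bsub>?L\<^esub> E = \<zero>\<^bsub>?L\<^esub>"
          using T.coord_rels[OF rel, of i] T.coord_of[OF xp EL] by simp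
        ultimately show ?thesis using actE0[of "b i (x \<otimes> p \<nu>)"] xp by (simp add: rad_B)
      qed
      have summand: "u i \<otimes> b i (x \<otimes> p \<nu>) \<otimes> q \<nu> \<in> std_trace D \<Lambda> e gt \<nu>" for i
      proof -
        define y where "y = b i (x \<otimes> p \<nu>)"
        have y: "y \<in> B" "y \<in> BA.rad_proj \<nu>" using rad[of i] xp by (simp_all add: y_def)
        have yn: "y \<otimes> \<epsilon> \<nu> = y" using y by (simp add: rad_B)
        obtain ns where ns: "set ns \<subseteq> \<Lambda>" "lsum D (map (\<lambda>\<mu>. \<epsilon> \<mu> \<otimes> y) ns) = y" using local_unit[of y] y(1) by auto
        have in_tr: "u i \<otimes> (\<epsilon> \<mu> \<otimes> y) \<otimes> q \<nu> \<in> std_trace D \<Lambda> e gt \<nu>" if \<mu>: "\<mu> \<in> \<Lambda>" for \<mu>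
        proof (cases "\<epsilon> \<mu> \<otimes> y = \<zero>")
          case True
          then show ?thesis using P.submoduleD(2)[OF Es.std_trace(1)[OF \<nu>]] qn by simp
        next
          case False
          then have gt: "gt \<mu> \<nu>" using rad_B_weights[OF \<nu> y(2) \<mu>] by simp
          have "(u i \<otimes> q \<mu>) \<otimes> (p \<mu> \<otimes> (y \<otimes> q \<nu>)) \<in> std_trace D \<Lambda> e gt \<nu>"
            using y(1) p[OF \<mu>] q[OF \<mu>] qn \<mu> \<nu>
            by (intro Es.std_trace(2)[where gt = gt, OF \<nu> \<mu> gt]) (simp_all add: m_assoc, simp add: m_assoc[symmetric])
          also have "(u i \<otimes> q \<mu>) \<otimes> (p \<mu> \<otimes> (y \<otimes> q \<nu>)) = u i \<otimes> ((q \<mu> \<otimes> p \<mu>) \<otimes> (y \<otimes> q \<nu>))"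
            using y(1) p[OF \<mu>] q[OF \<mu>] qn by (simp add: m_assoc)
          also have "\<dots> = u i \<otimes> (\<epsilon> \<mu> \<otimes> y) \<otimes> q \<nu>" using qp[OF \<mu>] \<mu> y(1) qn by (simp add: m_assoc)
          finally show ?thesis .
        qed
        have cl: "\<epsilon> \<mu> \<otimes> y \<in> carrier D" if "\<mu> \<in> set ns" for \<mu> using that ns(1) y(1) by auto
        have "u i \<otimes> y = lsum D (map (\<lambda>\<mu>. u i \<otimes> (\<epsilon> \<mu> \<otimes> y)) ns)"
          using lsum_mult_left[of "u i" ns "\<lambda>\<mu>. \<epsilon> \<mu> \<otimes> y", OF u_closed cl] ns(2) by simp
        then have "u i \<otimes> y \<otimes> q \<nu> = lsum D (map (\<lambda>\<mu>. u i \<otimes> (\<epsilon> \<mu> \<otimes> y)) ns) \<otimes> q \<nu>" by simp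
        also have "\<dots> = lsum D (map (\<lambda>\<mu>. u i \<otimes> (\<epsilon> \<mu> \<otimes> y) \<otimes> q \<nu>) ns)"
          using cl by (intro lsum_mult_right qn) auto
        finally have "u i \<otimes> y \<otimes> q \<nu> = lsum D (map (\<lambda>\<mu>. u i \<otimes> (\<epsilon> \<mu> \<otimes> y) \<otimes> q \<nu>) ns)" .
        also have "\<dots> \<in> std_trace D \<Lambda> e gt \<nu>"
          by (rule Es.submodule_lsum[OF \<nu> Es.std_trace(1)[OF \<nu>]]) (use in_tr ns(1) in blast)
        finally show ?thesis unfolding y_def .
      qed
      obtain "is" where "is": "x \<otimes> p \<nu> = lsum D (map (\<lambda>i. u i \<otimes> b i (x \<otimes> p \<nu>)) is)"
        using dual_expansion[of "{x \<otimes> p \<nu>}"] xp by auto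
      have "x = x \<otimes> p \<nu> \<otimes> q \<nu>" using x pn qn pq[OF \<nu>] by (simp add: m_assoc)
      also have "\<dots> = lsum D (map (\<lambda>i. u i \<otimes> b i (x \<otimes> p \<nu>)) is) \<otimes> q \<nu>" using "is" by simp
      also have "\<dots> = lsum D (map (\<lambda>i. u i \<otimes> b i (x \<otimes> p \<nu>) \<otimes> q \<nu>) is)"
        using xp qn by (intro lsum_mult_right) auto
      also have "\<dots> \<in> std_trace D \<Lambda> e gt \<nu>"
        using summand by (intro Es.submodule_lsum[OF \<nu> Es.std_trace(1)[OF \<nu>]])
      finally show "x \<in> std_trace D \<Lambda> e gt \<nu>" .
    qed
  qed
  have "module_iso D (std_module D \<Lambda> e gt \<nu>) T.Ind"
    unfolding std_module_def using first_isomorphism[OF \<theta> Pu T.Ind_unital surj K] .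
  moreover have "unital_module D (std_module D \<Lambda> e gt \<nu>)"
    unfolding std_module_def by (rule P.quotient_unital_module[OF Es.std_trace(1)[OF \<nu>]])
  ultimately show ?thesis by (rule module_iso_sym)
qed

theorem strong_exact_borel: "strong_exact_borel T D \<Lambda> e gt B"
proof -
  have "idem_span \<subseteq> B" by (rule idem_span_least[OF B_sub \<epsilon>_B])
  then show ?thesis
    unfolding strong_exact_borel_def exact_borel_def
    using B_sub Es.simples_indexed BA.simples_indexed directed induction_exact induced_simple idem_span_maximal
    by blast
qed

end

section \<open>Path algebras\<close>

abbreviation lk where "lk \<equiv> Poly_Mapping.lookup"
abbreviation sg where "sg \<equiv> Poly_Mapping.single"
abbreviation sc :: "'k::comm_ring_1 \<Rightarrow> ('x \<Rightarrow>\<^sub>0 'k) \<Rightarrow> ('x \<Rightarrow>\<^sub>0 'k)" where "sc c \<equiv> Poly_Mapping.map ((*) c)"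

lemma lookup_sc [simp]: "lk (sc c f) x = c * lk f x"
  by (simp add: Poly_Mapping.map.rep_eq when_def)

lemma sc_simps: "sc (c + d) f = sc c f + sc d f" "sc c (f + g) = sc c f + sc c g" "sc 0 f = 0" "sc c 0 = 0"
  "sc c (sg p d) = sg p (c * d)" "sc 1 f = f"
  by (rule poly_mapping_eqI; simp add: lookup_add algebra_simps lookup_single when_def)+

lemma map_zero_fun [simp]: "Poly_Mapping.map (\<lambda>a. 0) f = 0"
  by (rule poly_mapping_eqI) (simp add: Poly_Mapping.map.rep_eq when_def)

lemma keys_sc: "Poly_Mapping.keys (sc c f) \<subseteq> Poly_Mapping.keys f"
  by (auto simp: in_keys_iff)

lemma poly_mapping_additive_induct [consumes 1, case_names zero single add]:
  assumes "Poly_Mapping.keys f \<subseteq> S" "P 0" "\<And>p c. p \<in> S \<Longrightarrow> P (sg p c)"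
    "\<And>f g. Poly_Mapping.keys f \<subseteq> S \<Longrightarrow> Poly_Mapping.keys g \<subseteq> S \<Longrightarrow> P f \<Longrightarrow> P g \<Longrightarrow> P (f + g)"
  shows "P (f :: 'x \<Rightarrow>\<^sub>0 'k::comm_ring_1)"
proof -
  have ks: "Poly_Mapping.keys (\<Sum>p\<in>A. sg p (lk f p)) \<subseteq> S" if "finite A" "A \<subseteq> S" for A
    using that by (induction A rule: finite_induct) (auto dest!: subsetD[OF Poly_Mapping.keys_add] split: if_splits)
  have "P (\<Sum>p\<in>A. sg p (lk f p))" if "finite A" "A \<subseteq> S" for A
    using that
  proof (induction A rule: finite_induct)
    case (insert p A)
    then have "P (sg p (lk f p) + (\<Sum>p\<in>A. sg p (lk f p)))"
      using ks[of A] by (intro assms(4)) (auto intro: assms(3) split: if_splits)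
    then show ?case using insert by simp
  qed (simp add: assms(2))
  then have "P (\<Sum>p\<in>Poly_Mapping.keys f. sg p (lk f p))" using assms(1) by simp
  moreover have "(\<Sum>p\<in>Poly_Mapping.keys f. sg p (lk f p)) = f"
  proof (rule poly_mapping_eqI)
    fix x
    have "lk (\<Sum>p\<in>Poly_Mapping.keys f. sg p (lk f p)) x = (\<Sum>p\<in>Poly_Mapping.keys f. lk (sg p (lk f p)) x)"
      by (simp add: Poly_Mapping.lookup_sum)
    also have "\<dots> = (\<Sum>p\<in>Poly_Mapping.keys f. if p = x then lk f x else 0)"
      by (rule sum.cong) (auto simp: lookup_single when_def)
    also have "\<dots> = lk f x" by (simp add: in_keys_iff)
    finally show "lk (\<Sum>p\<in>Poly_Mapping.keys f. sg p (lk f p)) x = lk f x" .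
  qed
  ultimately show ?thesis by simp
qed

lemma (in pre_digraph) cas_append_ex: "cas u (p @ q) w \<longleftrightarrow> (\<exists>v. cas u p v \<and> cas v q w)"
  by (induction p arbitrary: u) auto

lemma (in pre_digraph) cas_unique: "cas u p v \<Longrightarrow> cas u p w \<Longrightarrow> v = w"
  by (induction p arbitrary: u) auto

lemma (in wf_digraph) cas_end: "u \<in> verts G \<Longrightarrow> set p \<subseteq> arcs G \<Longrightarrow> cas u p v \<Longrightarrow> v \<in> verts G"
  by (induction p arbitrary: u) (auto intro: head_in_verts)

text \<open>The parameter \<open>dummy\<close> fixes the field of coefficients, of which the quiver knows nothing.\<close>

locale quiver_algebra =
  fixes Q :: "('v, 'q) pre_digraph" and dummy :: "'k::field"
  assumes fin: "fin_digraph Q"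
begin

interpretation fin_digraph Q by (rule fin)

abbreviation PA :: "('k, 'v \<times> 'q list \<Rightarrow>\<^sub>0 'k) module" where "PA \<equiv> path_algebra Q"
abbreviation pmul (infixl \<open>\<cdot>\<close> 70) where "f \<cdot> g \<equiv> f \<otimes>\<^bsub>PA\<^esub> g"
abbreviation comp where "comp q p \<equiv> awalk (fst p) (snd p) (fst q)"

lemma PA_simps [simp]: "carrier PA = {f. Poly_Mapping.keys f \<subseteq> qpaths Q}" "\<zero>\<^bsub>PA\<^esub> = 0" "f \<oplus>\<^bsub>PA\<^esub> g = f + g"
  "c \<odot>\<^bsub>PA\<^esub> f = sc c f" "\<one>\<^bsub>PA\<^esub> = (\<Sum>v\<in>verts Q. sg (v, []) 1)"
  by (simp_all add: path_algebra_def)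

lemma pmul_superset:
  assumes "finite A" "Poly_Mapping.keys f \<subseteq> A" "finite B" "Poly_Mapping.keys g \<subseteq> B"
  shows "f \<cdot> g = (\<Sum>q\<in>A. \<Sum>p\<in>B. sc (lk f q * lk g p) (path_mult Q q p))"
proof -
  have "f \<cdot> g = (\<Sum>q\<in>Poly_Mapping.keys f. \<Sum>p\<in>Poly_Mapping.keys g. sc (lk f q * lk g p) (path_mult Q q p))"
    by (simp add: path_algebra_def)
  also have "\<dots> = (\<Sum>q\<in>Poly_Mapping.keys f. \<Sum>p\<in>B. sc (lk f q * lk g p) (path_mult Q q p))"
    using assms by (intro sum.cong refl sum.mono_neutral_left) (auto simp: in_keys_iff sc_simps)
  also have "\<dots> = (\<Sum>q\<in>A. \<Sum>p\<in>B. sc (lk f q * lk g p) (path_mult Q q p))"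
    using assms by (intro sum.mono_neutral_left) (auto simp: in_keys_iff sc_simps)
  finally show ?thesis .
qed

lemma pmul_add_left: "(f + f') \<cdot> g = f \<cdot> g + f' \<cdot> g"
proof -
  let ?A = "Poly_Mapping.keys f \<union> Poly_Mapping.keys f'" and ?B = "Poly_Mapping.keys g"
  have "Poly_Mapping.keys (f + f') \<subseteq> ?A" by (rule Poly_Mapping.keys_add)
  then show ?thesis
    using pmul_superset[of ?A f ?B g] pmul_superset[of ?A f' ?B g] pmul_superset[of ?A "f + f'" ?B g]
    by (simp add: lookup_add distrib_right sc_simps sum.distrib)
qed

lemma pmul_add_right: "g \<cdot> (f + f') = g \<cdot> f + g \<cdot> f'"
proof -
  let ?A = "Poly_Mapping.keys f \<union> Poly_Mapping.keys f'" and ?B = "Poly_Mapping.keys g"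
  have "Poly_Mapping.keys (f + f') \<subseteq> ?A" by (rule Poly_Mapping.keys_add)
  then show ?thesis
    using pmul_superset[of ?B g ?A f] pmul_superset[of ?B g ?A f'] pmul_superset[of ?B g ?A "f + f'"]
    by (simp add: lookup_add distrib_left sc_simps sum.distrib)
qed

lemma pmul_zero [simp]: "0 \<cdot> f = 0" "f \<cdot> 0 = 0"
  by (simp_all add: path_algebra_def)

lemma pmul_single: "sg q c \<cdot> sg p d = (if comp q p then sg (fst p, snd p @ snd q) (c * d) else 0)"
  using pmul_superset[of "{q}" "sg q c" "{p}" "sg p d"] by (simp add: path_mult_def sc_simps)

lemma pmul_sum_left: "finite A \<Longrightarrow> sum h A \<cdot> g = (\<Sum>x\<in>A. h x \<cdot> g)"
  by (induction A rule: finite_induct) (auto simp: pmul_add_left)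

lemma pmul_sum_right: "finite A \<Longrightarrow> g \<cdot> sum h A = (\<Sum>x\<in>A. g \<cdot> h x)"
  by (induction A rule: finite_induct) (auto simp: pmul_add_right)

lemma qpath_iff: "p \<in> qpaths Q \<longleftrightarrow> fst p \<in> verts Q \<and> set (snd p) \<subseteq> arcs Q \<and> (\<exists>v. cas (fst p) (snd p) v)"
  by (cases p) (auto simp: qpaths_def awalk_def)

lemma comp_iff: "p \<in> qpaths Q \<Longrightarrow> comp q p \<longleftrightarrow> cas (fst p) (snd p) (fst q)"
  by (auto simp: qpath_iff awalk_def)

lemma awalk_iff_cas: "(w, p) \<in> qpaths Q \<Longrightarrow> awalk w p v \<longleftrightarrow> cas w p v"
  by (auto simp: qpath_iff awalk_def)

lemma comp_path: "p \<in> qpaths Q \<Longrightarrow> q \<in> qpaths Q \<Longrightarrow> comp q p \<Longrightarrow> (fst p, snd p @ snd q) \<in> qpaths Q"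
  by (auto simp: qpath_iff awalk_def cas_append_ex)

lemmas carrier_induct = poly_mapping_additive_induct[of _ "qpaths Q", consumes 1, case_names zero single add]

lemma carrier_add: "f \<in> carrier PA \<Longrightarrow> g \<in> carrier PA \<Longrightarrow> f + g \<in> carrier PA"
  using Poly_Mapping.keys_add[of f g] by auto

lemma carrier_zero: "0 \<in> carrier PA"
  by simp

text \<open>A bilinear statement about the path algebra only has to be checked on paths.\<close>

lemma bilinear_induct [consumes 2, case_names zero1 zero2 add1 add2 single]:
  assumes "f \<in> carrier PA" "g \<in> carrier PA"
    and z1: "\<And>g. P 0 g" and z2: "\<And>f. P f 0"
    and a1: "\<And>f f' g. f \<in> carrier PA \<Longrightarrow> f' \<in> carrier PA \<Longrightarrow> P f g \<Longrightarrow> P f' g \<Longrightarrow> P (f + f') g"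
    and a2: "\<And>f g g'. g \<in> carrier PA \<Longrightarrow> g' \<in> carrier PA \<Longrightarrow> P f g \<Longrightarrow> P f g' \<Longrightarrow> P f (g + g')"
    and s: "\<And>q p c d. q \<in> qpaths Q \<Longrightarrow> p \<in> qpaths Q \<Longrightarrow> P (sg q c) (sg p d)"
  shows "P f g"
proof -
  have f: "Poly_Mapping.keys f \<subseteq> qpaths Q" and g: "Poly_Mapping.keys g \<subseteq> qpaths Q" using assms(1,2) by auto
  show ?thesis
    using f
  proof (induction f rule: carrier_induct)
    case (single q c)
    show ?case using g by (induction g rule: carrier_induct) (use z2 s single a2 in auto)
  qed (use z1 a1 in auto)
qed

lemma carrier_mult: "f \<in> carrier PA \<Longrightarrow> g \<in> carrier PA \<Longrightarrow> f \<cdot> g \<in> carrier PA"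
proof (induction f g rule: bilinear_induct)
  case (single q p c d)
  then show ?case using comp_path by (auto simp: pmul_single)
qed (auto simp: pmul_add_left pmul_add_right simp del: PA_simps intro: carrier_add, simp_all)

lemma pmul_assoc:
  assumes "f \<in> carrier PA" "g \<in> carrier PA" "h \<in> carrier PA" shows "(f \<cdot> g) \<cdot> h = f \<cdot> (g \<cdot> h)"
proof -
  have *: "(sg r a \<cdot> sg q c) \<cdot> sg p d = sg r a \<cdot> (sg q c \<cdot> sg p d)"
    if "r \<in> qpaths Q" "q \<in> qpaths Q" "p \<in> qpaths Q" for r q p :: "'v \<times> 'q list" and a c d :: 'k
    using that comp_path[of q r] comp_path[of p q]
    by (auto simp: pmul_single comp_iff awalk_iff_cas cas_append_ex mult.assoc simp del: cas_append_iff awalk_append_iff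
        dest: cas_unique)
  have h: "Poly_Mapping.keys h \<subseteq> qpaths Q" using assms by simp
  show ?thesis
    using assms(1,2)
  proof (induction f g rule: bilinear_induct)
    case (single r q a c)
    show ?case using h by (induction h rule: carrier_induct) (use * single in \<open>auto simp: pmul_add_right\<close>)
  qed (auto simp: pmul_add_left pmul_add_right)
qed

lemma one_carrier: "\<one>\<^bsub>PA\<^esub> \<in> carrier PA"
proof -
  have "(\<Sum>v\<in>A. sg (v, []) 1 :: _ \<Rightarrow>\<^sub>0 'k) \<in> carrier PA" if "finite A" "A \<subseteq> verts Q" for A
    using that
  proof (induction A rule: finite_induct)
    case (insert v A)
    have "(sg (v, []) 1 :: _ \<Rightarrow>\<^sub>0 'k) \<in> carrier PA" using insert by (auto simp: qpath_iff)
    from carrier_add[OF this insert.IH] insert show ?case by simp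
  qed simp
  from this[of "verts Q"] show ?thesis by simp
qed

lemma vertex_mult:
  assumes "p \<in> qpaths Q"
  shows "sg (v, []) a \<cdot> sg p c = (if cas (fst p) (snd p) v then sg p (a * c) else 0)"
    and "sg p c \<cdot> sg (v, []) a = (if v = fst p then sg p (c * a) else 0)"
  using assms by (cases p; auto simp: pmul_single qpath_iff awalk_def)+

lemma one_mult: assumes "f \<in> carrier PA" shows "\<one>\<^bsub>PA\<^esub> \<cdot> f = f" "f \<cdot> \<one>\<^bsub>PA\<^esub> = f"
proof -
  have f: "Poly_Mapping.keys f \<subseteq> qpaths Q" using assms by simp
  have "\<one>\<^bsub>PA\<^esub> \<cdot> f = f \<and> f \<cdot> \<one>\<^bsub>PA\<^esub> = f"
    using f
  proof (induction f rule: carrier_induct)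
    case (single p c)
    obtain w where w: "cas (fst p) (snd p) w" using single by (auto simp: qpath_iff)
    have wV: "w \<in> verts Q" "fst p \<in> verts Q" using cas_end w single by (auto simp: qpath_iff)
    have "(\<Sum>v\<in>verts Q. sg (v, []) 1) \<cdot> sg p c = (\<Sum>v\<in>verts Q. if v = w then sg p c else 0)"
      unfolding pmul_sum_left[OF finite_verts]
      using w by (intro sum.cong) (auto simp: vertex_mult[OF single] dest: cas_unique)
    moreover have "sg p c \<cdot> (\<Sum>v\<in>verts Q. sg (v, []) 1) = (\<Sum>v\<in>verts Q. if v = fst p then sg p c else 0)"
      unfolding pmul_sum_right[OF finite_verts]
      by (intro sum.cong) (auto simp: vertex_mult[OF single])
    ultimately show ?case using wV finite_verts by simp
  qed (auto simp: pmul_add_left pmul_add_right)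
  then show "\<one>\<^bsub>PA\<^esub> \<cdot> f = f" "f \<cdot> \<one>\<^bsub>PA\<^esub> = f" by auto
qed

lemma path_ring: "ring PA"
proof (rule ringI)
  show "abelian_group PA"
  proof (rule abelian_groupI)
    show "\<exists>g\<in>carrier PA. g \<oplus>\<^bsub>PA\<^esub> f = \<zero>\<^bsub>PA\<^esub>" if "f \<in> carrier PA" for f
      using that by (intro bexI[of _ "- f"]) auto
  qed (use carrier_add in \<open>auto simp: ac_simps simp del: PA_simps(1)\<close>, simp_all)
  show "Group.monoid PA"
    by (rule monoidI) (use carrier_mult one_carrier pmul_assoc one_mult in \<open>auto simp del: PA_simps\<close>)
qed (auto simp: pmul_add_left pmul_add_right)

lemma path_idealI:
  assumes sub: "I \<subseteq> carrier PA" and z: "0 \<in> I" and add: "\<And>f g. f \<in> I \<Longrightarrow> g \<in> I \<Longrightarrow> f + g \<in> I"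
    and neg: "\<And>f. f \<in> I \<Longrightarrow> - f \<in> I"
    and mult: "\<And>f g. f \<in> I \<Longrightarrow> g \<in> carrier PA \<Longrightarrow> g \<cdot> f \<in> I" "\<And>f g. f \<in> I \<Longrightarrow> g \<in> carrier PA \<Longrightarrow> f \<cdot> g \<in> I"
  shows "ideal I PA"
proof (rule idealI[OF path_ring])
  interpret ring PA by (rule path_ring)
  show "subgroup I (add_monoid PA)"
  proof (rule subgroup.intro)
    show "inv\<^bsub>add_monoid PA\<^esub> f \<in> I" if f: "f \<in> I" for f
    proof -
      have "f \<in> carrier PA" "- f \<in> carrier PA" using f neg sub by auto
      then have "\<ominus>\<^bsub>PA\<^esub> f = - f" using minus_equality[of "- f" f] by simp
      then show ?thesis using neg[OF f] by (simp add: a_inv_def)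
    qed
  qed (use sub z add in auto)
qed (use mult in auto)

lemma genideal_subset: "ideal I PA \<Longrightarrow> R \<subseteq> I \<Longrightarrow> genideal PA R \<subseteq> I"
  unfolding genideal_def by blast

lemma genideal_superset: "R \<subseteq> genideal PA R"
  unfolding genideal_def by blast

text \<open>Concatenation yields a trivial path only from two equal trivial paths.\<close>

lemma lookup_vertex_mult:
  assumes "f \<in> carrier PA" "g \<in> carrier PA"
  shows "lk (f \<cdot> g) (v, []) = lk f (v, []) * lk g (v, [])"
  using assms
proof (induction f g rule: bilinear_induct)
  case (single q p c d)
  then show ?case
    by (cases p; cases q) (auto simp: pmul_single lookup_single when_def awalk_def qpath_iff)
qed (auto simp: pmul_add_left pmul_add_right lookup_add algebra_simps)

end

subsection \<open>Algebras presented by a quiver with additional sinks\<close>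

text \<open>The properties of the extended algebra on which everything else rests; \<open>V\<^sub>1\<close> is the set of old vertices.
  The assumption \<open>source\<close> reflects the additional arrow that starts at each old vertex, and \<open>sink\<close> the
  absence of arrows that start at an added one.\<close>

locale tilde_algebra = k_algebra scl for scl :: "'k::field \<Rightarrow> 'a::ring_1 \<Rightarrow> 'a" +
  fixes V V\<^sub>1 :: "'v set" and e :: "'v \<Rightarrow> 'a" and \<chi> :: "'v \<Rightarrow> 'a \<Rightarrow> 'k"
  assumes V_finite: "finite V" and V\<^sub>1_subset: "V\<^sub>1 \<subseteq> V" and V\<^sub>1_nonempty: "V\<^sub>1 \<noteq> {}"
    and e_orth: "v \<in> V \<Longrightarrow> w \<in> V \<Longrightarrow> e v * e w = (if v = w then e v else 0)"
    and e_sum: "(\<Sum>v\<in>V. e v) = 1"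
    and char_add: "v \<in> V \<Longrightarrow> \<chi> v (x + y) = \<chi> v x + \<chi> v y"
    and char_mult: "v \<in> V \<Longrightarrow> \<chi> v (x * y) = \<chi> v x * \<chi> v y"
    and char_scl: "v \<in> V \<Longrightarrow> \<chi> v (scl c x) = c * \<chi> v x"
    and char_e: "v \<in> V \<Longrightarrow> w \<in> V \<Longrightarrow> \<chi> v (e w) = (if v = w then 1 else 0)"
    and radical_eq: "jacobson_radical = {x. \<forall>v\<in>V. \<chi> v x = 0}"
    and radical_nilpotent: "\<exists>m. rad_pow m = ({0} :: 'a set)"
    and finite_span: "\<exists>X. finite X \<and> module.span scl X = UNIV"
    and source: "v \<in> V\<^sub>1 \<Longrightarrow> (\<And>y. y \<in> jacobson_radical \<Longrightarrow> y * x = 0) \<Longrightarrow> e v * x = 0"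
    and sink: "v \<in> V \<Longrightarrow> v \<notin> V\<^sub>1 \<Longrightarrow> y \<in> jacobson_radical \<Longrightarrow> y * e v = 0"

lemma fin_digraph_tilde: assumes "fin_digraph Q" shows "fin_digraph (tilde_quiver Q)"
proof -
  interpret fin_digraph Q by fact
  show ?thesis by unfold_locales (auto simp: tilde_quiver_def)
qed

lemma tilde_quiver_simps [simp]:
  "verts (tilde_quiver Q) = verts Q <+> verts Q" "arcs (tilde_quiver Q) = arcs Q <+> verts Q"
  "tail (tilde_quiver Q) (Inl a) = Inl (tail Q a)" "tail (tilde_quiver Q) (Inr v) = Inl v"
  "head (tilde_quiver Q) (Inl a) = Inl (head Q a)" "head (tilde_quiver Q) (Inr v) = Inr v"
  by (simp_all add: tilde_quiver_def)

lemma tilde_cas_Inl: "pre_digraph.cas (tilde_quiver Q) (Inl u) (map Inl p) (Inl v) \<longleftrightarrow> pre_digraph.cas Q u p v"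
  by (induction p arbitrary: u) (auto simp: pre_digraph.cas.simps)

lemma tilde_cas_Inr: "pre_digraph.cas (tilde_quiver Q) (Inr u) p v \<Longrightarrow> p = []"
proof (cases p)
  case (Cons a q)
  then show "pre_digraph.cas (tilde_quiver Q) (Inr u) p v \<Longrightarrow> p = []"
    by (cases a) (auto simp: pre_digraph.cas.simps)
qed auto

text \<open>Added vertices are sinks, so an additional arrow can only come last.\<close>

lemma tilde_path_cases:
  assumes "pre_digraph.cas (tilde_quiver Q) (Inl u) p v"
  shows "\<exists>p'. p = map Inl p' \<or> (\<exists>k. p = map Inl p' @ [Inr k])"
  using assms
proof (induction p arbitrary: u)
  case Nil then show ?case by (intro exI[of _ "[]"]) simp
next
  case (Cons a p)
  show ?case
  proof (cases a)
    case (Inl a')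
    then have "pre_digraph.cas (tilde_quiver Q) (Inl (head Q a')) p v"
      using Cons.prems by (simp add: pre_digraph.cas.simps)
    then obtain p' where "p = map Inl p' \<or> (\<exists>k. p = map Inl p' @ [Inr k])" using Cons.IH by blast
    then show ?thesis using Inl by (intro exI[of _ "a' # p'"]) auto
  next
    case (Inr k)
    then have "p = []" using Cons.prems tilde_cas_Inr by (auto simp: pre_digraph.cas.simps)
    then show ?thesis using Inr by (intro exI[of _ "[]"]) auto
  qed
qed

locale tilde_presentation =
  fixes Q :: "('v, 'q) pre_digraph"
    and R :: "('v \<times> 'q list \<Rightarrow>\<^sub>0 'k::field) set" and scl :: "'k \<Rightarrow> 'a::ring_1 \<Rightarrow> 'a"
    and \<phi> :: "(('v + 'v) \<times> ('q + 'v) list \<Rightarrow>\<^sub>0 'k) \<Rightarrow> 'a"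
  assumes fin: "fin_digraph Q"
    and adm: "admissible_relations Q R"
    and pres: "presentation (tilde_quiver Q) (tilde_relation ` R) scl \<phi>"
begin

sublocale P: quiver_algebra Q "0 :: 'k"
  by (rule quiver_algebra.intro[OF fin])

sublocale T: quiver_algebra "tilde_quiver Q" "0 :: 'k"
  by (rule quiver_algebra.intro[OF fin_digraph_tilde[OF fin]])

sublocale k_algebra scl using pres by (simp add: presentation_def)

lemma \<phi>_hom:
  shows \<phi>_add: "f \<in> carrier T.PA \<Longrightarrow> g \<in> carrier T.PA \<Longrightarrow> \<phi> (f + g) = \<phi> f + \<phi> g"
    and \<phi>_mult: "f \<in> carrier T.PA \<Longrightarrow> g \<in> carrier T.PA \<Longrightarrow> \<phi> (f \<otimes>\<^bsub>T.PA\<^esub> g) = \<phi> f * \<phi> g"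
    and \<phi>_one: "\<phi> \<one>\<^bsub>T.PA\<^esub> = 1"
    and \<phi>_sc: "f \<in> carrier T.PA \<Longrightarrow> \<phi> (sc c f) = scl c (\<phi> f)"
    and \<phi>_surj: "\<exists>f\<in>carrier T.PA. \<phi> f = x"
    and \<phi>_ker: "f \<in> carrier T.PA \<Longrightarrow> \<phi> f = 0 \<longleftrightarrow> f \<in> genideal T.PA (tilde_relation ` R)"
proof -
  have hom: "\<phi> \<in> ring_hom T.PA type_ring" using pres by (simp add: presentation_def)
  show "f \<in> carrier T.PA \<Longrightarrow> g \<in> carrier T.PA \<Longrightarrow> \<phi> (f + g) = \<phi> f + \<phi> g"
    using ring_hom_add[OF hom, of f g] by (simp add: type_ring_def)
  show "f \<in> carrier T.PA \<Longrightarrow> g \<in> carrier T.PA \<Longrightarrow> \<phi> (f \<otimes>\<^bsub>T.PA\<^esub> g) = \<phi> f * \<phi> g"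
    using ring_hom_mult[OF hom, of f g] by (simp add: type_ring_def)
  show "\<phi> \<one>\<^bsub>T.PA\<^esub> = 1"
    using ring_hom_one[OF hom] by (simp add: type_ring_def del: T.PA_simps)
  show "f \<in> carrier T.PA \<Longrightarrow> \<phi> (sc c f) = scl c (\<phi> f)"
    using pres by (auto simp: presentation_def)
  show "\<exists>f\<in>carrier T.PA. \<phi> f = x"
  proof -
    have "x \<in> \<phi> ` carrier T.PA" using pres unfolding presentation_def by blast
    then show ?thesis by blast
  qed
  have "a_kernel T.PA type_ring \<phi> = genideal T.PA (tilde_relation ` R)"
    using pres by (simp add: presentation_def)
  then have "{f \<in> carrier T.PA. \<phi> f = 0} = genideal T.PA (tilde_relation ` R)"
    by (simp add: a_kernel_def' type_ring_def)
  then show "f \<in> carrier T.PA \<Longrightarrow> \<phi> f = 0 \<longleftrightarrow> f \<in> genideal T.PA (tilde_relation ` R)" by blast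
qed

lemma \<phi>_zero: "\<phi> 0 = 0" using \<phi>_add[of 0 0] by simp

lemma \<phi>_minus: "f \<in> carrier T.PA \<Longrightarrow> \<phi> (- f) = - \<phi> f"
  using minus_unique[of "\<phi> f" "\<phi> (- f)"] \<phi>_add[of f "- f"] \<phi>_zero by simp

lemma \<phi>_sum: "finite A \<Longrightarrow> (\<And>x. x \<in> A \<Longrightarrow> h x \<in> carrier T.PA) \<Longrightarrow>
    sum h A \<in> carrier T.PA \<and> \<phi> (sum h A) = (\<Sum>x\<in>A. \<phi> (h x))"
proof (induction A rule: finite_induct)
  case (insert x A)
  then show ?case using T.carrier_add[of "h x" "sum h A"] \<phi>_add[of "h x" "sum h A"] by (simp del: T.PA_simps)
qed (simp add: \<phi>_zero)

lemma R_paths: "r \<in> R \<Longrightarrow> Poly_Mapping.keys r \<subseteq> qpaths Q" "r \<in> R \<Longrightarrow> p \<in> Poly_Mapping.keys r \<Longrightarrow> 2 \<le> length (snd p)"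
  using adm unfolding admissible_relations_def by auto

definition \<iota> :: "'v \<times> 'q list \<Rightarrow> ('v + 'v) \<times> ('q + 'v) list" where
  "\<iota> p = (Inl (fst p), map Inl (snd p))"

lemma \<iota>_path: "p \<in> qpaths Q \<Longrightarrow> \<iota> p \<in> qpaths (tilde_quiver Q)"
proof -
  assume p: "p \<in> qpaths Q"
  then obtain v where "pre_digraph.cas Q (fst p) (snd p) v" by (auto simp: P.qpath_iff)
  then have "pre_digraph.cas (tilde_quiver Q) (Inl (fst p)) (map Inl (snd p)) (Inl v)" by (simp add: tilde_cas_Inl)
  then show ?thesis using p by (auto simp: P.qpath_iff T.qpath_iff \<iota>_def)
qed

lemma tilde_relation_superset:
  fixes f :: "'v \<times> 'q list \<Rightarrow>\<^sub>0 'k"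
  shows "finite A \<Longrightarrow> Poly_Mapping.keys f \<subseteq> A \<Longrightarrow> tilde_relation f = (\<Sum>p\<in>A. sg (\<iota> p) (lk f p))"
  unfolding tilde_relation_def \<iota>_def by (intro sum.mono_neutral_left) (auto simp: in_keys_iff)

lemma tilde_relation_add: "tilde_relation (f + g :: 'v \<times> 'q list \<Rightarrow>\<^sub>0 'k) = tilde_relation f + tilde_relation g"
proof -
  let ?A = "Poly_Mapping.keys f \<union> Poly_Mapping.keys g"
  have "Poly_Mapping.keys (f + g) \<subseteq> ?A" by (rule Poly_Mapping.keys_add)
  then show ?thesis
    using tilde_relation_superset[of ?A f] tilde_relation_superset[of ?A g] tilde_relation_superset[of ?A "f + g"]
    by (simp add: lookup_add single_add sum.distrib)
qed

lemma tilde_relation_zero: "tilde_relation (0 :: 'v \<times> 'q list \<Rightarrow>\<^sub>0 'k) = 0" by (simp add: tilde_relation_def)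

lemma tilde_relation_minus: "tilde_relation (- f :: 'v \<times> 'q list \<Rightarrow>\<^sub>0 'k) = - tilde_relation f"
  using minus_unique[of "tilde_relation f" "tilde_relation (- f)"] tilde_relation_add[of f "- f"] tilde_relation_zero
  by simp

lemma tilde_relation_single: "tilde_relation (sg p c :: 'v \<times> 'q list \<Rightarrow>\<^sub>0 'k) = sg (\<iota> p) c"
  using tilde_relation_superset[of "{p}" "sg p c"] by simp

lemma tilde_relation_carrier: "f \<in> carrier P.PA \<Longrightarrow> tilde_relation f \<in> carrier T.PA"
proof -
  assume "f \<in> carrier P.PA"
  then have "Poly_Mapping.keys f \<subseteq> qpaths Q" by simp
  then show ?thesis
  proof (induction f rule: P.carrier_induct)
    case (add f g)
    then show ?case using T.carrier_add by (simp add: tilde_relation_add del: T.PA_simps)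
  qed (auto simp: tilde_relation_zero tilde_relation_single \<iota>_path)
qed

lemma tilde_relation_mult:
  assumes "f \<in> carrier P.PA" "g \<in> carrier P.PA"
  shows "tilde_relation (f \<otimes>\<^bsub>P.PA\<^esub> g) = tilde_relation f \<otimes>\<^bsub>T.PA\<^esub> tilde_relation g"
  using assms
proof (induction f g rule: P.bilinear_induct)
  case (single q p c d)
  have "T.comp (\<iota> q) (\<iota> p) \<longleftrightarrow> P.comp q p"
    using single \<iota>_path by (simp add: P.comp_iff T.comp_iff) (simp add: \<iota>_def tilde_cas_Inl)
  then show ?case
    by (simp add: P.pmul_single T.pmul_single tilde_relation_single tilde_relation_zero) (simp add: \<iota>_def)
qed (auto simp: P.pmul_add_left P.pmul_add_right T.pmul_add_left T.pmul_add_right tilde_relation_add tilde_relation_zero)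

lemma \<phi>_relation: "r \<in> R \<Longrightarrow> \<phi> (tilde_relation r) = 0"
  using \<phi>_ker[of "tilde_relation r"] tilde_relation_carrier R_paths T.genideal_superset[of "tilde_relation ` R"] by auto

lemma \<phi>_genideal: assumes "f \<in> genideal P.PA R" shows "\<phi> (tilde_relation f) = 0"
proof -
  let ?I = "{f \<in> carrier P.PA. \<phi> (tilde_relation f) = 0}"
  have "ideal ?I P.PA"
  proof (rule P.path_idealI)
    show "f + g \<in> ?I" if "f \<in> ?I" "g \<in> ?I" for f g
      using that P.carrier_add[of f g] \<phi>_add tilde_relation_carrier
      by (simp add: tilde_relation_add del: P.PA_simps T.PA_simps)
    show "- f \<in> ?I" if "f \<in> ?I" for f
      using that tilde_relation_carrier[of f] by (auto simp: tilde_relation_minus \<phi>_minus simp del: T.PA_simps)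
  qed (use P.carrier_zero P.carrier_mult \<phi>_mult tilde_relation_mult tilde_relation_carrier in
      \<open>auto simp: tilde_relation_zero \<phi>_zero simp del: P.PA_simps(1) T.PA_simps(1)\<close>)
  moreover have "R \<subseteq> ?I" using \<phi>_relation R_paths by auto
  ultimately show ?thesis using P.genideal_subset assms by blast
qed

subsection \<open>Stripping a final sink arrow\<close>

text \<open>This is a left inverse of the multiplication by the arrow \<open>k \<rightarrow> Inr k\<close> from the left. Its purpose is to
  show that an element of the presented algebra annihilated by this multiplication is annihilated by \<open>e\<^sub>k\<close>.\<close>

definition strip :: "'v \<Rightarrow> (('v + 'v) \<times> ('q + 'v) list \<Rightarrow>\<^sub>0 'k) \<Rightarrow> (('v + 'v) \<times> ('q + 'v) list \<Rightarrow>\<^sub>0 'k)" where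
  "strip k f = (\<Sum>p\<in>Poly_Mapping.keys f.
     if snd p \<noteq> [] \<and> last (snd p) = Inr k then sg (fst p, butlast (snd p)) (lk f p) else 0)"

lemma strip_superset: "finite A \<Longrightarrow> Poly_Mapping.keys f \<subseteq> A \<Longrightarrow> strip k f =
    (\<Sum>p\<in>A. if snd p \<noteq> [] \<and> last (snd p) = Inr k then sg (fst p, butlast (snd p)) (lk f p) else 0)"
  unfolding strip_def by (intro sum.mono_neutral_left) (auto simp: in_keys_iff)

lemma strip_zero [simp]: "strip k 0 = 0" by (simp add: strip_def)

lemma strip_add: "strip k (f + g) = strip k f + strip k g"
proof -
  let ?A = "Poly_Mapping.keys f \<union> Poly_Mapping.keys g"
  have "Poly_Mapping.keys (f + g) \<subseteq> ?A" by (rule Poly_Mapping.keys_add)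
  then have "strip k (f + g) = (\<Sum>p\<in>?A. (if snd p \<noteq> [] \<and> last (snd p) = Inr k then sg (fst p, butlast (snd p)) (lk f p) else 0)
      + (if snd p \<noteq> [] \<and> last (snd p) = Inr k then sg (fst p, butlast (snd p)) (lk g p) else 0))"
    using strip_superset[of ?A "f + g"] by (simp add: lookup_add single_add if_distrib cong: sum.cong if_cong)
  then show ?thesis
    using strip_superset[of ?A f] strip_superset[of ?A g] by (simp add: sum.distrib)
qed

lemma strip_minus: "strip k (- f) = - strip k f"
  using minus_unique[of "strip k f" "strip k (- f)"] strip_add[of k f "- f"] by simp

lemma strip_single: "strip k (sg p c) =
    (if snd p \<noteq> [] \<and> last (snd p) = Inr k then sg (fst p, butlast (snd p)) c else 0)"
  using strip_superset[of "{p}" "sg p c"] by simp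

lemma butlast_path: assumes "p \<in> qpaths (tilde_quiver Q)" "snd p \<noteq> []"
  shows "(fst p, butlast (snd p)) \<in> qpaths (tilde_quiver Q)"
proof -
  obtain v where "pre_digraph.cas (tilde_quiver Q) (fst p) (butlast (snd p) @ [last (snd p)]) v"
    using assms by (auto simp: T.qpath_iff)
  then have "\<exists>w. pre_digraph.cas (tilde_quiver Q) (fst p) (butlast (snd p)) w"
    by (auto simp only: pre_digraph.cas_append_ex)
  then show ?thesis using assms in_set_butlastD by (fastforce simp: T.qpath_iff)
qed

lemma strip_carrier: "f \<in> carrier T.PA \<Longrightarrow> strip k f \<in> carrier T.PA"
proof -
  assume "f \<in> carrier T.PA"
  then have "Poly_Mapping.keys f \<subseteq> qpaths (tilde_quiver Q)" by simp
  then show ?thesis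
  proof (induction f rule: T.carrier_induct)
    case (single p c)
    then show ?case using butlast_path by (auto simp: strip_single)
  next
    case (add f g)
    then show ?case using T.carrier_add by (simp add: strip_add del: T.PA_simps)
  qed simp
qed

lemma cas_last_Inr:
  "pre_digraph.cas (tilde_quiver Q) u p v \<Longrightarrow> p \<noteq> [] \<Longrightarrow> last p = Inr k \<Longrightarrow> v = Inr k"
proof (induction p arbitrary: u)
  case (Cons a p)
  then show ?case by (cases "p = []") (auto simp: pre_digraph.cas.simps)
qed simp

text \<open>The last arrow of a composite \<open>q \<cdot> p\<close> is the last arrow of \<open>q\<close>, unless \<open>q\<close> is trivial; and the only trivial
  path that can follow an arrow ending in \<open>Inr k\<close> is the one at \<open>Inr k\<close>.\<close>

lemma strip_mult:
  assumes "f \<in> carrier T.PA" "g \<in> carrier T.PA"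
  shows "strip k (f \<otimes>\<^bsub>T.PA\<^esub> g) = strip k f \<otimes>\<^bsub>T.PA\<^esub> g + sc (lk f (Inr k, [])) (strip k g)"
  using assms
proof (induction f g rule: T.bilinear_induct)
  case (single q p c d)
  show ?case
  proof (cases "snd q = []")
    case True
    then obtain w where q: "q = (w, [])" by (cases q) auto
    obtain v where v: "pre_digraph.cas (tilde_quiver Q) (fst p) (snd p) v" using single by (auto simp: T.qpath_iff)
    have "pre_digraph.cas (tilde_quiver Q) (fst p) (snd p) w \<longleftrightarrow> w = Inr k" if "snd p \<noteq> []" "last (snd p) = Inr k"
      using cas_last_Inr[OF v that] cas_last_Inr[OF _ that] v by blast
    then show ?thesis
      unfolding q T.vertex_mult(1)[OF single(2)] by (auto simp: strip_single lookup_single when_def sc_simps)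
  next
    case False
    have "lk (sg q c) (Inr k, []) = 0" using False by (auto simp: lookup_single when_def)
    then show ?thesis using False by (auto simp: T.pmul_single strip_single butlast_append sc_simps)
  qed
qed (auto simp: T.pmul_add_left T.pmul_add_right strip_add lookup_add sc_simps add.assoc
    add.commute add.left_commute)

text \<open>By the Leibniz rule for \<open>strip\<close> the elements with both properties form an ideal of the path algebra. It
  contains the relations, which involve no trivial paths and no additional arrows.\<close>

lemma kernel_properties:
  assumes f: "f \<in> carrier T.PA" "\<phi> f = 0"
  shows "lk f (v, []) = 0" "\<phi> (strip k f) = 0"
proof -
  let ?I = "{f \<in> carrier T.PA. (\<forall>v. lk f (v, []) = 0) \<and> \<phi> f = 0 \<and> \<phi> (strip k f) = 0}"
  have "ideal ?I T.PA"
  proof (rule T.path_idealI)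
    show "f + g \<in> ?I" if "f \<in> ?I" "g \<in> ?I" for f g
      using that T.carrier_add[of f g] \<phi>_add strip_carrier
      by (simp add: strip_add lookup_add del: T.PA_simps)
    show "- f \<in> ?I" if "f \<in> ?I" for f
      using that strip_carrier[of f k] by (auto simp: strip_minus \<phi>_minus)
    show "g \<otimes>\<^bsub>T.PA\<^esub> f \<in> ?I" if fg: "f \<in> ?I" "g \<in> carrier T.PA" for f g
    proof -
      have f: "f \<in> carrier T.PA" using fg by blast
      have "\<phi> (strip k (g \<otimes>\<^bsub>T.PA\<^esub> f)) = \<phi> (strip k g) * \<phi> f + scl (lk g (Inr k, [])) (\<phi> (strip k f))"
      proof -
        have sf: "strip k f \<in> carrier T.PA" and sg: "strip k g \<in> carrier T.PA" using strip_carrier f fg(2) by blast+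
        then have "sc (lk g (Inr k, [])) (strip k f) \<in> carrier T.PA" using keys_sc[of _ "strip k f"] by fastforce
        then show ?thesis
          unfolding strip_mult[OF fg(2) f]
          using \<phi>_add T.carrier_mult[OF sg f] \<phi>_mult[OF sg f] \<phi>_sc[OF sf] by simp
      qed
      then show ?thesis using fg f T.carrier_mult[OF fg(2) f]
        by (simp add: \<phi>_mult T.lookup_vertex_mult del: T.PA_simps)
    qed
    show "f \<otimes>\<^bsub>T.PA\<^esub> g \<in> ?I" if fg: "f \<in> ?I" "g \<in> carrier T.PA" for f g
    proof -
      have f: "f \<in> carrier T.PA" "lk f (Inr k, []) = 0" using fg by blast+
      have "strip k (f \<otimes>\<^bsub>T.PA\<^esub> g) = strip k f \<otimes>\<^bsub>T.PA\<^esub> g"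
        using strip_mult[OF f(1) fg(2)] f(2) by (simp add: sc_simps)
      then show ?thesis using fg f T.carrier_mult[OF f(1) fg(2)] strip_carrier[OF f(1), of k]
        by (simp add: \<phi>_mult T.lookup_vertex_mult del: T.PA_simps)
    qed
  qed (use T.carrier_zero in \<open>auto simp: \<phi>_zero simp del: T.PA_simps(1)\<close>)
  moreover have "tilde_relation ` R \<subseteq> ?I"
  proof
    fix f assume "f \<in> tilde_relation ` R"
    then obtain r where r: "r \<in> R" "f = tilde_relation r" by blast
    note rp = R_paths[OF r(1)]
    have f: "f \<in> carrier T.PA" using tilde_relation_carrier[of r] rp(1) r(2) by auto
    have "strip k f = 0 \<and> (\<forall>v. lk f (v, []) = 0)"
    proof -
      have "strip k g = 0 \<and> (\<forall>v. lk g (v, []) = 0)" if "Poly_Mapping.keys g \<subseteq> {\<iota> p | p. 2 \<le> length (snd p)}" for g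
        using that
      proof (induction g rule: poly_mapping_additive_induct)
        case (single p c)
        then show ?case by (auto simp: strip_single lookup_single when_def \<iota>_def last_map)
      qed (auto simp: strip_add lookup_add)
      moreover have "Poly_Mapping.keys f \<subseteq> {\<iota> p | p. 2 \<le> length (snd p)}"
      proof
        fix p assume "p \<in> Poly_Mapping.keys f"
        then have "p \<in> (\<Union>x\<in>Poly_Mapping.keys r. Poly_Mapping.keys (sg (\<iota> x) (lk r x)))"
          using Poly_Mapping.keys_sum[of "\<lambda>x. sg (\<iota> x) (lk r x)" "Poly_Mapping.keys r"] r(2)
            tilde_relation_superset[of "Poly_Mapping.keys r" r] by auto
        then obtain x where "x \<in> Poly_Mapping.keys r" "p = \<iota> x" by (auto split: if_splits)
        then show "p \<in> {\<iota> p | p. 2 \<le> length (snd p)}" using rp(2)[of x] by blast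
      qed
      ultimately show ?thesis by blast
    qed
    then show "f \<in> ?I" using f \<phi>_relation[OF r(1)] r(2) by (simp add: \<phi>_zero)
  qed
  ultimately have "f \<in> ?I" using T.genideal_subset \<phi>_ker f by blast
  then show "lk f (v, []) = 0" "\<phi> (strip k f) = 0" by auto
qed

subsection \<open>Characters and the radical\<close>

definition vchar :: "('v + 'v) \<Rightarrow> 'a \<Rightarrow> 'k" where
  "vchar v x = lk (SOME f. f \<in> carrier T.PA \<and> \<phi> f = x) (v, [])"

lemma vchar_\<phi>: assumes f: "f \<in> carrier T.PA" shows "vchar v (\<phi> f) = lk f (v, [])"
proof -
  define g where "g = (SOME g. g \<in> carrier T.PA \<and> \<phi> g = \<phi> f)"
  have g: "g \<in> carrier T.PA" "\<phi> g = \<phi> f"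
    using someI[of "\<lambda>g. g \<in> carrier T.PA \<and> \<phi> g = \<phi> f" f] f unfolding g_def by auto
  have mf: "- f \<in> carrier T.PA" using f by simp
  have "\<phi> (g + - f) = 0" using \<phi>_add[OF g(1) mf] \<phi>_minus[OF f] g(2) by simp
  then have "lk (g + - f) (v, []) = 0" using kernel_properties(1) T.carrier_add[OF g(1) mf] by blast
  moreover have "vchar v (\<phi> f) = lk g (v, [])" unfolding vchar_def g_def ..
  ultimately show ?thesis by (simp add: lookup_minus)
qed

text \<open>The filtration by lengths of paths, which bounds the powers of the radical.\<close>

definition deg_ge :: "nat \<Rightarrow> 'a set" where
  "deg_ge j = \<phi> ` {f. Poly_Mapping.keys f \<subseteq> {p \<in> qpaths (tilde_quiver Q). j \<le> length (snd p)}}"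

lemma deg_ge_zero: "0 \<in> deg_ge j"
  unfolding deg_ge_def by (rule image_eqI[of _ _ 0]) (auto simp: \<phi>_zero)

lemma deg_ge_diff: assumes "x \<in> deg_ge j" "y \<in> deg_ge j" shows "x - y \<in> deg_ge j"
proof -
  obtain f g where f: "x = \<phi> f" "Poly_Mapping.keys f \<subseteq> {p \<in> qpaths (tilde_quiver Q). j \<le> length (snd p)}"
    and g: "y = \<phi> g" "Poly_Mapping.keys g \<subseteq> {p \<in> qpaths (tilde_quiver Q). j \<le> length (snd p)}"
    using assms unfolding deg_ge_def by blast
  have c: "f \<in> carrier T.PA" "g \<in> carrier T.PA" using f g by auto
  then have mg: "- g \<in> carrier T.PA" by simp
  have "x - y = \<phi> (f + - g)" using \<phi>_add[OF c(1) mg] \<phi>_minus[OF c(2)] f g by simp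
  moreover have "Poly_Mapping.keys (f + - g) \<subseteq> {p \<in> qpaths (tilde_quiver Q). j \<le> length (snd p)}"
    using Poly_Mapping.keys_add[of f "- g"] f(2) g(2) by auto
  ultimately show ?thesis unfolding deg_ge_def by blast
qed

lemma deg_ge_mult: assumes "x \<in> deg_ge i" "y \<in> deg_ge j" shows "x * y \<in> deg_ge (i + j)"
proof -
  let ?S = "\<lambda>j. {p \<in> qpaths (tilde_quiver Q). j \<le> length (snd p)}"
  obtain f g where f: "x = \<phi> f" "Poly_Mapping.keys f \<subseteq> ?S i" and g: "y = \<phi> g" "Poly_Mapping.keys g \<subseteq> ?S j"
    using assms unfolding deg_ge_def by blast
  have "Poly_Mapping.keys (f \<otimes>\<^bsub>T.PA\<^esub> g) \<subseteq> ?S (i + j)"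
    using f(2)
  proof (induction f rule: poly_mapping_additive_induct)
    case (single q c)
    show ?case
      using g(2)
    proof (induction g rule: poly_mapping_additive_induct)
      case (single p d)
      then show ?case using \<open>q \<in> ?S i\<close> T.comp_path by (auto simp: T.pmul_single)
    next
      case (add f g)
      then show ?case using Poly_Mapping.keys_add[of "sg q c \<otimes>\<^bsub>T.PA\<^esub> f" "sg q c \<otimes>\<^bsub>T.PA\<^esub> g"]
        by (auto simp: T.pmul_add_right)
    qed simp
  next
    case (add f f')
    then show ?case using Poly_Mapping.keys_add[of "f \<otimes>\<^bsub>T.PA\<^esub> g" "f' \<otimes>\<^bsub>T.PA\<^esub> g"]
      by (auto simp: T.pmul_add_left)
  qed simp
  moreover have "x * y = \<phi> (f \<otimes>\<^bsub>T.PA\<^esub> g)"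
  proof -
    have "f \<in> carrier T.PA" "g \<in> carrier T.PA" using f g by auto
    then show ?thesis using \<phi>_mult f g by simp
  qed
  ultimately show ?thesis unfolding deg_ge_def by blast
qed

text \<open>Up to one additional arrow at its end, a nontrivial path is a path in \<open>Q\<close>; and long paths in \<open>Q\<close> are zero
  because the relations are admissible.\<close>

lemma deg_ge_vanish: "\<exists>m. deg_ge m = {0}"
proof -
  obtain m where m: "\<And>p. p \<in> qpaths Q \<Longrightarrow> m \<le> length (snd p) \<Longrightarrow> sg p 1 \<in> genideal P.PA R"
    using adm unfolding admissible_relations_def by blast
  have \<iota>0: "\<phi> (sg (\<iota> p) 1) = 0" if "p \<in> qpaths Q" "m \<le> length (snd p)" for p
    using \<phi>_genideal[OF m[OF that]] by (simp add: tilde_relation_single)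
  have path: "\<phi> (sg p 1) = 0" if p: "p \<in> qpaths (tilde_quiver Q)" "Suc m \<le> length (snd p)" for p
  proof -
    obtain v where v: "pre_digraph.cas (tilde_quiver Q) (fst p) (snd p) v" using p by (auto simp: T.qpath_iff)
    obtain w where w: "fst p = Inl w"
    proof (cases "fst p")
      case (Inr k)
      then show ?thesis using tilde_cas_Inr v p(2) by fastforce
    qed
    obtain p' where "snd p = map Inl p' \<or> (\<exists>k. snd p = map Inl p' @ [Inr k])"
      using tilde_path_cases v w by metis
    then consider "snd p = map Inl p'" | k where "snd p = map Inl p' @ [Inr k]" by blast
    then show ?thesis
    proof cases
      case 1
      have wV: "w \<in> verts Q" and arcs: "set p' \<subseteq> arcs Q" using p(1) w 1 by (auto simp: T.qpath_iff)
      have "\<exists>v. pre_digraph.cas Q w p' v"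
      proof (cases v)
        case (Inl v')
        then show ?thesis using v 1 w tilde_cas_Inl by metis
      next
        case (Inr k)
        interpret fin_digraph "tilde_quiver Q" by (rule fin_digraph_tilde[OF fin])
        have "p' \<noteq> []" using p(2) 1 by auto
        have False if "pre_digraph.cas (tilde_quiver Q) u (map Inl p') (Inr k)" "p' \<noteq> []" for u and p' :: "'q list"
          using that
        proof (induction p' arbitrary: u)
          case (Cons a p')
          then show ?case by (cases "p' = []") (auto simp: pre_digraph.cas.simps)
        qed simp
        then show ?thesis using v 1 Inr \<open>p' \<noteq> []\<close> by auto
      qed
      then have "(w, p') \<in> qpaths Q" using wV arcs by (auto simp: P.qpath_iff)
      moreover have "m \<le> length p'" using p(2) 1 by simp
      moreover have "p = \<iota> (w, p')" using w 1 by (simp add: \<iota>_def prod_eq_iff)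
      ultimately show ?thesis using \<iota>0[of "(w, p')"] by simp
    next
      case 2
      have wV: "w \<in> verts Q" and arcs: "set p' \<subseteq> arcs Q" "k \<in> verts Q" using p(1) w 2 by (auto simp: T.qpath_iff)
      have "pre_digraph.cas (tilde_quiver Q) (Inl w) (map Inl p' @ [Inr k]) v" using v w 2 by simp
      then have cas: "pre_digraph.cas (tilde_quiver Q) (Inl w) (map Inl p') (Inl k)"
        by (auto simp only: pre_digraph.cas_append_ex pre_digraph.cas.simps tilde_quiver_simps)
      then have "pre_digraph.cas Q w p' k" by (simp add: tilde_cas_Inl)
      then have q: "(w, p') \<in> qpaths Q" using wV arcs by (auto simp: P.qpath_iff)
      moreover have "m \<le> length p'" using p(2) 2 by simp
      ultimately have z: "\<phi> (sg (\<iota> (w, p')) 1) = 0" using \<iota>0[of "(w, p')"] by simp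
      have "(Inl k, [Inr k]) \<in> qpaths (tilde_quiver Q)" using arcs by (auto simp: T.qpath_iff pre_digraph.cas.simps)
      then have "\<phi> (sg (Inl k, [Inr k]) 1 \<otimes>\<^bsub>T.PA\<^esub> sg (\<iota> (w, p')) 1) = \<phi> (sg (Inl k, [Inr k]) 1) * \<phi> (sg (\<iota> (w, p')) 1)"
        using \<iota>_path[OF q] by (intro \<phi>_mult) auto
      moreover have "sg (Inl k, [Inr k]) 1 \<otimes>\<^bsub>T.PA\<^esub> sg (\<iota> (w, p')) 1 = (sg p 1 :: _ \<Rightarrow>\<^sub>0 'k)"
        using T.comp_iff[OF \<iota>_path[OF q], of "(Inl k, [Inr k])"] cas w 2
        by (cases p) (simp add: T.pmul_single \<iota>_def)
      ultimately show ?thesis using z by simp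
    qed
  qed
  have "\<phi> f = 0" if "Poly_Mapping.keys f \<subseteq> {p \<in> qpaths (tilde_quiver Q). Suc m \<le> length (snd p)}" for f
    using that
  proof (induction f rule: poly_mapping_additive_induct)
    case (single p c)
    have "\<phi> (sc c (sg p 1)) = scl c (\<phi> (sg p 1))" using single by (intro \<phi>_sc) auto
    then show ?case using path[of p] single by (simp add: sc_simps)
  next
    case (add f g)
    then have "f \<in> carrier T.PA" "g \<in> carrier T.PA" by auto
    then show ?case using add \<phi>_add by simp
  qed (simp add: \<phi>_zero)
  then have "deg_ge (Suc m) \<subseteq> {0}" unfolding deg_ge_def by auto
  then show ?thesis using deg_ge_zero by blast
qed

abbreviation "VT \<equiv> verts (tilde_quiver Q)"

lemma \<phi>_cases: obtains f where "f \<in> carrier T.PA" "\<phi> f = x"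
  using \<phi>_surj[of x] by blast

lemma vchar_add: "vchar v (x + y) = vchar v x + vchar v y"
proof -
  obtain f g where "f \<in> carrier T.PA" "\<phi> f = x" "g \<in> carrier T.PA" "\<phi> g = y" using \<phi>_cases by metis
  then show ?thesis using vchar_\<phi>[of f v] vchar_\<phi>[of g v] vchar_\<phi>[OF T.carrier_add[of f g], of v] \<phi>_add[of f g]
    by (simp add: lookup_add)
qed

lemma vchar_mult: "vchar v (x * y) = vchar v x * vchar v y"
proof -
  obtain f g where "f \<in> carrier T.PA" "\<phi> f = x" "g \<in> carrier T.PA" "\<phi> g = y" using \<phi>_cases by metis
  then show ?thesis using vchar_\<phi>[of f v] vchar_\<phi>[of g v] vchar_\<phi>[OF T.carrier_mult[of f g], of v] \<phi>_mult[of f g]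
    T.lookup_vertex_mult[of f g v] by (simp del: T.PA_simps)
qed

lemma vchar_scl: "vchar v (scl c x) = c * vchar v x"
proof -
  obtain f where f: "f \<in> carrier T.PA" "\<phi> f = x" using \<phi>_cases by metis
  then have "sc c f \<in> carrier T.PA" using keys_sc[of c f] by auto
  then show ?thesis using f vchar_\<phi>[of f v] vchar_\<phi>[of "sc c f" v] \<phi>_sc[of f c] by simp
qed

lemma vertex_path: "v \<in> VT \<Longrightarrow> (v, []) \<in> qpaths (tilde_quiver Q)"
  by (auto simp: T.qpath_iff pre_digraph.cas.simps)

lemma vchar_idem: "v \<in> VT \<Longrightarrow> w \<in> VT \<Longrightarrow> vchar v (vertex_idem \<phi> w) = (if v = w then 1 else 0)"
  unfolding vertex_idem_def
  using vchar_\<phi>[of "sg (w, []) 1" v] vertex_path[of w] by (auto simp: lookup_single when_def)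

lemma vchar_one: "v \<in> VT \<Longrightarrow> vchar v 1 = 1"
  using vchar_mult[of v 1 "vertex_idem \<phi> v"] vchar_idem[of v v] by simp

lemma vchar_zero: "vchar v 0 = 0" using vchar_scl[of v 0 0] by simp
lemma vchar_minus: "vchar v (x - y) = vchar v x - vchar v y"
  using vchar_add[of v "x - y" y] by (simp add: eq_diff_eq)

definition rad where "rad = {x. \<forall>v\<in>VT. vchar v x = 0}"

lemma rad_deg: "rad \<subseteq> deg_ge 1"
proof
  fix x assume x: "x \<in> rad"
  obtain f where f: "f \<in> carrier T.PA" "\<phi> f = x" using \<phi>_cases by metis
  have "1 \<le> length (snd p)" if p: "p \<in> Poly_Mapping.keys f" for p
  proof (cases "snd p = []")
    case True
    have "fst p \<in> VT" using f p by (auto simp: T.qpath_iff)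
    then have "lk f p = 0" using vchar_\<phi>[OF f(1), of "fst p"] x f(2) True by (cases p) (simp add: rad_def)
    then show ?thesis using p by (simp add: in_keys_iff)
  qed (simp add: Suc_leI)
  then have "Poly_Mapping.keys f \<subseteq> {p \<in> qpaths (tilde_quiver Q). 1 \<le> length (snd p)}" using f by auto
  then show "x \<in> deg_ge 1" unfolding deg_ge_def using f(2) by blast
qed

lemma rad_nilpotent: "x \<in> rad \<Longrightarrow> \<exists>m. x ^ m = 0"
proof -
  assume x: "x \<in> rad"
  have "x ^ Suc j \<in> deg_ge (Suc j)" for j
  proof (induction j)
    case (Suc j)
    have "x * x ^ Suc j \<in> deg_ge (1 + Suc j)" using deg_ge_mult rad_deg x Suc by blast
    then show ?case by simp
  qed (use rad_deg x in auto)
  moreover obtain m where "deg_ge m = {0}" using deg_ge_vanish by blast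
  moreover have "deg_ge (Suc m) \<subseteq> deg_ge m" for m unfolding deg_ge_def by (rule image_mono) auto
  ultimately show ?thesis by blast
qed

lemma left_ideal_add: "left_ideal J \<Longrightarrow> x \<in> J \<Longrightarrow> y \<in> J \<Longrightarrow> x + y \<in> (J :: 'a set)"
  unfolding left_ideal_def by (metis diff_0 diff_minus_eq_add)

text \<open>The kernel of a character is a maximal left ideal. Conversely, the common kernel of the characters is an
  ideal of nilpotent elements, so it lies in every maximal left ideal.\<close>

lemma jacobson_eq: "jacobson_radical = rad"
proof
  have "maximal_left_ideal {x. vchar v x = 0}" if v: "v \<in> VT" for v
    unfolding maximal_left_ideal_def
  proof (intro conjI allI impI; (elim conjE)?)
    show "left_ideal {x. vchar v x = 0}"
      by (auto simp: left_ideal_def vchar_zero vchar_minus vchar_mult)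
    show "{x. vchar v x = 0} \<noteq> UNIV" using vchar_one[OF v] by (auto simp: set_eq_iff intro!: exI[of _ 1])
    fix K assume K: "left_ideal K" "{x. vchar v x = 0} \<subseteq> K"
    show "K = {x. vchar v x = 0} \<or> K = UNIV"
    proof (cases "\<exists>y\<in>K. vchar v y \<noteq> 0")
      case True
      then obtain y where y: "y \<in> K" "vchar v y \<noteq> 0" by blast
      let ?z = "scl (inverse (vchar v y)) 1 * y"
      have z: "?z \<in> K" using K(1) y(1) by (auto simp: left_ideal_def)
      have "vchar v (1 - ?z) = 0" using y(2) by (simp add: vchar_minus vchar_mult vchar_scl vchar_one[OF v])
      then have "(1 - ?z) + ?z \<in> K" using K z left_ideal_add by blast
      then have "1 \<in> K" by simp
      then have "x * 1 \<in> K" for x using K(1) unfolding left_ideal_def by blast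
      then show ?thesis by auto
    next
      case False
      then show ?thesis using K(2) by blast
    qed
  qed
  then show "jacobson_radical \<subseteq> rad" unfolding jacobson_radical_def rad_def by blast
  have "rad \<subseteq> J" if J: "maximal_left_ideal J" for J
  proof (rule ccontr)
    assume "\<not> rad \<subseteq> J"
    then obtain x where x: "x \<in> rad" "x \<notin> J" by blast
    have Jl: "left_ideal J" using J by (simp add: maximal_left_ideal_def)
    let ?K = "{j + a * x | j a. j \<in> J}"
    have "left_ideal ?K"
      unfolding left_ideal_def
    proof (intro conjI ballI allI)
      show "0 \<in> ?K" using Jl by (auto simp: left_ideal_def intro!: exI[of _ 0])
      show "y - z \<in> ?K" if yz: "y \<in> ?K" "z \<in> ?K" for y z
      proof -
        obtain j a j' a' where "y = j + a * x" "j \<in> J" "z = j' + a' * x" "j' \<in> J" using yz by blast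
        then have "y - z = (j - j') + (a - a') * x" "j - j' \<in> J"
          using Jl by (auto simp: left_ideal_def algebra_simps)
        then show ?thesis by blast
      qed
      show "b * y \<in> ?K" if y: "y \<in> ?K" for b y
      proof -
        obtain j a where "y = j + a * x" "j \<in> J" using y by blast
        then have "b * y = b * j + (b * a) * x" "b * j \<in> J"
          using Jl by (auto simp: left_ideal_def algebra_simps)
        then show ?thesis by blast
      qed
    qed
    moreover have "J \<subseteq> ?K"
    proof
      fix j assume "j \<in> J"
      moreover have "j = j + 0 * x" by simp
      ultimately show "j \<in> ?K" by blast
    qed
    moreover have "0 + 1 * x \<in> ?K" using Jl unfolding left_ideal_def by blast
    then have "?K \<noteq> J" using x(2) by auto
    ultimately have "?K = UNIV" using J unfolding maximal_left_ideal_def by blast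
    then obtain j a where ja: "1 = j + a * x" "j \<in> J" by blast
    have "a * x \<in> rad" using x(1) by (simp add: rad_def vchar_mult)
    then obtain m where m: "(a * x) ^ m = 0" using rad_nilpotent by blast
    have "1 - (a * x) ^ i \<in> J" for i
    proof (induction i)
      case 0 then show ?case using Jl by (simp add: left_ideal_def)
    next
      case (Suc i)
      have "(a * x) * (1 - (a * x) ^ i) \<in> J" using Suc Jl by (auto simp: left_ideal_def)
      moreover have "j = 1 - a * x" using ja(1) by (simp add: eq_diff_eq)
      then have "1 - a * x \<in> J" using ja(2) by simp
      ultimately have "(a * x) * (1 - (a * x) ^ i) + (1 - a * x) \<in> J" using left_ideal_add[OF Jl] by blast
      then show ?case by (simp add: algebra_simps)
    qed
    from this[of m] have "1 \<in> J" by (simp add: m)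
    then have "b * 1 \<in> J" for b using Jl unfolding left_ideal_def by blast
    then have "J = UNIV" by auto
    then show False using J by (simp add: maximal_left_ideal_def)
  qed
  then show "rad \<subseteq> jacobson_radical" unfolding jacobson_radical_def by blast
qed

lemma rad_pow_deg: "rad_pow j \<subseteq> deg_ge j"
proof (induction j)
  case 0
  have "x \<in> deg_ge 0" for x
  proof -
    obtain f where "f \<in> carrier T.PA" "\<phi> f = x" using \<phi>_cases by metis
    then show ?thesis unfolding deg_ge_def by auto
  qed
  then show ?case by auto
next
  case (Suc j)
  have "x \<in> deg_ge (Suc j)" if "x \<in> group_closure (jacobson_radical * rad_pow j)" for x
    using that
  proof (induction rule: group_closure.induct)
    case (base s)
    then show ?case
    proof
      assume "s \<in> jacobson_radical * rad_pow j"
      then obtain y z where "s = y * z" "y \<in> jacobson_radical" "z \<in> rad_pow j" by (auto elim: set_times_elim)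
      then show ?thesis using deg_ge_mult[of y 1 z j] rad_deg Suc jacobson_eq by auto
    qed (simp add: deg_ge_zero)
  qed (rule deg_ge_diff)
  then show ?case by auto
qed

lemma spanning: "\<exists>X. finite X \<and> module.span scl X = UNIV"
proof -
  interpret TQ: fin_digraph "tilde_quiver Q" by (rule fin_digraph_tilde[OF fin])
  obtain m where m: "deg_ge m = {0}" using deg_ge_vanish by blast
  let ?S = "{p \<in> qpaths (tilde_quiver Q). length (snd p) \<le> m}"
  have "?S \<subseteq> VT \<times> {l. set l \<subseteq> arcs (tilde_quiver Q) \<and> length l \<le> m}" by (auto simp: T.qpath_iff)
  then have fin: "finite ?S"
    by (rule finite_subset) (intro finite_cartesian_product TQ.finite_verts finite_lists_length_le TQ.finite_arcs)
  let ?X = "(\<lambda>p. \<phi> (sg p 1)) ` ?S"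
  have "\<phi> f \<in> span ?X" if "Poly_Mapping.keys f \<subseteq> qpaths (tilde_quiver Q)" for f
    using that
  proof (induction f rule: T.carrier_induct)
    case zero then show ?case by (simp add: \<phi>_zero span_zero)
  next
    case (single p c)
    have "\<phi> (sc c (sg p 1)) = scl c (\<phi> (sg p 1))" using single by (intro \<phi>_sc) auto
    then have eq: "\<phi> (sg p c) = scl c (\<phi> (sg p 1))" by (simp add: sc_simps)
    show ?case
    proof (cases "length (snd p) \<le> m")
      case True
      then show ?thesis unfolding eq using single by (intro span_scale span_base) auto
    next
      case False
      then have "\<phi> (sg p 1) \<in> deg_ge m" unfolding deg_ge_def using single by (intro imageI) auto
      then show ?thesis unfolding eq using m by (simp add: span_zero)
    qed
  next
    case (add f g)
    then have "f \<in> carrier T.PA" "g \<in> carrier T.PA" by auto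
    then show ?case using add \<phi>_add span_add by simp
  qed
  then have "x \<in> span ?X" for x
  proof -
    assume *: "\<And>f. Poly_Mapping.keys f \<subseteq> qpaths (tilde_quiver Q) \<Longrightarrow> \<phi> f \<in> span ?X"
    obtain f where "f \<in> carrier T.PA" "\<phi> f = x" using \<phi>_cases by metis
    then show ?thesis using *[of f] by auto
  qed
  then have "span ?X = UNIV" by blast
  then show ?thesis using fin by blast
qed

text \<open>Stripping the product with the arrow \<open>k \<rightarrow> Inr k\<close> leaves the product with the trivial path at \<open>k\<close>.\<close>

lemma source_injective:
  assumes k: "k \<in> verts Q" and x: "\<And>y. y \<in> jacobson_radical \<Longrightarrow> y * x = 0"
  shows "vertex_idem \<phi> (Inl k) * x = 0"
proof -
  obtain f where f: "f \<in> carrier T.PA" "\<phi> f = x" using \<phi>_cases by metis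
  let ?\<alpha> = "sg (Inl k, [Inr k]) 1 :: _ \<Rightarrow>\<^sub>0 'k"
  have \<alpha>: "?\<alpha> \<in> carrier T.PA" using k by (auto simp: T.qpath_iff pre_digraph.cas.simps)
  have "vchar v (\<phi> ?\<alpha>) = 0" for v using vchar_\<phi>[OF \<alpha>] by (simp add: lookup_single when_def)
  then have "\<phi> ?\<alpha> \<in> jacobson_radical" by (simp add: jacobson_eq rad_def)
  then have "\<phi> (?\<alpha> \<otimes>\<^bsub>T.PA\<^esub> f) = 0" using x \<phi>_mult[OF \<alpha> f(1)] f(2) by simp
  then have "\<phi> (strip k (?\<alpha> \<otimes>\<^bsub>T.PA\<^esub> f)) = 0" using kernel_properties(2) T.carrier_mult[OF \<alpha> f(1)] by blast
  also have "strip k (?\<alpha> \<otimes>\<^bsub>T.PA\<^esub> f) = sg (Inl k, []) 1 \<otimes>\<^bsub>T.PA\<^esub> f"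
    using strip_mult[OF \<alpha> f(1), of k] by (simp add: strip_single lookup_single when_def sc_simps)
  also have "\<phi> \<dots> = \<phi> (sg (Inl k, []) 1) * \<phi> f"
    using vertex_path[of "Inl k"] k f(1) by (intro \<phi>_mult) auto
  finally show ?thesis using f(2) by (simp add: vertex_idem_def)
qed

lemma sink_killed:
  assumes k: "k \<in> verts Q" and y: "y \<in> jacobson_radical" shows "y * vertex_idem \<phi> (Inr k) = 0"
proof -
  obtain f where f: "f \<in> carrier T.PA" "\<phi> f = y" using \<phi>_cases by metis
  have e: "(sg (Inr k, []) 1 :: _ \<Rightarrow>\<^sub>0 'k) \<in> carrier T.PA" using vertex_path[of "Inr k"] k by auto
  have "Poly_Mapping.keys f \<subseteq> qpaths (tilde_quiver Q)" using f by simp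
  then have "f \<otimes>\<^bsub>T.PA\<^esub> sg (Inr k, []) 1 = sg (Inr k, []) (lk f (Inr k, []))"
  proof (induction f rule: T.carrier_induct)
    case (single q c)
    have "snd q = []" if "fst q = Inr k"
      using single that tilde_cas_Inr by (auto simp: T.qpath_iff)
    then show ?case
      unfolding T.vertex_mult(2)[OF single] by (cases q) (auto simp: lookup_single when_def)
  qed (auto simp: T.pmul_add_left lookup_add single_add)
  moreover have "Inr k \<in> VT" using k by auto
  then have "lk f (Inr k, []) = 0"
    using y vchar_\<phi>[OF f(1), of "Inr k"] f(2) unfolding jacobson_eq rad_def by simp
  ultimately have "\<phi> (f \<otimes>\<^bsub>T.PA\<^esub> sg (Inr k, []) 1) = 0" by (simp add: \<phi>_zero)
  then show ?thesis using \<phi>_mult[OF f(1) e] f(2) by (simp add: vertex_idem_def)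
qed

lemma vertex_idem_mult: "v \<in> VT \<Longrightarrow> w \<in> VT \<Longrightarrow>
    vertex_idem \<phi> v * vertex_idem \<phi> w = (if v = w then vertex_idem \<phi> v else 0)"
proof -
  assume v: "v \<in> VT" and w: "w \<in> VT"
  have "\<phi> (sg (v, []) 1) * \<phi> (sg (w, []) 1) = \<phi> (sg (v, []) 1 \<otimes>\<^bsub>T.PA\<^esub> sg (w, []) 1)"
    using vertex_path[OF v] vertex_path[OF w] by (intro \<phi>_mult[symmetric]) auto
  also have "sg (v, []) 1 \<otimes>\<^bsub>T.PA\<^esub> sg (w, []) 1 = (if v = w then sg (v, []) 1 else (0 :: _ \<Rightarrow>\<^sub>0 'k))"
    unfolding T.vertex_mult(1)[OF vertex_path[OF w]] by (auto simp: pre_digraph.cas.simps)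
  finally show ?thesis by (simp add: vertex_idem_def \<phi>_zero)
qed

lemma vertex_idem_sum: "(\<Sum>v\<in>VT. vertex_idem \<phi> v) = 1"
proof -
  have "finite VT" using fin_digraph.finite_verts[OF fin_digraph_tilde[OF fin]] .
  then have "\<phi> (\<Sum>v\<in>VT. sg (v, []) 1) = (\<Sum>v\<in>VT. vertex_idem \<phi> v)"
    using \<phi>_sum[of VT "\<lambda>v. sg (v, []) 1"] vertex_path unfolding vertex_idem_def by auto
  then show ?thesis using \<phi>_one by simp
qed

theorem tilde_algebra: "tilde_algebra scl VT (Inl ` verts Q) (vertex_idem \<phi>) vchar"
proof unfold_locales
  show "finite VT" using fin_digraph.finite_verts[OF fin_digraph_tilde[OF fin]] .
  have "VT \<noteq> {}" using vertex_idem_sum by (metis sum.empty zero_neq_one)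
  then show "Inl ` verts Q \<noteq> {}" by auto
  obtain m where "deg_ge m = {0}" using deg_ge_vanish by blast
  moreover have "0 \<in> rad_pow m" by (cases m) auto
  ultimately show "\<exists>m. rad_pow m = ({0} :: 'a set)" using rad_pow_deg[of m] by blast
qed (use vertex_idem_mult vertex_idem_sum vchar_add vchar_mult vchar_scl vchar_idem jacobson_eq spanning
    source_injective sink_killed in \<open>auto simp: rad_def\<close>)

end

section \<open>The graded algebra\<close>

locale graded_tilde = tilde_algebra scl V V\<^sub>1 e \<chi>
  for scl :: "'k::field \<Rightarrow> 'a::ring_1 \<Rightarrow> 'a" and V V\<^sub>1 :: "('v + 'v) set" and e :: "('v + 'v) \<Rightarrow> 'a"
    and \<chi> :: "('v + 'v) \<Rightarrow> 'a \<Rightarrow> 'k" +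
  fixes G :: "nat \<Rightarrow> 'a set"
  assumes V\<^sub>1_iff: "v \<in> V \<Longrightarrow> v \<in> V\<^sub>1 \<longleftrightarrow> isl v"
    and grading: "positive_grading scl G"
    and rad_filtration: "rad_pow j = group_closure (\<Union>i\<in>{j..}. G i)"
begin

subsection \<open>Homogeneous components\<close>

lemma G_subspace: "subspace (G i)" and G_mult: "x \<in> G i \<Longrightarrow> y \<in> G j \<Longrightarrow> x * y \<in> G (i + j)"
  and G_unique: "\<exists>!g. (\<forall>i. g i \<in> G i) \<and> finite {i. g i \<noteq> 0} \<and> x = (\<Sum>i | g i \<noteq> 0. g i)"
  using grading unfolding positive_grading_def by auto

definition \<pi> :: "nat \<Rightarrow> 'a \<Rightarrow> 'a" where
  "\<pi> i x = (THE g. (\<forall>i. g i \<in> G i) \<and> finite {i. g i \<noteq> 0} \<and> x = (\<Sum>i | g i \<noteq> 0. g i)) i"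

lemma \<pi>_in: "\<pi> i x \<in> G i" and \<pi>_finite: "finite {i. \<pi> i x \<noteq> 0}" and \<pi>_sum: "(\<Sum>i | \<pi> i x \<noteq> 0. \<pi> i x) = x"
proof -
  have "(\<forall>i. \<pi> i x \<in> G i) \<and> finite {i. \<pi> i x \<noteq> 0} \<and> x = (\<Sum>i | \<pi> i x \<noteq> 0. \<pi> i x)"
    using theI'[OF G_unique[of x]] unfolding \<pi>_def .
  then show "\<pi> i x \<in> G i" "finite {i. \<pi> i x \<noteq> 0}" "(\<Sum>i | \<pi> i x \<noteq> 0. \<pi> i x) = x" by auto
qed

lemma \<pi>_eqI:
  assumes "\<And>i. g i \<in> G i" "finite S" "\<And>i. i \<notin> S \<Longrightarrow> g i = 0" "x = (\<Sum>i\<in>S. g i)"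
  shows "\<pi> i x = g i"
proof -
  have "{i. g i \<noteq> 0} \<subseteq> S" using assms(3) by auto
  then have "finite {i. g i \<noteq> 0}" "x = (\<Sum>i | g i \<noteq> 0. g i)"
    using assms(2,4) by (auto intro: finite_subset sum.mono_neutral_right)
  moreover define P where "P h \<longleftrightarrow> (\<forall>i. h i \<in> G i) \<and> finite {i. h i \<noteq> 0} \<and> x = (\<Sum>i | h i \<noteq> 0. h i)" for h
  ultimately have "P g" using assms(1) by simp
  moreover have "P (\<lambda>i. \<pi> i x)" unfolding P_def using \<pi>_in[of _ x] \<pi>_finite[of x] \<pi>_sum[of x, symmetric]
    by (intro conjI allI)
  moreover have "\<exists>!h. P h" unfolding P_def by (rule G_unique)
  ultimately have "(\<lambda>i. \<pi> i x) = g" by blast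
  then show ?thesis by (rule fun_cong)
qed

lemma \<pi>_sum_superset: "finite S \<Longrightarrow> {i. \<pi> i x \<noteq> 0} \<subseteq> S \<Longrightarrow> (\<Sum>i\<in>S. \<pi> i x) = x"
proof -
  assume "finite S" "{i. \<pi> i x \<noteq> 0} \<subseteq> S"
  then have "(\<Sum>i | \<pi> i x \<noteq> 0. \<pi> i x) = (\<Sum>i\<in>S. \<pi> i x)" by (intro sum.mono_neutral_left) auto
  then show ?thesis by (simp only: \<pi>_sum)
qed

lemma \<pi>_add: "\<pi> i (x + y) = \<pi> i x + \<pi> i y"
proof (rule \<pi>_eqI[where S = "{i. \<pi> i x \<noteq> 0} \<union> {i. \<pi> i y \<noteq> 0}"])
  show "\<pi> i x + \<pi> i y \<in> G i" for i using G_subspace \<pi>_in by (simp add: subspace_add)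
  show "x + y = (\<Sum>i\<in>{i. \<pi> i x \<noteq> 0} \<union> {i. \<pi> i y \<noteq> 0}. \<pi> i x + \<pi> i y)"
    by (simp add: sum.distrib \<pi>_sum_superset \<pi>_finite)
qed (auto simp: \<pi>_finite)

lemma \<pi>_scl: "\<pi> i (scl c x) = scl c (\<pi> i x)"
proof (rule \<pi>_eqI[where S = "{i. \<pi> i x \<noteq> 0}"])
  show "scl c (\<pi> i x) \<in> G i" for i using G_subspace \<pi>_in by (simp add: subspace_scale)
  show "scl c x = (\<Sum>i | \<pi> i x \<noteq> 0. scl c (\<pi> i x))" by (simp add: scale_sum_right[symmetric] \<pi>_sum)
qed (auto simp: \<pi>_finite)

lemma \<pi>_zero [simp]: "\<pi> i 0 = 0" using \<pi>_add[of i 0 0] by simp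
lemma \<pi>_diff: "\<pi> i (x - y) = \<pi> i x - \<pi> i y" using \<pi>_add[of i "x - y" y] by (simp add: eq_diff_eq)
lemma \<pi>_sum_distrib: "\<pi> i (sum h A) = (\<Sum>x\<in>A. \<pi> i (h x))"
  by (induction A rule: infinite_finite_induct) (auto simp: \<pi>_add)

lemma G_zero: "0 \<in> G i" using G_subspace by (simp add: subspace_0)

lemma \<pi>_G: assumes "x \<in> G j" shows "\<pi> i x = (if i = j then x else 0)"
  by (rule \<pi>_eqI[where S = "{j}"]) (use assms G_zero in auto)

lemma \<pi>_mult_right: assumes y: "y \<in> G j" shows "\<pi> n (x * y) = (if n \<ge> j then \<pi> (n - j) x * y else 0)"
proof (rule \<pi>_eqI[where S = "(\<lambda>i. i + j) ` {i. \<pi> i x \<noteq> 0}"])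
  show "(if i \<ge> j then \<pi> (i - j) x * y else 0) \<in> G i" for i
    using G_mult[OF \<pi>_in y, of "i - j" x] G_zero by auto
  show "finite ((\<lambda>i. i + j) ` {i. \<pi> i x \<noteq> 0})" using \<pi>_finite by simp
  show "(if i \<ge> j then \<pi> (i - j) x * y else 0) = 0" if i: "i \<notin> (\<lambda>i. i + j) ` {i. \<pi> i x \<noteq> 0}" for i
  proof -
    have "\<pi> (i - j) x = 0" if "j \<le> i"
    proof (rule ccontr)
      assume "\<pi> (i - j) x \<noteq> 0"
      then have "i \<in> (\<lambda>i. i + j) ` {i. \<pi> i x \<noteq> 0}" using that by (intro image_eqI[of _ _ "i - j"]) auto
      then show False using i by blast
    qed
    then show ?thesis by simp
  qed
  have "x * y = (\<Sum>i | \<pi> i x \<noteq> 0. \<pi> i x * y)" by (simp add: sum_distrib_right[symmetric] \<pi>_sum)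
  also have "\<dots> = (\<Sum>i\<in>(\<lambda>i. i + j) ` {i. \<pi> i x \<noteq> 0}. if i \<ge> j then \<pi> (i - j) x * y else 0)"
    by (subst sum.reindex) auto
  finally show "x * y = \<dots>" .
qed

lemma \<pi>_mult_left: assumes x: "x \<in> G j" shows "\<pi> n (x * y) = (if n \<ge> j then x * \<pi> (n - j) y else 0)"
proof (rule \<pi>_eqI[where S = "(\<lambda>i. i + j) ` {i. \<pi> i y \<noteq> 0}"])
  show "(if i \<ge> j then x * \<pi> (i - j) y else 0) \<in> G i" for i
    using G_mult[OF x \<pi>_in, of "i - j" y] G_zero by auto
  show "finite ((\<lambda>i. i + j) ` {i. \<pi> i y \<noteq> 0})" using \<pi>_finite by simp
  show "(if i \<ge> j then x * \<pi> (i - j) y else 0) = 0" if i: "i \<notin> (\<lambda>i. i + j) ` {i. \<pi> i y \<noteq> 0}" for i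
  proof -
    have "\<pi> (i - j) y = 0" if "j \<le> i"
    proof (rule ccontr)
      assume "\<pi> (i - j) y \<noteq> 0"
      then have "i \<in> (\<lambda>i. i + j) ` {i. \<pi> i y \<noteq> 0}" using that by (intro image_eqI[of _ _ "i - j"]) auto
      then show False using i by blast
    qed
    then show ?thesis by simp
  qed
  have "x * y = (\<Sum>i | \<pi> i y \<noteq> 0. x * \<pi> i y)" by (simp add: sum_distrib_left[symmetric] \<pi>_sum)
  also have "\<dots> = (\<Sum>i\<in>(\<lambda>i. i + j) ` {i. \<pi> i y \<noteq> 0}. if i \<ge> j then x * \<pi> (i - j) y else 0)"
    by (subst sum.reindex) auto
  finally show "x * y = \<dots>" .
qed

subsection \<open>The radical filtration\<close>

definition N :: nat where "N = nilpotency_degree TYPE('a)"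

lemma rad_pow_N: "rad_pow N = ({0} :: 'a set)"
  unfolding N_def nilpotency_degree_def using radical_nilpotent by (rule LeastI_ex)

lemma rad_pow_iff: "x \<in> rad_pow j \<longleftrightarrow> (\<forall>i<j. \<pi> i x = 0)"
proof
  assume "x \<in> rad_pow j"
  then have "x \<in> group_closure (\<Union>i\<in>{j..}. G i)" by (simp add: rad_filtration)
  then show "\<forall>i<j. \<pi> i x = 0"
    by (induction rule: group_closure.induct) (auto simp: \<pi>_G \<pi>_diff)
next
  assume z: "\<forall>i<j. \<pi> i x = 0"
  have "(\<Sum>i\<in>S. \<pi> i x) \<in> group_closure (\<Union>i\<in>{j..}. G i)" if "finite S" for S
    using that
  proof (induction S rule: finite_induct)
    case (insert i S)
    have "\<pi> i x \<in> group_closure (\<Union>i\<in>{j..}. G i)"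
    proof (cases "i < j")
      case False
      then show ?thesis using \<pi>_in by (intro group_closure.base insertI2 UN_I[of i]) auto
    qed (use z in auto)
    then show ?case using insert by (simp add: group_closure_add)
  qed simp
  from this[OF \<pi>_finite[of x]] show "x \<in> rad_pow j" by (simp add: \<pi>_sum rad_filtration)
qed

lemma \<pi>_ge_N: "N \<le> i \<Longrightarrow> \<pi> i x = 0"
  using rad_pow_iff[of "\<pi> i x" N] rad_pow_N by (auto simp: \<pi>_G[OF \<pi>_in])

text \<open>Degrees are integers, with zero components outside of the range, so that they can be shifted
  freely by differences of row and column indices.\<close>

definition gpart :: "int \<Rightarrow> 'a \<Rightarrow> 'a" where "gpart m x = (if m < 0 then 0 else \<pi> (nat m) x)"

text \<open>This is the power \<open>Rad\<^sup>m\<close>, and the whole algebra for \<open>m \<le> 0\<close>. With this convention the case distinctions in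
  the entry spaces disappear: their numerators are \<open>J (r - c)\<close> and their denominators \<open>J (N + r - c)\<close>.\<close>

definition J :: "int \<Rightarrow> 'a set" where "J m = {x. \<forall>i<m. gpart i x = 0}"

lemma gpart_simps [simp]: "gpart m 0 = 0" "gpart m (x + y) = gpart m x + gpart m y" "gpart m (x - y) = gpart m x - gpart m y"
  "gpart m (scl c x) = scl c (gpart m x)" "gpart m (sum h A) = (\<Sum>x\<in>A. gpart m (h x))"
  by (auto simp: gpart_def \<pi>_add \<pi>_diff \<pi>_scl \<pi>_sum_distrib)

lemma gpart_gp [simp]: "gpart i (gpart j x) = (if i = j then gpart j x else 0)"
  by (auto simp: gpart_def \<pi>_G[OF \<pi>_in])

lemma gpart_neg: "m < 0 \<Longrightarrow> gpart m x = 0" and gpart_ge_N: "int N \<le> m \<Longrightarrow> gpart m x = 0"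
  by (auto simp: gpart_def intro: \<pi>_ge_N)

lemma gpart_sum: assumes "finite S" "{0..<int N} \<subseteq> S" shows "(\<Sum>i\<in>S. gpart i x) = x"
proof -
  have "(\<Sum>i\<in>S. gpart i x) = (\<Sum>i\<in>{0..<int N}. gpart i x)"
    using assms by (intro sum.mono_neutral_right) (auto simp: gpart_neg gpart_ge_N)
  also have "\<dots> = (\<Sum>i\<in>int ` {..<N}. gpart i x)"
    by (simp add: lessThan_atLeast0 image_int_atLeastLessThan)
  also have "\<dots> = (\<Sum>i<N. \<pi> i x)" by (subst sum.reindex) (auto simp: gpart_def)
  also have "\<dots> = x"
  proof (rule \<pi>_sum_superset)
    show "{i. \<pi> i x \<noteq> 0} \<subseteq> {..<N}"
    proof
      fix i assume "i \<in> {i. \<pi> i x \<noteq> 0}"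
      then have "\<not> N \<le> i" using \<pi>_ge_N by auto
      then show "i \<in> {..<N}" by simp
    qed
  qed simp
  finally show ?thesis .
qed

lemma gpart_eqI: assumes "\<And>i. gpart i x = gpart i y" shows "x = y"
proof -
  have "x = (\<Sum>i\<in>{0..<int N}. gpart i x)" by (rule gpart_sum[symmetric]) auto
  also have "\<dots> = (\<Sum>i\<in>{0..<int N}. gpart i y)" by (simp only: assms)
  also have "\<dots> = y" by (rule gpart_sum) auto
  finally show ?thesis .
qed

lemma gpart_in: "gpart m x \<in> G (nat m)" by (auto simp: gpart_def \<pi>_in G_zero)

lemma gpart_G: "x \<in> G i \<Longrightarrow> gpart m x = (if m = int i then x else 0)"
  by (auto simp: gpart_def \<pi>_G)

lemma gpart_mult_right: assumes "gpart j y = y" shows "gpart (i + j) (x * y) = gpart i x * y"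
proof (cases "j < 0")
  case True
  then show ?thesis using assms by (simp add: gpart_neg)
next
  case False
  then have "y \<in> G (nat j)" using gpart_in[of j y] assms by simp
  then have *: "\<pi> (nat (i + j)) (x * y) = (if nat j \<le> nat (i + j) then \<pi> (nat (i + j) - nat j) x * y else 0)"
    by (rule \<pi>_mult_right)
  consider "i + j < 0" | "0 \<le> i + j" "i < 0" | "0 \<le> i" by linarith
  then show ?thesis
  proof cases
    case 3
    then have "nat (i + j) - nat j = nat i" "nat j \<le> nat (i + j)" using False by auto
    then show ?thesis using * 3 False by (simp add: gpart_def)
  next
    case 2
    then have "\<not> nat j \<le> nat (i + j)" using False by auto
    then show ?thesis using * 2 by (simp add: gpart_def)
  next
    case 1
    then have "i < 0" using False by auto
    then show ?thesis using 1 by (simp add: gpart_neg)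
  qed
qed

lemma gpart_mult_left: assumes "gpart i x = x" shows "gpart (i + j) (x * y) = x * gpart j y"
proof (cases "i < 0")
  case True
  then show ?thesis using assms by (simp add: gpart_neg)
next
  case False
  then have "x \<in> G (nat i)" using gpart_in[of i x] assms by simp
  then have *: "\<pi> (nat (i + j)) (x * y) = (if nat i \<le> nat (i + j) then x * \<pi> (nat (i + j) - nat i) y else 0)"
    by (rule \<pi>_mult_left)
  consider "i + j < 0" | "0 \<le> i + j" "j < 0" | "0 \<le> j" by linarith
  then show ?thesis
  proof cases
    case 3
    then have "nat (i + j) - nat i = nat j" "nat i \<le> nat (i + j)" using False by auto
    then show ?thesis using * 3 False by (simp add: gpart_def)
  next
    case 2
    then have "\<not> nat i \<le> nat (i + j)" using False by auto
    then show ?thesis using * 2 by (simp add: gpart_def)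
  next
    case 1
    then have "j < 0" using False by auto
    then show ?thesis using 1 by (simp add: gpart_neg)
  qed
qed

lemma J_zero [simp]: "0 \<in> J m" and J_add: "x \<in> J m \<Longrightarrow> y \<in> J m \<Longrightarrow> x + y \<in> J m"
  and J_diff: "x \<in> J m \<Longrightarrow> y \<in> J m \<Longrightarrow> x - y \<in> J m" and J_scl: "x \<in> J m \<Longrightarrow> scl c x \<in> J m"
  by (auto simp: J_def)

lemma J_sum: "(\<And>i. i \<in> A \<Longrightarrow> h i \<in> J m) \<Longrightarrow> sum h A \<in> J m"
  by (induction A rule: infinite_finite_induct) (auto intro: J_add)

lemma J_nonpos: "m \<le> 0 \<Longrightarrow> J m = UNIV" by (auto simp: J_def gpart_neg)

lemma J_ge_N: "int N \<le> m \<Longrightarrow> J m = {0}"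
proof -
  assume m: "int N \<le> m"
  have "x = 0" if "x \<in> J m" for x
  proof (rule gpart_eqI)
    show "gpart i x = gpart i 0" for i using that m gpart_ge_N[of i x] by (cases "i < m") (auto simp: J_def)
  qed
  then show ?thesis by auto
qed

lemma J_mono: "m \<le> m' \<Longrightarrow> J m' \<subseteq> J m" by (auto simp: J_def)

lemma gpart_in_J: "gpart i x \<in> J i" by (simp add: J_def)

lemma J_mult: assumes "x \<in> J a" "y \<in> J b" shows "x * y \<in> J (a + b)"
  unfolding J_def
proof (intro CollectI allI impI)
  fix i assume i: "i < a + b"
  have "gpart i (x * y) = gpart i (\<Sum>j\<in>{0..<int N}. x * gpart j y)"
    unfolding sum_distrib_left[symmetric] by (subst gpart_sum) auto
  also have "\<dots> = (\<Sum>j\<in>{0..<int N}. gpart (i - j) x * gpart j y)"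
    using gpart_mult_right[of j "gpart j y" "i - j" x for j] by (simp add: algebra_simps)
  also have "\<dots> = 0"
  proof (rule sum.neutral, rule ballI)
    fix j show "gpart (i - j) x * gpart j y = 0" using assms i by (cases "j < b") (auto simp: J_def)
  qed
  finally show "gpart i (x * y) = 0" .
qed

lemma rad_pow_J: "rad_pow j = J (int j)"
proof (rule Set.set_eqI)
  fix x
  have "(\<forall>i<j. \<pi> i x = 0) \<longleftrightarrow> (\<forall>i<int j. gpart i x = 0)"
    unfolding gpart_def by (metis nat_int nat_less_iff not_less of_nat_0_le_iff of_nat_less_iff)
  then show "x \<in> rad_pow j \<longleftrightarrow> x \<in> J (int j)" by (simp add: rad_pow_iff J_def)
qed

lemma ent_num_J: "ent_num r c = J (r - c)"
  by (auto simp: ent_num_def rad_pow_J J_nonpos)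

lemma ent_den_J: "ent_den r c = J (int N + r - c)"
proof -
  have "int (N - nat (c - r)) = int N + r - c" if "\<not> c < r" "c - r < int N" using that by auto
  then show ?thesis
    by (auto simp: ent_den_def N_def[symmetric] rad_pow_J J_ge_N J_nonpos diff_diff_eq2)
qed

lemma char_zero: "v \<in> V \<Longrightarrow> \<chi> v 0 = 0" and char_diff: "v \<in> V \<Longrightarrow> \<chi> v (x - y) = \<chi> v x - \<chi> v y"
proof -
  show z: "v \<in> V \<Longrightarrow> \<chi> v 0 = 0" using char_scl[of v 0 0] by simp
  show "v \<in> V \<Longrightarrow> \<chi> v (x - y) = \<chi> v x - \<chi> v y" using char_add[of v "x - y" y] by simp
qed

text \<open>The first power of the radical is generated by products of elements of the radical with arbitrary
  elements. These products stay in the radical, which is the common kernel of the characters.\<close>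

lemma radical_J: "jacobson_radical = J 1"
proof -
  have "x \<in> jacobson_radical" if "x \<in> group_closure (jacobson_radical * UNIV)" for x :: 'a
    using that
  proof (induction rule: group_closure.induct)
    case (base s)
    then show ?case
      unfolding radical_eq by (auto simp: char_mult char_zero set_times_def)
  next
    case (diff s t)
    have "\<chi> v (s - t) = 0" if "v \<in> V" for v
      using char_add[OF that, of "s - t" t] diff that by (simp add: radical_eq)
    then show ?case by (simp add: radical_eq)
  qed
  moreover have "x \<in> group_closure (jacobson_radical * UNIV)" if "x \<in> jacobson_radical" for x :: 'a
  proof -
    have "x * 1 \<in> jacobson_radical * UNIV" using that by (intro set_times_intro) auto
    then show ?thesis by (intro group_closure.base) simp
  qed
  ultimately have "(jacobson_radical :: 'a set) = rad_pow 1" by auto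
  then show ?thesis by (simp add: rad_pow_J)
qed

lemma J1_iff: "x \<in> J 1 \<longleftrightarrow> (\<forall>v\<in>V. \<chi> v x = 0)"
  using radical_J radical_eq by blast

lemma char_sum: "v \<in> V \<Longrightarrow> \<chi> v (sum h A) = (\<Sum>x\<in>A. \<chi> v (h x))"
  by (induction A rule: infinite_finite_induct) (auto simp: char_add char_zero)

lemma char_gp0: "v \<in> V \<Longrightarrow> \<chi> v (gpart 0 x) = \<chi> v x"
proof -
  assume v: "v \<in> V"
  have "gpart i (x - gpart 0 x) = 0" if "i < 1" for i
  proof (cases "i = 0")
    case False
    then have "i < 0" using that by linarith
    then show ?thesis by (simp only: gpart_neg)
  qed simp
  then have "x - gpart 0 x \<in> J 1" unfolding J_def by blast
  then show ?thesis using v char_diff[of v x "gpart 0 x"] by (simp add: J1_iff)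
qed

lemma gp0_mult: "gpart 0 (x * y) = gpart 0 x * gpart 0 y"
proof -
  have "gpart 0 (x * y) = gpart 0 (\<Sum>j\<in>{0..<int N}. x * gpart j y)"
    unfolding sum_distrib_left[symmetric] by (subst gpart_sum) auto
  also have "\<dots> = (\<Sum>j\<in>{0..<int N}. gpart (0 - j) x * gpart j y)"
  proof (unfold gpart_simps, rule sum.cong[OF refl])
    fix j show "gpart 0 (x * gpart j y) = gpart (0 - j) x * gpart j y" using gpart_mult_right[of j "gpart j y" "- j" x] by simp
  qed
  also have "\<dots> = (\<Sum>j\<in>{0..<int N}. if j = 0 then gpart 0 x * gpart 0 y else 0)"
    by (rule sum.cong) (auto simp: gpart_neg)
  also have "\<dots> = gpart 0 x * gpart 0 y" using gpart_ge_N[of 0 x] by (cases "N = 0") auto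
  finally show ?thesis .
qed

lemma gp0_one: "gpart 0 1 = 1"
proof -
  have "gpart 0 1 * gpart j y = gpart j y" for j y
    using gpart_mult_right[of j "gpart j y" 0 1] by simp
  then have "gpart 0 1 * (\<Sum>j\<in>{0..<int N}. gpart j 1) = (\<Sum>j\<in>{0..<int N}. gpart j 1)" by (simp add: sum_distrib_left)
  then show ?thesis using gpart_sum[of "{0..<int N}" 1] by simp
qed

text \<open>The vertex idempotents need not be homogeneous; their components of degree zero are.\<close>

definition \<epsilon> :: "'v + 'v \<Rightarrow> 'a" where "\<epsilon> v = gpart 0 (e v)"

lemma \<epsilon>_orth: "v \<in> V \<Longrightarrow> w \<in> V \<Longrightarrow> \<epsilon> v * \<epsilon> w = (if v = w then \<epsilon> v else 0)"
  unfolding \<epsilon>_def gp0_mult[symmetric] by (auto simp: e_orth)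

lemma \<epsilon>_sum: "(\<Sum>v\<in>V. \<epsilon> v) = 1"
  unfolding \<epsilon>_def gpart_simps(5)[symmetric] e_sum by (rule gp0_one)

lemma char_\<epsilon>: "v \<in> V \<Longrightarrow> w \<in> V \<Longrightarrow> \<chi> v (\<epsilon> w) = (if v = w then 1 else 0)"
  unfolding \<epsilon>_def using char_gp0 char_e by simp

lemma gpart_\<epsilon>: "gpart 0 (\<epsilon> v) = \<epsilon> v" by (simp add: \<epsilon>_def)

text \<open>The difference of both sides is killed by all characters, so it lies in the radical, whose elements have
  no component of degree zero.\<close>

lemma degree_zero: assumes "gpart 0 x = x" shows "x = (\<Sum>v\<in>V. scl (\<chi> v x) (\<epsilon> v))"
proof -
  let ?y = "\<Sum>v\<in>V. scl (\<chi> v x) (\<epsilon> v)"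
  have "\<chi> w (x - ?y) = 0" if "w \<in> V" for w
    using that V_finite by (simp add: char_diff char_sum char_scl char_\<epsilon> if_distrib cong: if_cong)
  then have "x - ?y \<in> J 1" by (simp add: J1_iff)
  then have "gpart 0 (x - ?y) = 0" by (simp add: J_def)
  then show ?thesis using assms by (simp add: gpart_\<epsilon>)
qed

lemma corner_degree_zero:
  assumes "v \<in> V" "w \<in> V" "gpart 0 x = x" "\<epsilon> v * x = x" "x * \<epsilon> w = x"
  shows "x = (if v = w then scl (\<chi> w x) (\<epsilon> w) else 0)"
proof -
  have "x = (\<Sum>u\<in>V. scl (\<chi> u x) (\<epsilon> u)) * \<epsilon> w" using degree_zero[OF assms(3)] assms(5) by simp
  also have "\<dots> = (\<Sum>u\<in>V. if u = w then scl (\<chi> w x) (\<epsilon> w) else 0)"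
    unfolding sum_distrib_right using assms(2) by (intro sum.cong) (auto simp: scl_mult_left \<epsilon>_orth)
  also have "\<dots> = scl (\<chi> w x) (\<epsilon> w)" using V_finite assms(2) by simp
  finally have x: "x = scl (\<chi> w x) (\<epsilon> w)" .
  show ?thesis
  proof (cases "v = w")
    case False
    have "\<chi> w x = \<chi> w (\<epsilon> v) * \<chi> w x" using char_mult[OF assms(2), of "\<epsilon> v" x] assms(4) by simp
    then have "\<chi> w x = 0" using False assms by (simp add: char_\<epsilon>)
    then show ?thesis using x False by simp
  qed (use x in simp)
qed

subsection \<open>The last layer of the filtration\<close>

text \<open>If the radical were zero, every element would satisfy the premise of \<open>source\<close>, so the old idempotents
  would vanish.\<close>

lemma N_ge_2: "2 \<le> N"
proof (rule ccontr)
  assume "\<not> 2 \<le> N"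
  then have "J 1 = {0}" using J_ge_N[of 1] by simp
  then have "jacobson_radical = ({0} :: 'a set)" using radical_J by simp
  then have "y * 1 = 0" if "y \<in> jacobson_radical" for y :: 'a using that unfolding mult_1_right by blast
  moreover obtain v where v: "v \<in> V\<^sub>1" using V\<^sub>1_nonempty by auto
  ultimately have "e v * 1 = 0" using source[of v 1] by blast
  then show False using char_e[of v v] char_zero[of v] v V\<^sub>1_subset by auto
qed

lemma \<epsilon>_e_J: "v \<in> V \<Longrightarrow> \<epsilon> v - e v \<in> J 1"
  unfolding J1_iff by (simp add: char_diff char_\<epsilon> char_e)

text \<open>The radical annihilates the last layer, so \<open>source\<close> applies; replacing \<open>e\<^sub>v\<close> by its component of degree
  zero changes nothing, as they differ by an element of the radical.\<close>

lemma last_layer_source: assumes "x \<in> J (int N - 1)" "v \<in> V\<^sub>1" shows "\<epsilon> v * x = 0"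
proof -
  have rad: "y * x = 0" if "y \<in> J 1" for y using J_mult[OF that assms(1)] J_ge_N[of "int N"] by simp
  then have "e v * x = 0" using source[of v x] assms(2) radical_J by blast
  moreover have "(\<epsilon> v - e v) * x = 0" using rad \<epsilon>_e_J assms(2) V\<^sub>1_subset by blast
  ultimately show ?thesis by (simp add: algebra_simps)
qed

lemma last_layer_sink: assumes "x \<in> J (int N - 1)" "v \<in> V" "v \<notin> V\<^sub>1" shows "x * \<epsilon> v = 0"
proof -
  have "x \<in> J 1" using assms(1) J_mono[of 1 "int N - 1"] N_ge_2 by auto
  then have "x * e v = 0" using sink[OF assms(2,3)] radical_J by blast
  moreover have "x * (\<epsilon> v - e v) = 0"
    using J_mult[OF assms(1) \<epsilon>_e_J[OF assms(2)]] J_ge_N[of "int N"] by simp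
  ultimately show ?thesis by (simp add: algebra_simps)
qed

end

section \<open>The trivial extension\<close>

text \<open>Functionals are only required to be additive, which makes the trivial extension a type with a
  ring structure; linearity is imposed where it is needed.\<close>

typedef (overloaded) ('a::ring_1, 'k::field) trivext = "{p :: 'a \<times> ('a \<Rightarrow> 'k). \<forall>x y. snd p (x + y) = snd p x + snd p y}"
  by (rule exI[of _ "(0, \<lambda>_. 0)"]) simp

setup_lifting type_definition_trivext

lift_definition alg :: "('a::ring_1, 'k::field) trivext \<Rightarrow> 'a" is fst .
lift_definition fnl :: "('a::ring_1, 'k::field) trivext \<Rightarrow> 'a \<Rightarrow> 'k" is snd .

lemma trivext_eqI: "alg a = alg b \<Longrightarrow> (\<And>x. fnl a x = fnl b x) \<Longrightarrow> a = b"
  by transfer (auto simp: prod_eq_iff)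

lemma fnl_add [simp]: "fnl a (x + y) = fnl a x + fnl a y"
  by transfer auto

lemma fnl_zero [simp]: "fnl a 0 = 0" using fnl_add[of a 0 0] by (metis add_cancel_left_left)
lemma fnl_diff [simp]: "fnl a (x - y) = fnl a x - fnl a y" using fnl_add[of a "x - y" y] by (simp add: eq_diff_eq)
lemma fnl_sum [simp]: "fnl a (sum h A) = (\<Sum>x\<in>A. fnl a (h x))"
  by (induction A rule: infinite_finite_induct) auto

instantiation trivext :: (ring_1, field) ring_1
begin

lift_definition zero_trivext :: "('a, 'b) trivext" is "(0, \<lambda>_. 0)" by simp
lift_definition one_trivext :: "('a, 'b) trivext" is "(1, \<lambda>_. 0)" by simp
lift_definition plus_trivext :: "('a, 'b) trivext \<Rightarrow> ('a, 'b) trivext \<Rightarrow> ('a, 'b) trivext"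
  is "\<lambda>p q. (fst p + fst q, \<lambda>x. snd p x + snd q x)" by (auto simp: algebra_simps)
lift_definition minus_trivext :: "('a, 'b) trivext \<Rightarrow> ('a, 'b) trivext \<Rightarrow> ('a, 'b) trivext"
  is "\<lambda>p q. (fst p - fst q, \<lambda>x. snd p x - snd q x)" by (auto simp: algebra_simps)
lift_definition uminus_trivext :: "('a, 'b) trivext \<Rightarrow> ('a, 'b) trivext"
  is "\<lambda>p. (- fst p, \<lambda>x. - snd p x)" by auto
lift_definition times_trivext :: "('a, 'b) trivext \<Rightarrow> ('a, 'b) trivext \<Rightarrow> ('a, 'b) trivext"
  is "\<lambda>p q. (fst p * fst q, \<lambda>x. snd q (x * fst p) + snd p (fst q * x))" by (auto simp: algebra_simps)

instance
  by intro_classes (transfer; auto simp: algebra_simps fun_eq_iff)+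

end

lemma trivext_simps [simp]:
  "alg 0 = 0" "fnl 0 x = 0" "alg 1 = 1" "fnl 1 x = 0" "alg (a + b) = alg a + alg b" "fnl (a + b) x = fnl a x + fnl b x"
  "alg (a - b) = alg a - alg b" "fnl (a - b) x = fnl a x - fnl b x" "alg (- a) = - alg a" "fnl (- a) x = - fnl a x"
  "alg (a * b) = alg a * alg b" "fnl (a * b) x = fnl b (x * alg a) + fnl a (alg b * x)"
  by (transfer; simp)+

lemma trivext_sum [simp]: "alg (sum h A) = (\<Sum>i\<in>A. alg (h i))" "fnl (sum h A) x = (\<Sum>i\<in>A. fnl (h i) x)"
  by (induction A rule: infinite_finite_induct) auto

lift_definition of_alg :: "'a::ring_1 \<Rightarrow> ('a, 'k::field) trivext" is "\<lambda>x. (x, \<lambda>_. 0)" by simp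

lift_definition of_fnl :: "('a::ring_1 \<Rightarrow> 'k::field) \<Rightarrow> ('a, 'k) trivext"
  is "\<lambda>F. (0, if \<forall>x y. F (x + y) = F x + F y then F else (\<lambda>_. 0))" by auto

lemma of_alg_simps [simp]: "alg (of_alg x) = x" "fnl (of_alg x) y = 0"
  by (transfer; simp)+

lemma of_fnl_simps: "alg (of_fnl F) = 0" "(\<And>x y. F (x + y) = F x + F y) \<Longrightarrow> fnl (of_fnl F) = F"
  by (transfer; simp)+

lemma of_alg_hom: "of_alg (x * y) = of_alg x * of_alg y" "of_alg (x + y) = of_alg x + of_alg y" "of_alg 0 = 0" "of_alg 1 = 1"
  by (auto intro!: trivext_eqI)

section \<open>Matrices over the trivial extension\<close>

lift_definition tscale :: "('k \<Rightarrow> 'a \<Rightarrow> 'a) \<Rightarrow> 'k \<Rightarrow> ('a::ring_1, 'k::field) trivext \<Rightarrow> ('a, 'k) trivext"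
  is "\<lambda>s c p. (s c (fst p), \<lambda>x. c * snd p x)" by (auto simp: algebra_simps)

lemma tscale_simps [simp]: "alg (tscale s c a) = s c (alg a)" "fnl (tscale s c a) x = c * fnl a x"
  by (transfer; simp)+

type_synonym ('a, 'k) tmat = "int \<Rightarrow> int \<Rightarrow> ('a, 'k) trivext"

definition mmul :: "('a::ring_1, 'k::field) tmat \<Rightarrow> ('a, 'k) tmat \<Rightarrow> ('a, 'k) tmat" where
  "mmul m m' = (\<lambda>r c. \<Sum>s | m r s \<noteq> 0. m r s * m' s c)"

definition supported :: "('a::ring_1, 'k::field) tmat \<Rightarrow> int set \<Rightarrow> bool" where
  "supported m S \<longleftrightarrow> finite S \<and> (\<forall>r c. m r c \<noteq> 0 \<longrightarrow> r \<in> S \<and> c \<in> S)"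

definition mat_unit :: "int \<Rightarrow> int \<Rightarrow> ('a::ring_1, 'k::field) trivext \<Rightarrow> ('a, 'k) tmat" where
  "mat_unit i j a = (\<lambda>r c. if r = i \<and> c = j then a else 0)"

lemma supported_mono: "supported m S \<Longrightarrow> S \<subseteq> S' \<Longrightarrow> finite S' \<Longrightarrow> supported m S'"
  by (auto simp: supported_def)

lemma supportedD: "supported m S \<Longrightarrow> r \<notin> S \<Longrightarrow> m r c = 0" "supported m S \<Longrightarrow> c \<notin> S \<Longrightarrow> m r c = 0"
  by (auto simp: supported_def)

lemma supportedI:
  assumes "finite S" "\<And>r c. r \<notin> S \<Longrightarrow> m r c = 0" "\<And>r c. c \<notin> S \<Longrightarrow> m r c = 0" shows "supported m S"
  using assms unfolding supported_def by blast

lemma supported_finite: "supported m S \<Longrightarrow> finite S" by (simp add: supported_def)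

lemma mmul_eq: "supported m S \<Longrightarrow> mmul m m' r c = (\<Sum>s\<in>S. m r s * m' s c)"
  unfolding mmul_def by (intro sum.mono_neutral_left) (auto simp: supported_def)

lemma mmul_supported: assumes "supported m S" "supported m' S" shows "supported (mmul m m') S"
  unfolding supported_def
proof (intro conjI allI impI)
  show "finite S" using assms by (simp add: supported_def)
  fix r c assume nz: "mmul m m' r c \<noteq> 0"
  show "r \<in> S"
  proof (rule ccontr)
    assume "r \<notin> S"
    then have "m r s = 0" for s by (rule supportedD(1)[OF assms(1)])
    then show False using nz by (simp add: mmul_def)
  qed
  show "c \<in> S"
  proof (rule ccontr)
    assume "c \<notin> S"
    then have "m' s c = 0" for s by (rule supportedD(2)[OF assms(2)])
    then show False using nz by (simp add: mmul_def)
  qed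
qed

lemma mmul_assoc:
  assumes "supported a S" "supported b S" "supported c S"
  shows "mmul (mmul a b) c = mmul a (mmul b c)"
proof (intro ext)
  fix i j
  have "mmul (mmul a b) c i j = (\<Sum>s\<in>S. \<Sum>t\<in>S. a i t * b t s * c s j)"
    using mmul_eq[OF mmul_supported[OF assms(1,2)]] mmul_eq[OF assms(1)] by (simp add: sum_distrib_right)
  also have "\<dots> = (\<Sum>t\<in>S. \<Sum>s\<in>S. a i t * b t s * c s j)" by (rule sum.swap)
  also have "\<dots> = mmul a (mmul b c) i j"
    using mmul_eq[OF assms(1)] mmul_eq[OF assms(2)] by (simp add: sum_distrib_left mult.assoc)
  finally show "mmul (mmul a b) c i j = mmul a (mmul b c) i j" .
qed

lemma mat_unit_supported: "supported (mat_unit i j a) {i, j}"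
  by (auto simp: supported_def mat_unit_def)

lemma mmul_mat_unit_left: "mmul (mat_unit i j a) m = (\<lambda>r c. if r = i then a * m j c else 0)"
  using mmul_eq[OF mat_unit_supported[of i j a], of m]
  by (intro ext) (cases "i = j"; auto simp: mat_unit_def)

lemma mmul_mat_unit_right: assumes "supported m S"
  shows "mmul m (mat_unit i j a) = (\<lambda>r c. if c = j then m r i * a else 0)"
proof (intro ext)
  fix r c
  have S: "supported m (insert i S)" using assms by (auto simp: supported_def)
  have "mmul m (mat_unit i j a) r c = (\<Sum>s\<in>insert i S. if s = i then (if c = j then m r i * a else 0) else 0)"
    unfolding mmul_eq[OF S] by (rule sum.cong) (auto simp: mat_unit_def)
  also have "\<dots> = (if c = j then m r i * a else 0)" using S by (simp add: supported_def)
  finally show "mmul m (mat_unit i j a) r c = (if c = j then m r i * a else 0)" .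
qed

context graded_tilde
begin

definition lin :: "('a, 'k) trivext \<Rightarrow> bool" where "lin a \<longleftrightarrow> (\<forall>c x. fnl a (scl c x) = c * fnl a x)"

text \<open>Entries of the two kinds of matrices: \<open>Num r c\<close> contains the representatives of the entries of \<open>D\<close> in
  position \<open>(r, c)\<close>, and \<open>Den r c\<close> those that represent zero. The second component of an entry in position
  \<open>(r, c)\<close> is a functional on the entry space in position \<open>(c, r)\<close>.\<close>

definition Num :: "int \<Rightarrow> int \<Rightarrow> ('a, 'k) trivext set" where
  "Num r c = {a. alg a \<in> J (r - c) \<and> lin a \<and> (\<forall>x\<in>J (int N + c - r). fnl a x = 0)}"

definition Den :: "int \<Rightarrow> int \<Rightarrow> ('a, 'k) trivext set" where
  "Den r c = {a. alg a \<in> J (int N + r - c) \<and> (\<forall>x\<in>J (c - r). fnl a x = 0)}"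

definition mats :: "('a, 'k) tmat set" where
  "mats = {m. (\<exists>S. supported m S) \<and> (\<forall>r c. m r c \<in> Num r c)}"

lemma lin_simps: "lin 0" "lin a \<Longrightarrow> lin b \<Longrightarrow> lin (a + b)" "lin a \<Longrightarrow> lin b \<Longrightarrow> lin (a - b)" "lin (of_alg x)"
  "lin a \<Longrightarrow> lin (tscale scl c a)" "lin a \<Longrightarrow> lin b \<Longrightarrow> lin (a * b)" "lin 1"
  by (auto simp: lin_def algebra_simps scl_mult_left scl_mult_right)

lemma Num_zero [simp]: "0 \<in> Num r c" by (simp add: Num_def lin_simps)
lemma Num_add: "a \<in> Num r c \<Longrightarrow> b \<in> Num r c \<Longrightarrow> a + b \<in> Num r c" by (simp add: Num_def lin_simps J_add)
lemma Num_diff: "a \<in> Num r c \<Longrightarrow> b \<in> Num r c \<Longrightarrow> a - b \<in> Num r c" by (simp add: Num_def lin_simps J_diff)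
lemma Num_scale: "a \<in> Num r c \<Longrightarrow> tscale scl k a \<in> Num r c" by (simp add: Num_def lin_simps J_scl)
lemma Num_sum: "(\<And>i. i \<in> A \<Longrightarrow> h i \<in> Num r c) \<Longrightarrow> sum h A \<in> Num r c"
  by (induction A rule: infinite_finite_induct) (auto intro: Num_add)

lemma Num_mult: assumes a: "a \<in> Num r s" and b: "b \<in> Num s c" shows "a * b \<in> Num r c"
proof -
  have "alg a * alg b \<in> J ((r - s) + (s - c))" using a b by (intro J_mult) (auto simp: Num_def)
  moreover have "fnl (a * b) x = 0" if x: "x \<in> J (int N + c - r)" for x
  proof -
    have aJ: "alg a \<in> J (r - s)" "alg b \<in> J (s - c)"
      and fa: "\<And>y. y \<in> J (int N + s - r) \<Longrightarrow> fnl a y = 0" and fb: "\<And>y. y \<in> J (int N + c - s) \<Longrightarrow> fnl b y = 0"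
      using a b by (auto simp: Num_def)
    have "x * alg a \<in> J (int N + c - s)" "alg b * x \<in> J (int N + s - r)"
      using J_mult[OF x aJ(1)] J_mult[OF aJ(2) x] by (simp_all add: algebra_simps)
    then show ?thesis by (simp add: fa fb)
  qed
  ultimately show ?thesis using a b by (simp add: Num_def lin_simps)
qed

lemma Num_of_alg [simp]: "of_alg x \<in> Num i i"
  by (simp add: Num_def lin_simps J_nonpos)

lemma matsI: "supported m S \<Longrightarrow> (\<And>r c. m r c \<in> Num r c) \<Longrightarrow> m \<in> mats" by (auto simp: mats_def)
lemma mats_supported: "m \<in> mats \<Longrightarrow> \<exists>S. supported m S" by (simp add: mats_def)
lemma mats_Num: "m \<in> mats \<Longrightarrow> m r c \<in> Num r c" by (simp add: mats_def)

lemma mats_supported_finite: "finite X \<Longrightarrow> X \<subseteq> mats \<Longrightarrow> \<exists>S. \<forall>m\<in>X. supported m S"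
proof (induction X rule: finite_induct)
  case (insert m X)
  then obtain S where S: "\<forall>m\<in>X. supported m S" by blast
  obtain T where T: "supported m T" using mats_supported insert.prems by blast
  show ?case
  proof (cases "X = {}")
    case False
    then have "finite S" "finite T" using S T by (auto simp: supported_def)
    then have "\<forall>m'\<in>insert m X. supported m' (S \<union> T)"
      using S T supported_mono[of _ S "S \<union> T"] supported_mono[of _ T "S \<union> T"] by blast
    then show ?thesis by blast
  qed (use T in blast)
qed simp

lemma mats_zero: "(\<lambda>_ _. 0) \<in> mats"
  by (rule matsI[of _ "{}"]) (auto simp: supported_def)

lemma mats_pair: assumes "m \<in> mats" "m' \<in> mats" obtains S where "supported m S" "supported m' S"
  using mats_supported_finite[of "{m, m'}"] assms by auto

lemma mats_add: assumes "m \<in> mats" "m' \<in> mats" shows "(\<lambda>r c. m r c + m' r c) \<in> mats"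
proof -
  obtain S where "supported m S" "supported m' S" using mats_pair[OF assms] .
  then have "supported (\<lambda>r c. m r c + m' r c) S" by (intro supportedI) (auto simp: supportedD supported_finite)
  then show ?thesis using assms by (intro matsI) (auto intro: Num_add mats_Num)
qed

lemma mats_diff: assumes "m \<in> mats" "m' \<in> mats" shows "(\<lambda>r c. m r c - m' r c) \<in> mats"
proof -
  obtain S where "supported m S" "supported m' S" using mats_pair[OF assms] .
  then have "supported (\<lambda>r c. m r c - m' r c) S" by (intro supportedI) (auto simp: supportedD supported_finite)
  then show ?thesis using assms by (intro matsI) (auto intro: Num_diff mats_Num)
qed

lemma mats_scale: assumes "m \<in> mats" shows "(\<lambda>r c. tscale scl k (m r c)) \<in> mats"
proof -
  obtain S where "supported m S" using mats_supported[OF assms] by blast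
  moreover have "tscale scl k 0 = 0" by (rule trivext_eqI) auto
  ultimately have "supported (\<lambda>r c. tscale scl k (m r c)) S" by (intro supportedI) (auto simp: supportedD supported_finite)
  then show ?thesis using assms by (intro matsI) (auto intro: Num_scale mats_Num)
qed

lemma mats_mmul: assumes "m \<in> mats" "m' \<in> mats" shows "mmul m m' \<in> mats"
proof -
  obtain S where "supported m S" "supported m' S" using mats_pair[OF assms] .
  then have "supported (mmul m m') S" by (rule mmul_supported)
  then show ?thesis using assms unfolding mmul_def
    by (intro matsI) (auto intro!: Num_sum Num_mult[OF mats_Num mats_Num])
qed

lemma mats_unit: "a \<in> Num i j \<Longrightarrow> mat_unit i j a \<in> mats"
  by (rule matsI[OF mat_unit_supported]) (auto simp: mat_unit_def)

subsection \<open>Cosets\<close>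

lemma coset_iff: "x +o J k = y +o J k \<longleftrightarrow> x - y \<in> J k"
proof
  assume "x +o J k = y +o J k"
  moreover have "x + 0 \<in> x +o J k" by (rule set_plus_intro2) simp
  ultimately show "x - y \<in> J k" using set_plus_imp_minus[of x y "J k"] by simp
next
  have *: "x +o J k \<subseteq> y +o J k" if "x - y \<in> J k" for x y
  proof
    fix z assume "z \<in> x +o J k"
    then have "z - x \<in> J k" by (rule set_plus_imp_minus)
    then have "(z - x) + (x - y) \<in> J k" using that by (rule J_add)
    then show "z \<in> y +o J k" by (simp add: set_minus_plus[symmetric])
  qed
  assume d: "x - y \<in> J k"
  then have "y - x \<in> J k" using J_diff[OF J_zero d] by simp
  then show "x +o J k = y +o J k" using * d by blast
qed

lemma J_plus_J: "J k + J k = J k"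
proof
  show "J k + J k \<subseteq> J k" using J_add by (auto elim: set_plus_elim)
  show "J k \<subseteq> J k + J k" by (rule set_zero_plus2) simp
qed

lemma coset_plus: "(x +o J k) + (y +o J k) = (x + y) +o J k"
  by (simp add: set_plus_rearrange J_plus_J)

lemma mem_coset: "y \<in> x +o J k \<longleftrightarrow> y - x \<in> J k" by (rule set_minus_plus[symmetric])

lemma ent_iff: "X \<in> ent r c \<longleftrightarrow> (\<exists>x\<in>J (r - c). X = x +o J (int N + r - c))"
  by (auto simp: ent_def ent_num_J ent_den_J)

lemma ent_scale_coset: "ent_scale scl r c k (x +o J (int N + r - c)) = scl k x +o J (int N + r - c)"
  unfolding ent_scale_def ent_den_J
  by (rule additive_image_coset) (auto simp: scale_right_distrib J_scl J_add)

text \<open>Changing one factor by an element of its denominator changes the product by an element of the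
  denominator in position \<open>(r, c)\<close>, since the exponents of the radical add up.\<close>

lemma ent_mult_coset:
  assumes x: "x \<in> J (r - s)" and y: "y \<in> J (s - c)"
  shows "ent_mult r c (x +o J (int N + r - s)) (y +o J (int N + s - c)) = x * y +o J (int N + r - c)"
    (is "_ = ?R")
  unfolding ent_mult_def ent_den_J
proof
  show "(x +o J (int N + r - s)) * (y +o J (int N + s - c)) + J (int N + r - c) \<subseteq> ?R"
  proof
    fix z assume "z \<in> (x +o J (int N + r - s)) * (y +o J (int N + s - c)) + J (int N + r - c)"
    then obtain x' y' d where x': "x' - x \<in> J (int N + r - s)" and y': "y' - y \<in> J (int N + s - c)"
      and d: "d \<in> J (int N + r - c)" and z: "z = x' * y' + d"
      by (auto elim!: set_plus_elim set_times_elim simp: mem_coset)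
    have "y' = (y' - y) + y" by simp
    moreover have "(y' - y) + y \<in> J (s - c)"
      using y y' J_mono[of "s - c" "int N + s - c"] by (intro J_add) auto
    ultimately have y'J: "y' \<in> J (s - c)" by simp
    have "(int N + r - s) + (s - c) = int N + r - c" "(r - s) + (int N + s - c) = int N + r - c" by simp_all
    then have "(x' - x) * y' \<in> J (int N + r - c)" "x * (y' - y) \<in> J (int N + r - c)"
      using J_mult[OF x' y'J] J_mult[OF x y'] by (simp_all only:)
    then have "(x' - x) * y' + x * (y' - y) + d \<in> J (int N + r - c)"
      using d by (intro J_add) simp_all
    moreover have "z - x * y = (x' - x) * y' + x * (y' - y) + d" by (simp add: z algebra_simps)
    ultimately show "z \<in> ?R" by (simp add: mem_coset)
  qed
  show "?R \<subseteq> (x +o J (int N + r - s)) * (y +o J (int N + s - c)) + J (int N + r - c)"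
  proof
    fix z assume "z \<in> ?R"
    then have "z - x * y \<in> J (int N + r - c)" by (simp add: mem_coset)
    moreover have "x * y \<in> (x +o J (int N + r - s)) * (y +o J (int N + s - c))"
      by (intro set_times_intro) (simp_all add: mem_coset)
    ultimately have "x * y + (z - x * y) \<in> (x +o J (int N + r - s)) * (y +o J (int N + s - c)) + J (int N + r - c)"
      by blast
    then show "z \<in> (x +o J (int N + r - s)) * (y +o J (int N + s - c)) + J (int N + r - c)" by simp
  qed
qed

lemma coset_sum: "finite T \<Longrightarrow> J k + (\<Sum>s\<in>T. z s +o J k) = (\<Sum>s\<in>T. z s) +o J k"
proof (induction T rule: finite_induct)
  case empty
  then show ?case by (simp add: set_add_0_right)
next
  case (insert s T)
  have "J k + (\<Sum>s\<in>insert s T. z s +o J k) = (z s +o J k) + (J k + (\<Sum>s\<in>T. z s +o J k))"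
    unfolding sum.insert[OF insert.hyps] by (rule add.left_commute)
  also have "\<dots> = (z s +o J k) + ((\<Sum>s\<in>T. z s) +o J k)" by (simp only: insert.IH)
  finally show ?case using insert.hyps by (simp add: coset_plus)
qed

subsection \<open>The surjection onto the algebra\<close>

abbreviation "DA \<equiv> D_algebra scl"

text \<open>The functional is evaluated on an arbitrary element of the coset \<open>X\<close>; for entries in \<open>Num\<close> its value does not
  depend on this choice.\<close>

definition \<Phi> :: "('a, 'k) tmat \<Rightarrow> ('k, 'a) D_elem" where
  "\<Phi> m = (\<lambda>r c. alg (m r c) +o ent_den r c, \<lambda>r c X. if X \<in> ent c r then fnl (m r c) (SOME x. x \<in> X) else 0)"

lemma DA_simps: "carrier DA = C_carrier \<times> C_dual_carrier scl" "\<zero>\<^bsub>DA\<^esub> = (ent_den, \<lambda>_ _ _. 0)"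
  "M \<oplus>\<^bsub>DA\<^esub> M' = (\<lambda>r c. fst M r c + fst M' r c, \<lambda>r c X. snd M r c X + snd M' r c X)"
  "M \<otimes>\<^bsub>DA\<^esub> M' = (C_mult (fst M) (fst M'), \<lambda>r c X. C_dual_lact (fst M) (snd M') r c X + C_dual_ract (snd M) (fst M') r c X)"
  "k \<odot>\<^bsub>DA\<^esub> M = (\<lambda>r c. ent_scale scl r c k (fst M r c), \<lambda>r c X. k * snd M r c X)"
  by (simp_all add: D_algebra_def case_prod_beta)

lemma fst_\<Phi>: "fst (\<Phi> m) r c = alg (m r c) +o J (int N + r - c)"
  by (simp add: \<Phi>_def ent_den_J)

lemma snd_\<Phi>: assumes "m r c \<in> Num r c" "x \<in> J (c - r)"
  shows "snd (\<Phi> m) r c (x +o J (int N + c - r)) = fnl (m r c) x"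
proof -
  let ?y = "SOME y. y \<in> x +o J (int N + c - r)"
  have "x \<in> x +o J (int N + c - r)" by (simp add: mem_coset)
  then have "?y \<in> x +o J (int N + c - r)" by (rule someI)
  then have "fnl (m r c) (?y - x) = 0" using assms(1) by (auto simp: mem_coset Num_def)
  then show ?thesis using assms(2) by (auto simp: \<Phi>_def ent_iff)
qed

lemma snd_\<Phi>_out: "X \<notin> ent c r \<Longrightarrow> snd (\<Phi> m) r c X = 0" by (simp add: \<Phi>_def)

lemma D_eqI:
  assumes "\<And>r c. fst M r c = fst M' r c"
    and "\<And>r c x. x \<in> J (c - r) \<Longrightarrow> snd M r c (x +o J (int N + c - r)) = snd M' r c (x +o J (int N + c - r))"
    and "\<And>r c X. X \<notin> ent c r \<Longrightarrow> snd M r c X = snd M' r c X"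
  shows "M = (M' :: ('k, 'a) D_elem)"
proof (rule prod_eqI)
  show "fst M = fst M'" using assms(1) by (intro ext)
  show "snd M = snd M'"
  proof (intro ext)
    fix r c X show "snd M r c X = snd M' r c X"
    proof (cases "X \<in> ent c r")
      case True
      then obtain x where "x \<in> J (c - r)" "X = x +o J (int N + c - r)" unfolding ent_iff by blast
      then show ?thesis using assms(2) by simp
    qed (use assms(3) in simp)
  qed
qed

lemma snd_\<Phi>_mats: "m \<in> mats \<Longrightarrow> x \<in> J (c - r) \<Longrightarrow> snd (\<Phi> m) r c (x +o J (int N + c - r)) = fnl (m r c) x"
  by (rule snd_\<Phi>[OF mats_Num])

lemma fst_\<Phi>_nonzero: "fst (\<Phi> m) r c \<noteq> ent_den r c \<Longrightarrow> m r c \<noteq> 0"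
proof
  assume "fst (\<Phi> m) r c \<noteq> ent_den r c" "m r c = 0"
  then show False by (simp add: fst_\<Phi> ent_den_J)
qed

lemma \<Phi>_carrier: assumes m: "m \<in> mats" shows "\<Phi> m \<in> carrier DA"
proof -
  obtain S where S: "supported m S" using mats_supported[OF m] by blast
  have fin: "finite (S \<times> S)" using S by (simp add: supported_def)
  have "fst (\<Phi> m) \<in> C_carrier"
    unfolding C_carrier_def
  proof (intro CollectI conjI allI)
    show "fst (\<Phi> m) r c \<in> ent r c" for r c
      using mats_Num[OF m, of r c] by (auto simp: fst_\<Phi> ent_iff Num_def)
    have "{(r, c). fst (\<Phi> m) r c \<noteq> ent_den r c} \<subseteq> S \<times> S"
      using fst_\<Phi>_nonzero S unfolding supported_def by blast
    then show "finite {(r, c). fst (\<Phi> m) r c \<noteq> ent_den r c}" using fin by (rule finite_subset)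
  qed
  moreover have "snd (\<Phi> m) \<in> C_dual_carrier scl"
    unfolding C_dual_carrier_def ent_dual_def
  proof (intro CollectI conjI allI ballI impI)
    fix r c
    note mN = mats_Num[OF m, of r c]
    show "snd (\<Phi> m) r c X = 0" if "X \<notin> ent c r" for X using that by (rule snd_\<Phi>_out)
    fix X :: "'a set" assume "X \<in> ent c r"
    then obtain x where x: "x \<in> J (c - r)" "X = x +o J (int N + c - r)" by (auto simp: ent_iff)
    show "snd (\<Phi> m) r c (ent_scale scl c r k X) = k * snd (\<Phi> m) r c X" for k
      unfolding x(2) ent_scale_coset snd_\<Phi>_mats[OF m J_scl[OF x(1)]] snd_\<Phi>_mats[OF m x(1)]
      using mN by (simp add: Num_def lin_def)
    fix Y :: "'a set" assume "Y \<in> ent c r"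
    then obtain y where y: "y \<in> J (c - r)" "Y = y +o J (int N + c - r)" by (auto simp: ent_iff)
    show "snd (\<Phi> m) r c (X + Y) = snd (\<Phi> m) r c X + snd (\<Phi> m) r c Y"
      unfolding x(2) y(2) coset_plus snd_\<Phi>_mats[OF m J_add[OF x(1) y(1)]] snd_\<Phi>_mats[OF m x(1)] snd_\<Phi>_mats[OF m y(1)]
      by simp
  next
    have "{(r, c). snd (\<Phi> m) r c \<noteq> (\<lambda>_. 0)} \<subseteq> S \<times> S"
    proof clarify
      fix r c assume ne: "snd (\<Phi> m) r c \<noteq> (\<lambda>_. 0)"
      have "m r c \<noteq> 0"
      proof
        assume "m r c = 0"
        then have "snd (\<Phi> m) r c = (\<lambda>_. 0)" by (simp add: \<Phi>_def fun_eq_iff)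
        then show False using ne by blast
      qed
      then show "r \<in> S \<and> c \<in> S" using S by (simp add: supported_def)
    qed
    then show "finite {(r, c). snd (\<Phi> m) r c \<noteq> (\<lambda>_. 0)}" using fin by (rule finite_subset)
  qed
  ultimately show ?thesis by (simp add: DA_simps mem_Times_iff)
qed

lemma \<Phi>_zero: "\<Phi> (\<lambda>_ _. 0) = \<zero>\<^bsub>DA\<^esub>"
  by (simp add: \<Phi>_def DA_simps fun_eq_iff)

lemma \<Phi>_add: assumes "m \<in> mats" "m' \<in> mats"
  shows "\<Phi> (\<lambda>r c. m r c + m' r c) = \<Phi> m \<oplus>\<^bsub>DA\<^esub> \<Phi> m'"
  by (rule D_eqI) (use assms mats_add[OF assms] in
    \<open>auto simp: DA_simps fst_\<Phi> coset_plus snd_\<Phi>_mats snd_\<Phi>_out\<close>)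

lemma \<Phi>_scale: assumes "m \<in> mats"
  shows "\<Phi> (\<lambda>r c. tscale scl k (m r c)) = k \<odot>\<^bsub>DA\<^esub> \<Phi> m"
proof (rule D_eqI)
  show "snd (\<Phi> (\<lambda>r c. tscale scl k (m r c))) r c (x +o J (int N + c - r)) =
      snd (k \<odot>\<^bsub>DA\<^esub> \<Phi> m) r c (x +o J (int N + c - r))" if "x \<in> J (c - r)" for r c x
    unfolding snd_\<Phi>_mats[OF mats_scale[OF assms] that] by (simp add: DA_simps snd_\<Phi>_mats[OF assms that])
qed (simp_all add: DA_simps fst_\<Phi> ent_scale_coset snd_\<Phi>_out)

text \<open>The sums that define the product in \<open>D\<close> run over the nonzero entries of \<open>D\<close>, the sum of matrix products
  over the nonzero representatives; the additional terms lie in the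
  denominators or are killed by the functionals.\<close>

lemma \<Phi>_mult: assumes m: "m \<in> mats" and m': "m' \<in> mats"
  shows "\<Phi> (mmul m m') = \<Phi> m \<otimes>\<^bsub>DA\<^esub> \<Phi> m'"
proof -
  obtain S where S: "supported m S" "supported m' S" using mats_pair[OF assms] .
  have finS: "finite S" using S by (simp add: supported_def)
  have aJ: "alg (m r c) \<in> J (r - c)" "alg (m' r c) \<in> J (r - c)" for r c
    using mats_Num[OF m] mats_Num[OF m'] by (auto simp: Num_def)
  have den_iff: "x +o J k = ent_den r c \<longleftrightarrow> x \<in> J k" if "k = int N + r - c" for x k r c
    using coset_iff[of x k 0] that by (simp add: ent_den_J)
  show ?thesis
  proof (rule D_eqI)
    fix r c
    let ?T = "{s. fst (\<Phi> m) r s \<noteq> ent_den r s \<and> fst (\<Phi> m') s c \<noteq> ent_den s c}"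
    have TS: "?T \<subseteq> S"
      using fst_\<Phi>_nonzero S(1) unfolding supported_def by blast
    have finT: "finite ?T" using TS finS by (rule finite_subset)
    have "fst (\<Phi> m \<otimes>\<^bsub>DA\<^esub> \<Phi> m') r c = J (int N + r - c) + (\<Sum>s\<in>?T. alg (m r s) * alg (m' s c) +o J (int N + r - c))"
      by (simp add: DA_simps C_mult_def ent_den_J[of r c]) (simp add: fst_\<Phi> ent_mult_coset aJ)
    also have "\<dots> = (\<Sum>s\<in>?T. alg (m r s) * alg (m' s c)) +o J (int N + r - c)"
      by (rule coset_sum[OF finT])
    also have "\<dots> = alg (mmul m m' r c) +o J (int N + r - c)"
      unfolding coset_iff
    proof -
      have "alg (mmul m m' r c) = (\<Sum>s\<in>S. alg (m r s) * alg (m' s c))" by (simp add: mmul_eq[OF S(1)])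
      also have "\<dots> = (\<Sum>s\<in>?T. alg (m r s) * alg (m' s c)) + (\<Sum>s\<in>S - ?T. alg (m r s) * alg (m' s c))"
        using sum.subset_diff[OF TS finS, of "\<lambda>s. alg (m r s) * alg (m' s c)"] by (simp add: add.commute)
      finally have "(\<Sum>s\<in>?T. alg (m r s) * alg (m' s c)) - alg (mmul m m' r c) =
          0 - (\<Sum>s\<in>S - ?T. alg (m r s) * alg (m' s c))" by simp
      also have "\<dots> \<in> J (int N + r - c)"
      proof (intro J_diff J_sum J_zero)
        fix s assume "s \<in> S - ?T"
        then have "alg (m r s) \<in> J (int N + r - s) \<or> alg (m' s c) \<in> J (int N + s - c)" by (auto simp: fst_\<Phi> den_iff)
        then have "alg (m r s) * alg (m' s c) \<in> J ((int N + r - s) + (s - c)) \<or>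
            alg (m r s) * alg (m' s c) \<in> J ((r - s) + (int N + s - c))" using aJ J_mult by blast
        then show "alg (m r s) * alg (m' s c) \<in> J (int N + r - c)" by (simp add: algebra_simps)
      qed
      finally show "(\<Sum>s\<in>?T. alg (m r s) * alg (m' s c)) - alg (mmul m m' r c) \<in> J (int N + r - c)" .
    qed
    finally show "fst (\<Phi> (mmul m m')) r c = fst (\<Phi> m \<otimes>\<^bsub>DA\<^esub> \<Phi> m') r c" by (simp add: fst_\<Phi>)
  next
    fix r c x assume x: "x \<in> J (c - r)"
    let ?X = "x +o J (int N + c - r)"
    have X: "?X \<in> ent c r" using x by (auto simp: ent_iff)
    have xa: "x * alg (m r s) \<in> J (c - s)" for s using J_mult[OF x aJ(1)[of r s]] by simp
    have bx: "alg (m' s c) * x \<in> J (s - r)" for s using J_mult[OF aJ(2)[of s c] x] by simp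
    have "C_dual_lact (fst (\<Phi> m)) (snd (\<Phi> m')) r c ?X =
        (\<Sum>s | fst (\<Phi> m) r s \<noteq> ent_den r s. fnl (m' s c) (x * alg (m r s)))"
      using X by (simp add: C_dual_lact_def) (simp add: fst_\<Phi> ent_mult_coset x aJ snd_\<Phi>[of m', OF mats_Num[OF m'] xa])
    also have "\<dots> = (\<Sum>s\<in>S. fnl (m' s c) (x * alg (m r s)))"
    proof (rule sum.mono_neutral_left[OF finS])
      show "{s. fst (\<Phi> m) r s \<noteq> ent_den r s} \<subseteq> S"
        using fst_\<Phi>_nonzero S(1) unfolding supported_def by blast
      show "\<forall>s\<in>S - {s. fst (\<Phi> m) r s \<noteq> ent_den r s}. fnl (m' s c) (x * alg (m r s)) = 0"
      proof
        fix s assume "s \<in> S - {s. fst (\<Phi> m) r s \<noteq> ent_den r s}"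
        then have "alg (m r s) \<in> J (int N + r - s)" by (auto simp: fst_\<Phi> den_iff)
        from J_mult[OF x this] have "x * alg (m r s) \<in> J (int N + c - s)" by (simp add: algebra_simps)
        then show "fnl (m' s c) (x * alg (m r s)) = 0" using mats_Num[OF m', of s c] by (simp add: Num_def)
      qed
    qed
    finally have l: "C_dual_lact (fst (\<Phi> m)) (snd (\<Phi> m')) r c ?X = (\<Sum>s\<in>S. fnl (m' s c) (x * alg (m r s)))" .
    have "C_dual_ract (snd (\<Phi> m)) (fst (\<Phi> m')) r c ?X =
        (\<Sum>s | fst (\<Phi> m') s c \<noteq> ent_den s c. fnl (m r s) (alg (m' s c) * x))"
      using X by (simp add: C_dual_ract_def) (simp add: fst_\<Phi> ent_mult_coset x aJ snd_\<Phi>[of m, OF mats_Num[OF m] bx])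
    also have "\<dots> = (\<Sum>s\<in>S. fnl (m r s) (alg (m' s c) * x))"
    proof (rule sum.mono_neutral_left[OF finS])
      show "{s. fst (\<Phi> m') s c \<noteq> ent_den s c} \<subseteq> S"
        using fst_\<Phi>_nonzero S(2) unfolding supported_def by blast
      show "\<forall>s\<in>S - {s. fst (\<Phi> m') s c \<noteq> ent_den s c}. fnl (m r s) (alg (m' s c) * x) = 0"
      proof
        fix s assume "s \<in> S - {s. fst (\<Phi> m') s c \<noteq> ent_den s c}"
        then have "alg (m' s c) \<in> J (int N + s - c)" by (auto simp: fst_\<Phi> den_iff)
        from J_mult[OF this x] have "alg (m' s c) * x \<in> J (int N + s - r)" by (simp add: algebra_simps)
        then show "fnl (m r s) (alg (m' s c) * x) = 0" using mats_Num[OF m, of r s] by (simp add: Num_def)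
      qed
    qed
    finally have r: "C_dual_ract (snd (\<Phi> m)) (fst (\<Phi> m')) r c ?X = (\<Sum>s\<in>S. fnl (m r s) (alg (m' s c) * x))" .
    have "snd (\<Phi> (mmul m m')) r c ?X = fnl (mmul m m' r c) x"
      by (rule snd_\<Phi>_mats[OF mats_mmul[OF m m'] x])
    also have "\<dots> = (\<Sum>s\<in>S. fnl (m' s c) (x * alg (m r s)) + fnl (m r s) (alg (m' s c) * x))"
      by (simp add: mmul_eq[OF S(1)])
    finally show "snd (\<Phi> (mmul m m')) r c ?X = snd (\<Phi> m \<otimes>\<^bsub>DA\<^esub> \<Phi> m') r c ?X"
      using l r by (simp add: DA_simps sum.distrib)
  next
    fix r c and X :: "'a set" assume "X \<notin> ent c r"
    then show "snd (\<Phi> (mmul m m')) r c X = snd (\<Phi> m \<otimes>\<^bsub>DA\<^esub> \<Phi> m') r c X"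
      by (simp add: snd_\<Phi>_out DA_simps C_dual_lact_def C_dual_ract_def)
  qed
qed

lemma \<Phi>_eq_iff: assumes "m \<in> mats" "m' \<in> mats"
  shows "\<Phi> m = \<Phi> m' \<longleftrightarrow> (\<forall>r c. m r c - m' r c \<in> Den r c)"
proof
  assume eq: "\<Phi> m = \<Phi> m'"
  show "\<forall>r c. m r c - m' r c \<in> Den r c"
  proof (intro allI)
    fix r c
    have "alg (m r c) - alg (m' r c) \<in> J (int N + r - c)"
      unfolding coset_iff[symmetric] fst_\<Phi>[symmetric] by (simp only: eq)
    moreover have "fnl (m r c) x = fnl (m' r c) x" if "x \<in> J (c - r)" for x
      using snd_\<Phi>_mats[OF assms(1) that] snd_\<Phi>_mats[OF assms(2) that] eq by simp
    ultimately show "m r c - m' r c \<in> Den r c" by (simp add: Den_def)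
  qed
next
  assume d: "\<forall>r c. m r c - m' r c \<in> Den r c"
  show "\<Phi> m = \<Phi> m'"
  proof (rule D_eqI)
    show "fst (\<Phi> m) r c = fst (\<Phi> m') r c" for r c
      using d by (simp add: fst_\<Phi> coset_iff Den_def)
    show "snd (\<Phi> m) r c (x +o J (int N + c - r)) = snd (\<Phi> m') r c (x +o J (int N + c - r))"
      if x: "x \<in> J (c - r)" for r c x
    proof -
      have "fnl (m r c - m' r c) x = 0" using d x unfolding Den_def by blast
      then show ?thesis using snd_\<Phi>_mats[OF assms(1) x] snd_\<Phi>_mats[OF assms(2) x] by simp
    qed
  qed (simp add: snd_\<Phi>_out)
qed

text \<open>Functionals on the entry spaces are extended to the whole algebra along the grading.\<close>

lemma \<Phi>_surj: assumes "d \<in> carrier DA" shows "\<exists>m\<in>mats. \<Phi> m = d"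
proof -
  obtain M f where d: "d = (M, f)" by (cases d)
  have M: "M \<in> C_carrier" and f: "f \<in> C_dual_carrier scl" using assms by (auto simp: d DA_simps)
  have "\<exists>x. x \<in> J (r - c) \<and> M r c = x +o J (int N + r - c) \<and> (M r c = ent_den r c \<longrightarrow> x = 0)" for r c
  proof (cases "M r c = ent_den r c")
    case True
    then show ?thesis by (intro exI[of _ 0]) (simp add: ent_den_J)
  next
    case False
    have "M r c \<in> ent r c" using M by (simp add: C_carrier_def)
    then show ?thesis using False unfolding ent_iff by blast
  qed
  then obtain a where a: "\<And>r c. a r c \<in> J (r - c)" "\<And>r c. M r c = a r c +o J (int N + r - c)"
    "\<And>r c. M r c = ent_den r c \<Longrightarrow> a r c = 0" by metis
  \<comment> \<open>The projection to \<open>J k\<close> along the components of lower degree.\<close>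
  define q where "q k x = (\<Sum>i\<in>{k..<int N}. gpart i x)" for k x
  have qJ: "q k x \<in> J k" for k x
    unfolding q_def
  proof (rule J_sum)
    fix i assume "i \<in> {k..<int N}"
    then show "gpart i x \<in> J k" using gpart_in_J[of i x] J_mono[of k i] by auto
  qed
  have q_id: "q k x = x" if x: "x \<in> J k" for k x
  proof -
    have "q k x = (\<Sum>i\<in>{min 0 k..<int N}. gpart i x)"
      unfolding q_def using x by (intro sum.mono_neutral_left) (auto simp: J_def)
    also have "\<dots> = x" by (rule gpart_sum) auto
    finally show ?thesis .
  qed
  have q_add: "q k (x + y) = q k x + q k y" and q_scl: "q k (scl t x) = scl t (q k x)" for k x y t
    by (simp_all add: q_def sum.distrib scale_sum_right)
  have fD: "f r c (X + Y) = f r c X + f r c Y" "f r c (ent_scale scl c r t X) = t * f r c X"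
    if "X \<in> ent c r" "Y \<in> ent c r" for r c X Y t
    using f that unfolding C_dual_carrier_def ent_dual_def by blast+
  have fout: "f r c X = 0" if "X \<notin> ent c r" for r c X
    using f that unfolding C_dual_carrier_def ent_dual_def by blast
  define F where "F r c x = f r c (q (c - r) x +o J (int N + c - r))" for r c x
  have ent_q: "q (c - r) x +o J (int N + c - r) \<in> ent c r" for r c x using qJ by (auto simp: ent_iff)
  have F_add: "F r c (x + y) = F r c x + F r c y" for r c x y
    unfolding F_def q_add coset_plus[symmetric] by (rule fD(1)[OF ent_q ent_q])
  have F_scl: "F r c (scl t x) = t * F r c x" for r c x t
    unfolding F_def q_scl ent_scale_coset[symmetric] by (rule fD(2)[OF ent_q ent_q])
  have F0: "F r c 0 = 0" for r c using F_scl[of r c 0 0] by simp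
  have F_kill: "F r c x = 0" if x: "x \<in> J (int N + c - r)" for r c x
  proof -
    have "x \<in> J (c - r)" using x J_mono[of "c - r" "int N + c - r"] by auto
    then have "F r c x = f r c (x +o J (int N + c - r))" by (simp add: F_def q_id)
    also have "x +o J (int N + c - r) = 0 +o J (int N + c - r)" using x by (simp only: coset_iff diff_zero)
    also have "f r c (0 +o J (int N + c - r)) = F r c 0" by (simp add: F_def q_id)
    finally show ?thesis by (simp add: F0)
  qed
  define m where "m r c = of_alg (a r c) + of_fnl (F r c)" for r c
  have malg: "alg (m r c) = a r c" and mfnl: "fnl (m r c) = F r c" for r c
    unfolding m_def by (auto simp: of_fnl_simps F_add fun_eq_iff)
  have mN: "m r c \<in> Num r c" for r c
    using a(1) F_kill by (simp add: Num_def malg mfnl lin_def F_scl)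
  let ?P = "{(r, c). M r c \<noteq> ent_den r c} \<union> {(r, c). f r c \<noteq> (\<lambda>_. 0)}"
  have fin: "finite ?P" using M f by (simp add: C_carrier_def C_dual_carrier_def)
  have "supported m (fst ` ?P \<union> snd ` ?P)"
    unfolding supported_def
  proof (intro conjI allI impI)
    show "finite (fst ` ?P \<union> snd ` ?P)" using fin by simp
    fix r c assume nz: "m r c \<noteq> 0"
    have "(r, c) \<in> ?P"
    proof (rule ccontr)
      assume "(r, c) \<notin> ?P"
      then have "a r c = 0" "F r c = (\<lambda>_. 0)" using a(3) by (auto simp: F_def)
      then have "m r c = 0" by (intro trivext_eqI) (auto simp: malg mfnl)
      then show False using nz by simp
    qed
    then show "r \<in> fst ` ?P \<union> snd ` ?P" "c \<in> fst ` ?P \<union> snd ` ?P" by force+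
  qed
  then have m: "m \<in> mats" using mN by (rule matsI)
  have "\<Phi> m = d"
  proof (rule D_eqI)
    show "fst (\<Phi> m) r c = fst d r c" for r c by (simp add: fst_\<Phi> malg d a(2))
    show "snd (\<Phi> m) r c (x +o J (int N + c - r)) = snd d r c (x +o J (int N + c - r))" if "x \<in> J (c - r)" for r c x
      unfolding snd_\<Phi>_mats[OF m that] mfnl by (simp add: F_def q_id[OF that] d)
  qed (simp add: snd_\<Phi>_out d fout)
  then show ?thesis using m by blast
qed

lemma \<Phi>_cases: assumes "d \<in> carrier DA" obtains m where "m \<in> mats" "d = \<Phi> m"
  using \<Phi>_surj[OF assms] by blast

text \<open>All axioms are transported from matrices over the trivial extension along \<open>\<Phi>\<close>.\<close>

theorem D_nonunital_algebra: "nonunital_algebra DA"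
proof -
  have Dc: "carrier DA = \<Phi> ` mats" using \<Phi>_surj \<Phi>_carrier by blast
  interpret A: abelian_group DA
  proof (rule abelian_groupI)
    show "x \<oplus>\<^bsub>DA\<^esub> y \<in> carrier DA" if "x \<in> carrier DA" "y \<in> carrier DA" for x y
      using that unfolding Dc by (auto simp: \<Phi>_add[symmetric] intro: mats_add)
    show "\<zero>\<^bsub>DA\<^esub> \<in> carrier DA" unfolding Dc using \<Phi>_zero mats_zero by (metis imageI)
    show "x \<oplus>\<^bsub>DA\<^esub> y \<oplus>\<^bsub>DA\<^esub> z = x \<oplus>\<^bsub>DA\<^esub> (y \<oplus>\<^bsub>DA\<^esub> z)" for x y z by (simp add: DA_simps ac_simps)
    show "x \<oplus>\<^bsub>DA\<^esub> y = y \<oplus>\<^bsub>DA\<^esub> x" for x y by (simp add: DA_simps ac_simps)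
    show "\<zero>\<^bsub>DA\<^esub> \<oplus>\<^bsub>DA\<^esub> x = x" if x: "x \<in> carrier DA" for x
    proof -
      obtain m where "m \<in> mats" "x = \<Phi> m" using x by (rule \<Phi>_cases)
      then show ?thesis using \<Phi>_add[OF mats_zero, of m] by (simp add: \<Phi>_zero)
    qed
    show "\<exists>y\<in>carrier DA. y \<oplus>\<^bsub>DA\<^esub> x = \<zero>\<^bsub>DA\<^esub>" if x: "x \<in> carrier DA" for x
    proof -
      obtain m where m: "m \<in> mats" "x = \<Phi> m" using x by (rule \<Phi>_cases)
      have m': "(\<lambda>r c. 0 - m r c) \<in> mats" using mats_diff[OF mats_zero m(1)] .
      have "\<Phi> (\<lambda>r c. 0 - m r c) \<oplus>\<^bsub>DA\<^esub> x = \<zero>\<^bsub>DA\<^esub>"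
        using \<Phi>_add[OF m' m(1)] m(2) \<Phi>_zero by simp
      then show ?thesis using \<Phi>_carrier[OF m'] by blast
    qed
  qed
  show ?thesis
  proof unfold_locales
    fix x y z and k l :: 'k
    assume "x \<in> carrier DA"
    then obtain m where m: "m \<in> mats" "x = \<Phi> m" by (rule \<Phi>_cases)
    show "k \<odot>\<^bsub>DA\<^esub> x \<in> carrier DA" unfolding m(2) \<Phi>_scale[OF m(1), symmetric] by (rule \<Phi>_carrier[OF mats_scale[OF m(1)]])
    have "\<Phi> (\<lambda>r c. tscale scl (k + l) (m r c)) = \<Phi> (\<lambda>r c. tscale scl k (m r c) + tscale scl l (m r c))"
      by (rule arg_cong[of _ _ \<Phi>]) (auto intro!: ext trivext_eqI simp: scale_left_distrib distrib_right)
    then show "(k + l) \<odot>\<^bsub>DA\<^esub> x = k \<odot>\<^bsub>DA\<^esub> x \<oplus>\<^bsub>DA\<^esub> l \<odot>\<^bsub>DA\<^esub> x"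
      using m by (simp add: \<Phi>_scale \<Phi>_add mats_scale)
    have "\<Phi> (\<lambda>r c. tscale scl k (tscale scl l (m r c))) = \<Phi> (\<lambda>r c. tscale scl (k * l) (m r c))"
      by (rule arg_cong[of _ _ \<Phi>]) (auto intro!: ext trivext_eqI)
    then show "k \<odot>\<^bsub>DA\<^esub> (l \<odot>\<^bsub>DA\<^esub> x) = (k * l) \<odot>\<^bsub>DA\<^esub> x"
      using m \<Phi>_scale[OF mats_scale[OF m(1)]] by (simp add: \<Phi>_scale)
    have "\<Phi> (\<lambda>r c. tscale scl 1 (m r c)) = \<Phi> m"
      by (rule arg_cong[of _ _ \<Phi>]) (auto intro!: ext trivext_eqI)
    then show "1 \<odot>\<^bsub>DA\<^esub> x = x" using m by (simp add: \<Phi>_scale)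
    assume "y \<in> carrier DA"
    then obtain m' where m': "m' \<in> mats" "y = \<Phi> m'" by (rule \<Phi>_cases)
    obtain S where S: "supported m S" "supported m' S" using mats_pair[OF m(1) m'(1)] .
    show "x \<otimes>\<^bsub>DA\<^esub> y \<in> carrier DA"
      unfolding m(2) m'(2) \<Phi>_mult[OF m(1) m'(1), symmetric] by (rule \<Phi>_carrier[OF mats_mmul[OF m(1) m'(1)]])
    have "\<Phi> (\<lambda>r c. tscale scl k (m r c + m' r c)) = \<Phi> (\<lambda>r c. tscale scl k (m r c) + tscale scl k (m' r c))"
      by (rule arg_cong[of _ _ \<Phi>]) (auto intro!: ext trivext_eqI simp: scale_right_distrib distrib_left)
    then show "k \<odot>\<^bsub>DA\<^esub> (x \<oplus>\<^bsub>DA\<^esub> y) = k \<odot>\<^bsub>DA\<^esub> x \<oplus>\<^bsub>DA\<^esub> k \<odot>\<^bsub>DA\<^esub> y"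
      using m m' \<Phi>_scale[OF mats_add[OF m(1) m'(1)]] by (simp add: \<Phi>_scale \<Phi>_add mats_scale)
    have sS: "supported (\<lambda>r c. tscale scl k (m r c)) S"
    proof -
      have "tscale scl k 0 = 0" by (rule trivext_eqI) auto
      then show ?thesis using S(1) by (intro supportedI) (auto simp: supportedD supported_finite)
    qed
    have linm: "fnl (m r c) (scl t z) = t * fnl (m r c) z" "fnl (m' r c) (scl t z) = t * fnl (m' r c) z" for r c t z
      using mats_Num[OF m(1)] mats_Num[OF m'(1)] by (auto simp: Num_def lin_def)
    have "mmul (\<lambda>r c. tscale scl k (m r c)) m' = (\<lambda>r c. tscale scl k (mmul m m' r c))"
      by (intro ext trivext_eqI)
        (simp_all add: mmul_eq[OF sS] mmul_eq[OF S(1)] scl_mult_left scl_mult_right scale_sum_right linm sum_distrib_left distrib_left)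
    then show "(k \<odot>\<^bsub>DA\<^esub> x) \<otimes>\<^bsub>DA\<^esub> y = k \<odot>\<^bsub>DA\<^esub> (x \<otimes>\<^bsub>DA\<^esub> y)"
      using m m' by (simp add: \<Phi>_scale[symmetric] \<Phi>_mult[symmetric] mats_scale mats_mmul)
    have "mmul m (\<lambda>r c. tscale scl k (m' r c)) = (\<lambda>r c. tscale scl k (mmul m m' r c))"
      by (intro ext trivext_eqI)
        (simp_all add: mmul_eq[OF S(1)] scl_mult_left scl_mult_right scale_sum_right linm sum_distrib_left distrib_left)
    then show "x \<otimes>\<^bsub>DA\<^esub> (k \<odot>\<^bsub>DA\<^esub> y) = k \<odot>\<^bsub>DA\<^esub> (x \<otimes>\<^bsub>DA\<^esub> y)"
      using m m' by (simp add: \<Phi>_scale[symmetric] \<Phi>_mult[symmetric] mats_scale mats_mmul)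
    assume "z \<in> carrier DA"
    then obtain m'' where m'': "m'' \<in> mats" "z = \<Phi> m''" by (rule \<Phi>_cases)
    obtain T where T: "supported m T" "supported m' T" "supported m'' T"
      using mats_supported_finite[of "{m, m', m''}"] m m' m'' by auto
    show "x \<otimes>\<^bsub>DA\<^esub> y \<otimes>\<^bsub>DA\<^esub> z = x \<otimes>\<^bsub>DA\<^esub> (y \<otimes>\<^bsub>DA\<^esub> z)"
      using m m' m'' mmul_assoc[OF T] by (simp add: \<Phi>_mult[symmetric] mats_mmul)
    have sT: "supported (\<lambda>r c. m r c + m' r c) T"
      using T by (intro supportedI) (auto simp: supportedD supported_finite)
    have "mmul (\<lambda>r c. m r c + m' r c) m'' = (\<lambda>r c. mmul m m'' r c + mmul m' m'' r c)"
      by (intro ext) (simp add: mmul_eq[OF sT] mmul_eq[OF T(1)] mmul_eq[OF T(2)] distrib_right sum.distrib)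
    then show "(x \<oplus>\<^bsub>DA\<^esub> y) \<otimes>\<^bsub>DA\<^esub> z = x \<otimes>\<^bsub>DA\<^esub> z \<oplus>\<^bsub>DA\<^esub> y \<otimes>\<^bsub>DA\<^esub> z"
      using m m' m'' by (simp add: \<Phi>_add[symmetric] \<Phi>_mult[symmetric] mats_mmul mats_add)
    have "mmul m'' (\<lambda>r c. m r c + m' r c) = (\<lambda>r c. mmul m'' m r c + mmul m'' m' r c)"
      by (intro ext) (simp add: mmul_eq[OF T(3)] distrib_left sum.distrib)
    then show "z \<otimes>\<^bsub>DA\<^esub> (x \<oplus>\<^bsub>DA\<^esub> y) = z \<otimes>\<^bsub>DA\<^esub> x \<oplus>\<^bsub>DA\<^esub> z \<otimes>\<^bsub>DA\<^esub> y"
      using m m' m'' by (simp add: \<Phi>_add[symmetric] \<Phi>_mult[symmetric] mats_mmul mats_add)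
  qed
qed

sublocale DA: nonunital_algebra DA by (rule D_nonunital_algebra)

end

context graded_tilde
begin

section \<open>Diagonal idempotents and characters of the matrix algebra\<close>

lemma \<Phi>_lsum:
  assumes "distinct js" "\<And>i. i \<in> set js \<Longrightarrow> h i \<in> mats"
  shows "(\<lambda>r c. \<Sum>i\<in>set js. h i r c) \<in> mats \<and>
    lsum DA (map (\<lambda>i. \<Phi> (h i)) js) = \<Phi> (\<lambda>r c. \<Sum>i\<in>set js. h i r c)"
  using assms
proof (induction js)
  case Nil
  then show ?case by (simp add: mats_zero \<Phi>_zero)
next
  case (Cons i js)
  have IH: "(\<lambda>r c. \<Sum>i\<in>set js. h i r c) \<in> mats"
    "lsum DA (map (\<lambda>i. \<Phi> (h i)) js) = \<Phi> (\<lambda>r c. \<Sum>i\<in>set js. h i r c)" using Cons by auto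
  have hi: "h i \<in> mats" using Cons.prems by simp
  have i: "i \<notin> set js" using Cons.prems by simp
  show ?case using mats_add[OF hi IH(1)] \<Phi>_add[OF hi IH(1)] IH(2) i by simp
qed

lemma of_alg_sum: "of_alg (sum h A) = (\<Sum>i\<in>A. of_alg (h i) :: ('a, 'k) trivext)"
  by (intro trivext_eqI) simp_all

lemma mat_unit_zero: "mat_unit i j 0 = (\<lambda>_ _. 0)" by (auto simp: mat_unit_def)

text \<open>This is used both for the vertex idempotents and for their components of degree zero.\<close>

definition diag_idem :: "('v + 'v \<Rightarrow> 'a) \<Rightarrow> ('v + 'v) \<times> int \<Rightarrow> ('k, 'a) D_elem" where
  "diag_idem f = (\<lambda>(v, i). \<Phi> (mat_unit i i (of_alg (f v))))"

definition rep :: "('k, 'a) D_elem \<Rightarrow> ('a, 'k) tmat" where "rep d = (SOME m. m \<in> mats \<and> \<Phi> m = d)"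

definition \<chi>D :: "('v + 'v) \<times> int \<Rightarrow> ('k, 'a) D_elem \<Rightarrow> 'k" where
  "\<chi>D = (\<lambda>(v, i) d. \<chi> v (alg (rep d i i)))"

abbreviation "\<Lambda> \<equiv> V \<times> (UNIV :: int set)"

lemma rep: assumes "d \<in> carrier DA" shows "rep d \<in> mats" "\<Phi> (rep d) = d"
proof -
  have "\<exists>m. m \<in> mats \<and> \<Phi> m = d" using \<Phi>_surj[OF assms] by blast
  from someI_ex[OF this] show "rep d \<in> mats" "\<Phi> (rep d) = d" unfolding rep_def by auto
qed

lemma rep_\<Phi>: assumes "m \<in> mats" shows "rep (\<Phi> m) r c - m r c \<in> Den r c"
  using \<Phi>_eq_iff[OF rep(1)[OF \<Phi>_carrier[OF assms]] assms] rep(2)[OF \<Phi>_carrier[OF assms]] by blast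

lemma \<chi>D_\<Phi>: assumes "m \<in> mats" shows "\<chi>D (v, i) (\<Phi> m) = \<chi> v (alg (m i i))"
proof -
  have "alg (rep (\<Phi> m) i i - m i i) \<in> J (int N + i - i)"
    using rep_\<Phi>[OF assms, of i i] unfolding Den_def by blast
  then have "alg (rep (\<Phi> m) i i) = alg (m i i)" using J_ge_N[of "int N"] by simp
  then show ?thesis by (simp add: \<chi>D_def)
qed

lemma unit_mats: "mat_unit i i (of_alg x) \<in> mats" by (rule mats_unit[OF Num_of_alg])

lemma diag_idem_closed: "diag_idem f \<nu> \<in> carrier DA" by (cases \<nu>) (simp add: diag_idem_def \<Phi>_carrier unit_mats)

lemma diag_idem_left: assumes "m \<in> mats"
  shows "diag_idem f (v, i) \<otimes>\<^bsub>DA\<^esub> \<Phi> m = \<Phi> (\<lambda>r c. if r = i then of_alg (f v) * m i c else 0)"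
    and "(\<lambda>r c. if r = i then of_alg (f v) * m i c else 0) \<in> mats"
  using \<Phi>_mult[OF unit_mats assms, of i "f v"] mats_mmul[OF unit_mats assms, of i "f v"]
  unfolding diag_idem_def mmul_mat_unit_left by simp_all

lemma diag_idem_right: assumes "m \<in> mats"
  shows "\<Phi> m \<otimes>\<^bsub>DA\<^esub> diag_idem f (v, i) = \<Phi> (\<lambda>r c. if c = i then m r i * of_alg (f v) else 0)"
    and "(\<lambda>r c. if c = i then m r i * of_alg (f v) else 0) \<in> mats"
proof -
  obtain S where S: "supported m S" using mats_supported[OF assms] by blast
  show "\<Phi> m \<otimes>\<^bsub>DA\<^esub> diag_idem f (v, i) = \<Phi> (\<lambda>r c. if c = i then m r i * of_alg (f v) else 0)"
    "(\<lambda>r c. if c = i then m r i * of_alg (f v) else 0) \<in> mats"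
    using \<Phi>_mult[OF assms unit_mats, of i "f v"] mats_mmul[OF assms unit_mats, of i "f v"]
    unfolding diag_idem_def mmul_mat_unit_right[OF S] by simp_all
qed

lemma corner:
  assumes m: "m \<in> mats" and "diag_idem f (v, i) \<otimes>\<^bsub>DA\<^esub> \<Phi> m = \<Phi> m" "\<Phi> m \<otimes>\<^bsub>DA\<^esub> diag_idem f (w, j) = \<Phi> m"
  shows "\<Phi> m = \<Phi> (mat_unit i j (of_alg (f v) * m i j * of_alg (f w)))"
    and "of_alg (f v) * m i j * of_alg (f w) \<in> Num i j"
proof -
  have "\<Phi> m = diag_idem f (v, i) \<otimes>\<^bsub>DA\<^esub> (\<Phi> m \<otimes>\<^bsub>DA\<^esub> diag_idem f (w, j))" using assms by simp
  also have "\<dots> = \<Phi> (\<lambda>r c. if r = i then of_alg (f v) * (if c = j then m i j * of_alg (f w) else 0) else 0)"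
    unfolding diag_idem_right(1)[OF m] diag_idem_left(1)[OF diag_idem_right(2)[OF m]] ..
  also have "(\<lambda>r c. if r = i then of_alg (f v) * (if c = j then m i j * of_alg (f w) else 0) else 0) =
      mat_unit i j (of_alg (f v) * m i j * of_alg (f w))"
    by (intro ext) (simp add: mat_unit_def mult.assoc)
  finally show "\<Phi> m = \<Phi> (mat_unit i j (of_alg (f v) * m i j * of_alg (f w)))" .
  show "of_alg (f v) * m i j * of_alg (f w) \<in> Num i j"
    by (intro Num_mult[OF Num_mult[OF Num_of_alg mats_Num[OF m]] Num_of_alg])
qed

text \<open>Modulo functionals the power \<open>b\<^sup>N\<close> is zero, and the product of two functionals is zero.\<close>

lemma square_zero: assumes "alg b \<in> J 1" shows "(b :: ('a, 'k) trivext) ^ (N + N) = 0"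
proof -
  have "alg (b ^ k) \<in> J (int k)" for k
  proof (induction k)
    case (Suc k)
    then show ?case using J_mult[OF assms Suc] by simp
  qed (simp add: J_nonpos)
  then have "alg (b ^ N) = 0" using J_ge_N[of "int N"] by blast
  then have "b ^ N * b ^ N = 0" by (intro trivext_eqI) simp_all
  then show ?thesis by (simp add: power_add)
qed

lemma alg_J1: assumes "x \<in> J (r - c)" "c < r" "v \<in> V" shows "\<chi> v x = 0"
proof -
  have "x \<in> J 1" using assms J_mono[of 1 "r - c"] by auto
  then show ?thesis using assms(3) J1_iff by blast
qed

text \<open>In the sum over \<open>s\<close> of the products of the entries \<open>(i, s)\<close> and \<open>(s, i)\<close>, one of the factors lies in the
  radical unless \<open>s = i\<close>.\<close>

lemma \<chi>D_mult: assumes v: "v \<in> V" and m: "m \<in> mats" and m': "m' \<in> mats"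
  shows "\<chi>D (v, i) (\<Phi> m \<otimes>\<^bsub>DA\<^esub> \<Phi> m') = \<chi>D (v, i) (\<Phi> m) * \<chi>D (v, i) (\<Phi> m')"
proof -
  obtain S where S: "supported m S" using mats_supported[OF m] by blast
  then have S': "supported m (insert i S)" by (auto simp: supported_def)
  have aJ: "alg (m i s) \<in> J (i - s)" "alg (m' s i) \<in> J (s - i)" for s
    using mats_Num[OF m, of i s] mats_Num[OF m', of s i] by (auto simp: Num_def)
  have "\<chi> v (alg (m i s)) * \<chi> v (alg (m' s i)) =
      (if s = i then \<chi> v (alg (m i i)) * \<chi> v (alg (m' i i)) else 0)" for s
    using alg_J1[OF aJ(1) _ v] alg_J1[OF aJ(2) _ v] by (cases s i rule: linorder_cases) auto
  then have "\<chi> v (alg (mmul m m' i i)) = (\<Sum>s\<in>insert i S. if s = i then \<chi> v (alg (m i i)) * \<chi> v (alg (m' i i)) else 0)"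
    unfolding mmul_eq[OF S'] by (simp add: char_sum v char_mult del: sum.insert)
  also have "\<dots> = \<chi> v (alg (m i i)) * \<chi> v (alg (m' i i))"
    using supported_finite[OF S'] by (subst sum.delta) auto
  finally show ?thesis unfolding \<Phi>_mult[OF m m', symmetric] by (simp add: \<chi>D_\<Phi> m m' mats_mmul)
qed

text \<open>An element of a corner is a matrix with a single entry, on the diagonal. So its nilpotency reduces to that
  of an element of the trivial extension whose first component lies in the radical.\<close>

theorem split_D:
  assumes f_orth: "\<And>v w. v \<in> V \<Longrightarrow> w \<in> V \<Longrightarrow> f v * f w = (if v = w then f v else 0)"
    and f_sum: "(\<Sum>v\<in>V. f v) = 1"
    and char_f: "\<And>v w. v \<in> V \<Longrightarrow> w \<in> V \<Longrightarrow> \<chi> v (f w) = (if v = w then 1 else 0)"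
  shows "split_algebra DA \<Lambda> (diag_idem f) \<chi>D"
proof unfold_locales
  fix \<nu> assume \<nu>: "\<nu> \<in> \<Lambda>"
  obtain v i where vi: "\<nu> = (v, i)" "v \<in> V" using \<nu> by auto
  show "diag_idem f \<nu> \<in> carrier DA" by (rule diag_idem_closed)
  show "diag_idem f \<nu> \<otimes>\<^bsub>DA\<^esub> diag_idem f \<mu> = (if \<nu> = \<mu> then diag_idem f \<nu> else \<zero>\<^bsub>DA\<^esub>)" if \<mu>: "\<mu> \<in> \<Lambda>" for \<mu>
  proof -
    obtain w j where wj: "\<mu> = (w, j)" "w \<in> V" using \<mu> by auto
    have "diag_idem f \<nu> \<otimes>\<^bsub>DA\<^esub> diag_idem f \<mu> = \<Phi> (\<lambda>r c. if r = i then of_alg (f v) * mat_unit j j (of_alg (f w)) i c else 0)"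
      unfolding vi wj using diag_idem_left(1)[OF unit_mats] by (simp add: diag_idem_def)
    also have "(\<lambda>r c. if r = i then of_alg (f v) * mat_unit j j (of_alg (f w)) i c else 0) =
        (if \<nu> = \<mu> then mat_unit i i (of_alg (f v)) else (\<lambda>_ _. 0))"
      using f_orth[OF vi(2) wj(2)]
      by (auto simp: fun_eq_iff mat_unit_def vi wj of_alg_hom(1)[symmetric] of_alg_hom(3))
    finally have eq: "diag_idem f \<nu> \<otimes>\<^bsub>DA\<^esub> diag_idem f \<mu> = \<Phi> (if \<nu> = \<mu> then mat_unit i i (of_alg (f v)) else (\<lambda>_ _. 0))" .
    have \<nu>': "diag_idem f \<nu> = \<Phi> (mat_unit i i (of_alg (f v)))" by (simp add: vi(1) diag_idem_def)
    show ?thesis unfolding eq by (auto simp: \<nu>'[symmetric] \<Phi>_zero)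
  qed
  show "\<chi>D \<nu> (diag_idem f \<mu>) = (if \<nu> = \<mu> then 1 else 0)" if \<mu>: "\<mu> \<in> \<Lambda>" for \<mu>
  proof -
    obtain w j where wj: "\<mu> = (w, j)" "w \<in> V" using \<mu> by auto
    have "\<chi>D \<nu> (diag_idem f \<mu>) = \<chi> v (alg (mat_unit j j (of_alg (f w) :: ('a, 'k) trivext) i i))"
      unfolding vi(1) wj(1) by (simp add: diag_idem_def \<chi>D_\<Phi>[OF unit_mats])
    then show ?thesis using char_f[OF vi(2) wj(2)] char_zero[OF vi(2)] by (auto simp: vi(1) wj(1) mat_unit_def)
  qed
  fix a assume a: "a \<in> carrier DA"
  then obtain m where m: "m \<in> mats" "a = \<Phi> m" by (rule \<Phi>_cases)
  show "\<chi>D \<nu> (k \<odot>\<^bsub>DA\<^esub> a) = k * \<chi>D \<nu> a" for k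
    unfolding m(2) \<Phi>_scale[OF m(1), symmetric] vi \<chi>D_\<Phi>[OF m(1)] \<chi>D_\<Phi>[OF mats_scale[OF m(1)]]
    by (simp add: char_scl vi(2))
  show "\<chi>D \<nu> (a \<oplus>\<^bsub>DA\<^esub> b) = \<chi>D \<nu> a + \<chi>D \<nu> b" if b: "b \<in> carrier DA" for b
  proof -
    obtain m' where m': "m' \<in> mats" "b = \<Phi> m'" using b by (rule \<Phi>_cases)
    show ?thesis unfolding m(2) m'(2) \<Phi>_add[OF m(1) m'(1), symmetric] vi
        \<chi>D_\<Phi>[OF m(1)] \<chi>D_\<Phi>[OF m'(1)] \<chi>D_\<Phi>[OF mats_add[OF m(1) m'(1)]]
      by (simp add: char_add vi(2))
  qed
  show "\<chi>D \<nu> (a \<otimes>\<^bsub>DA\<^esub> b) = \<chi>D \<nu> a * \<chi>D \<nu> b" if b: "b \<in> carrier DA" for b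
  proof -
    obtain m' where m': "m' \<in> mats" "b = \<Phi> m'" using b by (rule \<Phi>_cases)
    show ?thesis unfolding m(2) m'(2) vi(1) by (rule \<chi>D_mult[OF vi(2) m(1) m'(1)])
  qed
  assume l: "diag_idem f \<nu> \<otimes>\<^bsub>DA\<^esub> a = a" and r: "a \<otimes>\<^bsub>DA\<^esub> diag_idem f \<nu> = a" and z: "\<chi>D \<nu> a = 0"
  define b where "b = of_alg (f v) * m i i * of_alg (f v)"
  have b: "a = \<Phi> (mat_unit i i b)" "b \<in> Num i i"
    using corner[OF m(1) l[unfolded m(2) vi(1)] r[unfolded m(2) vi(1)]] unfolding b_def m(2) by auto
  have "\<chi> v (alg (m i i)) = 0" using z unfolding m(2) vi(1) \<chi>D_\<Phi>[OF m(1)] .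
  then have "\<chi> w (alg b) = 0" if "w \<in> V" for w
    using that vi(2) by (simp add: b_def char_mult char_f)
  then have "alg b \<in> J 1" by (simp add: J1_iff)
  then have bN: "b ^ (N + N) = 0" by (rule square_zero)
  have "((\<lambda>x. a \<otimes>\<^bsub>DA\<^esub> x) ^^ k) (diag_idem f \<nu>) = \<Phi> (mat_unit i i (b ^ k * of_alg (f v))) \<and> b ^ k * of_alg (f v) \<in> Num i i" for k
  proof (induction k)
    case 0
    then show ?case by (simp add: vi(1) diag_idem_def)
  next
    case (Suc k)
    have eq: "mmul (mat_unit i i b) (mat_unit i i (b ^ k * of_alg (f v))) = mat_unit i i (b ^ Suc k * of_alg (f v))"
      unfolding mmul_mat_unit_left by (auto simp: mat_unit_def fun_eq_iff mult.assoc)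
    have "((\<lambda>x. a \<otimes>\<^bsub>DA\<^esub> x) ^^ Suc k) (diag_idem f \<nu>) = \<Phi> (mat_unit i i b) \<otimes>\<^bsub>DA\<^esub> \<Phi> (mat_unit i i (b ^ k * of_alg (f v)))"
      using Suc by (simp add: b(1))
    also have "\<dots> = \<Phi> (mat_unit i i (b ^ Suc k * of_alg (f v)))"
      unfolding \<Phi>_mult[OF mats_unit[OF b(2)] mats_unit[OF conjunct2[OF Suc]], symmetric] eq ..
    finally show ?case using Num_mult[OF b(2) conjunct2[OF Suc]] by (simp add: mult.assoc)
  qed
  from this[of "N + N"] have "((\<lambda>x. a \<otimes>\<^bsub>DA\<^esub> x) ^^ (N + N)) (diag_idem f \<nu>) = \<zero>\<^bsub>DA\<^esub>"
    unfolding bN by (simp add: mat_unit_zero \<Phi>_zero)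
  then show "\<exists>k. ((\<lambda>x. a \<otimes>\<^bsub>DA\<^esub> x) ^^ k) (diag_idem f \<nu>) = \<zero>\<^bsub>DA\<^esub>" by blast
next
  fix a assume "a \<in> carrier DA"
  then obtain m where m: "m \<in> mats" "a = \<Phi> m" by (rule \<Phi>_cases)
  obtain S where S: "supported m S" using mats_supported[OF m(1)] by blast
  note finS = supported_finite[OF S]
  obtain ns where ns: "set ns = V \<times> S" "distinct ns"
    using finite_distinct_list[of "V \<times> S"] V_finite finS by blast
  have f1: "(\<Sum>v\<in>V. of_alg (f v)) = (1 :: ('a, 'k) trivext)"
    unfolding of_alg_sum[symmetric] f_sum by (rule of_alg_hom)
  define h where "h \<nu> = (\<lambda>r c. if r = snd \<nu> then of_alg (f (fst \<nu>)) * m (snd \<nu>) c else 0)" for \<nu> :: "('v + 'v) \<times> int"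
  define h' where "h' \<nu> = (\<lambda>r c. if c = snd \<nu> then m r (snd \<nu>) * of_alg (f (fst \<nu>)) else 0)" for \<nu> :: "('v + 'v) \<times> int"
  have h: "diag_idem f \<nu> \<otimes>\<^bsub>DA\<^esub> a = \<Phi> (h \<nu>)" "h \<nu> \<in> mats" "a \<otimes>\<^bsub>DA\<^esub> diag_idem f \<nu> = \<Phi> (h' \<nu>)" "h' \<nu> \<in> mats" for \<nu>
    using diag_idem_left[OF m(1), where f = f and v = "fst \<nu>" and i = "snd \<nu>"]
      diag_idem_right[OF m(1), where f = f and v = "fst \<nu>" and i = "snd \<nu>"]
    by (simp_all add: h_def h'_def m(2))
  have "(\<Sum>\<nu>\<in>V \<times> S. h \<nu> r c) = m r c" for r c
  proof -
    have "(\<Sum>\<nu>\<in>V \<times> S. h \<nu> r c) = (\<Sum>v\<in>V. \<Sum>i\<in>S. if i = r then of_alg (f v) * m r c else 0)"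
      unfolding sum.cartesian_product by (rule sum.cong) (auto simp: h_def)
    also have "\<dots> = (\<Sum>v\<in>V. of_alg (f v) * m r c)"
      using supportedD(1)[OF S, of r c] by (intro sum.cong refl) (auto simp: sum.delta[OF finS])
    also have "\<dots> = m r c" unfolding sum_distrib_right[symmetric] f1 by simp
    finally show ?thesis .
  qed
  moreover have "(\<Sum>\<nu>\<in>V \<times> S. h' \<nu> r c) = m r c" for r c
  proof -
    have "(\<Sum>\<nu>\<in>V \<times> S. h' \<nu> r c) = (\<Sum>v\<in>V. \<Sum>i\<in>S. if i = c then m r c * of_alg (f v) else 0)"
      unfolding sum.cartesian_product by (rule sum.cong) (auto simp: h'_def)
    also have "\<dots> = (\<Sum>v\<in>V. m r c * of_alg (f v))"
      using supportedD(2)[OF S, of c r] by (intro sum.cong refl) (auto simp: sum.delta[OF finS])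
    also have "\<dots> = m r c" unfolding sum_distrib_left[symmetric] f1 by simp
    finally show ?thesis .
  qed
  ultimately have "lsum DA (map (\<lambda>\<nu>. diag_idem f \<nu> \<otimes>\<^bsub>DA\<^esub> a) ns) = a" "lsum DA (map (\<lambda>\<nu>. a \<otimes>\<^bsub>DA\<^esub> diag_idem f \<nu>) ns) = a"
    using \<Phi>_lsum[OF ns(2), of h] \<Phi>_lsum[OF ns(2), of h'] h(2,4) unfolding h(1) h(3) unfolding ns(1) m(2) by simp_all
  then show "\<exists>ns. set ns \<subseteq> \<Lambda> \<and> distinct ns \<and> lsum DA (map (\<lambda>\<nu>. diag_idem f \<nu> \<otimes>\<^bsub>DA\<^esub> a) ns) = a \<and>
      lsum DA (map (\<lambda>\<nu>. a \<otimes>\<^bsub>DA\<^esub> diag_idem f \<nu>) ns) = a"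
    using ns by (intro exI[of _ ns]) auto
qed

end

context graded_tilde
begin

section \<open>Homogeneous matrices\<close>

text \<open>The component of degree \<open>m\<close> of the trivial extension in which a functional on \<open>G i\<close> has degree \<open>N - 1 - i\<close>.\<close>

definition hpart :: "int \<Rightarrow> ('a, 'k) trivext \<Rightarrow> ('a, 'k) trivext" where
  "hpart m a = of_alg (gpart m (alg a)) + of_fnl (\<lambda>x. fnl a (gpart (int N - 1 - m) x))"

lemma hpart_simps [simp]: "alg (hpart m a) = gpart m (alg a)" "fnl (hpart m a) x = fnl a (gpart (int N - 1 - m) x)"
  by (simp_all add: hpart_def of_fnl_simps)

lemma hpart_add: "hpart m (a + b) = hpart m a + hpart m b" and hpart_diff: "hpart m (a - b) = hpart m a - hpart m b"
  and hpart_zero [simp]: "hpart m 0 = 0" and hpart_scale: "hpart m (tscale scl c a) = tscale scl c (hpart m a)"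
  and hpart_hp [simp]: "hpart m (hpart m a) = hpart m a" and hpart_sum: "hpart m (sum h A) = (\<Sum>i\<in>A. hpart m (h i))"
  by (intro trivext_eqI; simp)+

lemma hpart_lin: "lin a \<Longrightarrow> lin (hpart m a)" by (simp add: lin_def)

lemma hpart_outside: assumes "m < 0 \<or> int N \<le> m" shows "hpart m a = 0"
  using assms by (intro trivext_eqI) (auto simp: gpart_neg gpart_ge_N)

text \<open>Multiplication by a homogeneous element of degree \<open>k\<close> shifts the components of the trivial extension by \<open>k\<close>,
  because \<open>fnl y (z * x)\<close> only sees the part of \<open>z * x\<close> in degree \<open>N - 1 - k\<close>.\<close>

lemma hpart_mult_left:
  assumes "hpart k y = y" shows "hpart (l + k) (x * y) = hpart l x * y"
proof (rule trivext_eqI)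
  have y: "gpart k (alg y) = alg y" "\<And>z. fnl y (gpart (int N - 1 - k) z) = fnl y z"
    using arg_cong[OF assms, of alg] arg_cong[OF assms, of fnl] by (simp_all add: fun_eq_iff)
  show "alg (hpart (l + k) (x * y)) = alg (hpart l x * y)" using gpart_mult_right[OF y(1)] by simp
  fix z
  let ?z = "gpart (int N - 1 - (l + k)) z"
  have "gpart (int N - 1 - k) (?z * alg x) = ?z * gpart l (alg x)"
    using gpart_mult_left[of "int N - 1 - (l + k)" ?z l "alg x"] by (simp add: algebra_simps)
  also have "\<dots> = gpart (int N - 1 - k) (z * gpart l (alg x))"
    using gpart_mult_right[of l "gpart l (alg x)" "int N - 1 - (l + k)" z] by (simp add: algebra_simps)
  finally have 1: "fnl y (?z * alg x) = fnl y (z * gpart l (alg x))" using y(2) by metis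
  have 2: "alg y * ?z = gpart (int N - 1 - l) (alg y * z)"
    using gpart_mult_left[OF y(1), of "int N - 1 - (l + k)" z] by (simp add: algebra_simps)
  show "fnl (hpart (l + k) (x * y)) z = fnl (hpart l x * y) z" by (simp add: 1 2)
qed

lemma hpart_Num: assumes "lin a" shows "hpart (r - c) a \<in> Num r c"
proof -
  have "gpart (int N - 1 - (r - c)) x = 0" if "x \<in> J (int N + c - r)" for x
    using that unfolding J_def by simp
  then show ?thesis using hpart_lin[OF assms] by (simp add: Num_def gpart_in_J)
qed

text \<open>A component of degree less than \<open>N + r - c\<close> does not depend on the representative.\<close>

lemma hpart_Den: assumes "a \<in> Den r c" "k < int N + r - c" shows "hpart k a = 0"
proof (rule trivext_eqI)
  show "alg (hpart k a) = alg 0" using assms by (simp add: Den_def J_def)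
  fix x
  have "gpart (int N - 1 - k) x \<in> J (c - r)"
    using gpart_in_J[of "int N - 1 - k" x] J_mono[of "c - r" "int N - 1 - k"] assms(2) by auto
  then show "fnl (hpart k a) x = fnl 0 x" using assms(1) by (simp add: Den_def)
qed

text \<open>The components of degree less than \<open>k\<close> vanish, and the subtraction removes the next \<open>N\<close> ones.\<close>

lemma J_remainder: assumes "x \<in> J k" shows "x - (\<Sum>j<N. gpart (k + int j) x) \<in> J (int N + k)"
  unfolding J_def
proof (intro CollectI allI impI)
  fix i assume i: "i < int N + k"
  have "gpart i (x - (\<Sum>j<N. gpart (k + int j) x)) = gpart i x - (\<Sum>j<N. if i = k + int j then gpart i x else 0)"
    unfolding gpart_simps gpart_gp by (intro arg_cong[of _ _ "\<lambda>y. gpart i x - y"] sum.cong) auto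
  also have "\<dots> = 0"
  proof (cases "i < k")
    case True
    then have z: "gpart i x = 0" using assms unfolding J_def by blast
    show ?thesis unfolding z by simp
  next
    case False
    then have "i = k + int j \<longleftrightarrow> j = nat (i - k)" for j by auto
    moreover have "nat (i - k) < N" using False i by auto
    ultimately show ?thesis by simp
  qed
  finally show "gpart i (x - (\<Sum>j<N. gpart (k + int j) x)) = 0" .
qed

text \<open>For the functionals the components occur in the reverse order, because \<open>(A\<^sub>i)\<^sup>*\<close> has degree \<open>N - 1 - i\<close>.\<close>

lemma Num_remainder: assumes a: "a \<in> Num r c"
  shows "(\<Sum>j<N. hpart (r + int j - c) a) - a \<in> Den r c"
proof -
  have "alg a - (\<Sum>j<N. gpart (r - c + int j) (alg a)) \<in> J (int N + (r - c))"
    using a by (intro J_remainder) (simp add: Num_def)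
  from J_diff[OF J_zero this] have "(\<Sum>j<N. gpart (r + int j - c) (alg a)) - alg a \<in> J (int N + r - c)"
    by (simp add: algebra_simps)
  moreover have "(\<Sum>j<N. fnl a (gpart (int N - 1 - (r + int j - c)) x)) = fnl a x" if x: "x \<in> J (c - r)" for x
  proof -
    have "(\<Sum>j<N. fnl a (gpart (int N - 1 - (r + int j - c)) x)) = (\<Sum>j<N. fnl a (gpart (c - r + int (N - Suc j)) x))"
      by (intro sum.cong refl arg_cong[of _ _ "fnl a"] arg_cong2[of _ _ _ _ gpart]) auto
    also have "\<dots> = (\<Sum>j<N. fnl a (gpart (c - r + int j) x))"
      by (rule sum.nat_diff_reindex[of "\<lambda>j. fnl a (gpart (c - r + int j) x)" N])
    also have "\<dots> = fnl a x - fnl a (x - (\<Sum>j<N. gpart (c - r + int j) x))" by simp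
    also have "fnl a (x - (\<Sum>j<N. gpart (c - r + int j) x)) = 0"
    proof -
      have "x - (\<Sum>j<N. gpart (c - r + int j) x) \<in> J (int N + c - r)"
        using J_remainder[OF x] by (simp add: algebra_simps)
      then show ?thesis using a unfolding Num_def by blast
    qed
    finally show ?thesis by simp
  qed
  ultimately show ?thesis by (simp add: Den_def)
qed

definition hmats :: "('a, 'k) tmat set" where "hmats = {m \<in> mats. \<forall>r c. hpart (r - c) (m r c) = m r c}"

lemma hmats_mats: "m \<in> hmats \<Longrightarrow> m \<in> mats" and hmats_hp: "m \<in> hmats \<Longrightarrow> hpart (r - c) (m r c) = m r c"
  by (auto simp: hmats_def)

lemma N_pos: "0 < int N" using N_ge_2 by simp

lemma hmats_mmul: assumes "m \<in> hmats" "m' \<in> hmats" shows "mmul m m' \<in> hmats"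
proof -
  have "hpart (r - c) (m r s * m' s c) = m r s * m' s c" for r s c
    using hpart_mult_left[OF hmats_hp[OF assms(2), of s c], of "r - s" "m r s"] hmats_hp[OF assms(1), of r s] by simp
  then show ?thesis using mats_mmul assms by (simp add: hmats_def mmul_def hpart_sum)
qed

lemma hmats_unit: assumes "a \<in> Num i j" "hpart (i - j) a = a" shows "mat_unit i j a \<in> hmats"
  using assms mats_unit by (auto simp: hmats_def mat_unit_def)

lemma hpart_\<epsilon>: "hpart 0 (of_alg (\<epsilon> v)) = of_alg (\<epsilon> v)"
  by (rule trivext_eqI) (simp_all add: gpart_\<epsilon>)

text \<open>The definition of \<open>B\<close> prescribes the degrees of the cosets and of the functionals separately; taking
  homogeneous components of any representative yields a homogeneous one.\<close>

lemma B_bar_eq: "B_bar scl G = \<Phi> ` hmats"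
proof
  show "\<Phi> ` hmats \<subseteq> B_bar scl G"
  proof (rule image_subsetI)
    fix m assume m: "m \<in> hmats"
    have h: "gpart (r - c) (alg (m r c)) = alg (m r c)" "fnl (m r c) (gpart (int N - 1 - (r - c)) x) = fnl (m r c) x" for r c x
      using arg_cong[OF hmats_hp[OF m], of alg r c] arg_cong[OF hmats_hp[OF m], of "\<lambda>a. fnl a x" r c] by simp_all
    have carr: "\<Phi> m \<in> carrier DA" by (rule \<Phi>_carrier[OF hmats_mats[OF m]])
    have low: "(\<exists>x\<in>G (nat (r - c)). fst (\<Phi> m) r c = x +o ent_den r c) \<and>
        (\<forall>i. \<forall>x\<in>G i. int i \<noteq> int N - 1 - (r - c) \<longrightarrow> snd (\<Phi> m) r c (x +o ent_den c r) = 0)" if rc: "c \<le> r" for r c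
    proof (intro conjI allI ballI impI)
      have "alg (m r c) \<in> G (nat (r - c))" using gpart_in[of "r - c" "alg (m r c)"] by (simp only: h)
      then show "\<exists>x\<in>G (nat (r - c)). fst (\<Phi> m) r c = x +o ent_den r c" by (auto simp: fst_\<Phi> ent_den_J)
      fix i x assume x: "x \<in> G i" "int i \<noteq> int N - 1 - (r - c)"
      have "x \<in> J (c - r)" using rc by (simp add: J_nonpos)
      then have "snd (\<Phi> m) r c (x +o ent_den c r) = fnl (m r c) x"
        unfolding ent_den_J by (rule snd_\<Phi>_mats[OF hmats_mats[OF m]])
      also have "\<dots> = fnl (m r c) (gpart (int N - 1 - (r - c)) x)" by (simp only: h)
      also have "\<dots> = 0" using gpart_G[OF x(1), of "int N - 1 - (r - c)"] x(2) by simp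
      finally show "snd (\<Phi> m) r c (x +o ent_den c r) = 0" .
    qed
    have up: "fst (\<Phi> m) r c = ent_den r c \<and> snd (\<Phi> m) r c = (\<lambda>_. 0)" if "r < c" for r c
    proof -
      have "hpart (r - c) (m r c) = 0" using that by (intro hpart_outside) simp
      then have "m r c = 0" by (simp only: hmats_hp[OF m])
      then show ?thesis by (simp add: fst_\<Phi> ent_den_J) (simp add: \<Phi>_def fun_eq_iff)
    qed
    show "\<Phi> m \<in> B_bar scl G"
      unfolding B_bar_def using carr low up by (cases "\<Phi> m") (simp add: N_def[symmetric])
  qed
  show "B_bar scl G \<subseteq> \<Phi> ` hmats"
  proof
    fix d assume d: "d \<in> B_bar scl G"
    then have "d \<in> carrier DA" by (auto simp: B_bar_def)
    then obtain m where m: "m \<in> mats" "d = \<Phi> m" by (rule \<Phi>_cases)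
    have low: "\<exists>x\<in>G (nat (r - c)). fst (\<Phi> m) r c = x +o ent_den r c"
      "x \<in> G i \<Longrightarrow> int i \<noteq> int N - 1 - (r - c) \<Longrightarrow> snd (\<Phi> m) r c (x +o ent_den c r) = 0" if "c \<le> r" for r c i x
      using d that unfolding m(2) B_bar_def N_def by (cases "\<Phi> m"; auto)+
    have up: "fst (\<Phi> m) r c = ent_den r c" "snd (\<Phi> m) r c = (\<lambda>_. 0)" if "r < c" for r c
      using d that unfolding m(2) B_bar_def by (cases "\<Phi> m"; auto)+
    define m' where "m' r c = hpart (r - c) (m r c)" for r c
    obtain S where S: "supported m S" using mats_supported[OF m(1)] by blast
    have "lin (m r c)" for r c using mats_Num[OF m(1), of r c] by (simp add: Num_def)
    then have "m' r c \<in> Num r c" for r c unfolding m'_def by (rule hpart_Num)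
    moreover have "supported m' S"
      using S by (intro supportedI) (auto simp: m'_def supportedD supported_finite)
    ultimately have "m' \<in> mats" by (intro matsI)
    then have m': "m' \<in> hmats" by (simp add: hmats_def m'_def)
    have "m' r c - m r c \<in> Den r c" for r c
    proof (cases "c \<le> r")
      case True
      obtain x where x: "x \<in> G (nat (r - c))" "fst (\<Phi> m) r c = x +o ent_den r c" using low(1)[OF True] by blast
      have xm: "x - alg (m r c) \<in> J (int N + r - c)"
        using x(2) unfolding fst_\<Phi> ent_den_J coset_iff[symmetric] by simp
      then have "gpart (r - c) (x - alg (m r c)) = 0" using N_pos unfolding J_def by simp
      moreover have "gpart (r - c) x = x" using gpart_G[OF x(1), of "r - c"] True by simp
      ultimately have "gpart (r - c) (alg (m r c)) = x" by simp
      moreover have "fnl (m r c) (gpart (int N - 1 - (r - c)) z) = fnl (m r c) z" for z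
      proof -
        let ?k = "int N - 1 - (r - c)"
        have "fnl (m r c) (gpart i z) = (if i = ?k then fnl (m r c) (gpart ?k z) else 0)" if i: "i \<in> {0..<int N}" for i
        proof -
          have "fnl (m r c) (gpart i z) = 0" if "i \<noteq> ?k"
          proof -
            have J: "gpart i z \<in> J (c - r)" using True by (simp add: J_nonpos)
            have "int (nat i) \<noteq> ?k" using that i by simp
            from low(2)[OF True gpart_in this] have "snd (\<Phi> m) r c (gpart i z +o ent_den c r) = 0" .
            then show ?thesis unfolding ent_den_J snd_\<Phi>_mats[OF m(1) J] .
          qed
          then show ?thesis by auto
        qed
        then have "(\<Sum>i\<in>{0..<int N}. fnl (m r c) (gpart i z)) = (\<Sum>i\<in>{0..<int N}. if i = ?k then fnl (m r c) (gpart ?k z) else 0)"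
          by (intro sum.cong refl)
        also have "\<dots> = fnl (m r c) (gpart ?k z)" using True by (auto simp: gpart_neg)
        finally have "fnl (m r c) (\<Sum>i\<in>{0..<int N}. gpart i z) = fnl (m r c) (gpart ?k z)" by (simp only: fnl_sum)
        moreover have "(\<Sum>i\<in>{0..<int N}. gpart i z) = z" by (rule gpart_sum) auto
        ultimately show ?thesis by simp
      qed
      ultimately show ?thesis using xm by (simp add: m'_def Den_def)
    next
      case False
      then have z: "m' r c = 0" unfolding m'_def by (intro hpart_outside) auto
      have "0 - alg (m r c) \<in> J (int N + r - c)"
        using up(1)[of r c] False unfolding fst_\<Phi> ent_den_J coset_iff[symmetric] by simp
      moreover have "fnl (m r c) x = 0" if "x \<in> J (c - r)" for x
        using up(2)[of r c] False snd_\<Phi>_mats[OF m(1) that] by simp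
      ultimately show ?thesis by (simp add: z Den_def)
    qed
    then have "\<Phi> m' = d" using \<Phi>_eq_iff[OF hmats_mats[OF m'] m(1)] m(2) by blast
    then show "d \<in> \<Phi> ` hmats" using m' by blast
  qed
qed

abbreviation "B \<equiv> B_bar scl G"

lemma B_subalgebra: "subalgebra B DA"
proof (rule DA.subalgebraI)
  show "B \<subseteq> carrier DA" unfolding B_bar_eq using \<Phi>_carrier hmats_mats by blast
  have "(\<lambda>_ _. 0) \<in> hmats" using mats_zero by (simp add: hmats_def)
  then show "\<zero>\<^bsub>DA\<^esub> \<in> B" unfolding B_bar_eq \<Phi>_zero[symmetric] by (rule imageI)
  fix x assume "x \<in> B"
  then obtain m where m: "m \<in> hmats" "x = \<Phi> m" unfolding B_bar_eq by blast
  have "(\<lambda>r c. tscale scl k (m r c)) \<in> hmats" for k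
    using mats_scale[OF hmats_mats[OF m(1)]] hmats_hp[OF m(1)] by (simp add: hmats_def hpart_scale)
  then show "k \<odot>\<^bsub>DA\<^esub> x \<in> B" for k
    unfolding m(2) \<Phi>_scale[OF hmats_mats[OF m(1)], symmetric] B_bar_eq by (rule imageI)
  fix y assume "y \<in> B"
  then obtain m' where m': "m' \<in> hmats" "y = \<Phi> m'" unfolding B_bar_eq by blast
  have "(\<lambda>r c. m r c + m' r c) \<in> hmats"
    using mats_add[OF hmats_mats[OF m(1)] hmats_mats[OF m'(1)]] hmats_hp[OF m(1)] hmats_hp[OF m'(1)]
    by (simp add: hmats_def hpart_add)
  then show "x \<oplus>\<^bsub>DA\<^esub> y \<in> B"
    unfolding m(2) m'(2) \<Phi>_add[OF hmats_mats[OF m(1)] hmats_mats[OF m'(1)], symmetric] B_bar_eq by (rule imageI)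
  show "x \<otimes>\<^bsub>DA\<^esub> y \<in> B"
    unfolding m(2) m'(2) \<Phi>_mult[OF hmats_mats[OF m(1)] hmats_mats[OF m'(1)], symmetric] B_bar_eq
    by (rule imageI[OF hmats_mmul[OF m(1) m'(1)]])
qed

section \<open>The dual basis\<close>

text \<open>The dual basis of \<open>D\<close> over \<open>B\<close>. The bound \<open>j < N\<close> ensures that the component of degree \<open>r + j - c\<close> of an entry
  in position \<open>(r, c)\<close> is independent of its representative.\<close>

definition dual_vec :: "int \<times> nat \<Rightarrow> ('k, 'a) D_elem" where "dual_vec = (\<lambda>(r, j). \<Phi> (mat_unit r (r + int j) 1))"

definition bmat :: "int \<Rightarrow> nat \<Rightarrow> ('a, 'k) tmat \<Rightarrow> ('a, 'k) tmat" where
  "bmat r j m = (\<lambda>r' c. if r' = r + int j then hpart (r + int j - c) (m r c) else 0)"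

definition dual_coeff :: "int \<times> nat \<Rightarrow> ('k, 'a) D_elem \<Rightarrow> ('k, 'a) D_elem" where
  "dual_coeff = (\<lambda>(r, j) d. if j < N then \<Phi> (bmat r j (rep d)) else \<zero>\<^bsub>DA\<^esub>)"

lemma one_Num: "1 \<in> Num r (r + int j)" by (simp add: Num_def lin_simps J_nonpos)

lemma bmat_hmats: assumes "m \<in> mats" shows "bmat r j m \<in> hmats"
proof -
  obtain S where S: "supported m S" using mats_supported[OF assms] by blast
  have "supported (bmat r j m) (insert (r + int j) S)"
    using S by (intro supportedI) (auto simp: bmat_def supportedD supported_finite)
  moreover have "lin (m r c)" for c using mats_Num[OF assms, of r c] by (simp add: Num_def)
  then have "bmat r j m r' c \<in> Num r' c" for r' c using hpart_Num[of "m r c" "r + int j" c] by (simp add: bmat_def)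
  ultimately have "bmat r j m \<in> mats" by (rule matsI)
  then show ?thesis by (simp add: hmats_def bmat_def)
qed

lemma dual_coeff_\<Phi>: assumes j: "j < N" and m: "m \<in> mats" shows "dual_coeff (r, j) (\<Phi> m) = \<Phi> (bmat r j m)"
proof -
  have "hpart (r + int j - c) (rep (\<Phi> m) r c - m r c) = 0" for c
    using j by (intro hpart_Den[OF rep_\<Phi>[OF m]]) simp
  then have "bmat r j (rep (\<Phi> m)) = bmat r j m" by (intro ext) (simp add: bmat_def hpart_diff)
  then show ?thesis using j by (simp add: dual_coeff_def)
qed

text \<open>Linearity over \<open>B\<close>: a homogeneous right factor of degree \<open>s - c\<close> turns the component of degree \<open>r + j - s\<close> into
  that of degree \<open>r + j - c\<close>. The expansion splits each entry into its \<open>N\<close> components.\<close>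

theorem D_dual_basis: "dual_basis DA \<Lambda> (diag_idem \<epsilon>) \<chi>D B dual_vec dual_coeff"
proof (intro dual_basis.intro dual_basis_axioms.intro)
  show "split_algebra DA \<Lambda> (diag_idem \<epsilon>) \<chi>D" by (rule split_D) (simp_all add: \<epsilon>_orth \<epsilon>_sum char_\<epsilon>)
  show "subalgebra B DA" by (rule B_subalgebra)
  show "diag_idem \<epsilon> ` \<Lambda> \<subseteq> B"
  proof (rule image_subsetI)
    fix \<nu> :: "('v + 'v) \<times> int"
    obtain v i where \<nu>: "\<nu> = (v, i)" by (cases \<nu>)
    have "mat_unit i i (of_alg (\<epsilon> v)) \<in> hmats" by (rule hmats_unit) (simp_all add: hpart_\<epsilon>)
    then show "diag_idem \<epsilon> \<nu> \<in> B" by (simp add: \<nu> diag_idem_def B_bar_eq)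
  qed
  show "dual_vec i \<in> carrier DA" for i by (cases i) (simp add: dual_vec_def \<Phi>_carrier mats_unit one_Num)
  have zB: "\<zero>\<^bsub>DA\<^esub> \<in> B" by (rule DA.subalgebraD[OF B_subalgebra])
  show cfB: "dual_coeff i d \<in> B" if "d \<in> carrier DA" for d i
    using zB bmat_hmats[OF rep(1)[OF that]] by (cases i) (simp add: dual_coeff_def B_bar_eq)
  fix i :: "int \<times> nat"
  obtain r j where i: "i = (r, j)" by (cases i)
  show "dual_coeff i (d \<oplus>\<^bsub>DA\<^esub> d') = dual_coeff i d \<oplus>\<^bsub>DA\<^esub> dual_coeff i d'" if d: "d \<in> carrier DA" and d': "d' \<in> carrier DA" for d d'
  proof (cases "j < N")
    case True
    obtain m0 where m0: "m0 \<in> mats" "d = \<Phi> m0" using d by (rule \<Phi>_cases)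
    obtain m1 where m1: "m1 \<in> mats" "d' = \<Phi> m1" using d' by (rule \<Phi>_cases)
    note m = m0 m1
    have "bmat r j (\<lambda>r c. m0 r c + m1 r c) = (\<lambda>r' c. bmat r j m0 r' c + bmat r j m1 r' c)"
      by (intro ext) (simp add: bmat_def hpart_add)
    then show ?thesis unfolding i m(2,4) \<Phi>_add[OF m(1,3), symmetric]
        dual_coeff_\<Phi>[OF True m(1)] dual_coeff_\<Phi>[OF True m(3)] dual_coeff_\<Phi>[OF True mats_add[OF m(1,3)]]
        \<Phi>_add[OF hmats_mats[OF bmat_hmats[OF m(1)]] hmats_mats[OF bmat_hmats[OF m(3)]], symmetric] by simp
  next
    case False
    then show ?thesis by (simp add: i dual_coeff_def)
  qed
  show "dual_coeff i (d \<otimes>\<^bsub>DA\<^esub> y) = dual_coeff i d \<otimes>\<^bsub>DA\<^esub> y" if d: "d \<in> carrier DA" and y: "y \<in> B" for d y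
  proof (cases "j < N")
    case True
    obtain m where m: "m \<in> mats" "d = \<Phi> m" using d by (rule \<Phi>_cases)
    obtain m' where m': "m' \<in> hmats" "y = \<Phi> m'" using y unfolding B_bar_eq by blast
    note m'm = hmats_mats[OF m'(1)] and bm = hmats_mats[OF bmat_hmats[OF m(1)]]
    obtain S where S: "supported m S" using mats_supported[OF m(1)] by blast
    have S': "supported m (insert (r + int j) S)" "supported (bmat r j m) (insert (r + int j) S)"
      using S by (intro supportedI; auto simp: bmat_def supportedD supported_finite)+
    have "hpart (r + int j - c) (m r s * m' s c) = hpart (r + int j - s) (m r s) * m' s c" for s c
    proof -
      have "r + int j - c = (r + int j - s) + (s - c)" by simp
      then show ?thesis using hpart_mult_left[OF hmats_hp[OF m'(1), of s c], of "r + int j - s" "m r s"] by (simp only:)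
    qed
    then have "bmat r j (mmul m m') = mmul (bmat r j m) m'"
      unfolding mmul_eq[OF S'(1)] mmul_eq[OF S'(2)] bmat_def
      by (intro ext) (auto simp: hpart_sum mmul_eq[OF S'(1)] mmul_eq[OF S'(2), unfolded bmat_def] simp del: sum.insert)
    then show ?thesis
      unfolding i m(2) m'(2) \<Phi>_mult[OF m(1) m'm, symmetric] dual_coeff_\<Phi>[OF True m(1)]
        dual_coeff_\<Phi>[OF True mats_mmul[OF m(1) m'm]] \<Phi>_mult[OF bm m'm, symmetric] by simp
  next
    case False
    have "y \<in> carrier DA" using y by (rule DA.subalgebraD[OF B_subalgebra])
    then show ?thesis using False by (simp add: i dual_coeff_def)
  qed
next
  fix X assume X: "finite X" "X \<subseteq> carrier DA"
  have "finite (rep ` X)" "rep ` X \<subseteq> mats" using X rep(1) by auto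
  then obtain S0 where S0: "\<forall>m\<in>rep ` X. supported m S0" using mats_supported_finite by blast
  define S where "S = (if X = {} then {} else S0)"
  have S: "supported (rep d) S" if "d \<in> X" for d using S0 that by (auto simp: S_def)
  have finS: "finite S"
  proof (cases "X = {}")
    case False
    then obtain d where "d \<in> X" by blast
    then show ?thesis using S supported_finite by blast
  qed (simp add: S_def)
  obtain js where js: "set js = S \<times> {..<N}" "distinct js"
    using finite_distinct_list[of "S \<times> {..<N}"] finS by blast
  have "d = lsum DA (map (\<lambda>i. dual_vec i \<otimes>\<^bsub>DA\<^esub> dual_coeff i d) js)" if d: "d \<in> X" for d
  proof -
    define m where "m = rep d"
    have "d \<in> carrier DA" using d X by blast
    from rep[OF this] have m: "m \<in> mats" "d = \<Phi> m" unfolding m_def by simp_all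
    have Sm: "supported m S" unfolding m_def by (rule S[OF d])
    define h where "h i = (\<lambda>r' c. if r' = fst i then hpart (fst i + int (snd i) - c) (m (fst i) c) else 0)" for i :: "int \<times> nat"
    have h: "dual_vec i \<otimes>\<^bsub>DA\<^esub> dual_coeff i d = \<Phi> (h i)" "h i \<in> mats" if i: "i \<in> set js" for i
    proof -
      obtain r j where rj: "i = (r, j)" "j < N" using i js by auto
      note bm = hmats_mats[OF bmat_hmats[OF m(1), of r j]]
      have eq: "mmul (mat_unit r (r + int j) 1) (bmat r j m) = h i"
        unfolding mmul_mat_unit_left by (simp add: h_def rj bmat_def fun_eq_iff)
      show "dual_vec i \<otimes>\<^bsub>DA\<^esub> dual_coeff i d = \<Phi> (h i)"
        unfolding m(2) rj(1) dual_coeff_\<Phi>[OF rj(2) m(1)] dual_vec_def eq[unfolded rj(1), symmetric] using \<Phi>_mult[OF mats_unit[OF one_Num] bm] by simp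
      show "h i \<in> mats" unfolding eq[symmetric] by (rule mats_mmul[OF mats_unit[OF one_Num] bm])
    qed
    have "(\<Sum>i\<in>S \<times> {..<N}. h i r c) = (\<Sum>j<N. hpart (r + int j - c) (m r c))" for r c
    proof -
      have "(\<Sum>i\<in>S \<times> {..<N}. h i r c) = (\<Sum>s\<in>S. \<Sum>j<N. if s = r then hpart (r + int j - c) (m r c) else 0)"
        unfolding sum.cartesian_product by (rule sum.cong) (auto simp: h_def)
      also have "\<dots> = (\<Sum>s\<in>S. if s = r then (\<Sum>j<N. hpart (r + int j - c) (m r c)) else 0)"
        by (intro sum.cong refl) simp
      also have "\<dots> = (\<Sum>j<N. hpart (r + int j - c) (m r c))"
        using supportedD(1)[OF Sm, of r c] by (simp add: sum.delta[OF finS])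
      finally show ?thesis .
    qed
    then have den: "(\<Sum>i\<in>S \<times> {..<N}. h i r c) - m r c \<in> Den r c" for r c
      using Num_remainder[OF mats_Num[OF m(1)]] by simp
    have hs: "(\<lambda>r c. \<Sum>i\<in>S \<times> {..<N}. h i r c) \<in> mats"
      "lsum DA (map (\<lambda>i. \<Phi> (h i)) js) = \<Phi> (\<lambda>r c. \<Sum>i\<in>S \<times> {..<N}. h i r c)"
      using \<Phi>_lsum[OF js(2), of h] h(2) js(1) by auto
    have "lsum DA (map (\<lambda>i. \<Phi> (h i)) js) = d"
      unfolding hs(2) m(2) \<Phi>_eq_iff[OF hs(1) m(1)] using den by blast
    moreover have "map (\<lambda>i. dual_vec i \<otimes>\<^bsub>DA\<^esub> dual_coeff i d) js = map (\<lambda>i. \<Phi> (h i)) js"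
      using h(1) by (intro map_cong refl)
    ultimately show ?thesis by (simp only:)
  qed
  then show "\<exists>js. \<forall>d\<in>X. d = lsum DA (map (\<lambda>i. dual_vec i \<otimes>\<^bsub>DA\<^esub> dual_coeff i d) js)" by blast
qed

end

context split_algebra
begin

lemma adjoin_lincomb:
  assumes "\<And>k. k \<in> set ks \<Longrightarrow> x k \<in> carrier D"
  shows "lsum D (map (\<lambda>k. c k \<odot> x k) ks) \<in> adjoin {\<zero>} (map x ks)"
  using assms
proof (induction ks)
  case (Cons k ks)
  have IH: "lsum D (map (\<lambda>k. c k \<odot> x k) ks) \<in> adjoin {\<zero>} (map x ks)" using Cons by simp
  have cl: "lsum D (map (\<lambda>k. c k \<odot> x k) ks) \<in> carrier D" using Cons.prems by (intro lsum_closed) auto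
  have "lsum D (map (\<lambda>k. c k \<odot> x k) (k # ks)) = lsum D (map (\<lambda>k. c k \<odot> x k) ks) \<oplus> c k \<odot> x k"
    using a_comm[OF _ cl, of "c k \<odot> x k"] Cons.prems by simp
  then show ?case using IH by auto
qed simp

end

context graded_tilde
begin

section \<open>The corners of the subalgebra\<close>

text \<open>The elements of degree \<open>m\<close> of the trivial extension in the corner of \<open>v\<close> and \<open>w\<close>. They are the entries of the
  elements of \<open>\<epsilon>\<^bsub>(v,i)\<^esub> B \<epsilon>\<^bsub>(w,j)\<^esub>\<close> for \<open>m = i - j\<close>.\<close>

definition hcorner :: "'v + 'v \<Rightarrow> 'v + 'v \<Rightarrow> int \<Rightarrow> ('a, 'k) trivext \<Rightarrow> bool" where
  "hcorner v w m a \<longleftrightarrow> lin a \<and> hpart m a = a \<and> of_alg (\<epsilon> v) * a = a \<and> a * of_alg (\<epsilon> w) = a"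

lemma hpart_proj: assumes "hpart m a = a" shows "hpart m (of_alg (\<epsilon> v) * a * of_alg (\<epsilon> w)) = of_alg (\<epsilon> v) * a * of_alg (\<epsilon> w)"
proof -
  have 1: "hpart m (of_alg (\<epsilon> v) * a) = of_alg (\<epsilon> v) * a"
    using hpart_mult_left[OF assms, of 0 "of_alg (\<epsilon> v)"] by (simp add: hpart_\<epsilon>)
  show ?thesis using hpart_mult_left[OF hpart_\<epsilon>, of m "of_alg (\<epsilon> v) * a" w] by (simp add: 1)
qed

lemma hcorner_Num: "hcorner v w (i - j) a \<Longrightarrow> a \<in> Num i j"
  using hpart_Num[of a i j] by (simp add: hcorner_def)

lemma of_alg_\<epsilon>_idem: "v \<in> V \<Longrightarrow> of_alg (\<epsilon> v) * of_alg (\<epsilon> v) = (of_alg (\<epsilon> v) :: ('a, 'k) trivext)"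
  by (simp add: of_alg_hom(1)[symmetric] \<epsilon>_orth)

lemma hcorner_proj: assumes "v \<in> V" "w \<in> V" "lin a" "hpart m a = a"
  shows "hcorner v w m (of_alg (\<epsilon> v) * a * of_alg (\<epsilon> w))"
proof -
  have "of_alg (\<epsilon> v) * (of_alg (\<epsilon> v) * a * of_alg (\<epsilon> w)) = of_alg (\<epsilon> v) * a * of_alg (\<epsilon> w)"
    using of_alg_\<epsilon>_idem[OF assms(1)] by (simp add: mult.assoc[symmetric])
  moreover have "of_alg (\<epsilon> v) * a * of_alg (\<epsilon> w) * of_alg (\<epsilon> w) = of_alg (\<epsilon> v) * a * of_alg (\<epsilon> w)"
    using of_alg_\<epsilon>_idem[OF assms(2)] by (simp add: mult.assoc)
  ultimately show ?thesis unfolding hcorner_def using hpart_proj[OF assms(4)] assms(3) by (simp add: lin_simps)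
qed

definition "Bcorner \<mu> \<nu> = {y \<in> B. diag_idem \<epsilon> \<mu> \<otimes>\<^bsub>DA\<^esub> y = y \<and> y \<otimes>\<^bsub>DA\<^esub> diag_idem \<epsilon> \<nu> = y}"

lemma Bcorner_eq: assumes v: "v \<in> V" and w: "w \<in> V"
  shows "Bcorner (v, i) (w, j) = (\<lambda>a. \<Phi> (mat_unit i j a)) ` {a. hcorner v w (i - j) a}"
proof
  show "Bcorner (v, i) (w, j) \<subseteq> (\<lambda>a. \<Phi> (mat_unit i j a)) ` {a. hcorner v w (i - j) a}"
  proof
    fix y assume "y \<in> Bcorner (v, i) (w, j)"
    then have y: "y \<in> B" "diag_idem \<epsilon> (v, i) \<otimes>\<^bsub>DA\<^esub> y = y" "y \<otimes>\<^bsub>DA\<^esub> diag_idem \<epsilon> (w, j) = y" by (simp_all add: Bcorner_def)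
    then obtain m where m: "m \<in> hmats" "y = \<Phi> m" unfolding B_bar_eq by blast
    have "hcorner v w (i - j) (of_alg (\<epsilon> v) * m i j * of_alg (\<epsilon> w))"
      using mats_Num[OF hmats_mats[OF m(1)], of i j] by (intro hcorner_proj v w hmats_hp[OF m(1)]) (simp add: Num_def)
    moreover have "y = \<Phi> (mat_unit i j (of_alg (\<epsilon> v) * m i j * of_alg (\<epsilon> w)))"
      using corner(1)[OF hmats_mats[OF m(1)]] y(2,3) unfolding m(2) by blast
    ultimately show "y \<in> (\<lambda>a. \<Phi> (mat_unit i j a)) ` {a. hcorner v w (i - j) a}" by blast
  qed
  show "(\<lambda>a. \<Phi> (mat_unit i j a)) ` {a. hcorner v w (i - j) a} \<subseteq> Bcorner (v, i) (w, j)"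
  proof (rule image_subsetI)
    fix a assume "a \<in> {a. hcorner v w (i - j) a}"
    then have a: "hcorner v w (i - j) a" by simp
    have h: "mat_unit i j a \<in> hmats" using a by (intro hmats_unit[OF hcorner_Num[OF a]]) (simp add: hcorner_def)
    have "(\<lambda>r c. if r = i then of_alg (\<epsilon> v) * mat_unit i j a i c else 0) = mat_unit i j a"
      "(\<lambda>r c. if c = j then mat_unit i j a r j * of_alg (\<epsilon> w) else 0) = mat_unit i j a"
      using a by (auto simp: hcorner_def mat_unit_def fun_eq_iff)
    then show "\<Phi> (mat_unit i j a) \<in> Bcorner (v, i) (w, j)"
      using h diag_idem_left(1)[OF hmats_mats[OF h], where v = v and i = i and f = \<epsilon>]
        diag_idem_right(1)[OF hmats_mats[OF h], where v = w and i = j and f = \<epsilon>]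
      by (simp add: Bcorner_def B_bar_eq)
  qed
qed

lemma hcorner_fnl: assumes "hcorner v w m a" shows "fnl a (x * \<epsilon> v) = fnl a x" "fnl a (\<epsilon> w * x) = fnl a x"
  "fnl a (gpart (int N - 1 - m) x) = fnl a x"
  using arg_cong[of _ _ "\<lambda>a. fnl a x", OF conjunct1[OF conjunct2[OF conjunct2[OF assms[unfolded hcorner_def]]]]]
    arg_cong[of _ _ "\<lambda>a. fnl a x", OF conjunct2[OF conjunct2[OF conjunct2[OF assms[unfolded hcorner_def]]]]]
    arg_cong[of _ _ "\<lambda>a. fnl a x", OF conjunct1[OF conjunct2[OF assms[unfolded hcorner_def]]]]
  by simp_all

text \<open>In degree zero the functionals live on the last layer of the radical filtration, which is annihilated
  by the added idempotents from the right and by the old ones from the left.\<close>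

lemma hcorner_zero_fnl: assumes a: "hcorner v w 0 a" and v: "v \<in> V" "w \<in> V" and x: "fnl a x \<noteq> 0"
  shows "v \<in> V\<^sub>1" "w \<notin> V\<^sub>1"
proof -
  let ?z = "gpart (int N - 1) x"
  have z: "?z \<in> J (int N - 1)" by (rule gpart_in_J)
  have zx: "fnl a ?z \<noteq> 0" using hcorner_fnl(3)[OF a, of x] x by simp
  show "v \<in> V\<^sub>1"
  proof (rule ccontr)
    assume "v \<notin> V\<^sub>1"
    from last_layer_sink[OF z v(1) this] show False using hcorner_fnl(1)[OF a, of ?z] zx by simp
  qed
  show "w \<notin> V\<^sub>1"
  proof
    assume "w \<in> V\<^sub>1"
    from last_layer_source[OF z this] show False using hcorner_fnl(2)[OF a, of ?z] zx by simp
  qed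
qed

lemma hcorner_alg: assumes "hcorner v w m a"
  shows "gpart m (alg a) = alg a" "\<epsilon> v * alg a = alg a" "alg a * \<epsilon> w = alg a"
  using arg_cong[of _ _ alg, OF conjunct1[OF conjunct2[OF conjunct2[OF assms[unfolded hcorner_def]]]]]
    arg_cong[of _ _ alg, OF conjunct2[OF conjunct2[OF conjunct2[OF assms[unfolded hcorner_def]]]]]
    arg_cong[of _ _ alg, OF conjunct1[OF conjunct2[OF assms[unfolded hcorner_def]]]]
  by simp_all

lemma hcorner_diagonal: assumes a: "hcorner v v 0 a" and v: "v \<in> V"
  shows "a = tscale scl (\<chi> v (alg a)) (of_alg (\<epsilon> v))"
proof (rule trivext_eqI)
  show "alg a = alg (tscale scl (\<chi> v (alg a)) (of_alg (\<epsilon> v)))"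
    using corner_degree_zero[OF v v hcorner_alg[OF a]] by simp
  show "fnl a x = fnl (tscale scl (\<chi> v (alg a)) (of_alg (\<epsilon> v))) x" for x
    using hcorner_zero_fnl[OF a v v, of x] by auto
qed

lemma hcorner_directed:
  assumes a: "hcorner v w (i - j) a" and vw: "v \<in> V" "w \<in> V" "(v, i) \<noteq> (w, j)" and nz: "a \<noteq> 0"
  shows "first_order (v, i) (w, j)" "i < j + int N"
proof -
  have "hpart (i - j) a \<noteq> 0" using a nz by (simp add: hcorner_def)
  then have range: "0 \<le> i - j" "i - j < int N" using hpart_outside[of "i - j" a] by linarith+
  then show "i < j + int N" by simp
  show "first_order (v, i) (w, j)"
  proof (cases "i = j")
    case True
    then have a0: "hcorner v w 0 a" and ne: "v \<noteq> w" using a vw by auto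
    have "alg a = 0" using corner_degree_zero[OF vw(1,2) hcorner_alg[OF a0]] ne by simp
    then obtain x where "fnl a x \<noteq> 0" using nz trivext_eqI[of a 0] by auto
    from hcorner_zero_fnl[OF a0 vw(1,2) this] have "isl v" "\<not> isl w" using V\<^sub>1_iff vw by auto
    then show ?thesis using True by (simp add: first_order_def)
  qed (use range in \<open>simp add: first_order_def\<close>)
qed

subsection \<open>Finite spanning sets\<close>

lemma tscale_mult_of_alg:
  "of_alg p * tscale scl c a = tscale scl c (of_alg p * a)" "tscale scl c a * of_alg p = tscale scl c (a * of_alg p)"
  by (intro trivext_eqI; simp add: scl_mult_left scl_mult_right)+

text \<open>A basis of the algebra together with its dual basis.\<close>

lemma finite_lin_span:
  "\<exists>(I :: ('a + 'a) set) g. finite I \<and> (\<forall>k. lin (g k)) \<and> (\<forall>a. lin a \<longrightarrow> (\<exists>c. a = (\<Sum>k\<in>I. tscale scl (c k) (g k))))"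
proof -
  obtain X where X: "finite X" "span X = UNIV" using finite_span by blast
  obtain Y where Y: "Y \<subseteq> X" "independent Y" "X \<subseteq> span Y" using maximal_independent_subset[of X] by blast
  have fin: "finite Y" using Y(1) X(1) by (rule finite_subset)
  have sp: "span Y = UNIV" using span_mono[OF Y(3)] X(2) by (simp add: span_span top.extremum_uniqueI)
  have R: "(\<Sum>x\<in>Y. scl (representation Y y x) x) = y" for y
    using sum_representation_eq[OF Y(2) _ fin] sp by simp
  have R_add: "representation Y (y + z) x = representation Y y x + representation Y z x"
    and R_scl: "representation Y (scl c y) x = c * representation Y y x" for y z c x
    using representation_add[OF Y(2)] representation_scale[OF Y(2)] sp by simp_all
  define g :: "'a + 'a \<Rightarrow> ('a, 'k) trivext" where
    "g k = (case k of Inl x \<Rightarrow> of_alg x | Inr x \<Rightarrow> of_fnl (\<lambda>y. representation Y y x))" for k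
  have gf: "fnl (of_fnl (\<lambda>y. representation Y y x)) z = representation Y z x" for x z
    by (subst of_fnl_simps(2)) (simp_all add: R_add)
  have "lin (g k)" for k
    by (cases k) (simp_all add: g_def lin_def gf R_scl)
  moreover have "\<exists>c. a = (\<Sum>k\<in>Y <+> Y. tscale scl (c k) (g k))" if "lin a" for a :: "('a, 'k) trivext"
  proof (intro exI trivext_eqI)
    let ?c = "case_sum (representation Y (alg a)) (fnl a)"
    have split: "(\<Sum>k\<in>Y <+> Y. tscale scl (?c k) (g k)) =
        (\<Sum>x\<in>Y. tscale scl (representation Y (alg a) x) (of_alg x)) +
        (\<Sum>x\<in>Y. tscale scl (fnl a x) (of_fnl (\<lambda>y. representation Y y x)))"
      using fin by (simp add: sum.Plus g_def)
    show "alg a = alg (\<Sum>k\<in>Y <+> Y. tscale scl (?c k) (g k))"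
      unfolding split by (simp add: of_fnl_simps(1) R)
    fix y
    have "fnl a y = fnl a (\<Sum>x\<in>Y. scl (representation Y y x) x)" by (simp add: R)
    also have "\<dots> = (\<Sum>x\<in>Y. fnl a x * representation Y y x)"
      using that by (simp add: lin_def mult.commute)
    finally show "fnl a y = fnl (\<Sum>k\<in>Y <+> Y. tscale scl (?c k) (g k)) y"
      unfolding split by (simp add: gf)
  qed
  ultimately show ?thesis using finite_Plus[OF fin fin] by blast
qed

text \<open>The corner is the image of the linear elements under a projection.\<close>

lemma Bcorner_finite_span:
  assumes v: "v \<in> V" and w: "w \<in> V"
  shows "\<exists>xs. set xs \<subseteq> Bcorner (v, i) (w, j) \<and>
    Bcorner (v, i) (w, j) \<subseteq> split_algebra.adjoin DA {\<zero>\<^bsub>DA\<^esub>} xs"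
proof -
  interpret SD: split_algebra DA \<Lambda> "diag_idem \<epsilon>" \<chi>D by (rule dual_basis.axioms(1)[OF D_dual_basis])
  obtain I :: "('a + 'a) set" and g :: "'a + 'a \<Rightarrow> ('a, 'k) trivext"
    where I: "finite I" and g: "\<And>k. lin (g k)"
      and span: "\<And>a. lin a \<Longrightarrow> \<exists>c. a = (\<Sum>k\<in>I. tscale scl (c k) (g k))" using finite_lin_span by blast
  obtain ks where ks: "set ks = I" "distinct ks" using finite_distinct_list[OF I] by blast
  define P where "P a = of_alg (\<epsilon> v) * hpart (i - j) a * of_alg (\<epsilon> w)" for a
  have P: "hcorner v w (i - j) (P (g k))" for k
    unfolding P_def by (rule hcorner_proj[OF v w hpart_lin[OF g] hpart_hp])
  have in_corner: "\<Phi> (mat_unit i j (P (g k))) \<in> Bcorner (v, i) (w, j)" for k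
    unfolding Bcorner_eq[OF v w] using P by blast
  have mP: "mat_unit i j (P (g k)) \<in> mats" for k by (rule mats_unit[OF hcorner_Num[OF P]])
  have "y \<in> SD.adjoin {\<zero>\<^bsub>DA\<^esub>} (map (\<lambda>k. \<Phi> (mat_unit i j (P (g k)))) ks)" if y: "y \<in> Bcorner (v, i) (w, j)" for y
  proof -
    obtain a where a: "hcorner v w (i - j) a" "y = \<Phi> (mat_unit i j a)"
      using y unfolding Bcorner_eq[OF v w] by blast
    have "lin a" using a(1) by (simp add: hcorner_def)
    then obtain c where c: "a = (\<Sum>k\<in>I. tscale scl (c k) (g k))" using span by blast
    have "a = P a" using a(1) by (simp add: P_def hcorner_def)
    also have "\<dots> = (\<Sum>k\<in>I. P (tscale scl (c k) (g k)))"
      by (subst c) (simp add: P_def hpart_sum sum_distrib_left sum_distrib_right)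
    also have "\<dots> = (\<Sum>k\<in>I. tscale scl (c k) (P (g k)))" by (simp add: P_def hpart_scale tscale_mult_of_alg)
    finally have aP: "a = (\<Sum>k\<in>I. tscale scl (c k) (P (g k)))" .
    have "(\<lambda>r s. \<Sum>k\<in>I. tscale scl (c k) (mat_unit i j (P (g k)) r s)) = mat_unit i j a"
    proof (intro ext)
      fix r s
      have "tscale scl k 0 = 0" for k by (rule trivext_eqI) simp_all
      then show "(\<Sum>k\<in>I. tscale scl (c k) (mat_unit i j (P (g k)) r s)) = mat_unit i j a r s"
        by (cases "r = i"; cases "s = j") (simp_all add: mat_unit_def aP)
    qed
    then have "y = lsum DA (map (\<lambda>k. \<Phi> (\<lambda>r s. tscale scl (c k) (mat_unit i j (P (g k)) r s))) ks)"
      using \<Phi>_lsum[OF ks(2), of "\<lambda>k r s. tscale scl (c k) (mat_unit i j (P (g k)) r s)"] mats_scale[OF mP] a(2) ks(1)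
      by simp
    also have "\<dots> = lsum DA (map (\<lambda>k. c k \<odot>\<^bsub>DA\<^esub> \<Phi> (mat_unit i j (P (g k)))) ks)" by (simp only: \<Phi>_scale[OF mP])
    also have "\<dots> \<in> SD.adjoin {\<zero>\<^bsub>DA\<^esub>} (map (\<lambda>k. \<Phi> (mat_unit i j (P (g k)))) ks)"
      by (rule SD.adjoin_lincomb) (rule \<Phi>_carrier[OF mP])
    finally show ?thesis .
  qed
  then show ?thesis using in_corner by (intro exI[of _ "map (\<lambda>k. \<Phi> (mat_unit i j (P (g k)))) ks"]) auto
qed

section \<open>The subalgebra is a strong exact Borel subalgebra\<close>

text \<open>The element \<open>y\<close> has a single entry \<open>a\<close>, in position \<open>(i, c)\<close>, and the character sees the entry in position
  \<open>(c, c)\<close> of the coefficient. This entry is nonzero only for \<open>r = i\<close> and \<open>c = i + j \<ge> i\<close>, so \<open>(v, i) > (w, c)\<close>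
  forces \<open>i = c\<close> and \<open>v \<noteq> w\<close>, and then the character \<open>\<chi>\<^sub>w\<close> kills \<open>a\<close>.\<close>

lemma coeff_weights:
  assumes v: "v \<in> V" and w: "w \<in> V" and gt: "first_order (v, i) (w, c)"
    and y: "y \<in> carrier DA" "diag_idem \<epsilon> (v, i) \<otimes>\<^bsub>DA\<^esub> y = y" "y \<otimes>\<^bsub>DA\<^esub> diag_idem \<epsilon> (w, c) = y"
  shows "\<chi>D (w, c) (dual_coeff (r, j) y) = 0"
proof -
  obtain m where m: "m \<in> mats" "y = \<Phi> m" using y(1) by (rule \<Phi>_cases)
  let ?a = "of_alg (\<epsilon> v) * m i c * of_alg (\<epsilon> w)"
  have a: "y = \<Phi> (mat_unit i c ?a)" "?a \<in> Num i c" using corner[OF m(1)] y(2,3) unfolding m(2) by blast+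
  show ?thesis
  proof (cases "j < N")
    case True
    have "\<chi>D (w, c) (dual_coeff (r, j) y) = \<chi> w (alg (bmat r j (mat_unit i c ?a) c c))"
      unfolding a(1) dual_coeff_\<Phi>[OF True mats_unit[OF a(2)]] by (rule \<chi>D_\<Phi>[OF hmats_mats[OF bmat_hmats[OF mats_unit[OF a(2)]]]])
    also have "\<dots> = 0"
    proof (cases "c = r + int j \<and> r = i")
      case True
      then have "i = c" "v \<noteq> w" using gt by (auto simp: first_order_def)
      then have "\<chi> w (alg ?a) = 0" using v w by (simp add: char_mult char_\<epsilon>)
      then have "\<chi> w (gpart 0 (alg ?a)) = 0" unfolding char_gp0[OF w] .
      then show ?thesis using True by (auto simp: bmat_def mat_unit_def)
    next
      case False
      then show ?thesis by (auto simp: bmat_def mat_unit_def char_zero w)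
    qed
    finally show ?thesis .
  next
    case False
    have "\<chi>D (w, c) (\<Phi> (\<lambda>_ _. 0)) = 0" unfolding \<chi>D_\<Phi>[OF mats_zero] by (simp add: char_zero w)
    then show ?thesis using False by (simp add: dual_coeff_def \<Phi>_zero)
  qed
qed

theorem B_bar_strong_exact_borel: "strong_exact_borel T DA \<Lambda> (diag_idem e) first_order B"
proof (rule directed_dual_basis.strong_exact_borel,
    intro directed_dual_basis.intro directed_dual_basis_axioms.intro)
  show "dual_basis DA \<Lambda> (diag_idem \<epsilon>) \<chi>D B dual_vec dual_coeff" by (rule D_dual_basis)
  show "split_algebra DA \<Lambda> (diag_idem e) \<chi>D" by (rule split_D) (simp_all add: e_orth e_sum char_e)
  show "\<not> first_order \<mu> \<mu>" for \<mu> :: "('v + 'v) \<times> int" by (auto simp: first_order_def)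
  show "first_order \<kappa> \<nu>" if "first_order \<kappa> \<mu>" "first_order \<mu> \<nu>" for \<kappa> \<mu> \<nu> :: "('v + 'v) \<times> int"
    using that by (auto simp: first_order_def)
  fix \<nu> assume "\<nu> \<in> \<Lambda>"
  then obtain w j where \<nu>: "\<nu> = (w, j)" and w: "w \<in> V" by auto
  show "y = \<chi>D \<nu> y \<odot>\<^bsub>DA\<^esub> diag_idem \<epsilon> \<nu>" if "y \<in> B" "diag_idem \<epsilon> \<nu> \<otimes>\<^bsub>DA\<^esub> y = y" "y \<otimes>\<^bsub>DA\<^esub> diag_idem \<epsilon> \<nu> = y" for y
  proof -
    have "y \<in> Bcorner (w, j) (w, j)" using that by (simp add: Bcorner_def \<nu>)
    then obtain a where a: "hcorner w w (j - j) a" "y = \<Phi> (mat_unit j j a)" unfolding Bcorner_eq[OF w w] by blast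
    have \<chi>y: "\<chi>D \<nu> y = \<chi> w (alg a)"
      unfolding \<nu> a(2) \<chi>D_\<Phi>[OF mats_unit[OF hcorner_Num[OF a(1)]]] by (simp add: mat_unit_def)
    have t0: "tscale scl k 0 = 0" for k by (rule trivext_eqI) simp_all
    have "a = tscale scl (\<chi>D \<nu> y) (of_alg (\<epsilon> w))" using hcorner_diagonal[OF _ w, of a] a(1) \<chi>y by simp
    then have "mat_unit j j a = (\<lambda>r c. tscale scl (\<chi>D \<nu> y) (mat_unit j j (of_alg (\<epsilon> w)) r c))"
      by (simp add: mat_unit_def fun_eq_iff t0)
    then have "\<Phi> (mat_unit j j a) = \<Phi> (\<lambda>r c. tscale scl (\<chi>D \<nu> y) (mat_unit j j (of_alg (\<epsilon> w)) r c))"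
      by (rule arg_cong)
    then have "y = \<Phi> (\<lambda>r c. tscale scl (\<chi>D \<nu> y) (mat_unit j j (of_alg (\<epsilon> w)) r c))" unfolding a(2)[symmetric] .
    then show ?thesis unfolding \<Phi>_scale[OF unit_mats] by (simp add: \<nu> diag_idem_def)
  qed
  have dir: "first_order \<mu> \<nu> \<and> fst \<mu> \<in> V \<and> snd \<mu> \<in> {j..<j + int N}"
    if "\<mu> \<in> \<Lambda>" "\<mu> \<noteq> \<nu>" "y \<in> B" "diag_idem \<epsilon> \<mu> \<otimes>\<^bsub>DA\<^esub> y = y" "y \<otimes>\<^bsub>DA\<^esub> diag_idem \<epsilon> \<nu> = y" "y \<noteq> \<zero>\<^bsub>DA\<^esub>" for \<mu> y
  proof -
    obtain v i where \<mu>: "\<mu> = (v, i)" and v: "v \<in> V" using \<open>\<mu> \<in> \<Lambda>\<close> by auto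
    have "y \<in> Bcorner (v, i) (w, j)" using that by (simp add: Bcorner_def \<nu> \<mu>)
    then obtain a where a: "hcorner v w (i - j) a" "y = \<Phi> (mat_unit i j a)" unfolding Bcorner_eq[OF v w] by blast
    have "a \<noteq> 0" using a(2) \<open>y \<noteq> \<zero>\<^bsub>DA\<^esub>\<close> by (auto simp: mat_unit_zero \<Phi>_zero)
    from hcorner_directed[OF a(1) v w _ this] show ?thesis
      using \<open>\<mu> \<noteq> \<nu>\<close> v by (auto simp: \<mu> \<nu> first_order_def)
  qed
  show "\<exists>F. finite F \<and> (\<forall>\<mu>\<in>\<Lambda> - F. \<forall>y\<in>B. diag_idem \<epsilon> \<mu> \<otimes>\<^bsub>DA\<^esub> y = y \<longrightarrow> y \<otimes>\<^bsub>DA\<^esub> diag_idem \<epsilon> \<nu> = y \<longrightarrow> y = \<zero>\<^bsub>DA\<^esub>)"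
  proof (intro exI conjI ballI impI)
    show "finite (insert \<nu> (V \<times> {j..<j + int N}))" using V_finite by simp
    fix \<mu> y assume "\<mu> \<in> \<Lambda> - insert \<nu> (V \<times> {j..<j + int N})" "y \<in> B" "diag_idem \<epsilon> \<mu> \<otimes>\<^bsub>DA\<^esub> y = y" "y \<otimes>\<^bsub>DA\<^esub> diag_idem \<epsilon> \<nu> = y"
    then show "y = \<zero>\<^bsub>DA\<^esub>" using dir[of \<mu> y] by (cases \<mu>) auto
  qed
  fix \<mu> assume \<mu>\<Lambda>: "\<mu> \<in> \<Lambda>"
  then obtain v i where \<mu>: "\<mu> = (v, i)" and v: "v \<in> V" by auto
  show "first_order \<mu> \<nu>" if "\<mu> \<noteq> \<nu>" "y \<in> B" "diag_idem \<epsilon> \<mu> \<otimes>\<^bsub>DA\<^esub> y = y" "y \<otimes>\<^bsub>DA\<^esub> diag_idem \<epsilon> \<nu> = y" "y \<noteq> \<zero>\<^bsub>DA\<^esub>" for y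
    using dir[OF \<mu>\<Lambda> that] by blast
  show "\<exists>xs. set xs \<subseteq> {y \<in> B. diag_idem \<epsilon> \<mu> \<otimes>\<^bsub>DA\<^esub> y = y \<and> y \<otimes>\<^bsub>DA\<^esub> diag_idem \<epsilon> \<nu> = y} \<and>
      {y \<in> B. diag_idem \<epsilon> \<mu> \<otimes>\<^bsub>DA\<^esub> y = y \<and> y \<otimes>\<^bsub>DA\<^esub> diag_idem \<epsilon> \<nu> = y} \<subseteq> split_algebra.adjoin DA {\<zero>\<^bsub>DA\<^esub>} xs"
    using Bcorner_finite_span[OF v w, of i j] unfolding Bcorner_def \<mu> \<nu> .
  show "\<chi>D \<nu> (dual_coeff k y) = 0" if "first_order \<mu> \<nu>" "y \<in> carrier DA" "diag_idem \<epsilon> \<mu> \<otimes>\<^bsub>DA\<^esub> y = y" "y \<otimes>\<^bsub>DA\<^esub> diag_idem \<epsilon> \<nu> = y" for k y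
    using coeff_weights[OF v w, of i j y "fst k" "snd k"] that unfolding \<mu> \<nu> by simp
qed

lemma diag_idem_eq: "diag_idem f = (\<lambda>(v, i). (\<lambda>r c. if r = i \<and> c = i then f v +o ent_den r c else ent_den r c, \<lambda>_ _ _. 0))"
  by (auto simp: diag_idem_def \<Phi>_def mat_unit_def fun_eq_iff)

end

theorem proposition14:
  fixes n :: nat
    and Q :: "(nat, 'q) pre_digraph"
    and R :: "(nat \<times> 'q list \<Rightarrow>\<^sub>0 'k::alg_closed_field) set"
    and scl :: "'k \<Rightarrow> 'a::ring_1 \<Rightarrow> 'a"
    and \<phi> :: "((nat + nat) \<times> ('q + nat) list \<Rightarrow>\<^sub>0 'k) \<Rightarrow> 'a"
    and G :: "nat \<Rightarrow> 'a set"
  assumes "fin_digraph Q" and "verts Q = {1..n}"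
    and "admissible_relations Q R"
    and "presentation (tilde_quiver Q) (tilde_relation ` R) scl \<phi>"
    and "positive_grading scl G"
    and "\<And>j. rad_pow j = group_closure (\<Union>i\<in>{j..}. G i)"
  shows "strong_exact_borel TYPE('m) (D_algebra scl)
           (verts (tilde_quiver Q) \<times> (UNIV :: int set)) (D_idem \<phi>) first_order (B_bar scl G)"
proof -
  interpret P: tilde_presentation Q R scl \<phi> by (rule tilde_presentation.intro[OF assms(1,3,4)])
  have t: "tilde_algebra scl (verts (tilde_quiver Q)) (Inl ` verts Q) (vertex_idem \<phi>) P.vchar" by (rule P.tilde_algebra)
  interpret graded_tilde scl "verts (tilde_quiver Q)" "Inl ` verts Q" "vertex_idem \<phi>" P.vchar G
  proof (intro graded_tilde.intro graded_tilde_axioms.intro t)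
    show "v \<in> Inl ` verts Q \<longleftrightarrow> isl v" if "v \<in> verts (tilde_quiver Q)" for v
      using that by (auto simp: tilde_quiver_def)
  qed (use assms in auto)
  have "D_idem \<phi> = diag_idem (vertex_idem \<phi>)" unfolding diag_idem_eq D_idem_def ..
  then show ?thesis using B_bar_strong_exact_borel by simp
qed

end
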